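(* Let $\mathsf{B}$ be a locally presentable abelian category with a projective generator $P$, let $R$ be an associative ring, and let $\theta\colon R\to\operatorname{Hom}_{\mathsf{B}}(P,P)^{\mathrm{op}}$ be a homomorphism of associative rings. Assume that the related functor $\Theta=\operatorname{Hom}_{\mathsf{B}}(P,-)\colon\mathsf{B}\to R\text{-}\mathrm{Mod}$ is fully faithful. Then: (a) the full subcategory $\Theta(\mathsf{B})\subset R\text{-}\mathrm{Mod}$ is the right $0$-perpendicular subcategory to a set of morphisms in $R\text{-}\mathrm{Mod}$; (b) assuming additionally that $\theta$ is injective, the full subcategory $\Theta(\mathsf{B})\subset R\text{-}\mathrm{Mod}$ is a right $1$-perpendicular subcategory in $R\text{-}\mathrm{Mod}$ if and only if it is closed under extensions, and in this case it is the right $1$-perpendicular subcategory to a set of objects; (c) assuming that $\theta$ is injective and given an integer $n\ge1$, the full subcategory $\Theta(\mathsf{B})\subset R\text{-}\mathrm{Mod}$ is the right $n$-perpendicular subcategory to a set of objects in $R\text{-}\mathrm{Mod}$ whenever the induced maps $\Theta\colon\operatorname{Ext}^i_{\mathsf{B}}(B,C)\to\operatorname{Ext}^i_R(\Theta(B),\Theta(C))$ are isomorphisms for all $B,C\in\mathsf{B}$ and all $i\le n$; (d) assuming that $\theta$ is injective, the full subcategory $\Theta(\mathsf{B})\subset R\text{-}\mathrm{Mod}$ is the right $\infty$-perpendicular subcategory to a set of objects in $R\text{-}\mathrm{Mod}$ whenever the induced maps $\Theta\colon\operatorname{Ext}^i_{\mathsf{B}}(B,C)\to\operatorname{Ext}^i_R(\Theta(B),\Theta(C))$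 are isomorphisms for all $B,C\in\mathsf{B}$ and all $0\le i<\infty$.
   Context: $R\text{-}\mathrm{Mod}$ is the category of left $R$-modules. For $B\in\mathsf{B}$, the left $R$-module structure on $\operatorname{Hom}_{\mathsf{B}}(P,B)$ comes from the right action of $R$ on $P$ given by $\theta$; the functor $\Theta$ is exact. $\Theta(\mathsf{B})$ denotes the essential image of $\Theta$. Let $\mathsf{A}$ be an abelian category and $\mathsf{C}\subset\mathsf{A}$ a full subcategory. - $\mathsf{C}$ is the right $0$-perpendicular subcategory to a class (or set) of morphisms $\mathsf{F}$ in $\mathsf{A}$ if an object $B\in\mathsf{A}$ belongs to $\mathsf{C}$ if and only if for every $f\colon U'\to U''$ in $\mathsf{F}$ the map $\operatorname{Hom}_{\mathsf{A}}(f,B)\colon\operatorname{Hom}_{\mathsf{A}}(U'',B)\to\operatorname{Hom}_{\mathsf{A}}(U',B)$ is an isomorphism. - $\mathsf{C}$ is the right $1$-perpendicular subcategory to a class (or set) of objects $\mathsf{E}$ in $\mathsf{A}$ if an object $B\in\mathsf{A}$ belongs to $\mathsf{C}$ if and only if $\operatorname{Hom}_{\mathsf{A}}(E,B)=0=\operatorname{Ext}^1_{\mathsf{A}}(E,B)$ for all $E\in\mathsf{E}$. It is called a right $1$-perpendicular subcategory if it is so with respect to some class of objects $\mathsf{E}$. - For an integer $n\ge1$ (respectively $n=\infty$), $\mathsf{C}$ is the right $n$-perpendicular subcategory to $\mathsf{E}$ if it is the right $1$-perpendicular subcategory to $\mathsf{E}$ and, moreover, $\operatorname{Ext}^i_{\mathsf{A}}(E,B)=0$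 for all $E\in\mathsf{E}$, $B\in\mathsf{C}$ and all $0\le i\le n$ (respectively, all $i\ge0$). *)

theory Defs
  imports Main "HOL-Algebra.Module" "HOL-Library.Extended_Nat"
begin

unbundle cardinal_syntax

section \<open>Universe\<close>

text \<open>
  HOL has no classes. The class of all sets is played by the type \<open>'u\<close>, which is
  required to be strongly inaccessible; ``sets'' are collections of cardinality less than that
  of \<open>'u\<close>, and ``classes'' are arbitrary collections. Up to bijection, the small subsets
  of \<open>'u\<close> are then exactly the elements of a Grothendieck universe.
\<close>

definition small :: "'u itself \<Rightarrow> 'a set \<Rightarrow> bool" where
  "small U A \<longleftrightarrow> |A| <o |UNIV :: 'u set|"

definition inaccessible_universe :: "'u itself \<Rightarrow> bool" where
  "inaccessible_universe U \<longleftrightarrow>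
     natLeq <o |UNIV :: 'u set| \<and>
     regularCard |UNIV :: 'u set| \<and>
     (\<forall>A :: 'u set. small U A \<longrightarrow> small U (Pow A))"

section \<open>Categories and functors\<close>

text \<open>
  Hom-sets of distinct pairs of objects need not be disjoint, so composition carries its objects:
  \<open>Comp C X Y Z g f\<close> is the composite of \<open>f : X \<rightarrow> Y\<close> and \<open>g : Y \<rightarrow> Z\<close>.
\<close>

record ('o, 'm) cat =
  Ob :: "'o set"
  Hom :: "'o \<Rightarrow> 'o \<Rightarrow> 'm set"
  Comp :: "'o \<Rightarrow> 'o \<Rightarrow> 'o \<Rightarrow> 'm \<Rightarrow> 'm \<Rightarrow> 'm"
  Idn :: "'o \<Rightarrow> 'm"

locale category =
  fixes C :: "('o, 'm, 'x) cat_scheme"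
  assumes Idn_in_Hom: "X \<in> Ob C \<Longrightarrow> Idn C X \<in> Hom C X X"
    and Comp_in_Hom:
      "\<lbrakk>X \<in> Ob C; Y \<in> Ob C; Z \<in> Ob C; f \<in> Hom C X Y; g \<in> Hom C Y Z\<rbrakk>
        \<Longrightarrow> Comp C X Y Z g f \<in> Hom C X Z"
    and Comp_Idn_left:
      "\<lbrakk>X \<in> Ob C; Y \<in> Ob C; f \<in> Hom C X Y\<rbrakk> \<Longrightarrow> Comp C X Y Y (Idn C Y) f = f"
    and Comp_Idn_right:
      "\<lbrakk>X \<in> Ob C; Y \<in> Ob C; f \<in> Hom C X Y\<rbrakk> \<Longrightarrow> Comp C X X Y f (Idn C X) = f"
    and Comp_assoc:
      "\<lbrakk>W \<in> Ob C; X \<in> Ob C; Y \<in> Ob C; Z \<in> Ob C;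
        f \<in> Hom C W X; g \<in> Hom C X Y; h \<in> Hom C Y Z\<rbrakk>
        \<Longrightarrow> Comp C W X Z (Comp C X Y Z h g) f = Comp C W Y Z h (Comp C W X Y g f)"

definition is_mono :: "('o, 'm, 'x) cat_scheme \<Rightarrow> 'o \<Rightarrow> 'o \<Rightarrow> 'm \<Rightarrow> bool" where
  "is_mono C X Y f \<longleftrightarrow> f \<in> Hom C X Y \<and>
     (\<forall>T \<in> Ob C. \<forall>g \<in> Hom C T X. \<forall>h \<in> Hom C T X.
        Comp C T X Y f g = Comp C T X Y f h \<longrightarrow> g = h)"

definition is_epi :: "('o, 'm, 'x) cat_scheme \<Rightarrow> 'o \<Rightarrow> 'o \<Rightarrow> 'm \<Rightarrow> bool" where
  "is_epi C X Y f \<longleftrightarrow> f \<in> Hom C X Y \<and>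
     (\<forall>T \<in> Ob C. \<forall>g \<in> Hom C Y T. \<forall>h \<in> Hom C Y T.
        Comp C X Y T g f = Comp C X Y T h f \<longrightarrow> g = h)"

definition isomorphic :: "('o, 'm, 'x) cat_scheme \<Rightarrow> 'o \<Rightarrow> 'o \<Rightarrow> bool" where
  "isomorphic C X Y \<longleftrightarrow> (\<exists>f \<in> Hom C X Y. \<exists>g \<in> Hom C Y X.
     Comp C X Y X g f = Idn C X \<and> Comp C Y X Y f g = Idn C Y)"

record ('o, 'm, 'p, 'n) func =
  Fob :: "'o \<Rightarrow> 'p"
  Fmap :: "'o \<Rightarrow> 'o \<Rightarrow> 'm \<Rightarrow> 'n"

definition is_functor ::
  "('o, 'm, 'x) cat_scheme \<Rightarrow> ('p, 'n, 'y) cat_scheme \<Rightarrow> ('o, 'm, 'p, 'n) func \<Rightarrow> bool" where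
  "is_functor C D F \<longleftrightarrow>
     (\<forall>X \<in> Ob C. Fob F X \<in> Ob D) \<and>
     (\<forall>X \<in> Ob C. \<forall>Y \<in> Ob C. \<forall>f \<in> Hom C X Y. Fmap F X Y f \<in> Hom D (Fob F X) (Fob F Y)) \<and>
     (\<forall>X \<in> Ob C. Fmap F X X (Idn C X) = Idn D (Fob F X)) \<and>
     (\<forall>X \<in> Ob C. \<forall>Y \<in> Ob C. \<forall>Z \<in> Ob C. \<forall>f \<in> Hom C X Y. \<forall>g \<in> Hom C Y Z.
        Fmap F X Z (Comp C X Y Z g f)
          = Comp D (Fob F X) (Fob F Y) (Fob F Z) (Fmap F Y Z g) (Fmap F X Y f))"

definition func_comp ::
  "('p, 'n, 'q, 'l) func \<Rightarrow> ('o, 'm, 'p, 'n) func \<Rightarrow> ('o, 'm, 'q, 'l) func" where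
  "func_comp G F = \<lparr>Fob = \<lambda>X. Fob G (Fob F X),
     Fmap = \<lambda>X Y f. Fmap G (Fob F X) (Fob F Y) (Fmap F X Y f)\<rparr>"

definition fully_faithful ::
  "('o, 'm, 'x) cat_scheme \<Rightarrow> ('p, 'n, 'y) cat_scheme \<Rightarrow> ('o, 'm, 'p, 'n) func \<Rightarrow> bool" where
  "fully_faithful C D F \<longleftrightarrow>
     (\<forall>X \<in> Ob C. \<forall>Y \<in> Ob C. bij_betw (Fmap F X Y) (Hom C X Y) (Hom D (Fob F X) (Fob F Y)))"

text \<open>Full subcategories are represented by their classes of objects.\<close>

definition essential_image ::
  "('o, 'm, 'x) cat_scheme \<Rightarrow> ('p, 'n, 'y) cat_scheme \<Rightarrow> ('o, 'm, 'p, 'n) func \<Rightarrow> 'p set" where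
  "essential_image C D F = {M \<in> Ob D. \<exists>X \<in> Ob C. isomorphic D (Fob F X) M}"

section \<open>Colimits and locally presentable categories\<close>

definition is_cocone ::
  "('i, 'j, 'x) cat_scheme \<Rightarrow> ('o, 'm, 'y) cat_scheme \<Rightarrow> ('i, 'j, 'o, 'm) func
    \<Rightarrow> 'o \<Rightarrow> ('i \<Rightarrow> 'm) \<Rightarrow> bool" where
  "is_cocone J C D X c \<longleftrightarrow> X \<in> Ob C \<and>
     (\<forall>i \<in> Ob J. c i \<in> Hom C (Fob D i) X) \<and>
     (\<forall>i \<in> Ob J. \<forall>j \<in> Ob J. \<forall>f \<in> Hom J i j.
        Comp C (Fob D i) (Fob D j) X (c j) (Fmap D i j f) = c i)"

definition is_colimit ::
  "('i, 'j, 'x) cat_scheme \<Rightarrow> ('o, 'm, 'y) cat_scheme \<Rightarrow> ('i, 'j, 'o, 'm) func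
    \<Rightarrow> 'o \<Rightarrow> ('i \<Rightarrow> 'm) \<Rightarrow> bool" where
  "is_colimit J C D X c \<longleftrightarrow> is_cocone J C D X c \<and>
     (\<forall>Y d. is_cocone J C D Y d \<longrightarrow>
        (\<exists>!h. h \<in> Hom C X Y \<and> (\<forall>i \<in> Ob J. Comp C (Fob D i) X Y h (c i) = d i)))"

text \<open>
  The universe attached to a category \<open>C :: ('o, 'u) cat\<close> is its type of morphisms \<open>'u\<close>.
  Every category with small Hom-sets has this form up to renaming of morphisms, since Hom-sets
  need not be disjoint; the type of objects is unrestricted. Likewise it suffices to test
  cocompleteness on shapes with objects and morphisms in \<open>'u\<close>.
\<close>

definition locally_small :: "('o, 'u, 'x) cat_scheme \<Rightarrow> bool" where
  "locally_small C \<longleftrightarrow> (\<forall>X \<in> Ob C. \<forall>Y \<in> Ob C. small TYPE('u) (Hom C X Y))"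

definition cocomplete :: "('o, 'u, 'x) cat_scheme \<Rightarrow> bool" where
  "cocomplete C \<longleftrightarrow>
     (\<forall>(J :: ('u, 'u) cat) D. category J \<and> small TYPE('u) (Ob J) \<and> locally_small J \<and>
        is_functor J C D \<longrightarrow> (\<exists>X c. is_colimit J C D X c))"

definition Set_cat :: "('u set, 'u \<Rightarrow> 'u) cat" where
  "Set_cat = \<lparr>Ob = {A. small TYPE('u) A}, Hom = \<lambda>A B. A \<rightarrow>\<^sub>E B,
     Comp = \<lambda>A B D g f. compose A g f, Idn = \<lambda>A. \<lambda>x\<in>A. x\<rparr>"

definition hom_functor :: "('o, 'u, 'x) cat_scheme \<Rightarrow> 'o \<Rightarrow> ('o, 'u, 'u set, 'u \<Rightarrow> 'u) func" where
  "hom_functor C X = \<lparr>Fob = Hom C X, Fmap = \<lambda>Y Z g. \<lambda>h\<in>Hom C X Y. Comp C X Y Z g h\<rparr>"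

definition poset_cat :: "'i rel \<Rightarrow> ('i, unit) cat" where
  "poset_cat r = \<lparr>Ob = Field r, Hom = \<lambda>i j. if (i, j) \<in> r then {()} else {},
     Comp = \<lambda>_ _ _ _ _. (), Idn = \<lambda>_. ()\<rparr>"

text \<open>Infinite regular cardinals of the universe are given as cardinal well-orders on \<open>'u\<close>.\<close>

definition small_regular_cardinal :: "'u rel \<Rightarrow> bool" where
  "small_regular_cardinal \<kappa> \<longleftrightarrow> Cinfinite \<kappa> \<and> regularCard \<kappa> \<and> \<kappa> <o |UNIV :: 'u set|"

definition directed_poset :: "'u rel \<Rightarrow> 'u rel \<Rightarrow> bool" where
  "directed_poset \<kappa> r \<longleftrightarrow>
     partial_order_on (Field r) r \<and> small TYPE('u) (Field r) \<and>
     (\<forall>A. A \<subseteq> Field r \<and> |A| <o \<kappa> \<longrightarrow> (\<exists>b \<in> Field r. \<forall>a \<in> A. (a, b) \<in> r))"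

definition presentable :: "('o, 'u, 'x) cat_scheme \<Rightarrow> 'u rel \<Rightarrow> 'o \<Rightarrow> bool" where
  "presentable C \<kappa> X \<longleftrightarrow> X \<in> Ob C \<and>
     (\<forall>(r :: 'u rel) D Y c.
        directed_poset \<kappa> r \<and> is_functor (poset_cat r) C D \<and> is_colimit (poset_cat r) C D Y c \<longrightarrow>
        is_colimit (poset_cat r) Set_cat (func_comp (hom_functor C X) D)
          (Fob (hom_functor C X) Y) (\<lambda>i. Fmap (hom_functor C X) (Fob D i) Y (c i)))"

definition locally_presentable :: "('o, 'u, 'x) cat_scheme \<Rightarrow> bool" where
  "locally_presentable C \<longleftrightarrow>
     category C \<and> locally_small C \<and> cocomplete C \<and>
     (\<exists>\<kappa> :: 'u rel. small_regular_cardinal \<kappa> \<and>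
        (\<exists>S \<subseteq> Ob C. small TYPE('u) S \<and> (\<forall>X \<in> S. presentable C \<kappa> X) \<and>
           (\<forall>Y \<in> Ob C. \<exists>(r :: 'u rel) D c.
              directed_poset \<kappa> r \<and> is_functor (poset_cat r) C D \<and>
              (\<forall>i \<in> Field r. Fob D i \<in> S) \<and> is_colimit (poset_cat r) C D Y c)))"

section \<open>Abelian categories\<close>

record ('o, 'm) addcat = "('o, 'm) cat" +
  HAdd :: "'o \<Rightarrow> 'o \<Rightarrow> 'm \<Rightarrow> 'm \<Rightarrow> 'm"
  HZero :: "'o \<Rightarrow> 'o \<Rightarrow> 'm"

text \<open>As everywhere in \<open>HOL-Algebra\<close>, groups are written multiplicatively.\<close>

definition hom_group :: "('o, 'm, 'x) addcat_scheme \<Rightarrow> 'o \<Rightarrow> 'o \<Rightarrow> 'm monoid" where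
  "hom_group C X Y = \<lparr>carrier = Hom C X Y, mult = HAdd C X Y, one = HZero C X Y\<rparr>"

locale preadditive_category = category C
  for C :: "('o, 'm, 'x) addcat_scheme" +
  assumes hom_comm_group: "\<lbrakk>X \<in> Ob C; Y \<in> Ob C\<rbrakk> \<Longrightarrow> comm_group (hom_group C X Y)"
    and Comp_HAdd_right:
      "\<lbrakk>X \<in> Ob C; Y \<in> Ob C; Z \<in> Ob C; f \<in> Hom C X Y; f' \<in> Hom C X Y; g \<in> Hom C Y Z\<rbrakk>
        \<Longrightarrow> Comp C X Y Z g (HAdd C X Y f f') = HAdd C X Z (Comp C X Y Z g f) (Comp C X Y Z g f')"
    and Comp_HAdd_left:
      "\<lbrakk>X \<in> Ob C; Y \<in> Ob C; Z \<in> Ob C; f \<in> Hom C X Y; g \<in> Hom C Y Z; g' \<in> Hom C Y Z\<rbrakk>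
        \<Longrightarrow> Comp C X Y Z (HAdd C Y Z g g') f = HAdd C X Z (Comp C X Y Z g f) (Comp C X Y Z g' f)"

definition is_zero_object :: "('o, 'm, 'x) addcat_scheme \<Rightarrow> 'o \<Rightarrow> bool" where
  "is_zero_object C Z \<longleftrightarrow> Z \<in> Ob C \<and>
     (\<forall>X \<in> Ob C. (\<exists>!f. f \<in> Hom C X Z) \<and> (\<exists>!f. f \<in> Hom C Z X))"

definition is_biproduct ::
  "('o, 'm, 'x) addcat_scheme \<Rightarrow> 'o \<Rightarrow> 'o \<Rightarrow> 'o \<Rightarrow> 'm \<Rightarrow> 'm \<Rightarrow> 'm \<Rightarrow> 'm \<Rightarrow> bool" where
  "is_biproduct C X Y W i1 i2 p1 p2 \<longleftrightarrow> W \<in> Ob C \<and>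
     i1 \<in> Hom C X W \<and> i2 \<in> Hom C Y W \<and> p1 \<in> Hom C W X \<and> p2 \<in> Hom C W Y \<and>
     Comp C X W X p1 i1 = Idn C X \<and> Comp C Y W Y p2 i2 = Idn C Y \<and>
     Comp C Y W X p1 i2 = HZero C Y X \<and> Comp C X W Y p2 i1 = HZero C X Y \<and>
     HAdd C W W (Comp C W X W i1 p1) (Comp C W Y W i2 p2) = Idn C W"

definition is_kernel ::
  "('o, 'm, 'x) addcat_scheme \<Rightarrow> 'o \<Rightarrow> 'o \<Rightarrow> 'o \<Rightarrow> 'm \<Rightarrow> 'm \<Rightarrow> bool" where
  "is_kernel C K X Y k f \<longleftrightarrow>
     K \<in> Ob C \<and> k \<in> Hom C K X \<and> f \<in> Hom C X Y \<and> Comp C K X Y f k = HZero C K Y \<and>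
     (\<forall>T \<in> Ob C. \<forall>t \<in> Hom C T X. Comp C T X Y f t = HZero C T Y \<longrightarrow>
        (\<exists>!u. u \<in> Hom C T K \<and> Comp C T K X k u = t))"

definition is_cokernel ::
  "('o, 'm, 'x) addcat_scheme \<Rightarrow> 'o \<Rightarrow> 'o \<Rightarrow> 'o \<Rightarrow> 'm \<Rightarrow> 'm \<Rightarrow> bool" where
  "is_cokernel C X Y Q f q \<longleftrightarrow>
     Q \<in> Ob C \<and> f \<in> Hom C X Y \<and> q \<in> Hom C Y Q \<and> Comp C X Y Q q f = HZero C X Q \<and>
     (\<forall>T \<in> Ob C. \<forall>t \<in> Hom C Y T. Comp C X Y T t f = HZero C X T \<longrightarrow>
        (\<exists>!u. u \<in> Hom C Q T \<and> Comp C Y Q T u q = t))"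

locale abelian_category = preadditive_category C
  for C :: "('o, 'm, 'x) addcat_scheme" +
  assumes ex_zero_object: "\<exists>Z. is_zero_object C Z"
    and ex_biproduct: "\<lbrakk>X \<in> Ob C; Y \<in> Ob C\<rbrakk> \<Longrightarrow> \<exists>W i1 i2 p1 p2. is_biproduct C X Y W i1 i2 p1 p2"
    and ex_kernel:
      "\<lbrakk>X \<in> Ob C; Y \<in> Ob C; f \<in> Hom C X Y\<rbrakk> \<Longrightarrow> \<exists>K k. is_kernel C K X Y k f"
    and ex_cokernel:
      "\<lbrakk>X \<in> Ob C; Y \<in> Ob C; f \<in> Hom C X Y\<rbrakk> \<Longrightarrow> \<exists>Q q. is_cokernel C X Y Q f q"
    and mono_is_kernel:
      "\<lbrakk>X \<in> Ob C; Y \<in> Ob C; is_mono C X Y f\<rbrakk> \<Longrightarrow> \<exists>Z \<in> Ob C. \<exists>g. is_kernel C X Y Z f g"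
    and epi_is_cokernel:
      "\<lbrakk>X \<in> Ob C; Y \<in> Ob C; is_epi C X Y f\<rbrakk> \<Longrightarrow> \<exists>Z \<in> Ob C. \<exists>g. is_cokernel C Z X Y g f"

definition projective_generator :: "('o, 'm, 'x) cat_scheme \<Rightarrow> 'o \<Rightarrow> bool" where
  "projective_generator C P \<longleftrightarrow> P \<in> Ob C \<and>
     (\<forall>X \<in> Ob C. \<forall>Y \<in> Ob C. \<forall>g. is_epi C X Y g \<longrightarrow>
        (\<forall>f \<in> Hom C P Y. \<exists>h \<in> Hom C P X. Comp C P X Y g h = f)) \<and>
     (\<forall>X \<in> Ob C. \<forall>Y \<in> Ob C. \<forall>f \<in> Hom C X Y. \<forall>g \<in> Hom C X Y.
        (\<forall>h \<in> Hom C P X. Comp C P X Y f h = Comp C P X Y g h) \<longrightarrow> f = g)"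

text \<open>Exactness of \<open>X \<rightarrow> Y \<rightarrow> Z\<close> at \<open>Y\<close>: \<open>f\<close> corestricts to an epimorphism onto \<open>Ker g\<close>.\<close>

definition exact_at ::
  "('o, 'm, 'x) addcat_scheme \<Rightarrow> 'o \<Rightarrow> 'o \<Rightarrow> 'o \<Rightarrow> 'm \<Rightarrow> 'm \<Rightarrow> bool" where
  "exact_at C X Y Z f g \<longleftrightarrow> f \<in> Hom C X Y \<and> g \<in> Hom C Y Z \<and>
     (\<exists>K k e. is_kernel C K Y Z k g \<and> is_epi C X K e \<and> f = Comp C X K Y k e)"

definition closed_under_extensions :: "('o, 'm, 'x) addcat_scheme \<Rightarrow> 'o set \<Rightarrow> bool" where
  "closed_under_extensions C S \<longleftrightarrow>
     (\<forall>X \<in> S. \<forall>Z \<in> S. \<forall>Y \<in> Ob C. \<forall>f g.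
        is_mono C X Y f \<and> exact_at C X Y Z f g \<and> is_epi C Y Z g \<longrightarrow> Y \<in> S)"

section \<open>Yoneda Ext\<close>

text \<open>
  An \<open>n\<close>-extension (\<open>n \<ge> 1\<close>) of \<open>X\<close> by \<open>Y\<close> is an exact sequence
  \<open>0 \<rightarrow> Y = E 0 \<rightarrow> E 1 \<rightarrow> \<dots> \<rightarrow> E n \<rightarrow> E (n + 1) = X \<rightarrow> 0\<close>
  with \<open>d i : E i \<rightarrow> E (i + 1)\<close>; values of \<open>E\<close> and \<open>d\<close> beyond this range are ignored.
\<close>

type_synonym ('o, 'm) extension = "(nat \<Rightarrow> 'o) \<times> (nat \<Rightarrow> 'm)"

definition extensions ::
  "('o, 'm, 'x) addcat_scheme \<Rightarrow> nat \<Rightarrow> 'o \<Rightarrow> 'o \<Rightarrow> ('o, 'm) extension set" where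
  "extensions C n X Y = {(E, d).
     E 0 = Y \<and> E (Suc n) = X \<and> (\<forall>i \<le> Suc n. E i \<in> Ob C) \<and>
     (\<forall>i \<le> n. d i \<in> Hom C (E i) (E (Suc i))) \<and>
     is_mono C (E 0) (E 1) (d 0) \<and>
     (\<forall>i < n. exact_at C (E i) (E (Suc i)) (E (Suc (Suc i))) (d i) (d (Suc i))) \<and>
     is_epi C (E n) (E (Suc n)) (d n)}"

text \<open>There is a morphism of \<open>n\<close>-extensions with components \<open>a\<close> at \<open>E 0\<close> and \<open>b\<close> at \<open>E (n + 1)\<close>.\<close>

definition ext_morphism ::
  "('o, 'm, 'x) addcat_scheme \<Rightarrow> nat \<Rightarrow> ('o, 'm) extension \<Rightarrow> ('o, 'm) extension
    \<Rightarrow> 'm \<Rightarrow> 'm \<Rightarrow> bool" where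
  "ext_morphism C n \<xi> \<eta> a b \<longleftrightarrow>
     (case \<xi> of (E, d) \<Rightarrow> case \<eta> of (E', d') \<Rightarrow>
       \<exists>\<phi>. \<phi> 0 = a \<and> \<phi> (Suc n) = b \<and>
         (\<forall>i \<le> Suc n. \<phi> i \<in> Hom C (E i) (E' i)) \<and>
         (\<forall>i \<le> n. Comp C (E i) (E' i) (E' (Suc i)) (d' i) (\<phi> i)
                 = Comp C (E i) (E (Suc i)) (E' (Suc i)) (\<phi> (Suc i)) (d i)))"

definition Yoneda_rel ::
  "('o, 'm, 'x) addcat_scheme \<Rightarrow> nat \<Rightarrow> 'o \<Rightarrow> 'o \<Rightarrow> ('o, 'm) extension rel" where
  "Yoneda_rel C n X Y =
     (let r = {(\<xi>, \<eta>). \<xi> \<in> extensions C n X Y \<and> \<eta> \<in> extensions C n X Y \<and>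
                 ext_morphism C n \<xi> \<eta> (Idn C Y) (Idn C X)}
      in (r \<union> r\<inverse>)\<^sup>+)"

text \<open>
  \<open>Ext C n X Y\<close> is the abelian group of Yoneda classes for \<open>n \<ge> 1\<close>.
  A morphism of extensions \<open>\<omega> \<rightarrow> \<xi>\<close> over \<open>(a, id)\<close> says that \<open>\<xi>\<close> represents the
  pushforward \<open>a\<^sub>*\<omega>\<close>. The Baer sum \<open>\<nabla>\<^sub>*(\<xi> \<oplus> \<eta>)\<Delta>\<^sup>*\<close> is thus \<open>(p\<^sub>1 + p\<^sub>2)\<^sub>*\<omega>\<close> for an extension
  \<open>\<omega>\<close> of \<open>X\<close> by \<open>Y \<oplus> Y\<close> with \<open>p\<^sub>1\<^sub>*\<omega> = \<xi>\<close> and \<open>p\<^sub>2\<^sub>*\<omega> = \<eta>\<close> (namely \<open>\<omega> = (\<xi> \<oplus> \<eta>)\<Delta>\<^sup>*\<close>), and the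
  zero class is \<open>0\<^sub>*\<omega>\<close> for any extension \<open>\<omega>\<close> of \<open>X\<close> by \<open>Y\<close>.
\<close>

definition Ext ::
  "('o, 'm, 'x) addcat_scheme \<Rightarrow> nat \<Rightarrow> 'o \<Rightarrow> 'o \<Rightarrow> ('o, 'm) extension set monoid" where
  "Ext C n X Y =
     \<lparr>carrier = extensions C n X Y // Yoneda_rel C n X Y,
      mult = \<lambda>a b. Yoneda_rel C n X Y `` {\<zeta> \<in> extensions C n X Y.
        \<exists>\<xi> \<in> a. \<exists>\<eta> \<in> b. \<exists>W i1 i2 p1 p2. \<exists>\<omega> \<in> extensions C n X W.
          is_biproduct C Y Y W i1 i2 p1 p2 \<and>
          ext_morphism C n \<omega> \<xi> p1 (Idn C X) \<and>
          ext_morphism C n \<omega> \<eta> p2 (Idn C X) \<and>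
          ext_morphism C n \<omega> \<zeta> (HAdd C W Y p1 p2) (Idn C X)},
      one = Yoneda_rel C n X Y `` {\<zeta> \<in> extensions C n X Y.
        \<exists>\<omega> \<in> extensions C n X Y. ext_morphism C n \<omega> \<zeta> (HZero C Y Y) (Idn C X)}\<rparr>"

definition Ext_vanishes :: "('o, 'm, 'x) addcat_scheme \<Rightarrow> nat \<Rightarrow> 'o \<Rightarrow> 'o \<Rightarrow> bool" where
  "Ext_vanishes C n X Y \<longleftrightarrow>
     (if n = 0 then Hom C X Y = {HZero C X Y}
      else carrier (Ext C n X Y) = {\<one>\<^bsub>Ext C n X Y\<^esub>})"

definition ext_apply ::
  "('o, 'm, 'p, 'n) func \<Rightarrow> ('o, 'm) extension \<Rightarrow> ('p, 'n) extension" where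
  "ext_apply F \<xi> = (case \<xi> of (E, d) \<Rightarrow>
     (\<lambda>i. Fob F (E i), \<lambda>i. Fmap F (E i) (E (Suc i)) (d i)))"

definition Ext_map ::
  "('p, 'n, 'y) addcat_scheme \<Rightarrow> ('o, 'm, 'p, 'n) func \<Rightarrow> nat \<Rightarrow> 'o \<Rightarrow> 'o
    \<Rightarrow> ('o, 'm) extension set \<Rightarrow> ('p, 'n) extension set" where
  "Ext_map D F n X Y a = Yoneda_rel D n (Fob F X) (Fob F Y) `` (ext_apply F ` a)"

definition Ext_map_iso ::
  "('o, 'm, 'x) addcat_scheme \<Rightarrow> ('p, 'n, 'y) addcat_scheme \<Rightarrow> ('o, 'm, 'p, 'n) func
    \<Rightarrow> nat \<Rightarrow> 'o \<Rightarrow> 'o \<Rightarrow> bool" where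
  "Ext_map_iso C D F n X Y \<longleftrightarrow>
     (if n = 0 then Fmap F X Y \<in> iso (hom_group C X Y) (hom_group D (Fob F X) (Fob F Y))
      else Ext_map D F n X Y \<in> iso (Ext C n X Y) (Ext D n (Fob F X) (Fob F Y)))"

section \<open>Right perpendicular subcategories\<close>

definition right_perp0 ::
  "('o, 'm, 'x) addcat_scheme \<Rightarrow> 'o set \<Rightarrow> ('o \<times> 'o \<times> 'm) set \<Rightarrow> bool" where
  "right_perp0 A S \<F> \<longleftrightarrow>
     (\<forall>(U, V, f) \<in> \<F>. U \<in> Ob A \<and> V \<in> Ob A \<and> f \<in> Hom A U V) \<and>
     S = {B \<in> Ob A. \<forall>(U, V, f) \<in> \<F>.
            (\<lambda>g. Comp A U V B g f) \<in> iso (hom_group A V B) (hom_group A U B)}"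

definition right_perp1 :: "('o, 'm, 'x) addcat_scheme \<Rightarrow> 'o set \<Rightarrow> 'o set \<Rightarrow> bool" where
  "right_perp1 A S \<E> \<longleftrightarrow> \<E> \<subseteq> Ob A \<and>
     S = {B \<in> Ob A. \<forall>E \<in> \<E>. Ext_vanishes A 0 E B \<and> Ext_vanishes A 1 E B}"

definition right_perp :: "('o, 'm, 'x) addcat_scheme \<Rightarrow> enat \<Rightarrow> 'o set \<Rightarrow> 'o set \<Rightarrow> bool" where
  "right_perp A n S \<E> \<longleftrightarrow> right_perp1 A S \<E> \<and>
     (\<forall>E \<in> \<E>. \<forall>B \<in> S. \<forall>i. enat i \<le> n \<longrightarrow> Ext_vanishes A i E B)"

section \<open>Module categories and the functor Theta\<close>

text \<open>
  The library locale \<open>module\<close> requires a commutative ring. The fields \<open>mult\<close> and \<open>one\<close> of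
  the record type \<open>module\<close> carry no meaning for a module and are unconstrained.
\<close>

locale left_module = R?: ring R + M?: abelian_group M for R (structure) and M (structure) +
  assumes smult_closed:
      "\<lbrakk>a \<in> carrier R; x \<in> carrier M\<rbrakk> \<Longrightarrow> a \<odot>\<^bsub>M\<^esub> x \<in> carrier M"
    and smult_l_distr:
      "\<lbrakk>a \<in> carrier R; b \<in> carrier R; x \<in> carrier M\<rbrakk>
        \<Longrightarrow> (a \<oplus>\<^bsub>R\<^esub> b) \<odot>\<^bsub>M\<^esub> x = a \<odot>\<^bsub>M\<^esub> x \<oplus>\<^bsub>M\<^esub> b \<odot>\<^bsub>M\<^esub> x"
    and smult_r_distr:
      "\<lbrakk>a \<in> carrier R; x \<in> carrier M; y \<in> carrier M\<rbrakk>
        \<Longrightarrow> a \<odot>\<^bsub>M\<^esub> (x \<oplus>\<^bsub>M\<^esub> y) = a \<odot>\<^bsub>M\<^esub> x \<oplus>\<^bsub>M\<^esub> a \<odot>\<^bsub>M\<^esub> y"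
    and smult_assoc:
      "\<lbrakk>a \<in> carrier R; b \<in> carrier R; x \<in> carrier M\<rbrakk>
        \<Longrightarrow> (a \<otimes>\<^bsub>R\<^esub> b) \<odot>\<^bsub>M\<^esub> x = a \<odot>\<^bsub>M\<^esub> (b \<odot>\<^bsub>M\<^esub> x)"
    and smult_one: "x \<in> carrier M \<Longrightarrow> \<one>\<^bsub>R\<^esub> \<odot>\<^bsub>M\<^esub> x = x"

definition left_module_hom ::
  "('r, 'x) ring_scheme \<Rightarrow> ('r, 'u) module \<Rightarrow> ('r, 'u) module \<Rightarrow> ('u \<Rightarrow> 'u) set" where
  "left_module_hom R M N = {f \<in> carrier M \<rightarrow>\<^sub>E carrier N.
     (\<forall>x \<in> carrier M. \<forall>y \<in> carrier M. f (x \<oplus>\<^bsub>M\<^esub> y) = f x \<oplus>\<^bsub>N\<^esub> f y) \<and>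
     (\<forall>a \<in> carrier R. \<forall>x \<in> carrier M. f (a \<odot>\<^bsub>M\<^esub> x) = a \<odot>\<^bsub>N\<^esub> f x)}"

text \<open>Left \<open>R\<close>-modules whose underlying set is a small subset of the universe \<open>'u\<close>.\<close>

definition RMod :: "('r, 'x) ring_scheme \<Rightarrow> (('r, 'u) module, 'u \<Rightarrow> 'u) addcat" where
  "RMod R = \<lparr>Ob = {M. left_module R M \<and> small TYPE('u) (carrier M)},
     Hom = left_module_hom R,
     Comp = \<lambda>L M N g f. compose (carrier L) g f,
     Idn = \<lambda>M. \<lambda>x\<in>carrier M. x,
     HAdd = \<lambda>M N f g. \<lambda>x\<in>carrier M. f x \<oplus>\<^bsub>N\<^esub> g x,
     HZero = \<lambda>M N. \<lambda>x\<in>carrier M. \<zero>\<^bsub>N\<^esub>\<rparr>"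

definition End_op :: "('o, 'm, 'x) addcat_scheme \<Rightarrow> 'o \<Rightarrow> 'm ring" where
  "End_op B P = \<lparr>carrier = Hom B P P, mult = \<lambda>f g. Comp B P P P g f, one = Idn B P,
     zero = HZero B P P, add = HAdd B P P\<rparr>"

text \<open>\<open>r\<close> acts on \<open>f : P \<rightarrow> X\<close> by precomposition with \<open>\<theta> r\<close>.\<close>

definition Theta ::
  "('o, 'u, 'x) addcat_scheme \<Rightarrow> 'o \<Rightarrow> ('r \<Rightarrow> 'u) \<Rightarrow> ('o, 'u, ('r, 'u) module, 'u \<Rightarrow> 'u) func" where
  "Theta B P \<theta> = \<lparr>
     Fob = \<lambda>X. \<lparr>carrier = Hom B P X, mult = undefined, one = undefined,
                 zero = HZero B P X, add = HAdd B P X,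
                 smult = \<lambda>r f. Comp B P P X f (\<theta> r)\<rparr>,
     Fmap = \<lambda>X Y g. \<lambda>f\<in>Hom B P X. Comp B P X Y g f\<rparr>"

definition Theta_image ::
  "('o, 'u, 'x) addcat_scheme \<Rightarrow> 'o \<Rightarrow> ('r, 'y) ring_scheme \<Rightarrow> ('r \<Rightarrow> 'u) \<Rightarrow> ('r, 'u) module set"
where
  "Theta_image B P R \<theta> = essential_image B (RMod R) (Theta B P \<theta>)"

end

theory Submission
  imports Defs
begin

text \<open>
  For a small set \<open>X\<close> let \<open>T X\<close> be the module \<open>Hom (P, P^X)\<close>, where \<open>P^X\<close> is the coproduct of \<open>X\<close> copies of \<open>P\<close>.
  Since \<open>Theta\<close> is fully faithful, linear maps from \<open>T X\<close> to a module \<open>M\<close> in the image correspond to families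
  of elements of \<open>M\<close> indexed by \<open>X\<close>: as far as the image can see, \<open>T X\<close> is the free module \<open>R^X\<close>. In other
  words, \<open>M\<close> is orthogonal to the comparison map \<open>R^X \<rightarrow> T X\<close> (\<open>free_towards\<close>, \<open>Th_free\<close>).

  Conversely, a module \<open>M\<close> orthogonal to all comparison maps lies in the image. A presentation of \<open>M\<close> by free
  modules extends to one by modules \<open>T Y \<rightarrow> T X\<close>, and its cokernel may be taken in \<open>B\<close>, because \<open>Theta\<close> is exact
  (\<open>Th_cokernel\<close>, \<open>mem_S_iff\<close>). Local presentability reduces the class of comparison maps to a single one.
  \<open>P\<close> is a colimit of presentable objects over a small poset, so every \<open>P \<rightarrow> P^X\<close> factors through
  the copower over a subset of bounded size (\<open>copower_support\<close>); hence for one sufficiently large set \<open>K\<close>,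
  extensions to the \<open>T X'\<close> with \<open>X' \<subseteq> X\<close> no larger than \<open>K\<close> glue to an extension to \<open>T X\<close> (\<open>orth_all\<close>). So the
  image is right 0-perpendicular to the one map \<open>R^K \<rightarrow> T K\<close>.

  If \<open>\<theta>\<close> is injective then so is \<open>R^K \<rightarrow> T K\<close>; let \<open>C\<close> be its cokernel. If \<open>Hom (C, M)\<close> and \<open>Ext^1 (C, M)\<close> vanish
  then \<open>M\<close> is orthogonal to the map. If the image is closed under extensions, the converse holds: an
  extension of \<open>C\<close> by \<open>M\<close> pulls back to an extension of \<open>T K\<close> by \<open>M\<close> in the image, where the lift of the basis of \<open>R^K\<close>
  extends to a splitting that descends to \<open>C\<close> (\<open>Ext_vanishes_1_if_closed\<close>). That perpendicular
  subcategories are closed under extensions is a piece of the long exact sequence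
  (\<open>right_perp1_closed_under_extensions\<close>).

  For the higher groups one also has \<open>Ext^n (C, M) = Ext^n (T K, M)\<close> up to the image of \<open>Ext^(n - 1) (R^K, M) = 0\<close>,
  and \<open>Ext^n (T K, M)\<close> comes from \<open>B\<close>, where \<open>P^K\<close> is projective. With Yoneda's definition of \<open>Ext\<close> as
  classes of exact sequences, the vanishing is decided by a projective resolution of length \<open>n\<close>: it says
  that every map to \<open>M\<close> from the left end extends to the next term (\<open>Ext_vanishes_resolution\<close>,
  \<open>extends_to_next_if_split\<close>). A resolution of \<open>C\<close> differs from one of \<open>T K\<close> by a single free summand
  (\<open>resolution_of_cokernel\<close>), so the criterion passes from \<open>T K\<close> to \<open>C\<close>. Closure under extensions follows
  from the hypothesis in degree one, as the middle term of an extension is determined by its class.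
\<close>

section \<open>Smallness\<close>

lemma small_subset: "small U B \<Longrightarrow> A \<subseteq> B \<Longrightarrow> small U A"
  unfolding small_def using card_of_mono1 ordLeq_ordLess_trans by blast

lemma small_image: "small U A \<Longrightarrow> small U (f ` A)"
  unfolding small_def using card_of_image ordLeq_ordLess_trans by blast

lemma small_inj_on: "small U (f ` A) \<Longrightarrow> inj_on f A \<Longrightarrow> small U A"
  by (metis inv_into_f_f small_image small_subset image_eqI subsetI)

lemma small_embedding: "small TYPE('u) A \<Longrightarrow> \<exists>e :: 'a \<Rightarrow> 'u. inj_on e A"
  unfolding small_def by (metis card_of_ordLeq ordLess_imp_ordLeq)

locale universe =
  fixes U :: "'u itself"
  assumes inaccessible: "inaccessible_universe TYPE('u)"
begin

lemma infinite_universe: "infinite (UNIV :: 'u set)"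
  using inaccessible unfolding inaccessible_universe_def
  using infinite_iff_natLeq_ordLeq ordLess_imp_ordLeq by blast

lemma small_finite: "finite A \<Longrightarrow> small TYPE('u) A"
  using inaccessible unfolding small_def inaccessible_universe_def
  by (metis finite_iff_ordLess_natLeq ordLess_transitive)

lemma small_Un: "small TYPE('u) A \<Longrightarrow> small TYPE('u) B \<Longrightarrow> small TYPE('u) (A \<union> B)"
  unfolding small_def using card_of_Un_ordLess_infinite[OF infinite_universe] by blast

text \<open>
  The strong limit property, carried from \<open>'u\<close> to sets of any type. Products and function spaces
  embed into power sets and inherit it.
\<close>

lemma small_Pow:
  assumes "small TYPE('u) A"
  shows "small TYPE('u) (Pow A)"
proof -
  obtain e :: "'a \<Rightarrow> 'u" where e: "inj_on e A"
    using small_embedding assms by blast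
  have "small TYPE('u) (Pow (e ` A))"
    using inaccessible small_image[OF assms] unfolding inaccessible_universe_def by blast
  then have "small TYPE('u) ((`) e ` Pow A)"
    by (simp add: image_Pow_surj)
  then show ?thesis
    by (rule small_inj_on) (rule inj_on_image_Pow[OF e])
qed

lemma small_Times:
  assumes "small TYPE('u) A" "small TYPE('u) B"
  shows "small TYPE('u) (A \<times> B)"
proof (rule small_inj_on[where f = "\<lambda>(a, b). {Inl a, Inr b}"])
  have "small TYPE('u) (A <+> B)"
    using assms card_of_Plus_ordLess_infinite[OF infinite_universe] unfolding small_def by blast
  then show "small TYPE('u) ((\<lambda>(a, b). {Inl a, Inr b}) ` (A \<times> B))"
    by (rule small_subset[OF small_Pow]) auto
  show "inj_on (\<lambda>(a, b). {Inl a, Inr b}) (A \<times> B)"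
    by (auto simp: inj_on_def doubleton_eq_iff)
qed

lemma small_functions:
  assumes "small TYPE('u) A" "small TYPE('u) B"
  shows "small TYPE('u) {f. (\<forall>x\<in>A. f x \<in> B) \<and> (\<forall>x. x \<notin> A \<longrightarrow> f x = d)}" (is "small _ ?F")
proof (rule small_inj_on[where f = "\<lambda>f. (\<lambda>x. (x, f x)) ` A"])
  show "small TYPE('u) ((\<lambda>f. (\<lambda>x. (x, f x)) ` A) ` ?F)"
    by (rule small_subset[OF small_Pow[OF small_Times[OF assms]]]) auto
  show "inj_on (\<lambda>f. (\<lambda>x. (x, f x)) ` A) ?F"
  proof (rule inj_onI, rule ext)
    fix f g x
    assume fg: "f \<in> ?F" "g \<in> ?F" "(\<lambda>x. (x, f x)) ` A = (\<lambda>x. (x, g x)) ` A"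
    show "f x = g x"
    proof (cases "x \<in> A")
      case True
      then have "(x, f x) \<in> (\<lambda>x. (x, g x)) ` A" using fg(3) by blast
      then show ?thesis by auto
    qed (use fg in auto)
  qed
qed

end

section \<open>Modules and linear maps\<close>

text \<open>
  Linear maps are handled as plain functions on carriers, between modules over possibly different
  types; the extensional morphisms of the module category are their restrictions.
\<close>

definition linear_map ::
  "('r, 'x) ring_scheme \<Rightarrow> ('r, 'a) module \<Rightarrow> ('r, 'b) module \<Rightarrow> ('a \<Rightarrow> 'b) \<Rightarrow> bool" where
  "linear_map R M N f \<longleftrightarrow>
     (\<forall>x \<in> carrier M. f x \<in> carrier N) \<and>
     (\<forall>x \<in> carrier M. \<forall>y \<in> carrier M. f (x \<oplus>\<^bsub>M\<^esub> y) = f x \<oplus>\<^bsub>N\<^esub> f y) \<and>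
     (\<forall>a \<in> carrier R. \<forall>x \<in> carrier M. f (a \<odot>\<^bsub>M\<^esub> x) = a \<odot>\<^bsub>N\<^esub> f x)"

locale base_ring =
  fixes R :: "('r, 'x) ring_scheme"
  assumes ring_R: "ring R"
begin

abbreviation "lm \<equiv> left_module R"
abbreviation "lin \<equiv> linear_map R"

lemma linI:
  "\<lbrakk>\<And>x. x \<in> carrier M \<Longrightarrow> f x \<in> carrier N;
    \<And>x y. x \<in> carrier M \<Longrightarrow> y \<in> carrier M \<Longrightarrow> f (x \<oplus>\<^bsub>M\<^esub> y) = f x \<oplus>\<^bsub>N\<^esub> f y;
    \<And>a x. a \<in> carrier R \<Longrightarrow> x \<in> carrier M \<Longrightarrow> f (a \<odot>\<^bsub>M\<^esub> x) = a \<odot>\<^bsub>N\<^esub> f x\<rbrakk> \<Longrightarrow> lin M N f"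
  by (simp add: linear_map_def)

lemma lin_closed: "lin M N f \<Longrightarrow> x \<in> carrier M \<Longrightarrow> f x \<in> carrier N"
  by (simp add: linear_map_def)

lemma lin_add:
  "lin M N f \<Longrightarrow> x \<in> carrier M \<Longrightarrow> y \<in> carrier M \<Longrightarrow> f (x \<oplus>\<^bsub>M\<^esub> y) = f x \<oplus>\<^bsub>N\<^esub> f y"
  by (simp add: linear_map_def)

lemma lin_smult:
  "lin M N f \<Longrightarrow> a \<in> carrier R \<Longrightarrow> x \<in> carrier M \<Longrightarrow> f (a \<odot>\<^bsub>M\<^esub> x) = a \<odot>\<^bsub>N\<^esub> f x"
  by (simp add: linear_map_def)

lemma lm_abelian_group: "lm M \<Longrightarrow> abelian_group M"
  by (rule left_module.axioms)

lemma lm_abelian_monoid: "lm M \<Longrightarrow> abelian_monoid M"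
  by (rule abelian_group.axioms(1)[OF lm_abelian_group])

lemmas mod_zero_closed [simp] = abelian_monoid.zero_closed[OF lm_abelian_monoid]
lemmas mod_add_closed [simp] = abelian_monoid.a_closed[OF lm_abelian_monoid]
lemmas mod_neg_closed [simp] = abelian_group.a_inv_closed[OF lm_abelian_group]
lemmas mod_smult_closed [simp] = left_module.smult_closed[where R = R]
lemmas mod_zero_add [simp] = abelian_monoid.l_zero[OF lm_abelian_monoid]
lemmas mod_add_zero [simp] = abelian_monoid.r_zero[OF lm_abelian_monoid]
lemmas mod_neg_add [simp] = abelian_group.l_neg[OF lm_abelian_group]
lemmas mod_add_neg [simp] = abelian_group.r_neg[OF lm_abelian_group]
lemmas mod_neg_neg [simp] = abelian_group.minus_minus[OF lm_abelian_group]
lemmas mod_assoc = abelian_monoid.a_assoc[OF lm_abelian_monoid]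
lemmas mod_comm = abelian_monoid.a_comm[OF lm_abelian_monoid]
lemmas mod_lcomm = abelian_monoid.a_lcomm[OF lm_abelian_monoid]
lemmas mod_neg_cancel [simp] = abelian_group.r_neg1[OF lm_abelian_group]
lemmas mod_cancel_neg [simp] = abelian_group.r_neg2[OF lm_abelian_group]
lemmas mod_neg_distrib = abelian_group.minus_add[OF lm_abelian_group]
lemmas mod_smult_add = left_module.smult_r_distr[where R = R]
lemmas mod_add_smult = left_module.smult_l_distr[where R = R]
lemmas mod_mult_smult = left_module.smult_assoc[where R = R]
lemmas mod_one_smult [simp] = left_module.smult_one[where R = R]

lemma mod_minus_unique:
  "lm M \<Longrightarrow> x \<in> carrier M \<Longrightarrow> y \<in> carrier M \<Longrightarrow> y \<oplus>\<^bsub>M\<^esub> x = \<zero>\<^bsub>M\<^esub> \<Longrightarrow> \<ominus>\<^bsub>M\<^esub> x = y"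
  by (rule abelian_group.minus_equality[OF lm_abelian_group])

lemma mod_neg_zero [simp]: "lm M \<Longrightarrow> \<ominus>\<^bsub>M\<^esub> \<zero>\<^bsub>M\<^esub> = \<zero>\<^bsub>M\<^esub>"
  by (rule mod_minus_unique) simp_all

lemma mod_left_cancel:
  assumes M: "lm M" "x \<in> carrier M" "y \<in> carrier M" "z \<in> carrier M"
  shows "x \<oplus>\<^bsub>M\<^esub> y = x \<oplus>\<^bsub>M\<^esub> z \<longleftrightarrow> y = z"
proof -
  interpret abelian_group M by (rule lm_abelian_group[OF M(1)])
  show ?thesis using M by simp
qed

lemma lin_cong:
  "lin M N f \<Longrightarrow> lm M \<Longrightarrow> (\<And>x. x \<in> carrier M \<Longrightarrow> f x = g x) \<Longrightarrow> lin M N g"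
  by (simp add: linear_map_def)

lemma neg_eq_smult: "lm M \<Longrightarrow> x \<in> carrier M \<Longrightarrow> \<ominus>\<^bsub>M\<^esub> x = (\<ominus>\<^bsub>R\<^esub> \<one>\<^bsub>R\<^esub>) \<odot>\<^bsub>M\<^esub> x"
  and zero_smult: "lm M \<Longrightarrow> x \<in> carrier M \<Longrightarrow> \<zero>\<^bsub>R\<^esub> \<odot>\<^bsub>M\<^esub> x = \<zero>\<^bsub>M\<^esub>"
  and smult_zero: "lm M \<Longrightarrow> a \<in> carrier R \<Longrightarrow> a \<odot>\<^bsub>M\<^esub> \<zero>\<^bsub>M\<^esub> = \<zero>\<^bsub>M\<^esub>"
proof -
  interpret R: ring R by (rule ring_R)
  show z: "\<zero>\<^bsub>R\<^esub> \<odot>\<^bsub>M\<^esub> x = \<zero>\<^bsub>M\<^esub>" if M: "lm M" "x \<in> carrier M" for x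
  proof -
    have "\<zero>\<^bsub>R\<^esub> \<odot>\<^bsub>M\<^esub> x \<oplus>\<^bsub>M\<^esub> \<zero>\<^bsub>R\<^esub> \<odot>\<^bsub>M\<^esub> x = \<zero>\<^bsub>R\<^esub> \<odot>\<^bsub>M\<^esub> x \<oplus>\<^bsub>M\<^esub> \<zero>\<^bsub>M\<^esub>"
      using M mod_add_smult[OF M(1), of "\<zero>\<^bsub>R\<^esub>" "\<zero>\<^bsub>R\<^esub>" x] by simp
    then show ?thesis using M by (subst (asm) mod_left_cancel) auto
  qed
  show "a \<odot>\<^bsub>M\<^esub> \<zero>\<^bsub>M\<^esub> = \<zero>\<^bsub>M\<^esub>" if M: "lm M" "a \<in> carrier R"
  proof -
    have "a \<odot>\<^bsub>M\<^esub> \<zero>\<^bsub>M\<^esub> \<oplus>\<^bsub>M\<^esub> a \<odot>\<^bsub>M\<^esub> \<zero>\<^bsub>M\<^esub> = a \<odot>\<^bsub>M\<^esub> \<zero>\<^bsub>M\<^esub> \<oplus>\<^bsub>M\<^esub> \<zero>\<^bsub>M\<^esub>"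
      using M mod_smult_add[OF M(1,2), of "\<zero>\<^bsub>M\<^esub>" "\<zero>\<^bsub>M\<^esub>"] by simp
    then show ?thesis using M by (subst (asm) mod_left_cancel) auto
  qed
  show "\<ominus>\<^bsub>M\<^esub> x = (\<ominus>\<^bsub>R\<^esub> \<one>\<^bsub>R\<^esub>) \<odot>\<^bsub>M\<^esub> x" if M: "lm M" "x \<in> carrier M"
  proof (rule mod_minus_unique)
    show "(\<ominus>\<^bsub>R\<^esub> \<one>\<^bsub>R\<^esub>) \<odot>\<^bsub>M\<^esub> x \<oplus>\<^bsub>M\<^esub> x = \<zero>\<^bsub>M\<^esub>"
      using M mod_add_smult[OF M(1), of "\<ominus>\<^bsub>R\<^esub> \<one>\<^bsub>R\<^esub>" "\<one>\<^bsub>R\<^esub>" x] by (simp add: z R.l_neg)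
  qed (use M in auto)
qed

lemma mod_smult_neg:
  assumes "lm M" "a \<in> carrier R" "x \<in> carrier M"
  shows "a \<odot>\<^bsub>M\<^esub> (\<ominus>\<^bsub>M\<^esub> x) = \<ominus>\<^bsub>M\<^esub> (a \<odot>\<^bsub>M\<^esub> x)"
proof (rule mod_minus_unique[symmetric])
  show "a \<odot>\<^bsub>M\<^esub> (\<ominus>\<^bsub>M\<^esub> x) \<oplus>\<^bsub>M\<^esub> a \<odot>\<^bsub>M\<^esub> x = \<zero>\<^bsub>M\<^esub>"
    using assms by (simp add: mod_smult_add[symmetric] smult_zero)
qed (use assms in auto)

lemma mod_eq_iff_diff:
  assumes "lm M" "x \<in> carrier M" "y \<in> carrier M"
  shows "x \<oplus>\<^bsub>M\<^esub> \<ominus>\<^bsub>M\<^esub> y = \<zero>\<^bsub>M\<^esub> \<longleftrightarrow> x = y"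
  using assms by (metis mod_add_neg mod_minus_unique mod_neg_closed mod_neg_neg)

lemma left_moduleI:
  assumes "\<zero>\<^bsub>M\<^esub> \<in> carrier M"
    and "\<And>x y. x \<in> carrier M \<Longrightarrow> y \<in> carrier M \<Longrightarrow> x \<oplus>\<^bsub>M\<^esub> y \<in> carrier M"
    and "\<And>a x. a \<in> carrier R \<Longrightarrow> x \<in> carrier M \<Longrightarrow> a \<odot>\<^bsub>M\<^esub> x \<in> carrier M"
    and "\<And>x y z. x \<in> carrier M \<Longrightarrow> y \<in> carrier M \<Longrightarrow> z \<in> carrier M \<Longrightarrow>
        (x \<oplus>\<^bsub>M\<^esub> y) \<oplus>\<^bsub>M\<^esub> z = x \<oplus>\<^bsub>M\<^esub> (y \<oplus>\<^bsub>M\<^esub> z)"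
    and "\<And>x y. x \<in> carrier M \<Longrightarrow> y \<in> carrier M \<Longrightarrow> x \<oplus>\<^bsub>M\<^esub> y = y \<oplus>\<^bsub>M\<^esub> x"
    and "\<And>x. x \<in> carrier M \<Longrightarrow> \<zero>\<^bsub>M\<^esub> \<oplus>\<^bsub>M\<^esub> x = x"
    and "\<And>x. x \<in> carrier M \<Longrightarrow> \<exists>y \<in> carrier M. y \<oplus>\<^bsub>M\<^esub> x = \<zero>\<^bsub>M\<^esub>"
    and "\<And>a x y. a \<in> carrier R \<Longrightarrow> x \<in> carrier M \<Longrightarrow> y \<in> carrier M \<Longrightarrow>
        a \<odot>\<^bsub>M\<^esub> (x \<oplus>\<^bsub>M\<^esub> y) = a \<odot>\<^bsub>M\<^esub> x \<oplus>\<^bsub>M\<^esub> a \<odot>\<^bsub>M\<^esub> y"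
    and "\<And>a b x. a \<in> carrier R \<Longrightarrow> b \<in> carrier R \<Longrightarrow> x \<in> carrier M \<Longrightarrow>
        (a \<oplus>\<^bsub>R\<^esub> b) \<odot>\<^bsub>M\<^esub> x = a \<odot>\<^bsub>M\<^esub> x \<oplus>\<^bsub>M\<^esub> b \<odot>\<^bsub>M\<^esub> x"
    and "\<And>a b x. a \<in> carrier R \<Longrightarrow> b \<in> carrier R \<Longrightarrow> x \<in> carrier M \<Longrightarrow>
        (a \<otimes>\<^bsub>R\<^esub> b) \<odot>\<^bsub>M\<^esub> x = a \<odot>\<^bsub>M\<^esub> (b \<odot>\<^bsub>M\<^esub> x)"
    and "\<And>x. x \<in> carrier M \<Longrightarrow> \<one>\<^bsub>R\<^esub> \<odot>\<^bsub>M\<^esub> x = x"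
  shows "lm M"
  by (intro left_module.intro ring_R abelian_groupI left_module_axioms.intro) (fact assms)+

text \<open>
  Since the module axioms are identities, apart from the existence of negatives, they pass to images.
  Quotients and copies on other carriers are obtained this way.
\<close>

lemma left_module_image:
  assumes M: "lm M"
    and car: "carrier N = q ` carrier M"
    and zero: "\<zero>\<^bsub>N\<^esub> = q \<zero>\<^bsub>M\<^esub>"
    and add: "\<And>x y. x \<in> carrier M \<Longrightarrow> y \<in> carrier M \<Longrightarrow> q x \<oplus>\<^bsub>N\<^esub> q y = q (x \<oplus>\<^bsub>M\<^esub> y)"
    and smult: "\<And>a x. a \<in> carrier R \<Longrightarrow> x \<in> carrier M \<Longrightarrow> a \<odot>\<^bsub>N\<^esub> q x = q (a \<odot>\<^bsub>M\<^esub> x)"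
  shows "lm N" "lin M N q"
proof -
  interpret R: ring R by (rule ring_R)
  show "lin M N q" by (rule linI) (auto simp: car add smult)
  show "lm N"
  proof (rule left_moduleI)
    show "\<exists>y \<in> carrier N. y \<oplus>\<^bsub>N\<^esub> x = \<zero>\<^bsub>N\<^esub>" if x: "x \<in> carrier N" for x
    proof -
      obtain z where z: "z \<in> carrier M" "x = q z" using x car by blast
      have "q (\<ominus>\<^bsub>M\<^esub> z) \<oplus>\<^bsub>N\<^esub> x = \<zero>\<^bsub>N\<^esub>" using z M by (simp add: add zero)
      then show ?thesis using z M car by auto
    qed
    show "x \<oplus>\<^bsub>N\<^esub> y = y \<oplus>\<^bsub>N\<^esub> x" if xy: "x \<in> carrier N" "y \<in> carrier N" for x y
    proof -
      obtain x' y' where "x' \<in> carrier M" "x = q x'" "y' \<in> carrier M" "y = q y'"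
        using xy car by blast
      then show ?thesis using mod_comm[OF M, of x' y'] by (simp add: add)
    qed
  qed (use M in \<open>auto simp: car zero add smult mod_assoc mod_smult_add mod_add_smult
      mod_mult_smult\<close>)
qed

lemma lin_zero [simp]: "lin M N f \<Longrightarrow> lm M \<Longrightarrow> lm N \<Longrightarrow> f \<zero>\<^bsub>M\<^esub> = \<zero>\<^bsub>N\<^esub>"
proof -
  assume a: "lin M N f" "lm M" "lm N"
  have "f \<zero>\<^bsub>M\<^esub> \<oplus>\<^bsub>N\<^esub> f \<zero>\<^bsub>M\<^esub> = f \<zero>\<^bsub>M\<^esub> \<oplus>\<^bsub>N\<^esub> \<zero>\<^bsub>N\<^esub>"
    using a lin_add[OF a(1), of "\<zero>\<^bsub>M\<^esub>" "\<zero>\<^bsub>M\<^esub>"] by (simp add: lin_closed[OF a(1)])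
  then show ?thesis
    using a lin_closed[OF a(1)] by (subst (asm) mod_left_cancel) auto
qed

lemma lin_neg:
  assumes a: "lin M N f" "lm M" "lm N" and x: "x \<in> carrier M"
  shows "f (\<ominus>\<^bsub>M\<^esub> x) = \<ominus>\<^bsub>N\<^esub> (f x)"
proof (rule mod_minus_unique[OF a(3), symmetric])
  have "f (\<ominus>\<^bsub>M\<^esub> x) \<oplus>\<^bsub>N\<^esub> f x = f (\<ominus>\<^bsub>M\<^esub> x \<oplus>\<^bsub>M\<^esub> x)"
    using a x by (simp only: lin_add[OF a(1)] mod_neg_closed)
  then show "f (\<ominus>\<^bsub>M\<^esub> x) \<oplus>\<^bsub>N\<^esub> f x = \<zero>\<^bsub>N\<^esub>" using a x by simp
qed (use a x in \<open>auto intro: lin_closed\<close>)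

lemma lin_comp: "lin L M f \<Longrightarrow> lin M N g \<Longrightarrow> lin L N (\<lambda>x. g (f x))"
  by (simp add: linear_map_def)

lemma lin_id: "lin M M (\<lambda>x. x)"
  by (simp add: linear_map_def)

lemma lin_zero_map: "lm N \<Longrightarrow> lin M N (\<lambda>x. \<zero>\<^bsub>N\<^esub>)"
  by (simp add: linear_map_def smult_zero)

lemma lin_plus: "lm M \<Longrightarrow> lm N \<Longrightarrow> lin M N f \<Longrightarrow> lin M N g \<Longrightarrow> lin M N (\<lambda>x. f x \<oplus>\<^bsub>N\<^esub> g x)"
  by (rule linI) (simp_all add: lin_add lin_smult lin_closed mod_smult_add mod_assoc mod_lcomm)

lemma lin_uminus: "lm M \<Longrightarrow> lm N \<Longrightarrow> lin M N f \<Longrightarrow> lin M N (\<lambda>x. \<ominus>\<^bsub>N\<^esub> f x)"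
  by (rule linI) (simp_all add: lin_add lin_smult lin_closed mod_smult_neg mod_neg_distrib)

lemma lin_minus:
  "lm M \<Longrightarrow> lm N \<Longrightarrow> lin M N f \<Longrightarrow> lin M N g \<Longrightarrow> lin M N (\<lambda>x. f x \<oplus>\<^bsub>N\<^esub> \<ominus>\<^bsub>N\<^esub> g x)"
  by (intro lin_plus lin_uminus)

lemma lin_eq_diff:
  assumes "lin M N f" "lm M" "lm N" "x \<in> carrier M" "y \<in> carrier M"
  shows "f x = f y \<longleftrightarrow> f (x \<oplus>\<^bsub>M\<^esub> \<ominus>\<^bsub>M\<^esub> y) = \<zero>\<^bsub>N\<^esub>"
  using assms by (simp add: lin_add lin_neg lin_closed mod_eq_iff_diff)

lemma lin_inj_iff:
  assumes "lin M N f" "lm M" "lm N"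
  shows "inj_on f (carrier M) \<longleftrightarrow> (\<forall>x \<in> carrier M. f x = \<zero>\<^bsub>N\<^esub> \<longrightarrow> x = \<zero>\<^bsub>M\<^esub>)"
proof
  assume "inj_on f (carrier M)"
  then show "\<forall>x \<in> carrier M. f x = \<zero>\<^bsub>N\<^esub> \<longrightarrow> x = \<zero>\<^bsub>M\<^esub>"
    using assms by (metis inj_on_def lin_zero mod_zero_closed)
next
  assume r: "\<forall>x \<in> carrier M. f x = \<zero>\<^bsub>N\<^esub> \<longrightarrow> x = \<zero>\<^bsub>M\<^esub>"
  show "inj_on f (carrier M)"
  proof (rule inj_onI)
    fix x y assume xy: "x \<in> carrier M" "y \<in> carrier M" "f x = f y"
    then have "x \<oplus>\<^bsub>M\<^esub> \<ominus>\<^bsub>M\<^esub> y = \<zero>\<^bsub>M\<^esub>"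
      using r lin_eq_diff[OF assms, of x y] assms(2) by auto
    then show "x = y" using xy assms mod_eq_iff_diff[of M x y] by simp
  qed
qed

section \<open>Submodules, factorisation of maps\<close>

definition submod :: "('r, 'a) module \<Rightarrow> 'a set \<Rightarrow> bool" where
  "submod M A \<longleftrightarrow> A \<subseteq> carrier M \<and> \<zero>\<^bsub>M\<^esub> \<in> A \<and> (\<forall>x \<in> A. \<forall>y \<in> A. x \<oplus>\<^bsub>M\<^esub> y \<in> A) \<and>
     (\<forall>a \<in> carrier R. \<forall>x \<in> A. a \<odot>\<^bsub>M\<^esub> x \<in> A)"

abbreviation "restr M A \<equiv> M\<lparr>carrier := A\<rparr>"

lemma submod_neg: "lm M \<Longrightarrow> submod M A \<Longrightarrow> x \<in> A \<Longrightarrow> \<ominus>\<^bsub>M\<^esub> x \<in> A"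
proof -
  interpret R: ring R by (rule ring_R)
  assume "lm M" "submod M A" "x \<in> A"
  then show ?thesis
    unfolding submod_def by (subst neg_eq_smult) auto
qed

lemma submod_module:
  assumes M: "lm M" "submod M A"
  shows "lm (restr M A)" "lin (restr M A) M (\<lambda>x. x)"
proof -
  show "lm (restr M A)"
  proof (rule left_moduleI)
    show "\<exists>y \<in> carrier (restr M A). y \<oplus>\<^bsub>restr M A\<^esub> x = \<zero>\<^bsub>restr M A\<^esub>"
      if "x \<in> carrier (restr M A)" for x
      using that submod_neg[OF M, of x] M by (intro bexI[of _ "\<ominus>\<^bsub>M\<^esub> x"]) (auto simp: submod_def subset_iff)
    show "x \<oplus>\<^bsub>restr M A\<^esub> y = y \<oplus>\<^bsub>restr M A\<^esub> x"
      if "x \<in> carrier (restr M A)" "y \<in> carrier (restr M A)" for x y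
      using that mod_comm[OF M(1), of x y] M(2) by (auto simp: submod_def)
  qed (use M in \<open>auto simp: submod_def subset_iff mod_assoc mod_smult_add mod_add_smult
      mod_mult_smult\<close>)
  show "lin (restr M A) M (\<lambda>x. x)"
    using M by (auto simp: linear_map_def submod_def)
qed

lemma lin_into_submod: "lin L (restr M A) f \<longleftrightarrow> lin L M f \<and> (\<forall>x \<in> carrier L. f x \<in> A)"
  if "A \<subseteq> carrier M"
  using that by (auto simp: linear_map_def)

lemma submod_kernel: "lin M N f \<Longrightarrow> lm M \<Longrightarrow> lm N \<Longrightarrow> submod M {x \<in> carrier M. f x = \<zero>\<^bsub>N\<^esub>}"
  by (auto simp: submod_def lin_add lin_smult smult_zero)

lemma submod_image:
  assumes "lin M N f" "lm M" "lm N"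
  shows "submod N (f ` carrier M)"
proof -
  have "f x \<oplus>\<^bsub>N\<^esub> f y \<in> f ` carrier M" if "x \<in> carrier M" "y \<in> carrier M" for x y
    using that assms by (metis image_eqI lin_add mod_add_closed)
  moreover have "a \<odot>\<^bsub>N\<^esub> f x \<in> f ` carrier M" if "x \<in> carrier M" "a \<in> carrier R" for x a
    using that assms by (metis image_eqI lin_smult mod_smult_closed)
  moreover have "\<zero>\<^bsub>N\<^esub> \<in> f ` carrier M"
    using assms by (metis image_eqI lin_zero mod_zero_closed)
  ultimately show ?thesis
    using assms by (auto simp: submod_def lin_closed)
qed

text \<open>
  Maps out of an image of \<open>q\<close> are defined by choosing preimages, so \<open>Q\<close> may be any module onto which
  \<open>M\<close> maps, not only a set of cosets.
\<close>

lemma lin_factor_surj: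
  assumes q: "lin M Q q" "q ` carrier M = carrier Q" and h: "lin M N h" and lm: "lm M" "lm Q" "lm N"
    and ker: "\<And>x. x \<in> carrier M \<Longrightarrow> q x = \<zero>\<^bsub>Q\<^esub> \<Longrightarrow> h x = \<zero>\<^bsub>N\<^esub>"
  shows "\<exists>k. lin Q N k \<and> (\<forall>x \<in> carrier M. k (q x) = h x)"
proof -
  define k where "k y = h (SOME x. x \<in> carrier M \<and> q x = y)" for y
  have k: "k (q x) = h x" if x: "x \<in> carrier M" for x
  proof -
    define x' where "x' = (SOME z. z \<in> carrier M \<and> q z = q x)"
    have x': "x' \<in> carrier M \<and> q x' = q x"
      unfolding x'_def by (rule someI[of _ x]) (use x in auto)
    then have "h (x' \<oplus>\<^bsub>M\<^esub> \<ominus>\<^bsub>M\<^esub> x) = \<zero>\<^bsub>N\<^esub>"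
      using lin_eq_diff[OF q(1) lm(1,2), of x' x] x ker[of "x' \<oplus>\<^bsub>M\<^esub> \<ominus>\<^bsub>M\<^esub> x"] lm by simp
    then have "h x' = h x"
      using lin_eq_diff[OF h lm(1,3), of x' x] x x' by simp
    then show ?thesis unfolding k_def x'_def .
  qed
  have "lin Q N k"
  proof (rule linI)
    fix y assume "y \<in> carrier Q"
    then obtain x where "x \<in> carrier M" "y = q x" using q(2) by blast
    then show "k y \<in> carrier N" using k lin_closed[OF h] by simp
  next
    fix y y' assume "y \<in> carrier Q" "y' \<in> carrier Q"
    then obtain x x' where x: "x \<in> carrier M" "y = q x" "x' \<in> carrier M" "y' = q x'"
      using q(2) by (metis imageE)
    have "k (y \<oplus>\<^bsub>Q\<^esub> y') = k (q (x \<oplus>\<^bsub>M\<^esub> x'))" using x lin_add[OF q(1)] by simp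
    then show "k (y \<oplus>\<^bsub>Q\<^esub> y') = k y \<oplus>\<^bsub>N\<^esub> k y'" using x k lm by (simp add: lin_add[OF h])
  next
    fix a y assume a: "a \<in> carrier R" "y \<in> carrier Q"
    then obtain x where x: "x \<in> carrier M" "y = q x" using q(2) by blast
    have "k (a \<odot>\<^bsub>Q\<^esub> y) = k (q (a \<odot>\<^bsub>M\<^esub> x))" using a x lin_smult[OF q(1)] by simp
    then show "k (a \<odot>\<^bsub>Q\<^esub> y) = a \<odot>\<^bsub>N\<^esub> k y" using a x k lm by (simp add: lin_smult[OF h])
  qed
  with k show ?thesis by blast
qed

lemma lin_factor_inj:
  assumes i: "lin K M i" "inj_on i (carrier K)" and h: "lin L M h" and lm: "lm K" "lm L" "lm M"
    and im: "\<And>x. x \<in> carrier L \<Longrightarrow> h x \<in> i ` carrier K"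
  shows "\<exists>k. lin L K k \<and> (\<forall>x \<in> carrier L. i (k x) = h x)"
proof -
  define k where "k x = inv_into (carrier K) i (h x)" for x
  have k: "k x \<in> carrier K" "i (k x) = h x" if "x \<in> carrier L" for x
    using im[OF that] by (auto simp: k_def inv_into_into f_inv_into_f)
  have eq: "x = y" if "x \<in> carrier K" "y \<in> carrier K" "i x = i y" for x y
    using that i(2) by (auto dest: inj_onD)
  have "lin L K k"
  proof (rule linI)
    fix x y assume "x \<in> carrier L" "y \<in> carrier L"
    then show "k (x \<oplus>\<^bsub>L\<^esub> y) = k x \<oplus>\<^bsub>K\<^esub> k y"
      using lm by (intro eq) (simp_all add: k lin_add[OF i(1)] lin_add[OF h])
  next
    fix a x assume "a \<in> carrier R" "x \<in> carrier L"
    then show "k (a \<odot>\<^bsub>L\<^esub> x) = a \<odot>\<^bsub>K\<^esub> k x"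
      using lm by (intro eq) (simp_all add: k lin_smult[OF i(1)] lin_smult[OF h])
  qed (rule k)
  with k show ?thesis by blast
qed

end

text \<open>
  A family \<open>c\<close> in \<open>T\<close> that behaves, as far as maps into \<open>M\<close> are concerned, like the basis of a free
  module. Applied to a free module it is the usual universal property; applied to \<open>Theta\<close> of a
  coproduct of copies of \<open>P\<close> it is the orthogonality that cuts out the image of \<open>Theta\<close>.
\<close>

definition free_towards ::
  "('r, 'x) ring_scheme \<Rightarrow> ('r, 'a) module \<Rightarrow> ('i \<Rightarrow> 'a) \<Rightarrow> 'i set \<Rightarrow> ('r, 'b) module \<Rightarrow> bool" where
  "free_towards R T c X M \<longleftrightarrow>
     (\<forall>m. (\<forall>x \<in> X. m x \<in> carrier M) \<longrightarrow>
        (\<exists>g. linear_map R T M g \<and> (\<forall>x \<in> X. g (c x) = m x))) \<and>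
     (\<forall>g h. linear_map R T M g \<and> linear_map R T M h \<and> (\<forall>x \<in> X. g (c x) = h (c x)) \<longrightarrow>
        (\<forall>t \<in> carrier T. g t = h t))"

lemma free_towards_ex:
  "free_towards R T c X M \<Longrightarrow> (\<And>x. x \<in> X \<Longrightarrow> m x \<in> carrier M) \<Longrightarrow>
    \<exists>g. linear_map R T M g \<and> (\<forall>x \<in> X. g (c x) = m x)"
  unfolding free_towards_def by blast

lemma free_towards_unique:
  "free_towards R T c X M \<Longrightarrow> linear_map R T M g \<Longrightarrow> linear_map R T M h \<Longrightarrow>
    (\<And>x. x \<in> X \<Longrightarrow> g (c x) = h (c x)) \<Longrightarrow> t \<in> carrier T \<Longrightarrow> g t = h t"
  unfolding free_towards_def by blast

context base_ring begin

lemma free_towards_iso: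
  assumes ft: "free_towards R T c X M"
    and f: "lin M N f" and g: "lin N M g" and inv: "\<And>y. y \<in> carrier N \<Longrightarrow> f (g y) = y"
  shows "free_towards R T c X N"
  unfolding free_towards_def
proof (intro conjI allI impI ballI)
  fix m assume m: "\<forall>x\<in>X. m x \<in> carrier N"
  then obtain k where k: "lin T M k" "\<forall>x\<in>X. k (c x) = g (m x)"
    using free_towards_ex[OF ft, of "\<lambda>x. g (m x)"] lin_closed[OF g] by auto
  then have "lin T N (\<lambda>t. f (k t))" "\<forall>x\<in>X. f (k (c x)) = m x"
    using lin_comp[OF k(1) f] inv m by auto
  then show "\<exists>g. lin T N g \<and> (\<forall>x\<in>X. g (c x) = m x)" by blast
next
  fix h h' t assume h: "lin T N h \<and> lin T N h' \<and> (\<forall>x\<in>X. h (c x) = h' (c x))"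
    and t: "t \<in> carrier T"
  then have eq: "g (h t) = g (h' t)"
    using lin_comp[OF _ g, of T h] lin_comp[OF _ g, of T h']
      free_towards_unique[OF ft, of "\<lambda>t. g (h t)" "\<lambda>t. g (h' t)" t] by simp
  show "h t = h' t"
  proof -
    have "h t \<in> carrier N" "h' t \<in> carrier N"
      using h t lin_closed[of T N h t] lin_closed[of T N h' t] by simp_all
    then have "f (g (h t)) = h t" "f (g (h' t)) = h' t"
      by (simp_all add: inv)
    then show ?thesis using eq by metis
  qed
qed

definition prod_module :: "('r, 'a) module \<Rightarrow> ('r, 'b) module \<Rightarrow> ('r, 'a \<times> 'b) module" where
  "prod_module M N = \<lparr>carrier = carrier M \<times> carrier N, mult = undefined, one = undefined,
     zero = (\<zero>\<^bsub>M\<^esub>, \<zero>\<^bsub>N\<^esub>), add = \<lambda>s t. (fst s \<oplus>\<^bsub>M\<^esub> fst t, snd s \<oplus>\<^bsub>N\<^esub> snd t),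
     smult = \<lambda>a s. (a \<odot>\<^bsub>M\<^esub> fst s, a \<odot>\<^bsub>N\<^esub> snd s)\<rparr>"

lemma prod_module:
  assumes M: "lm M" and N: "lm N"
  shows "lm (prod_module M N)"
proof (rule left_moduleI)
  show "\<exists>y \<in> carrier (prod_module M N). y \<oplus>\<^bsub>prod_module M N\<^esub> x = \<zero>\<^bsub>prod_module M N\<^esub>"
    if "x \<in> carrier (prod_module M N)" for x
    using that assms
    by (intro bexI[of _ "(\<ominus>\<^bsub>M\<^esub> fst x, \<ominus>\<^bsub>N\<^esub> snd x)"]) (auto simp: prod_module_def)
  show "x \<oplus>\<^bsub>prod_module M N\<^esub> y = y \<oplus>\<^bsub>prod_module M N\<^esub> x"
    if "x \<in> carrier (prod_module M N)" "y \<in> carrier (prod_module M N)" for x y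
    using that mod_comm[OF M, of "fst x" "fst y"] mod_comm[OF N, of "snd x" "snd y"]
    by (auto simp: prod_module_def)
qed (use assms in \<open>auto simp: prod_module_def mod_assoc mod_smult_add mod_add_smult mod_mult_smult\<close>)

end

locale module_universe = universe U + base_ring R for U :: "'u itself" and R :: "'r ring" +
  assumes small_R: "small TYPE('u) (carrier R)"
begin

abbreviation obj :: "('r, 'u) module \<Rightarrow> bool" where
  "obj M \<equiv> M \<in> Ob (RMod R)"

lemma obj_iff: "obj M \<longleftrightarrow> lm M \<and> small TYPE('u) (carrier M)"
  by (simp add: RMod_def)

lemma obj_lm [simp]: "obj M \<Longrightarrow> lm M"
  by (simp add: obj_iff)

text \<open>
  Direct sums and free modules live on other types than \<open>'u\<close>. Being small, they can be moved back.
\<close>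

lemma ex_obj_copy:
  fixes N :: "('r, 'a) module"
  assumes N: "lm N" "small TYPE('u) (carrier N)"
  shows "\<exists>M i j. obj M \<and> lin N M i \<and> lin M N j \<and>
    (\<forall>x \<in> carrier N. j (i x) = x) \<and> (\<forall>y \<in> carrier M. i (j y) = y)"
proof -
  obtain i :: "'a \<Rightarrow> 'u" where i: "inj_on i (carrier N)"
    using small_embedding N(2) by blast
  define j where "j = inv_into (carrier N) i"
  have ji: "j (i x) = x" if "x \<in> carrier N" for x
    using that i by (simp add: j_def)
  define M :: "('r, 'u) module" where "M = \<lparr>carrier = i ` carrier N, mult = undefined,
    one = undefined, zero = i \<zero>\<^bsub>N\<^esub>, add = \<lambda>x y. i (j x \<oplus>\<^bsub>N\<^esub> j y), smult = \<lambda>a x. i (a \<odot>\<^bsub>N\<^esub> j x)\<rparr>"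
  have M: "lm M" "lin N M i"
    by (rule left_module_image[OF N(1), of _ i]; simp add: M_def ji)+
  have "lin M N j"
    by (rule linI) (auto simp: M_def ji N)
  moreover have "obj M"
    using M N(2) by (simp add: obj_iff M_def small_image)
  ultimately show ?thesis
    using M(2) ji by (intro exI[of _ M] exI[of _ i] exI[of _ j]) (auto simp: M_def)
qed

lemma obj_restr: "obj M \<Longrightarrow> submod M A \<Longrightarrow> obj (restr M A)"
  by (auto simp: obj_iff submod_module intro: small_subset simp: submod_def)

text \<open>
  The quotient is carried by a set of representatives, which keeps it inside \<open>'u\<close>.
\<close>

lemma ex_quotient:
  assumes M: "obj M" and A: "submod M A"
  shows "\<exists>Q q. obj Q \<and> lin M Q q \<and> q ` carrier M = carrier Q \<and>
    (\<forall>x \<in> carrier M. q x = \<zero>\<^bsub>Q\<^esub> \<longleftrightarrow> x \<in> A)"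
proof -
  have lmM: "lm M" using M by simp
  define eq where "eq x y \<longleftrightarrow> x \<in> carrier M \<and> y \<in> carrier M \<and> x \<oplus>\<^bsub>M\<^esub> \<ominus>\<^bsub>M\<^esub> y \<in> A" for x y
  have Asub: "\<And>x. x \<in> A \<Longrightarrow> x \<in> carrier M" using A by (auto simp: submod_def)
  have refl: "eq x x" if "x \<in> carrier M" for x
    using that A lmM by (simp add: eq_def submod_def)
  have sym: "eq y x" if "eq x y" for x y
  proof -
    have "\<ominus>\<^bsub>M\<^esub> (x \<oplus>\<^bsub>M\<^esub> \<ominus>\<^bsub>M\<^esub> y) \<in> A" using that submod_neg[OF lmM A] by (simp add: eq_def)
    then show ?thesis using that lmM by (auto simp: eq_def mod_neg_distrib mod_comm)
  qed
  have add: "eq (x \<oplus>\<^bsub>M\<^esub> x') (y \<oplus>\<^bsub>M\<^esub> y')" if "eq x y" "eq x' y'" for x y x' y'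
  proof -
    have "(x \<oplus>\<^bsub>M\<^esub> \<ominus>\<^bsub>M\<^esub> y) \<oplus>\<^bsub>M\<^esub> (x' \<oplus>\<^bsub>M\<^esub> \<ominus>\<^bsub>M\<^esub> y') \<in> A"
      using that A by (simp add: eq_def submod_def)
    moreover have "(x \<oplus>\<^bsub>M\<^esub> \<ominus>\<^bsub>M\<^esub> y) \<oplus>\<^bsub>M\<^esub> (x' \<oplus>\<^bsub>M\<^esub> \<ominus>\<^bsub>M\<^esub> y') =
        (x \<oplus>\<^bsub>M\<^esub> x') \<oplus>\<^bsub>M\<^esub> \<ominus>\<^bsub>M\<^esub> (y \<oplus>\<^bsub>M\<^esub> y')"
      using that lmM by (simp add: eq_def mod_neg_distrib mod_assoc mod_lcomm)
    ultimately show ?thesis using that lmM by (simp add: eq_def)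
  qed
  have smult: "eq (a \<odot>\<^bsub>M\<^esub> x) (a \<odot>\<^bsub>M\<^esub> y)" if "eq x y" "a \<in> carrier R" for a x y
  proof -
    have "a \<odot>\<^bsub>M\<^esub> (x \<oplus>\<^bsub>M\<^esub> \<ominus>\<^bsub>M\<^esub> y) \<in> A" using that A by (simp add: eq_def submod_def)
    then show ?thesis
      using that lmM by (simp add: eq_def mod_smult_add mod_smult_neg)
  qed
  have trans: "eq x z" if "eq x y" "eq y z" for x y z
  proof -
    have "eq (x \<oplus>\<^bsub>M\<^esub> y) (z \<oplus>\<^bsub>M\<^esub> y)"
      using add[OF that] that lmM mod_comm[OF lmM, of y z] by (simp add: eq_def)
    moreover have "(x \<oplus>\<^bsub>M\<^esub> y) \<oplus>\<^bsub>M\<^esub> \<ominus>\<^bsub>M\<^esub> (z \<oplus>\<^bsub>M\<^esub> y) = x \<oplus>\<^bsub>M\<^esub> \<ominus>\<^bsub>M\<^esub> z"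
      using that lmM by (simp add: eq_def mod_neg_distrib mod_assoc mod_lcomm[OF lmM, of y])
    ultimately show ?thesis using that by (simp add: eq_def)
  qed
  define q where "q x = (SOME y. eq x y)" for x
  have q_eq: "eq x (q x)" if "x \<in> carrier M" for x
    unfolding q_def by (rule someI[of _ x]) (rule refl[OF that])
  have q_cong: "q x = q y" if "eq x y" for x y
  proof -
    have "eq x = eq y" using that sym trans by blast
    then show ?thesis by (simp add: q_def)
  qed
  have q_car: "q x \<in> carrier M" if "x \<in> carrier M" for x using q_eq[OF that] by (simp add: eq_def)
  define Q :: "('r, 'u) module" where "Q = \<lparr>carrier = q ` carrier M, mult = undefined,
    one = undefined, zero = q \<zero>\<^bsub>M\<^esub>, add = \<lambda>x y. q (x \<oplus>\<^bsub>M\<^esub> y), smult = \<lambda>a x. q (a \<odot>\<^bsub>M\<^esub> x)\<rparr>"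
  have Q: "lm Q" "lin M Q q"
    using lmM q_eq add smult sym
    by (intro left_module_image[OF lmM, of _ q]; simp add: Q_def; intro q_cong; simp)+
  have ker: "q x = \<zero>\<^bsub>Q\<^esub> \<longleftrightarrow> x \<in> A" if x: "x \<in> carrier M" for x
  proof -
    have z: "eq \<zero>\<^bsub>M\<^esub> (q \<zero>\<^bsub>M\<^esub>)" using q_eq lmM by simp
    have "eq x \<zero>\<^bsub>M\<^esub>" if "q x = q \<zero>\<^bsub>M\<^esub>"
      using trans[OF q_eq[OF x]] sym[OF z] that by simp
    then have "q x = \<zero>\<^bsub>Q\<^esub> \<longleftrightarrow> eq x \<zero>\<^bsub>M\<^esub>"
      using q_cong[of x "\<zero>\<^bsub>M\<^esub>"] by (auto simp: Q_def)
    then show ?thesis using x lmM by (simp add: eq_def)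
  qed
  have car: "q ` carrier M = carrier Q"
    by (simp add: Q_def)
  have "small TYPE('u) (carrier Q)"
    unfolding car[symmetric] using M by (intro small_image) (simp add: obj_iff)
  then have "obj Q"
    using Q(1) by (simp add: obj_iff)
  then show ?thesis
    using Q(2) car ker by (intro exI[of _ Q] exI[of _ q]) simp
qed

lemma ex_biproduct:
  assumes M: "obj M" and N: "obj N"
  shows "\<exists>S i1 i2 p1 p2. obj S \<and> lin M S i1 \<and> lin N S i2 \<and> lin S M p1 \<and> lin S N p2 \<and>
    (\<forall>x \<in> carrier M. p1 (i1 x) = x \<and> p2 (i1 x) = \<zero>\<^bsub>N\<^esub>) \<and>
    (\<forall>y \<in> carrier N. p1 (i2 y) = \<zero>\<^bsub>M\<^esub> \<and> p2 (i2 y) = y) \<and>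
    (\<forall>s \<in> carrier S. i1 (p1 s) \<oplus>\<^bsub>S\<^esub> i2 (p2 s) = s)"
proof -
  let ?D = "prod_module M N"
  have D: "lm ?D" by (rule prod_module) (use M N in simp_all)
  have sm: "small TYPE('u) (carrier ?D)"
    using M N by (simp add: prod_module_def small_Times obj_iff)
  obtain S i j where S: "obj S" "lin ?D S i" "lin S ?D j"
    "\<forall>x \<in> carrier ?D. j (i x) = x" "\<forall>y \<in> carrier S. i (j y) = y"
    using ex_obj_copy[OF D sm] by blast
  have l0: "lin M ?D (\<lambda>x. (x, \<zero>\<^bsub>N\<^esub>))" "lin N ?D (\<lambda>y. (\<zero>\<^bsub>M\<^esub>, y))" "lin ?D M fst" "lin ?D N snd"
    using M N by (auto simp: linear_map_def prod_module_def smult_zero)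
  have l: "lin M S (\<lambda>x. i (x, \<zero>\<^bsub>N\<^esub>))" "lin N S (\<lambda>y. i (\<zero>\<^bsub>M\<^esub>, y))"
    "lin S M (\<lambda>s. fst (j s))" "lin S N (\<lambda>s. snd (j s))"
    by (rule lin_comp[OF l0(1) S(2)], rule lin_comp[OF l0(2) S(2)],
        rule lin_comp[OF S(3) l0(3)], rule lin_comp[OF S(3) l0(4)])
  have "i (fst (j s), \<zero>\<^bsub>N\<^esub>) \<oplus>\<^bsub>S\<^esub> i (\<zero>\<^bsub>M\<^esub>, snd (j s)) = s" if s: "s \<in> carrier S" for s
  proof -
    have js: "j s \<in> carrier ?D" by (rule lin_closed[OF S(3) s])
    then have "fst (j s) \<in> carrier M" "snd (j s) \<in> carrier N" by (auto simp: prod_module_def)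
    then have "i (fst (j s), \<zero>\<^bsub>N\<^esub>) \<oplus>\<^bsub>S\<^esub> i (\<zero>\<^bsub>M\<^esub>, snd (j s)) = i (fst (j s), snd (j s))"
      using M N lin_add[OF S(2), symmetric] by (simp add: prod_module_def)
    then show ?thesis using s S(5) by simp
  qed
  moreover have "fst (j (i (x, \<zero>\<^bsub>N\<^esub>))) = x \<and> snd (j (i (x, \<zero>\<^bsub>N\<^esub>))) = \<zero>\<^bsub>N\<^esub>"
    if "x \<in> carrier M" for x using that S(4) N by (simp add: prod_module_def)
  moreover have "fst (j (i (\<zero>\<^bsub>M\<^esub>, x))) = \<zero>\<^bsub>M\<^esub> \<and> snd (j (i (\<zero>\<^bsub>M\<^esub>, x))) = x"
    if "x \<in> carrier N" for x using that S(4) M by (simp add: prod_module_def)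
  ultimately show ?thesis
    using S(1) l
    by (intro exI[of _ S] exI[of _ "\<lambda>x. i (x, \<zero>\<^bsub>N\<^esub>)"] exI[of _ "\<lambda>y. i (\<zero>\<^bsub>M\<^esub>, y)"]
        exI[of _ "\<lambda>s. fst (j s)"] exI[of _ "\<lambda>s. snd (j s)"]) blast
qed

text \<open>
  The pushout is the quotient of \<open>M \<oplus> E\<close> by the pairs \<open>(a y, - f y)\<close>; the statement collects what element
  chases with it require. The clause on the zeros of \<open>u\<close> makes \<open>u\<close> injective if \<open>f\<close> is.
\<close>

lemma ex_pushout:
  assumes Y: "obj Y" and M: "obj M" and E: "obj E" and a: "lin Y M a" and f: "lin Y E f"
  shows "\<exists>W u v. obj W \<and> lin M W u \<and> lin E W v \<and> (\<forall>y \<in> carrier Y. u (a y) = v (f y)) \<and>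
    (\<forall>w \<in> carrier W. \<exists>m \<in> carrier M. \<exists>e \<in> carrier E. w = u m \<oplus>\<^bsub>W\<^esub> v e) \<and>
    (\<forall>m \<in> carrier M. u m = \<zero>\<^bsub>W\<^esub> \<longrightarrow> (\<exists>y \<in> carrier Y. m = a y \<and> f y = \<zero>\<^bsub>E\<^esub>)) \<and>
    (\<forall>N s t. obj N \<and> lin M N s \<and> lin E N t \<and> (\<forall>y \<in> carrier Y. s (a y) = t (f y)) \<longrightarrow>
      (\<exists>w. lin W N w \<and> (\<forall>m \<in> carrier M. w (u m) = s m) \<and> (\<forall>e \<in> carrier E. w (v e) = t e)))"
proof -
  have lms: "lm Y" "lm M" "lm E" using Y M E by simp_all
  obtain S i1 i2 p1 p2 where S: "obj S" "lin M S i1" "lin E S i2" "lin S M p1" "lin S E p2"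
    and p: "\<And>x. x \<in> carrier M \<Longrightarrow> p1 (i1 x) = x" "\<And>x. x \<in> carrier M \<Longrightarrow> p2 (i1 x) = \<zero>\<^bsub>E\<^esub>"
      "\<And>y. y \<in> carrier E \<Longrightarrow> p1 (i2 y) = \<zero>\<^bsub>M\<^esub>" "\<And>y. y \<in> carrier E \<Longrightarrow> p2 (i2 y) = y"
      "\<And>s. s \<in> carrier S \<Longrightarrow> i1 (p1 s) \<oplus>\<^bsub>S\<^esub> i2 (p2 s) = s"
    using ex_biproduct[OF M E] by metis
  have lmS: "lm S" using S by simp
  note cl = lin_closed[OF a] lin_closed[OF f] lin_closed[OF S(2)] lin_closed[OF S(3)]
    lin_closed[OF S(4)] lin_closed[OF S(5)]
  define k where "k y = i1 (a y) \<oplus>\<^bsub>S\<^esub> \<ominus>\<^bsub>S\<^esub> i2 (f y)" for y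
  have k: "lin Y S k"
    unfolding k_def by (intro lin_minus lms lmS lin_comp[OF a S(2)] lin_comp[OF f S(3)])
  define A where "A = k ` carrier Y"
  obtain W q where W: "obj W" "lin S W q" "q ` carrier S = carrier W"
    "\<forall>x \<in> carrier S. q x = \<zero>\<^bsub>W\<^esub> \<longleftrightarrow> x \<in> A"
    using ex_quotient[OF S(1) submod_image[OF k lms(1) lmS]] unfolding A_def by blast
  have lmW: "lm W" using W by simp
  define u v where "u m = q (i1 m)" and "v e = q (i2 e)" for m e
  have uv: "lin M W u" "lin E W v"
    unfolding u_def v_def by (rule lin_comp[OF S(2) W(2)], rule lin_comp[OF S(3) W(2)])
  have "u (a y) = v (f y)" if "y \<in> carrier Y" for y
    unfolding u_def v_def using that W(4) lms lmS lmW cl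
    by (subst lin_eq_diff[OF W(2)]) (auto simp: A_def k_def)
  moreover have "\<exists>m \<in> carrier M. \<exists>e \<in> carrier E. w = u m \<oplus>\<^bsub>W\<^esub> v e" if w: "w \<in> carrier W" for w
  proof -
    obtain s where s: "s \<in> carrier S" "w = q s" using w W(3) by blast
    have "w = u (p1 s) \<oplus>\<^bsub>W\<^esub> v (p2 s)"
      unfolding u_def v_def s(2)
      by (subst lin_add[OF W(2), symmetric]) (simp_all add: p(5)[OF s(1)] cl(3-6) s(1))
    then show ?thesis using cl(5,6)[OF s(1)] by (intro bexI)
  qed
  moreover have "\<exists>y \<in> carrier Y. m = a y \<and> f y = \<zero>\<^bsub>E\<^esub>" if m: "m \<in> carrier M" "u m = \<zero>\<^bsub>W\<^esub>" for m
  proof -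
    obtain y where y: "y \<in> carrier Y" "i1 m = k y"
      using W(4) m(2) cl(3)[OF m(1)] unfolding u_def A_def by blast
    have "p1 (k y) = a y" "p2 (k y) = \<ominus>\<^bsub>E\<^esub> f y"
      unfolding k_def using y lms lmS cl p S
      by (simp_all add: lin_add[OF S(4)] lin_add[OF S(5)] lin_neg)
    then have "m = a y" "\<ominus>\<^bsub>E\<^esub> f y = \<zero>\<^bsub>E\<^esub>" using y(2) p(1,2)[OF m(1)] by simp_all
    moreover have "f y = \<zero>\<^bsub>E\<^esub>"
      using \<open>\<ominus>\<^bsub>E\<^esub> f y = \<zero>\<^bsub>E\<^esub>\<close> mod_neg_neg[OF lms(3) cl(2)[OF y(1)]] lms(3) by simp
    ultimately show ?thesis using y(1) by blast
  qed
  moreover have "\<exists>w. lin W N w \<and> (\<forall>m \<in> carrier M. w (u m) = s m) \<and> (\<forall>e \<in> carrier E. w (v e) = t e)"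
    if N: "obj N" "lin M N s" "lin E N t" "\<forall>y \<in> carrier Y. s (a y) = t (f y)" for N s t
  proof -
    have lmN: "lm N" using N by simp
    define h where "h z = s (p1 z) \<oplus>\<^bsub>N\<^esub> t (p2 z)" for z
    have h: "lin S N h"
      unfolding h_def by (intro lin_plus lmS lmN lin_comp[OF S(4) N(2)] lin_comp[OF S(5) N(3)])
    have "h z = \<zero>\<^bsub>N\<^esub>" if z: "z \<in> carrier S" "q z = \<zero>\<^bsub>W\<^esub>" for z
    proof -
      obtain y where y: "y \<in> carrier Y" "z = k y" using W(4) z A_def by blast
      have "p1 (k y) = a y" "p2 (k y) = \<ominus>\<^bsub>E\<^esub> f y"
        unfolding k_def using y lms lmS cl p S
        by (simp_all add: lin_add[OF S(4)] lin_add[OF S(5)] lin_neg)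
      then show ?thesis
        using y N lms lmN cl lin_closed[OF N(3)] by (simp add: h_def lin_neg)
    qed
    then obtain w where w: "lin W N w" "\<forall>z \<in> carrier S. w (q z) = h z"
      using lin_factor_surj[OF W(2,3) h lmS lmW lmN] by blast
    have "w (u m) = s m" if "m \<in> carrier M" for m
      using that w(2) cl p lms lmN N lin_closed[OF N(2)] unfolding u_def h_def by simp
    moreover have "w (v e) = t e" if "e \<in> carrier E" for e
      using that w(2) cl p lms lmN N lin_closed[OF N(3)] unfolding v_def h_def by simp
    ultimately show ?thesis using w by blast
  qed
  ultimately show ?thesis
    using W(1) uv by (intro exI[of _ W] exI[of _ u] exI[of _ v]) blast
qed

end

section \<open>Free and projective modules\<close>

context base_ring begin

definition finite_support_module :: "'i set \<Rightarrow> ('r, 'i \<Rightarrow> 'r) module" where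
  "finite_support_module X =
     \<lparr>carrier = {\<phi>. (\<forall>x\<in>X. \<phi> x \<in> carrier R) \<and> (\<forall>x. x \<notin> X \<longrightarrow> \<phi> x = \<zero>\<^bsub>R\<^esub>) \<and>
        finite {x. \<phi> x \<noteq> \<zero>\<^bsub>R\<^esub>}},
      mult = undefined, one = undefined, zero = \<lambda>_. \<zero>\<^bsub>R\<^esub>,
      add = \<lambda>\<phi> \<psi> x. \<phi> x \<oplus>\<^bsub>R\<^esub> \<psi> x, smult = \<lambda>a \<phi> x. a \<otimes>\<^bsub>R\<^esub> \<phi> x\<rparr>"

definition unit_vector :: "'i \<Rightarrow> 'i \<Rightarrow> 'r" where
  "unit_vector x = (\<lambda>y. if y = x then \<one>\<^bsub>R\<^esub> else \<zero>\<^bsub>R\<^esub>)"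

definition linear_combination :: "('r, 'a) module \<Rightarrow> ('i \<Rightarrow> 'a) \<Rightarrow> ('i \<Rightarrow> 'r) \<Rightarrow> 'a" where
  "linear_combination M m \<phi> = finsum M (\<lambda>x. \<phi> x \<odot>\<^bsub>M\<^esub> m x) {x. \<phi> x \<noteq> \<zero>\<^bsub>R\<^esub>}"

lemma fs_carrier_R: "\<phi> \<in> carrier (finite_support_module X) \<Longrightarrow> \<phi> x \<in> carrier R"
proof -
  interpret R: ring R by (rule ring_R)
  show "\<phi> \<in> carrier (finite_support_module X) \<Longrightarrow> \<phi> x \<in> carrier R"
    by (cases "x \<in> X") (auto simp: finite_support_module_def)
qed

lemma fs_simps:
  "\<zero>\<^bsub>finite_support_module X\<^esub> = (\<lambda>_. \<zero>\<^bsub>R\<^esub>)"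
  "(\<phi> \<oplus>\<^bsub>finite_support_module X\<^esub> \<psi>) = (\<lambda>x. \<phi> x \<oplus>\<^bsub>R\<^esub> \<psi> x)"
  "a \<odot>\<^bsub>finite_support_module X\<^esub> \<phi> = (\<lambda>x. a \<otimes>\<^bsub>R\<^esub> \<phi> x)"
  by (simp_all add: finite_support_module_def)

lemma finite_support_module: "lm (finite_support_module X)"
proof -
  interpret R: ring R by (rule ring_R)
  let ?F = "finite_support_module X"
  note c = fs_carrier_R[where X = X]
  show ?thesis
  proof (rule left_moduleI)
    show "\<zero>\<^bsub>?F\<^esub> \<in> carrier ?F" by (simp add: finite_support_module_def)
  next
    fix \<phi> \<psi> assume pq: "\<phi> \<in> carrier ?F" "\<psi> \<in> carrier ?F"
    have "{x. \<phi> x \<oplus>\<^bsub>R\<^esub> \<psi> x \<noteq> \<zero>\<^bsub>R\<^esub>} \<subseteq> {x. \<phi> x \<noteq> \<zero>\<^bsub>R\<^esub>} \<union> {x. \<psi> x \<noteq> \<zero>\<^bsub>R\<^esub>}" by auto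
    then have "finite {x. \<phi> x \<oplus>\<^bsub>R\<^esub> \<psi> x \<noteq> \<zero>\<^bsub>R\<^esub>}"
      using pq by (auto simp: finite_support_module_def intro: finite_subset)
    with pq show "\<phi> \<oplus>\<^bsub>?F\<^esub> \<psi> \<in> carrier ?F" by (auto simp: finite_support_module_def)
    show "\<phi> \<oplus>\<^bsub>?F\<^esub> \<psi> = \<psi> \<oplus>\<^bsub>?F\<^esub> \<phi>"
      using c[OF pq(1)] c[OF pq(2)] by (simp add: finite_support_module_def R.a_comm)
  next
    fix a \<phi> assume pq: "a \<in> carrier R" "\<phi> \<in> carrier ?F"
    have "{x. a \<otimes>\<^bsub>R\<^esub> \<phi> x \<noteq> \<zero>\<^bsub>R\<^esub>} \<subseteq> {x. \<phi> x \<noteq> \<zero>\<^bsub>R\<^esub>}" using pq by auto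
    then have "finite {x. a \<otimes>\<^bsub>R\<^esub> \<phi> x \<noteq> \<zero>\<^bsub>R\<^esub>}"
      using pq by (auto simp: finite_support_module_def intro: finite_subset)
    with pq show "a \<odot>\<^bsub>?F\<^esub> \<phi> \<in> carrier ?F" by (auto simp: finite_support_module_def)
  next
    fix \<phi> assume p: "\<phi> \<in> carrier ?F"
    have "{x. \<ominus>\<^bsub>R\<^esub> \<phi> x \<noteq> \<zero>\<^bsub>R\<^esub>} \<subseteq> {x. \<phi> x \<noteq> \<zero>\<^bsub>R\<^esub>}" by auto
    then have "finite {x. \<ominus>\<^bsub>R\<^esub> \<phi> x \<noteq> \<zero>\<^bsub>R\<^esub>}"
      using p by (auto simp: finite_support_module_def intro: finite_subset)
    then have "(\<lambda>x. \<ominus>\<^bsub>R\<^esub> \<phi> x) \<in> carrier ?F"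
      using p by (auto simp: finite_support_module_def)
    moreover have "(\<lambda>x. \<ominus>\<^bsub>R\<^esub> \<phi> x) \<oplus>\<^bsub>?F\<^esub> \<phi> = \<zero>\<^bsub>?F\<^esub>"
      using c[OF p] by (simp add: finite_support_module_def R.l_neg)
    ultimately show "\<exists>y \<in> carrier ?F. y \<oplus>\<^bsub>?F\<^esub> \<phi> = \<zero>\<^bsub>?F\<^esub>" by blast
  qed (simp_all add: fs_simps c R.a_assoc R.m_assoc R.l_distr R.r_distr)
qed

lemma unit_vector_carrier: "x \<in> X \<Longrightarrow> unit_vector x \<in> carrier (finite_support_module X)"
proof -
  interpret R: ring R by (rule ring_R)
  have "{y. (y = x \<longrightarrow> \<one>\<^bsub>R\<^esub> \<noteq> \<zero>\<^bsub>R\<^esub>) \<and> y = x} \<subseteq> {x}" by blast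
  then show "x \<in> X \<Longrightarrow> unit_vector x \<in> carrier (finite_support_module X)"
    by (auto simp: finite_support_module_def unit_vector_def)
qed

text \<open>
  Sums over the exact supports are awkward to add, since supports change; any finite set that contains
  the support will do.
\<close>

lemma linear_combination_superset:
  assumes M: "lm M" and m: "\<And>x. x \<in> X \<Longrightarrow> m x \<in> carrier M"
    and p: "\<phi> \<in> carrier (finite_support_module X)"
    and A: "finite A" "{x. \<phi> x \<noteq> \<zero>\<^bsub>R\<^esub>} \<subseteq> A" "A \<subseteq> X"
  shows "linear_combination M m \<phi> = finsum M (\<lambda>x. \<phi> x \<odot>\<^bsub>M\<^esub> m x) A"
proof -
  interpret M: left_module R M by fact
  show ?thesis
    unfolding linear_combination_def
  proof (rule M.M.add.finprod_mono_neutral_cong_left[OF A(1,2)])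
    show "\<phi> i \<odot>\<^bsub>M\<^esub> m i = \<zero>\<^bsub>M\<^esub>" if "i \<in> A - {x. \<phi> x \<noteq> \<zero>\<^bsub>R\<^esub>}" for i
      using that A(3) m[of i] M by (auto simp: zero_smult)
    show "(\<lambda>x. \<phi> x \<odot>\<^bsub>M\<^esub> m x) \<in> A \<rightarrow> carrier M"
      using A(3) m M fs_carrier_R[OF p] by auto
  qed simp
qed

lemma fs_support:
  assumes "\<phi> \<in> carrier (finite_support_module X)"
  shows "finite {x. \<phi> x \<noteq> \<zero>\<^bsub>R\<^esub>}" "{x. \<phi> x \<noteq> \<zero>\<^bsub>R\<^esub>} \<subseteq> X"
  using assms by (auto simp: finite_support_module_def)

lemma finsum_smult:
  assumes M: "lm M" and a: "a \<in> carrier R" and f: "\<And>x. x \<in> A \<Longrightarrow> f x \<in> carrier M"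
  shows "finsum M (\<lambda>x. a \<odot>\<^bsub>M\<^esub> f x) A = a \<odot>\<^bsub>M\<^esub> finsum M f A"
proof -
  interpret M: left_module R M by fact
  show ?thesis
    using f
  proof (induction A rule: infinite_finite_induct)
    case (insert x A)
    then have "f \<in> A \<rightarrow> carrier M" "(\<lambda>x. a \<odot>\<^bsub>M\<^esub> f x) \<in> A \<rightarrow> carrier M"
      using a M by auto
    with insert a M show ?case
      by (simp add: mod_smult_add)
  qed (use a M in \<open>simp_all add: smult_zero\<close>)
qed

lemma linear_combination_lin:
  assumes M: "lm M" and m: "\<And>x. x \<in> X \<Longrightarrow> m x \<in> carrier M"
  shows "lin (finite_support_module X) M (linear_combination M m)"
proof -
  interpret M: left_module R M by fact
  interpret R: ring R by (rule ring_R)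
  let ?F = "finite_support_module X"
  note F = finite_support_module[of X]
  note c = fs_carrier_R[where X = X]
  have cl: "(\<lambda>x. \<phi> x \<odot>\<^bsub>M\<^esub> m x) \<in> A \<rightarrow> carrier M" if "\<phi> \<in> carrier ?F" "A \<subseteq> X" for \<phi> A
    using that m c M by auto
  note sup = linear_combination_superset[OF M m]
  show ?thesis
  proof (rule linI)
    fix \<phi> assume p: "\<phi> \<in> carrier ?F"
    show "linear_combination M m \<phi> \<in> carrier M"
      unfolding linear_combination_def
      by (intro M.M.finsum_closed cl[OF p] fs_support(2)[OF p])
  next
    fix \<phi> \<psi> assume p: "\<phi> \<in> carrier ?F" and q: "\<psi> \<in> carrier ?F"
    define A where "A = {x. \<phi> x \<noteq> \<zero>\<^bsub>R\<^esub>} \<union> {x. \<psi> x \<noteq> \<zero>\<^bsub>R\<^esub>}"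
    have A: "finite A" "A \<subseteq> X" using fs_support[OF p] fs_support[OF q] by (auto simp: A_def)
    have pq: "\<phi> \<oplus>\<^bsub>?F\<^esub> \<psi> \<in> carrier ?F" using F p q by simp
    have "linear_combination M m (\<phi> \<oplus>\<^bsub>?F\<^esub> \<psi>) = finsum M (\<lambda>x. (\<phi> \<oplus>\<^bsub>?F\<^esub> \<psi>) x \<odot>\<^bsub>M\<^esub> m x) A"
      by (rule sup[OF _ pq A(1) _ A(2)]) (auto simp: A_def finite_support_module_def)
    also have "\<dots> = finsum M (\<lambda>x. \<phi> x \<odot>\<^bsub>M\<^esub> m x \<oplus>\<^bsub>M\<^esub> \<psi> x \<odot>\<^bsub>M\<^esub> m x) A"
    proof (rule M.M.finsum_cong'[OF refl])
      show "(\<lambda>x. \<phi> x \<odot>\<^bsub>M\<^esub> m x \<oplus>\<^bsub>M\<^esub> \<psi> x \<odot>\<^bsub>M\<^esub> m x) \<in> A \<rightarrow> carrier M"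
        using A(2) m c[OF p] c[OF q] M by auto
      show "(\<phi> \<oplus>\<^bsub>?F\<^esub> \<psi>) x \<odot>\<^bsub>M\<^esub> m x = \<phi> x \<odot>\<^bsub>M\<^esub> m x \<oplus>\<^bsub>M\<^esub> \<psi> x \<odot>\<^bsub>M\<^esub> m x" if "x \<in> A" for x
      proof -
        have "m x \<in> carrier M" using that A(2) m by blast
        moreover have "(\<phi> \<oplus>\<^bsub>?F\<^esub> \<psi>) x = \<phi> x \<oplus>\<^bsub>R\<^esub> \<psi> x" by (simp add: finite_support_module_def)
        ultimately show ?thesis using M c[OF p] c[OF q] by (simp add: mod_add_smult)
      qed
    qed
    also have "\<dots> = finsum M (\<lambda>x. \<phi> x \<odot>\<^bsub>M\<^esub> m x) A \<oplus>\<^bsub>M\<^esub> finsum M (\<lambda>x. \<psi> x \<odot>\<^bsub>M\<^esub> m x) A"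
      by (rule M.M.finsum_addf[OF cl[OF p A(2)] cl[OF q A(2)]])
    also have "\<dots> = linear_combination M m \<phi> \<oplus>\<^bsub>M\<^esub> linear_combination M m \<psi>"
      using sup[OF _ p A(1) _ A(2)] sup[OF _ q A(1) _ A(2)] by (simp add: A_def)
    finally show "linear_combination M m (\<phi> \<oplus>\<^bsub>?F\<^esub> \<psi>) =
      linear_combination M m \<phi> \<oplus>\<^bsub>M\<^esub> linear_combination M m \<psi>" .
  next
    fix a \<phi> assume a: "a \<in> carrier R" and p: "\<phi> \<in> carrier ?F"
    define A where "A = {x. \<phi> x \<noteq> \<zero>\<^bsub>R\<^esub>}"
    have A: "finite A" "A \<subseteq> X" using fs_support[OF p] by (auto simp: A_def)
    have ap: "a \<odot>\<^bsub>?F\<^esub> \<phi> \<in> carrier ?F" using F a p by simp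
    have "linear_combination M m (a \<odot>\<^bsub>?F\<^esub> \<phi>) = finsum M (\<lambda>x. (a \<odot>\<^bsub>?F\<^esub> \<phi>) x \<odot>\<^bsub>M\<^esub> m x) A"
      by (rule sup[OF _ ap A(1) _ A(2)]) (use a in \<open>auto simp: A_def finite_support_module_def\<close>)
    also have "\<dots> = finsum M (\<lambda>x. a \<odot>\<^bsub>M\<^esub> (\<phi> x \<odot>\<^bsub>M\<^esub> m x)) A"
    proof (rule M.M.finsum_cong'[OF refl])
      show "(\<lambda>x. a \<odot>\<^bsub>M\<^esub> (\<phi> x \<odot>\<^bsub>M\<^esub> m x)) \<in> A \<rightarrow> carrier M"
        using A(2) m c[OF p] a M by auto
      show "(a \<odot>\<^bsub>?F\<^esub> \<phi>) x \<odot>\<^bsub>M\<^esub> m x = a \<odot>\<^bsub>M\<^esub> (\<phi> x \<odot>\<^bsub>M\<^esub> m x)" if "x \<in> A" for x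
      proof -
        have "m x \<in> carrier M" using that A(2) m by blast
        moreover have "(a \<odot>\<^bsub>?F\<^esub> \<phi>) x = a \<otimes>\<^bsub>R\<^esub> \<phi> x" by (simp add: finite_support_module_def)
        ultimately show ?thesis using M c[OF p] a by (simp add: mod_mult_smult)
      qed
    qed
    also have "\<dots> = a \<odot>\<^bsub>M\<^esub> linear_combination M m \<phi>"
      unfolding linear_combination_def A_def[symmetric]
      by (rule finsum_smult[OF M a]) (use A(2) m c[OF p] M in auto)
    finally show "linear_combination M m (a \<odot>\<^bsub>?F\<^esub> \<phi>) = a \<odot>\<^bsub>M\<^esub> linear_combination M m \<phi>" .
  qed
qed

lemma finite_support_module_induct:
  assumes p: "\<phi> \<in> carrier (finite_support_module X)"
    and zero: "Q (\<lambda>_. \<zero>\<^bsub>R\<^esub>)"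
    and step: "\<And>\<psi> a x. \<lbrakk>\<psi> \<in> carrier (finite_support_module X); a \<in> carrier R; x \<in> X; Q \<psi>\<rbrakk> \<Longrightarrow>
      Q (\<psi> \<oplus>\<^bsub>finite_support_module X\<^esub> a \<odot>\<^bsub>finite_support_module X\<^esub> unit_vector x)"
  shows "Q \<phi>"
proof -
  interpret R: ring R by (rule ring_R)
  let ?F = "finite_support_module X"
  have "Q \<phi>" if "finite A" "\<phi> \<in> carrier ?F" "{x. \<phi> x \<noteq> \<zero>\<^bsub>R\<^esub>} \<subseteq> A" for A \<phi>
    using that
  proof (induction A arbitrary: \<phi> rule: finite_induct)
    case empty
    then have "\<phi> = (\<lambda>_. \<zero>\<^bsub>R\<^esub>)" by auto
    then show ?case using zero by simp
  next
    case (insert y A)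
    note c = fs_carrier_R[OF insert.prems(1)]
    show ?case
    proof (cases "y \<in> X")
      case False
      then have "\<phi> y = \<zero>\<^bsub>R\<^esub>" using insert.prems by (auto simp: finite_support_module_def)
      then show ?thesis using insert by blast
    next
      case True
      let ?\<psi> = "\<phi>(y := \<zero>\<^bsub>R\<^esub>)"
      have "{x. ?\<psi> x \<noteq> \<zero>\<^bsub>R\<^esub>} \<subseteq> {x. \<phi> x \<noteq> \<zero>\<^bsub>R\<^esub>}" by auto
      then have "finite {x. ?\<psi> x \<noteq> \<zero>\<^bsub>R\<^esub>}"
        using fs_support(1)[OF insert.prems(1)] finite_subset by blast
      then have \<psi>: "?\<psi> \<in> carrier ?F"
        using insert.prems(1) by (auto simp: finite_support_module_def)
      have "Q ?\<psi>" by (rule insert.IH[OF \<psi>]) (use insert.prems in auto)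
      then have "Q (?\<psi> \<oplus>\<^bsub>?F\<^esub> \<phi> y \<odot>\<^bsub>?F\<^esub> unit_vector y)" by (rule step[OF \<psi> c True])
      moreover have "?\<psi> \<oplus>\<^bsub>?F\<^esub> \<phi> y \<odot>\<^bsub>?F\<^esub> unit_vector y = \<phi>"
        using c by (auto simp: finite_support_module_def unit_vector_def)
      ultimately show ?thesis by simp
    qed
  qed
  then show ?thesis using p fs_support(1)[OF p] by blast
qed

lemma finite_support_module_free:
  assumes M: "lm M"
  shows "free_towards R (finite_support_module X) unit_vector X M"
  unfolding free_towards_def
proof (intro conjI allI impI ballI)
  interpret R: ring R by (rule ring_R)
  fix m assume m: "\<forall>x\<in>X. m x \<in> carrier M"
  have "linear_combination M m (unit_vector x) = m x" if x: "x \<in> X" for x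
  proof -
    interpret M: left_module R M by fact
    have "linear_combination M m (unit_vector x) = finsum M (\<lambda>y. unit_vector x y \<odot>\<^bsub>M\<^esub> m y) {x}"
      by (rule linear_combination_superset[OF M _ unit_vector_carrier[OF x]])
        (use m x in \<open>auto simp: unit_vector_def split: if_splits\<close>)
    also have "\<dots> = m x" using m x M by (simp add: unit_vector_def)
    finally show ?thesis .
  qed
  then show "\<exists>g. lin (finite_support_module X) M g \<and> (\<forall>x\<in>X. g (unit_vector x) = m x)"
    using linear_combination_lin[OF M, of X m] m by blast
next
  let ?F = "finite_support_module X"
  fix g h \<phi>
  assume gh: "lin ?F M g \<and> lin ?F M h \<and> (\<forall>x\<in>X. g (unit_vector x) = h (unit_vector x))"
    and p: "\<phi> \<in> carrier ?F"
  note F = finite_support_module[of X]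
  have g: "lin ?F M g" and h: "lin ?F M h" using gh by auto
  show "g \<phi> = h \<phi>"
  proof (rule finite_support_module_induct[OF p])
    have "(\<lambda>_. \<zero>\<^bsub>R\<^esub>) = \<zero>\<^bsub>?F\<^esub>" by (simp add: finite_support_module_def)
    then show "g (\<lambda>_. \<zero>\<^bsub>R\<^esub>) = h (\<lambda>_. \<zero>\<^bsub>R\<^esub>)" using lin_zero[OF g F M] lin_zero[OF h F M] by simp
  next
    fix \<psi> a x
    assume a: "\<psi> \<in> carrier ?F" "a \<in> carrier R" "x \<in> X" "g \<psi> = h \<psi>"
    note u = unit_vector_carrier[OF a(3)]
    show "g (\<psi> \<oplus>\<^bsub>?F\<^esub> a \<odot>\<^bsub>?F\<^esub> unit_vector x) = h (\<psi> \<oplus>\<^bsub>?F\<^esub> a \<odot>\<^bsub>?F\<^esub> unit_vector x)"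
      using a u gh F by (simp add: lin_add[OF g] lin_add[OF h] lin_smult[OF g] lin_smult[OF h])
  qed
qed

end

context module_universe begin

text \<open>
  Besides its universal property, the free module needs its coordinate map \<open>j\<close>: the universal property
  does not see directly that an element with vanishing coordinates is zero.
\<close>

lemma ex_free:
  fixes X :: "'i set"
  assumes X: "small TYPE('u) X"
  shows "\<exists>F e j. obj F \<and> (\<forall>x \<in> X. e x \<in> carrier F) \<and>
    (\<forall>M :: ('r, 'u) module. lm M \<longrightarrow> free_towards R F e X M) \<and>
    lin F (finite_support_module X) j \<and> inj_on j (carrier F) \<and> (\<forall>x \<in> X. j (e x) = unit_vector x)"
proof -
  let ?D = "finite_support_module X"
  have D: "lm ?D" by (rule finite_support_module)
  have sm: "small TYPE('u) (carrier ?D)"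
    by (rule small_subset[OF small_functions[OF X small_R, of "\<zero>\<^bsub>R\<^esub>"]])
      (auto simp: finite_support_module_def)
  obtain F i j where F: "obj F" "lin ?D F i" "lin F ?D j"
    "\<forall>x \<in> carrier ?D. j (i x) = x" "\<forall>y \<in> carrier F. i (j y) = y"
    using ex_obj_copy[OF D sm] by blast
  have free: "free_towards R F (\<lambda>x. i (unit_vector x)) X M" if M: "lm M" for M :: "('r, 'u) module"
    unfolding free_towards_def
  proof (intro conjI allI impI ballI)
    fix m assume "\<forall>x\<in>X. m x \<in> carrier M"
    then obtain g where g: "lin ?D M g" "\<forall>x\<in>X. g (unit_vector x) = m x"
      using free_towards_ex[OF finite_support_module_free[OF M, of X], of m] by blast
    have "lin F M (\<lambda>y. g (j y))" by (rule lin_comp[OF F(3) g(1)])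
    moreover have "\<forall>x\<in>X. g (j (i (unit_vector x))) = m x"
      using g(2) F(4) by (simp add: unit_vector_carrier)
    ultimately show "\<exists>g. lin F M g \<and> (\<forall>x\<in>X. g (i (unit_vector x)) = m x)" by blast
  next
    fix g h t
    assume gh: "lin F M g \<and> lin F M h \<and> (\<forall>x\<in>X. g (i (unit_vector x)) = h (i (unit_vector x)))"
      and t: "t \<in> carrier F"
    have gl: "lin ?D M (\<lambda>y. g (i y))" and hl: "lin ?D M (\<lambda>y. h (i y))"
      using gh by (auto intro: lin_comp[OF F(2)])
    have "g (i (j t)) = h (i (j t))"
      by (rule free_towards_unique[OF finite_support_module_free[OF M] gl hl _ lin_closed[OF F(3) t]])
        (use gh in blast)
    then show "g t = h t" using F(5) t by simp
  qed
  moreover have "\<forall>x \<in> X. i (unit_vector x) \<in> carrier F"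
    by (auto intro!: lin_closed[OF F(2)] unit_vector_carrier)
  moreover have "inj_on j (carrier F)" using F(5) by (intro inj_on_inverseI[of _ i]) simp
  moreover have "\<forall>x \<in> X. j (i (unit_vector x)) = unit_vector x"
    using F(4) by (simp add: unit_vector_carrier)
  ultimately show ?thesis
    using F(1,3) by (intro exI[of _ F] exI[of _ "\<lambda>x. i (unit_vector x)"] exI[of _ j]) blast
qed

text \<open>
  Lifting is asked along any map whose image contains that of \<open>h\<close>. This is the form in which
  projectivity enters the construction of chain maps, where one lifts to a module that covers a kernel.
\<close>

definition projective :: "('r, 'u) module \<Rightarrow> bool" where
  "projective Q \<longleftrightarrow> (\<forall>M N p h. obj M \<and> obj N \<and> lin M N p \<and> lin Q N h \<and>
     (\<forall>x \<in> carrier Q. h x \<in> p ` carrier M) \<longrightarrow>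
     (\<exists>l. lin Q M l \<and> (\<forall>x \<in> carrier Q. p (l x) = h x)))"

lemma projectiveD:
  "projective Q \<Longrightarrow> obj M \<Longrightarrow> obj N \<Longrightarrow> lin M N p \<Longrightarrow> lin Q N h \<Longrightarrow>
    (\<And>x. x \<in> carrier Q \<Longrightarrow> h x \<in> p ` carrier M) \<Longrightarrow>
    \<exists>l. lin Q M l \<and> (\<forall>x \<in> carrier Q. p (l x) = h x)"
  unfolding projective_def by blast

lemma free_projective:
  assumes e: "\<forall>x \<in> X. e x \<in> carrier F" and free: "\<And>M :: ('r, 'u) module. lm M \<Longrightarrow> free_towards R F e X M"
  shows "projective F"
  unfolding projective_def
proof (intro allI impI, elim conjE)
  fix M N p h
  assume M: "obj M" "obj N" and p: "lin M N p" and h: "lin F N h"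
    and im: "\<forall>x \<in> carrier F. h x \<in> p ` carrier M"
  have "\<forall>x\<in>X. \<exists>y \<in> carrier M. p y = h (e x)"
    using e im by (metis imageE)
  then obtain m where m: "\<forall>x\<in>X. m x \<in> carrier M \<and> p (m x) = h (e x)" by metis
  then obtain l where l: "lin F M l" "\<forall>x\<in>X. l (e x) = m x"
    using free_towards_ex[OF free[OF obj_lm[OF M(1)]], of m] by blast
  have "p (l x) = h x" if "x \<in> carrier F" for x
    using free_towards_unique[OF free[OF obj_lm[OF M(2)]] lin_comp[OF l(1) p] h _ that] l(2) m by simp
  with l show "\<exists>l. lin F M l \<and> (\<forall>x \<in> carrier F. p (l x) = h x)" by blast
qed

lemma ex_projective_cover:
  assumes M: "obj M"
  shows "\<exists>F p. obj F \<and> projective F \<and> lin F M p \<and> p ` carrier F = carrier M"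
proof -
  obtain F e where F: "obj F" "\<forall>x \<in> carrier M. e x \<in> carrier F"
    "\<forall>N :: ('r, 'u) module. lm N \<longrightarrow> free_towards R F e (carrier M) N"
    using ex_free[of "carrier M"] M by (auto simp: obj_iff)
  then obtain p where p: "lin F M p" "\<forall>x\<in>carrier M. p (e x) = x"
    using free_towards_ex[of R F e "carrier M" M "\<lambda>x. x"] M by auto
  have "p ` carrier F = carrier M"
  proof
    show "p ` carrier F \<subseteq> carrier M" using lin_closed[OF p(1)] by blast
    show "carrier M \<subseteq> p ` carrier F"
    proof
      fix x assume "x \<in> carrier M"
      then show "x \<in> p ` carrier F" using p(2) F(2) by (metis image_eqI)
    qed
  qed
  moreover have "projective F" using free_projective[OF F(2)] F(3) by blast
  ultimately show ?thesis using F(1) p(1) by blast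
qed

lemma projective_biproduct:
  assumes proj: "projective M" "projective N" and lms: "lm S"
    and S: "lin M S i1" "lin N S i2" "lin S M p1" "lin S N p2"
      "\<forall>s \<in> carrier S. i1 (p1 s) \<oplus>\<^bsub>S\<^esub> i2 (p2 s) = s"
  shows "projective S"
  unfolding projective_def
proof (intro allI impI, elim conjE)
  fix A B p h
  assume A: "obj A" "obj B" and p: "lin A B p" and h: "lin S B h"
    and im: "\<forall>x \<in> carrier S. h x \<in> p ` carrier A"
  have 1: "lin M B (\<lambda>x. h (i1 x))" by (rule lin_comp[OF S(1) h])
  have 2: "lin N B (\<lambda>x. h (i2 x))" by (rule lin_comp[OF S(2) h])
  have "h (i1 x) \<in> p ` carrier A" if x: "x \<in> carrier M" for x
    using im lin_closed[OF S(1) x] by blast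
  then obtain l1 where l1: "lin M A l1" "\<forall>x \<in> carrier M. p (l1 x) = h (i1 x)"
    using projectiveD[OF proj(1) A p 1] by blast
  have "h (i2 x) \<in> p ` carrier A" if x: "x \<in> carrier N" for x
    using im lin_closed[OF S(2) x] by blast
  then obtain l2 where l2: "lin N A l2" "\<forall>x \<in> carrier N. p (l2 x) = h (i2 x)"
    using projectiveD[OF proj(2) A p 2] by blast
  have lmA: "lm A" using A by simp
  let ?l = "\<lambda>s. l1 (p1 s) \<oplus>\<^bsub>A\<^esub> l2 (p2 s)"
  have "lin S A ?l"
    by (rule lin_plus[OF lms lmA lin_comp[OF S(3) l1(1)] lin_comp[OF S(4) l2(1)]])
  moreover have "p (?l s) = h s" if s: "s \<in> carrier S" for s
  proof -
    note c = lin_closed[OF S(3) s] lin_closed[OF S(4) s]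
    have "p (?l s) = h (i1 (p1 s)) \<oplus>\<^bsub>B\<^esub> h (i2 (p2 s))"
      using l1 l2 c lin_closed[OF l1(1) c(1)] lin_closed[OF l2(1) c(2)] by (simp add: lin_add[OF p])
    also have "\<dots> = h (i1 (p1 s) \<oplus>\<^bsub>S\<^esub> i2 (p2 s))"
      by (rule lin_add[OF h lin_closed[OF S(1) c(1)] lin_closed[OF S(2) c(2)], symmetric])
    finally show ?thesis using S(5) s by simp
  qed
  ultimately show "\<exists>l. lin S A l \<and> (\<forall>x \<in> carrier S. p (l x) = h x)" by blast
qed

end

section \<open>The category of small modules in terms of elements\<close>

context module_universe begin

lemma Hom_iff: "f \<in> Hom (RMod R) M N \<longleftrightarrow> lin M N f \<and> f \<in> extensional (carrier M)"
  by (auto simp: RMod_def left_module_hom_def linear_map_def PiE_def)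

lemma Hom_lin: "f \<in> Hom (RMod R) M N \<Longrightarrow> lin M N f"
  by (simp add: Hom_iff)

lemma restrict_Hom: "lin M N f \<Longrightarrow> lm M \<Longrightarrow> restrict f (carrier M) \<in> Hom (RMod R) M N"
  unfolding Hom_iff by (auto intro: lin_cong)

lemma Hom_eqI:
  "f \<in> Hom (RMod R) M N \<Longrightarrow> g \<in> Hom (RMod R) M N' \<Longrightarrow> (\<And>x. x \<in> carrier M \<Longrightarrow> f x = g x) \<Longrightarrow> f = g"
  unfolding Hom_iff by (auto intro: extensionalityI)

lemma Comp_apply: "x \<in> carrier L \<Longrightarrow> Comp (RMod R) L M N g f x = g (f x)"
  by (simp add: RMod_def compose_def)

lemma Comp_extensional: "Comp (RMod R) L M N g f \<in> extensional (carrier L)"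
  by (simp add: RMod_def compose_def)

lemma Comp_eq_iff:
  "Comp (RMod R) L M N g f = Comp (RMod R) L M' N' g' f' \<longleftrightarrow>
     (\<forall>x \<in> carrier L. g (f x) = g' (f' x))"
proof
  assume eq: "Comp (RMod R) L M N g f = Comp (RMod R) L M' N' g' f'"
  show "\<forall>x \<in> carrier L. g (f x) = g' (f' x)"
  proof
    fix x assume "x \<in> carrier L"
    then show "g (f x) = g' (f' x)" using fun_cong[OF eq, of x] by (simp add: Comp_apply)
  qed
next
  assume "\<forall>x \<in> carrier L. g (f x) = g' (f' x)"
  then show "Comp (RMod R) L M N g f = Comp (RMod R) L M' N' g' f'"
    by (intro extensionalityI[OF Comp_extensional Comp_extensional]) (simp add: Comp_apply)
qed

lemma Idn_apply: "x \<in> carrier M \<Longrightarrow> Idn (RMod R) M x = x"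
  by (simp add: RMod_def)

lemma HZero_apply: "x \<in> carrier M \<Longrightarrow> HZero (RMod R) M N x = \<zero>\<^bsub>N\<^esub>"
  by (simp add: RMod_def)

lemma HZero_eq_iff:
  "f \<in> extensional (carrier M) \<Longrightarrow> f = HZero (RMod R) M N \<longleftrightarrow> (\<forall>x \<in> carrier M. f x = \<zero>\<^bsub>N\<^esub>)"
  by (auto simp: RMod_def extensional_def fun_eq_iff)

lemma Idn_eq_iff:
  "f \<in> extensional (carrier M) \<Longrightarrow> f = Idn (RMod R) M \<longleftrightarrow> (\<forall>x \<in> carrier M. f x = x)"
  by (auto simp: RMod_def extensional_def fun_eq_iff)

lemma HZero_Hom: "lm M \<Longrightarrow> lm N \<Longrightarrow> HZero (RMod R) M N \<in> Hom (RMod R) M N"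
  using restrict_Hom[OF lin_zero_map] by (simp add: RMod_def)

text \<open>
  A monomorphism is tested on the inclusion of its kernel, an epimorphism on the projection to its
  cokernel; each is compared with a zero map.
\<close>

lemma is_mono_iff:
  assumes X: "obj X" and Y: "obj Y"
  shows "is_mono (RMod R) X Y f \<longleftrightarrow> f \<in> Hom (RMod R) X Y \<and> inj_on f (carrier X)"
proof (intro iffI conjI; (elim conjE)?)
  assume m: "is_mono (RMod R) X Y f"
  then show f: "f \<in> Hom (RMod R) X Y" by (simp add: is_mono_def)
  have lf: "lin X Y f" using f by (rule Hom_lin)
  let ?K = "{x \<in> carrier X. f x = \<zero>\<^bsub>Y\<^esub>}"
  have K: "submod X ?K" using submod_kernel[OF lf] X Y by simp
  let ?i = "restrict (\<lambda>x. x) ?K" and ?z = "restrict (\<lambda>x. \<zero>\<^bsub>X\<^esub>) ?K"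
  have oK: "obj (restr X ?K)" by (rule obj_restr[OF X K])
  have "?i \<in> Hom (RMod R) (restr X ?K) X"
    using restrict_Hom[OF submod_module(2)[OF obj_lm[OF X] K] obj_lm[OF oK]] by simp
  moreover have "?z \<in> Hom (RMod R) (restr X ?K) X"
    using restrict_Hom[OF lin_zero_map[OF obj_lm[OF X]] obj_lm[OF oK]] by simp
  moreover have "Comp (RMod R) (restr X ?K) X Y f ?i = Comp (RMod R) (restr X ?K) X Y f ?z"
    unfolding Comp_eq_iff using lin_zero[OF lf] X Y by auto
  ultimately have "?i = ?z" using m oK unfolding is_mono_def by blast
  then have eq: "?i x = ?z x" for x by (rule fun_cong)
  have "x = \<zero>\<^bsub>X\<^esub>" if "x \<in> ?K" for x
    using that eq[of x] by simp
  then show "inj_on f (carrier X)"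
    using lin_inj_iff[OF lf] X Y by auto
next
  assume f: "f \<in> Hom (RMod R) X Y" and inj: "inj_on f (carrier X)"
  show "is_mono (RMod R) X Y f"
    unfolding is_mono_def Comp_eq_iff
  proof (intro conjI ballI impI f)
    fix T g h
    assume gh: "g \<in> Hom (RMod R) T X" "h \<in> Hom (RMod R) T X" "\<forall>x\<in>carrier T. f (g x) = f (h x)"
    show "g = h"
    proof (rule Hom_eqI[OF gh(1,2)])
      fix x assume x: "x \<in> carrier T"
      show "g x = h x"
        using inj_onD[OF inj] gh(3) x lin_closed[OF Hom_lin[OF gh(1)] x]
          lin_closed[OF Hom_lin[OF gh(2)] x] by blast
    qed
  qed
qed

lemma is_epi_iff:
  assumes X: "obj X" and Y: "obj Y"
  shows "is_epi (RMod R) X Y f \<longleftrightarrow> f \<in> Hom (RMod R) X Y \<and> f ` carrier X = carrier Y"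
proof (intro iffI conjI; (elim conjE)?)
  assume m: "is_epi (RMod R) X Y f"
  then show f: "f \<in> Hom (RMod R) X Y" by (simp add: is_epi_def)
  have lf: "lin X Y f" using f by (rule Hom_lin)
  have I: "submod Y (f ` carrier X)" using submod_image[OF lf] X Y by simp
  obtain Q q where Q: "obj Q" "lin Y Q q" "\<forall>y \<in> carrier Y. q y = \<zero>\<^bsub>Q\<^esub> \<longleftrightarrow> y \<in> f ` carrier X"
    using ex_quotient[OF Y I] by blast
  let ?q = "restrict q (carrier Y)" and ?z = "HZero (RMod R) Y Q"
  have q: "?q \<in> Hom (RMod R) Y Q" by (rule restrict_Hom[OF Q(2) obj_lm[OF Y]])
  have z: "?z \<in> Hom (RMod R) Y Q" by (rule HZero_Hom) (use Y Q in simp_all)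
  have "Comp (RMod R) X Y Q ?q f = Comp (RMod R) X Y Q ?z f"
    unfolding Comp_eq_iff
  proof
    fix x assume x: "x \<in> carrier X"
    then show "?q (f x) = ?z (f x)"
      using Q(3) lin_closed[OF lf x] by (simp add: HZero_apply)
  qed
  then have "?q = ?z" using m q z Q(1) unfolding is_epi_def by blast
  then have eq: "?q y = ?z y" for y by (rule fun_cong)
  have "y \<in> f ` carrier X" if y: "y \<in> carrier Y" for y
    using eq[of y] y Q(3) by (simp add: HZero_apply)
  then show "f ` carrier X = carrier Y" using lin_closed[OF lf] by blast
next
  assume f: "f \<in> Hom (RMod R) X Y" and surj: "f ` carrier X = carrier Y"
  show "is_epi (RMod R) X Y f"
    unfolding is_epi_def Comp_eq_iff
  proof (intro conjI ballI impI f)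
    fix T g h
    assume gh: "g \<in> Hom (RMod R) Y T" "h \<in> Hom (RMod R) Y T" "\<forall>x\<in>carrier X. g (f x) = h (f x)"
    show "g = h"
    proof (rule Hom_eqI[OF gh(1,2)])
      fix y assume "y \<in> carrier Y"
      then obtain x where "x \<in> carrier X" "y = f x" using surj by blast
      then show "g y = h y" using gh(3) by simp
    qed
  qed
qed

lemma kernel_inclusion:
  assumes Y: "obj Y" and Z: "obj Z" and g: "g \<in> Hom (RMod R) Y Z"
  defines "K \<equiv> {y \<in> carrier Y. g y = \<zero>\<^bsub>Z\<^esub>}"
  shows "obj (restr Y K)" "is_kernel (RMod R) (restr Y K) Y Z (restrict (\<lambda>x. x) K) g"
proof -
  note lg = Hom_lin[OF g]
  have K: "submod Y K" unfolding K_def using submod_kernel[OF lg] Y Z by simp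
  show o: "obj (restr Y K)" by (rule obj_restr[OF Y K])
  let ?i = "restrict (\<lambda>x. x) K"
  have i: "?i \<in> Hom (RMod R) (restr Y K) Y"
    using restrict_Hom[OF submod_module(2)[OF obj_lm[OF Y] K] obj_lm[OF o]] by simp
  show "is_kernel (RMod R) (restr Y K) Y Z ?i g"
    unfolding is_kernel_def
  proof (intro conjI ballI impI o i g)
    show "Comp (RMod R) (restr Y K) Y Z g ?i = HZero (RMod R) (restr Y K) Z"
      unfolding HZero_eq_iff[OF Comp_extensional] by (simp add: Comp_apply K_def)
    fix T t
    assume T: "obj T" and t: "t \<in> Hom (RMod R) T Y"
      and gt: "Comp (RMod R) T Y Z g t = HZero (RMod R) T Z"
    have tK: "t x \<in> K" if x: "x \<in> carrier T" for x
    proof -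
      have "g (t x) = \<zero>\<^bsub>Z\<^esub>"
        using fun_cong[OF gt, of x] x by (simp add: Comp_apply HZero_apply)
      then show ?thesis using lin_closed[OF Hom_lin[OF t] x] by (simp add: K_def)
    qed
    have "K \<subseteq> carrier Y" by (auto simp: K_def)
    then have "t \<in> Hom (RMod R) T (restr Y K)"
      using t tK by (simp add: Hom_iff lin_into_submod)
    moreover have "Comp (RMod R) T (restr Y K) Y ?i t = t"
      by (rule extensionalityI[OF Comp_extensional])
        (use t tK in \<open>auto simp: Hom_iff Comp_apply\<close>)
    moreover have "u = t"
      if u: "u \<in> Hom (RMod R) T (restr Y K)" "Comp (RMod R) T (restr Y K) Y ?i u = t" for u
    proof (rule Hom_eqI[OF u(1) t])
      fix x assume x: "x \<in> carrier T"
      have "u x \<in> K" using lin_closed[OF Hom_lin[OF u(1)] x] by simp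
      then show "u x = t x" using fun_cong[OF u(2), of x] x by (simp add: Comp_apply)
    qed
    ultimately show "\<exists>!u. u \<in> Hom (RMod R) T (restr Y K) \<and> Comp (RMod R) T (restr Y K) Y ?i u = t"
      by blast
  qed
qed

lemma Comp_Hom:
  assumes "f \<in> Hom (RMod R) L M" "g \<in> Hom (RMod R) M N" "obj L"
  shows "Comp (RMod R) L M N g f \<in> Hom (RMod R) L N"
  unfolding Hom_iff
proof
  show "lin L N (Comp (RMod R) L M N g f)"
    by (rule lin_cong[OF lin_comp[OF Hom_lin[OF assms(1)] Hom_lin[OF assms(2)]]])
      (use assms(3) in \<open>simp_all add: Comp_apply\<close>)
qed (rule Comp_extensional)

text \<open>
  The kernel in the definition of exactness is arbitrary; it is compared with the submodule of
  zeros of \<open>g\<close> by its universal property.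
\<close>

lemma exact_at_iff:
  assumes X: "obj X" and Y: "obj Y" and Z: "obj Z"
  shows "exact_at (RMod R) X Y Z f g \<longleftrightarrow> f \<in> Hom (RMod R) X Y \<and> g \<in> Hom (RMod R) Y Z \<and>
    f ` carrier X = {y \<in> carrier Y. g y = \<zero>\<^bsub>Z\<^esub>}"
proof
  assume ex: "exact_at (RMod R) X Y Z f g"
  then have f: "f \<in> Hom (RMod R) X Y" and g: "g \<in> Hom (RMod R) Y Z" by (auto simp: exact_at_def)
  obtain K k e where K: "is_kernel (RMod R) K Y Z k g" "is_epi (RMod R) X K e"
    "f = Comp (RMod R) X K Y k e"
    using ex unfolding exact_at_def by blast
  have oK: "obj K" and k: "k \<in> Hom (RMod R) K Y"
    and gk: "Comp (RMod R) K Y Z g k = HZero (RMod R) K Z"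
    using K(1) by (auto simp: is_kernel_def)
  have e: "e ` carrier X = carrier K" using K(2) is_epi_iff[OF X oK] by blast
  have fk: "f x = k (e x)" if "x \<in> carrier X" for x using that K(3) by (simp add: Comp_apply)
  have gk0: "g (k x) = \<zero>\<^bsub>Z\<^esub>" if x: "x \<in> carrier K" for x
    using fun_cong[OF gk, of x] x by (simp add: Comp_apply HZero_apply)
  let ?K = "{y \<in> carrier Y. g y = \<zero>\<^bsub>Z\<^esub>}"
  let ?i = "restrict (\<lambda>x. x) ?K"
  note ki = kernel_inclusion[OF Y Z g]
  have "?i \<in> Hom (RMod R) (restr Y ?K) Y"
    "Comp (RMod R) (restr Y ?K) Y Z g ?i = HZero (RMod R) (restr Y ?K) Z"
    using ki(2) by (auto simp: is_kernel_def)
  then obtain u where u: "u \<in> Hom (RMod R) (restr Y ?K) K"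
    "Comp (RMod R) (restr Y ?K) K Y k u = ?i"
    using K(1) ki(1) unfolding is_kernel_def by blast
  have "f ` carrier X = ?K"
  proof (intro equalityI subsetI)
    fix y assume "y \<in> f ` carrier X"
    then obtain x where x: "x \<in> carrier X" "y = f x" by blast
    have "e x \<in> carrier K" using e x(1) by blast
    then show "y \<in> ?K" using gk0 lin_closed[OF Hom_lin[OF k]] x fk by simp
  next
    fix y assume y: "y \<in> ?K"
    have "u y \<in> carrier K" using lin_closed[OF Hom_lin[OF u(1)], of y] y by simp
    then obtain x where x: "x \<in> carrier X" "e x = u y" using e by (metis imageE)
    have "k (u y) = y" using fun_cong[OF u(2), of y] y by (simp add: Comp_apply)
    then show "y \<in> f ` carrier X" using x fk by (metis image_eqI)
  qed
  then show "f \<in> Hom (RMod R) X Y \<and> g \<in> Hom (RMod R) Y Z \<and>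
    f ` carrier X = {y \<in> carrier Y. g y = \<zero>\<^bsub>Z\<^esub>}" using f g by blast
next
  assume a: "f \<in> Hom (RMod R) X Y \<and> g \<in> Hom (RMod R) Y Z \<and>
    f ` carrier X = {y \<in> carrier Y. g y = \<zero>\<^bsub>Z\<^esub>}"
  let ?K = "{y \<in> carrier Y. g y = \<zero>\<^bsub>Z\<^esub>}"
  have f: "f \<in> Hom (RMod R) X Y" and g: "g \<in> Hom (RMod R) Y Z" and im: "f ` carrier X = ?K"
    using a by auto
  note ki = kernel_inclusion[OF Y Z g]
  have "\<forall>x \<in> carrier X. f x \<in> ?K" using im by blast
  then have fK: "f \<in> Hom (RMod R) X (restr Y ?K)"
    using f lin_into_submod[of ?K Y X f] by (simp add: Hom_iff)
  have "is_epi (RMod R) X (restr Y ?K) f"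
    unfolding is_epi_iff[OF X ki(1)] using fK im by simp
  moreover have "f = Comp (RMod R) X (restr Y ?K) Y (restrict (\<lambda>x. x) ?K) f"
    by (rule extensionalityI[OF _ Comp_extensional])
      (use f im in \<open>auto simp: Hom_iff Comp_apply\<close>)
  ultimately show "exact_at (RMod R) X Y Z f g"
    unfolding exact_at_def using f g ki(2) by blast
qed

definition iso_modules :: "('r, 'u) module \<Rightarrow> ('r, 'u) module \<Rightarrow> bool" where
  "iso_modules M N \<longleftrightarrow> (\<exists>f g. lin M N f \<and> lin N M g \<and>
     (\<forall>x \<in> carrier M. g (f x) = x) \<and> (\<forall>y \<in> carrier N. f (g y) = y))"

lemma isomorphic_iff:
  assumes M: "obj M" and N: "obj N"
  shows "isomorphic (RMod R) M N \<longleftrightarrow> iso_modules M N"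
proof
  assume "isomorphic (RMod R) M N"
  then obtain f g where fg: "f \<in> Hom (RMod R) M N" "g \<in> Hom (RMod R) N M"
    "Comp (RMod R) M N M g f = Idn (RMod R) M" "Comp (RMod R) N M N f g = Idn (RMod R) N"
    unfolding isomorphic_def by blast
  then show "iso_modules M N"
    unfolding iso_modules_def Idn_eq_iff[OF Comp_extensional]
    by (intro exI[of _ f] exI[of _ g]) (auto simp: Comp_apply Hom_lin)
next
  assume "iso_modules M N"
  then obtain f g where fg: "lin M N f" "lin N M g" "\<forall>x \<in> carrier M. g (f x) = x"
    "\<forall>y \<in> carrier N. f (g y) = y"
    unfolding iso_modules_def by blast
  show "isomorphic (RMod R) M N"
    unfolding isomorphic_def Idn_eq_iff[OF Comp_extensional]
  proof (intro bexI conjI)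
    show "restrict f (carrier M) \<in> Hom (RMod R) M N" "restrict g (carrier N) \<in> Hom (RMod R) N M"
      using restrict_Hom[OF fg(1) obj_lm[OF M]] restrict_Hom[OF fg(2) obj_lm[OF N]] .
  qed (use fg lin_closed[OF fg(1)] lin_closed[OF fg(2)] in \<open>auto simp: Comp_apply\<close>)
qed

lemma iso_modules_refl: "iso_modules M M"
  unfolding iso_modules_def using lin_id by blast

lemma iso_modules_sym: "iso_modules M N \<Longrightarrow> iso_modules N M"
  unfolding iso_modules_def by blast

lemma iso_modules_trans: "iso_modules L M \<Longrightarrow> iso_modules M N \<Longrightarrow> iso_modules L N"
proof -
  assume "iso_modules L M" "iso_modules M N"
  then obtain f g f' g' where fg: "lin L M f" "lin M L g" "\<forall>x \<in> carrier L. g (f x) = x"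
    "\<forall>y \<in> carrier M. f (g y) = y" "lin M N f'" "lin N M g'" "\<forall>x \<in> carrier M. g' (f' x) = x"
    "\<forall>y \<in> carrier N. f' (g' y) = y"
    unfolding iso_modules_def by blast
  have "\<forall>x \<in> carrier L. g (g' (f' (f x))) = x" using fg(3,7) lin_closed[OF fg(1)] by simp
  moreover have "\<forall>y \<in> carrier N. f' (f (g (g' y))) = y" using fg(4,8) lin_closed[OF fg(6)] by simp
  ultimately show "iso_modules L N"
    unfolding iso_modules_def using lin_comp[OF fg(1,5)] lin_comp[OF fg(6,2)] by blast
qed

lemma iso_modulesI:
  assumes f: "lin M N f" "inj_on f (carrier M)" "f ` carrier M = carrier N" and lms: "lm M" "lm N"
  shows "iso_modules M N"
proof -
  obtain g where g: "lin N M g" "\<forall>y \<in> carrier N. f (g y) = y"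
    using lin_factor_inj[OF f(1,2) lin_id lms(1,2,2)] f(3) by blast
  have "g (f x) = x" if x: "x \<in> carrier M" for x
    by (rule inj_onD[OF f(2)])
      (use x g(2) lin_closed[OF f(1) x] lin_closed[OF g(1)] in simp_all)
  then show ?thesis unfolding iso_modules_def using f(1) g by blast
qed

end

section \<open>Yoneda extensions of modules\<close>

text \<open>
  Yoneda equivalence is generated by morphisms in both directions, and its zigzags cannot be straightened
  in general. All information is extracted from it through properties that every morphism preserves
  and reflects.
\<close>

lemma Yoneda_rel_invariant:
  assumes "(\<xi>, \<eta>) \<in> Yoneda_rel C n X Y"
    and inv: "\<And>\<xi> \<eta>. \<lbrakk>\<xi> \<in> extensions C n X Y; \<eta> \<in> extensions C n X Y;
      ext_morphism C n \<xi> \<eta> (Idn C Y) (Idn C X)\<rbrakk> \<Longrightarrow> Q \<xi> \<longleftrightarrow> Q \<eta>"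
  shows "Q \<xi> \<longleftrightarrow> Q \<eta>"
  using assms(1) unfolding Yoneda_rel_def Let_def
  by (induction rule: trancl_induct) (use inv in blast)+

lemma Yoneda_rel_extensions:
  assumes "(\<xi>, \<eta>) \<in> Yoneda_rel C n X Y"
  shows "\<xi> \<in> extensions C n X Y" "\<eta> \<in> extensions C n X Y"
  using assms unfolding Yoneda_rel_def Let_def
  by (induction rule: trancl_induct) auto

lemma Yoneda_relI:
  "\<xi> \<in> extensions C n X Y \<Longrightarrow> \<eta> \<in> extensions C n X Y \<Longrightarrow>
    ext_morphism C n \<xi> \<eta> (Idn C Y) (Idn C X) \<Longrightarrow> (\<xi>, \<eta>) \<in> Yoneda_rel C n X Y"
  unfolding Yoneda_rel_def Let_def by (intro r_into_trancl) simp

lemma Yoneda_rel_sym: "(\<xi>, \<eta>) \<in> Yoneda_rel C n X Y \<Longrightarrow> (\<eta>, \<xi>) \<in> Yoneda_rel C n X Y"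
proof -
  have "sym (Yoneda_rel C n X Y)"
    unfolding Yoneda_rel_def Let_def by (intro sym_trancl sym_Un_converse)
  then show "(\<xi>, \<eta>) \<in> Yoneda_rel C n X Y \<Longrightarrow> (\<eta>, \<xi>) \<in> Yoneda_rel C n X Y" by (rule symD)
qed

lemma Yoneda_rel_trans:
  "(\<xi>, \<eta>) \<in> Yoneda_rel C n X Y \<Longrightarrow> (\<eta>, \<zeta>) \<in> Yoneda_rel C n X Y \<Longrightarrow>
    (\<xi>, \<zeta>) \<in> Yoneda_rel C n X Y"
  unfolding Yoneda_rel_def Let_def by (rule trancl_trans)

context module_universe begin

text \<open>
  Extensions and their morphisms, freed from the requirement that maps be extensional; element chases
  take place at this level.
\<close>

definition exact_seq ::
  "nat \<Rightarrow> ('r, 'u) module \<Rightarrow> ('r, 'u) module \<Rightarrow> (nat \<Rightarrow> ('r, 'u) module) \<Rightarrow> (nat \<Rightarrow> 'u \<Rightarrow> 'u) \<Rightarrow> bool"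
where
  "exact_seq n X Y E d \<longleftrightarrow> E 0 = Y \<and> E (Suc n) = X \<and> (\<forall>i \<le> Suc n. obj (E i)) \<and>
     (\<forall>i \<le> n. lin (E i) (E (Suc i)) (d i)) \<and> inj_on (d 0) (carrier (E 0)) \<and>
     (\<forall>i < n. d i ` carrier (E i) = {y \<in> carrier (E (Suc i)). d (Suc i) y = \<zero>\<^bsub>E (Suc (Suc i))\<^esub>}) \<and>
     d n ` carrier (E n) = carrier (E (Suc n))"

definition seq_morphism ::
  "nat \<Rightarrow> (nat \<Rightarrow> ('r, 'u) module) \<Rightarrow> (nat \<Rightarrow> 'u \<Rightarrow> 'u) \<Rightarrow> (nat \<Rightarrow> ('r, 'u) module) \<Rightarrow> (nat \<Rightarrow> 'u \<Rightarrow> 'u) \<Rightarrow>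
    ('u \<Rightarrow> 'u) \<Rightarrow> ('u \<Rightarrow> 'u) \<Rightarrow> bool"
where
  "seq_morphism n E d E' d' a b \<longleftrightarrow> (\<exists>\<phi>. (\<forall>i \<le> Suc n. lin (E i) (E' i) (\<phi> i)) \<and>
     (\<forall>x \<in> carrier (E 0). \<phi> 0 x = a x) \<and> (\<forall>x \<in> carrier (E (Suc n)). \<phi> (Suc n) x = b x) \<and>
     (\<forall>i \<le> n. \<forall>x \<in> carrier (E i). d' i (\<phi> i x) = \<phi> (Suc i) (d i x)))"

lemma exact_seqD:
  assumes "exact_seq n X Y E d"
  shows "E 0 = Y" "E (Suc n) = X" "\<And>i. i \<le> Suc n \<Longrightarrow> obj (E i)"
    "\<And>i. i \<le> n \<Longrightarrow> lin (E i) (E (Suc i)) (d i)" "inj_on (d 0) (carrier (E 0))"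
    "\<And>i. i < n \<Longrightarrow> d i ` carrier (E i) = {y \<in> carrier (E (Suc i)). d (Suc i) y = \<zero>\<^bsub>E (Suc (Suc i))\<^esub>}"
    "d n ` carrier (E n) = carrier (E (Suc n))"
    "\<And>i. i \<le> Suc n \<Longrightarrow> lm (E i)"
    "\<And>i x. i \<le> n \<Longrightarrow> x \<in> carrier (E i) \<Longrightarrow> d i x \<in> carrier (E (Suc i))"
    "\<And>i x. i < n \<Longrightarrow> x \<in> carrier (E i) \<Longrightarrow> d (Suc i) (d i x) = \<zero>\<^bsub>E (Suc (Suc i))\<^esub>"
    "obj X" "obj Y" "lm X" "lm Y"
proof -
  note e = assms[unfolded exact_seq_def]
  show "E 0 = Y" "E (Suc n) = X" "\<And>i. i \<le> Suc n \<Longrightarrow> obj (E i)"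
    "\<And>i. i \<le> n \<Longrightarrow> lin (E i) (E (Suc i)) (d i)" "inj_on (d 0) (carrier (E 0))"
    "\<And>i. i < n \<Longrightarrow> d i ` carrier (E i) = {y \<in> carrier (E (Suc i)). d (Suc i) y = \<zero>\<^bsub>E (Suc (Suc i))\<^esub>}"
    "d n ` carrier (E n) = carrier (E (Suc n))" "\<And>i. i \<le> Suc n \<Longrightarrow> lm (E i)"
    using e by auto
  show "d i x \<in> carrier (E (Suc i))" if "i \<le> n" "x \<in> carrier (E i)" for i x
    using that e lin_closed[of "E i" "E (Suc i)" "d i" x] by simp
  show "d (Suc i) (d i x) = \<zero>\<^bsub>E (Suc (Suc i))\<^esub>" if "i < n" "x \<in> carrier (E i)" for i x
  proof -
    have "d i ` carrier (E i) = {y \<in> carrier (E (Suc i)). d (Suc i) y = \<zero>\<^bsub>E (Suc (Suc i))\<^esub>}"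
      using e that(1) by blast
    then show ?thesis using imageI[OF that(2), of "d i"] by simp
  qed
  show "obj X" "obj Y" "lm X" "lm Y" using e by auto
qed

lemma extensions_iff:
  assumes n: "n \<ge> 1"
  shows "(E, d) \<in> extensions (RMod R) n X Y \<longleftrightarrow>
    exact_seq n X Y E d \<and> (\<forall>i \<le> n. d i \<in> extensional (carrier (E i)))"
proof (cases "E 0 = Y \<and> E (Suc n) = X \<and> (\<forall>i \<le> Suc n. obj (E i))")
  case True
  then have o: "obj (E i)" if "i \<le> Suc n" for i using that by blast
  let ?h = "\<forall>i \<le> n. d i \<in> Hom (RMod R) (E i) (E (Suc i))"
  let ?im = "\<lambda>i. d i ` carrier (E i) = {y \<in> carrier (E (Suc i)). d (Suc i) y = \<zero>\<^bsub>E (Suc (Suc i))\<^esub>}"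
  have ex: "exact_at (RMod R) (E i) (E (Suc i)) (E (Suc (Suc i))) (d i) (d (Suc i)) \<longleftrightarrow> ?im i"
    if "i < n" ?h for i
    using that exact_at_iff[of "E i" "E (Suc i)" "E (Suc (Suc i))" "d i" "d (Suc i)"]
      o[of i] o[of "Suc i"] o[of "Suc (Suc i)"] by simp
  have mo: "is_mono (RMod R) (E 0) (E 1) (d 0) \<longleftrightarrow> inj_on (d 0) (carrier (E 0))" if ?h
    using that is_mono_iff[of "E 0" "E 1" "d 0"] o[of 0] o[of 1] by simp
  have ep: "is_epi (RMod R) (E n) (E (Suc n)) (d n) \<longleftrightarrow> d n ` carrier (E n) = carrier (E (Suc n))"
    if ?h using that is_epi_iff[of "E n" "E (Suc n)" "d n"] o[of n] o[of "Suc n"] by simp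
  have "(E, d) \<in> extensions (RMod R) n X Y \<longleftrightarrow> ?h \<and> is_mono (RMod R) (E 0) (E 1) (d 0) \<and>
     (\<forall>i < n. exact_at (RMod R) (E i) (E (Suc i)) (E (Suc (Suc i))) (d i) (d (Suc i))) \<and>
     is_epi (RMod R) (E n) (E (Suc n)) (d n)"
    using True unfolding extensions_def by simp
  also have "\<dots> \<longleftrightarrow> ?h \<and> inj_on (d 0) (carrier (E 0)) \<and> (\<forall>i < n. ?im i) \<and>
     d n ` carrier (E n) = carrier (E (Suc n))"
  proof (rule conj_cong[OF refl])
    assume h: ?h
    show "is_mono (RMod R) (E 0) (E 1) (d 0) \<and>
       (\<forall>i < n. exact_at (RMod R) (E i) (E (Suc i)) (E (Suc (Suc i))) (d i) (d (Suc i))) \<and>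
       is_epi (RMod R) (E n) (E (Suc n)) (d n) \<longleftrightarrow>
       inj_on (d 0) (carrier (E 0)) \<and> (\<forall>i < n. ?im i) \<and> d n ` carrier (E n) = carrier (E (Suc n))"
      unfolding mo[OF h] ep[OF h] using ex[OF _ h] by (simp only: cong: conj_cong imp_cong)
  qed
  also have "\<dots> \<longleftrightarrow> exact_seq n X Y E d \<and> (\<forall>i \<le> n. d i \<in> extensional (carrier (E i)))"
    using True unfolding exact_seq_def Hom_iff by blast
  finally show ?thesis .
next
  case False
  then show ?thesis by (auto simp: extensions_def exact_seq_def)
qed

abbreviation "restrict_maps E d \<equiv> \<lambda>i. restrict (d i) (carrier (E i))"

lemma restrict_extension:
  assumes e: "exact_seq n X Y E d" and n: "n \<ge> 1"
  shows "(E, restrict_maps E d) \<in> extensions (RMod R) n X Y"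
proof -
  note D = exact_seqD[OF e]
  have "exact_seq n X Y E (restrict_maps E d)"
    unfolding exact_seq_def
  proof (intro conjI allI impI)
    fix i assume "i \<le> n"
    then show "lin (E i) (E (Suc i)) (restrict (d i) (carrier (E i)))"
      by (intro lin_cong[OF D(4)]) (simp_all add: D)
  next
    fix i assume "i < n"
    then show "restrict (d i) (carrier (E i)) ` carrier (E i) =
      {y \<in> carrier (E (Suc i)). restrict (d (Suc i)) (carrier (E (Suc i))) y = \<zero>\<^bsub>E (Suc (Suc i))\<^esub>}"
      using D(6)[of i] by auto
  next
    show "inj_on (restrict (d 0) (carrier (E 0))) (carrier (E 0))"
      using D(5) by (simp add: inj_on_def)
    show "restrict (d n) (carrier (E n)) ` carrier (E n) = carrier (E (Suc n))"
      using D(7) by simp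
  qed (simp_all add: D(1,2,3))
  then show ?thesis using extensions_iff[OF n] by simp
qed

lemma seq_morphism_cong:
  assumes "exact_seq n X Y E d" "exact_seq n X' Y' E' d'"
    and "seq_morphism n E d E' d' a b"
    and "\<And>x. x \<in> carrier Y \<Longrightarrow> a x = a' x" "\<And>x. x \<in> carrier X \<Longrightarrow> b x = b' x"
  shows "seq_morphism n E (restrict_maps E d) E' (restrict_maps E' d') a' b'"
    "seq_morphism n E d E' d' a' b'"
proof -
  obtain \<phi> where p: "\<forall>i \<le> Suc n. lin (E i) (E' i) (\<phi> i)"
     "\<forall>x \<in> carrier (E 0). \<phi> 0 x = a x" "\<forall>x \<in> carrier (E (Suc n)). \<phi> (Suc n) x = b x"
     "\<forall>i \<le> n. \<forall>x \<in> carrier (E i). d' i (\<phi> i x) = \<phi> (Suc i) (d i x)"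
    using assms(3) unfolding seq_morphism_def by blast
  note D = exact_seqD[OF assms(1)]
  have ab: "\<forall>x \<in> carrier (E 0). \<phi> 0 x = a' x" "\<forall>x \<in> carrier (E (Suc n)). \<phi> (Suc n) x = b' x"
    using p(2,3) assms(4,5) D(1,2) by simp_all
  show "seq_morphism n E d E' d' a' b'"
    unfolding seq_morphism_def using p(1,4) ab by blast
  have "\<phi> i x \<in> carrier (E' i)" if "i \<le> n" "x \<in> carrier (E i)" for i x
    using that p(1) lin_closed[of "E i" "E' i" "\<phi> i" x] by simp
  then have "\<forall>i \<le> n. \<forall>x \<in> carrier (E i).
      restrict_maps E' d' i (\<phi> i x) = \<phi> (Suc i) (restrict_maps E d i x)"
    using p(4) by simp
  then show "seq_morphism n E (restrict_maps E d) E' (restrict_maps E' d') a' b'"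
    unfolding seq_morphism_def using p(1) ab by blast
qed

lemma ext_morphism_iff:
  assumes e: "exact_seq n X Y E d" "exact_seq n X' Y' E' d'"
    and a: "a \<in> extensional (carrier Y)" and b: "b \<in> extensional (carrier X)"
  shows "ext_morphism (RMod R) n (E, d) (E', d') a b \<longleftrightarrow> seq_morphism n E d E' d' a b"
proof
  assume "ext_morphism (RMod R) n (E, d) (E', d') a b"
  then obtain \<phi> where p: "\<phi> 0 = a" "\<phi> (Suc n) = b" "\<forall>i \<le> Suc n. \<phi> i \<in> Hom (RMod R) (E i) (E' i)"
    "\<forall>i \<le> n. Comp (RMod R) (E i) (E' i) (E' (Suc i)) (d' i) (\<phi> i)
                 = Comp (RMod R) (E i) (E (Suc i)) (E' (Suc i)) (\<phi> (Suc i)) (d i)"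
    unfolding ext_morphism_def by auto
  then show "seq_morphism n E d E' d' a b"
    unfolding seq_morphism_def Comp_eq_iff
    by (intro exI[of _ \<phi>]) (auto simp: Hom_lin)
next
  assume "seq_morphism n E d E' d' a b"
  then obtain \<phi> where p: "\<forall>i \<le> Suc n. lin (E i) (E' i) (\<phi> i)"
     "\<forall>x \<in> carrier (E 0). \<phi> 0 x = a x" "\<forall>x \<in> carrier (E (Suc n)). \<phi> (Suc n) x = b x"
     "\<forall>i \<le> n. \<forall>x \<in> carrier (E i). d' i (\<phi> i x) = \<phi> (Suc i) (d i x)"
    unfolding seq_morphism_def by blast
  note D = exact_seqD[OF e(1)]
  let ?\<phi> = "\<lambda>i. restrict (\<phi> i) (carrier (E i))"
  have "?\<phi> 0 = a" by (rule extensionalityI[of _ "carrier (E 0)"]) (use p(2) a D(1) in auto)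
  moreover have "?\<phi> (Suc n) = b"
    by (rule extensionalityI[of _ "carrier (E (Suc n))"]) (use p(3) b D(2) in auto)
  moreover have "\<forall>i \<le> Suc n. ?\<phi> i \<in> Hom (RMod R) (E i) (E' i)"
    using p(1) D(8) restrict_Hom by blast
  moreover have "\<forall>i \<le> n. Comp (RMod R) (E i) (E' i) (E' (Suc i)) (d' i) (?\<phi> i)
                 = Comp (RMod R) (E i) (E (Suc i)) (E' (Suc i)) (?\<phi> (Suc i)) (d i)"
    unfolding Comp_eq_iff using p(4) D(9) by simp
  ultimately show "ext_morphism (RMod R) n (E, d) (E', d') a b"
    unfolding ext_morphism_def by (auto intro!: exI[of _ ?\<phi>])
qed

lemma seq_morphism_comp:
  assumes "seq_morphism n E d E' d' a b" "seq_morphism n E' d' E'' d'' a' b'"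
    and e: "exact_seq n X Y E d"
  shows "seq_morphism n E d E'' d'' (\<lambda>x. a' (a x)) (\<lambda>x. b' (b x))"
proof -
  obtain \<phi> where p: "\<forall>i \<le> Suc n. lin (E i) (E' i) (\<phi> i)"
     "\<forall>x \<in> carrier (E 0). \<phi> 0 x = a x" "\<forall>x \<in> carrier (E (Suc n)). \<phi> (Suc n) x = b x"
     "\<forall>i \<le> n. \<forall>x \<in> carrier (E i). d' i (\<phi> i x) = \<phi> (Suc i) (d i x)"
    using assms(1) unfolding seq_morphism_def by blast
  obtain \<psi> where q: "\<forall>i \<le> Suc n. lin (E' i) (E'' i) (\<psi> i)"
     "\<forall>x \<in> carrier (E' 0). \<psi> 0 x = a' x" "\<forall>x \<in> carrier (E' (Suc n)). \<psi> (Suc n) x = b' x"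
     "\<forall>i \<le> n. \<forall>x \<in> carrier (E' i). d'' i (\<psi> i x) = \<psi> (Suc i) (d' i x)"
    using assms(2) unfolding seq_morphism_def by blast
  have c: "\<phi> i x \<in> carrier (E' i)" if "i \<le> Suc n" "x \<in> carrier (E i)" for i x
    using that p(1) lin_closed[of "E i" "E' i" "\<phi> i" x] by simp
  let ?\<chi> = "\<lambda>i x. \<psi> i (\<phi> i x)"
  have "\<forall>i \<le> Suc n. lin (E i) (E'' i) (?\<chi> i)" using p(1) q(1) lin_comp by blast
  moreover have "\<forall>x \<in> carrier (E 0). ?\<chi> 0 x = a' (a x)" using p(2) q(2) c[of 0] by force
  moreover have "\<forall>x \<in> carrier (E (Suc n)). ?\<chi> (Suc n) x = b' (b x)"
    using p(3) q(3) c[of "Suc n"] by force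
  moreover have "\<forall>i \<le> n. \<forall>x \<in> carrier (E i). d'' i (?\<chi> i x) = ?\<chi> (Suc i) (d i x)"
    using p(4) q(4) c by simp
  ultimately show ?thesis unfolding seq_morphism_def by (intro exI[of _ ?\<chi>]) simp
qed

lemma seq_morphism_minus:
  assumes e: "exact_seq n X Y E d" "exact_seq n X' Y' E' d'"
    and f: "seq_morphism n E d E' d' a b" and g: "seq_morphism n E d E' d' a' b'"
  shows "seq_morphism n E d E' d' (\<lambda>x. a x \<oplus>\<^bsub>Y'\<^esub> \<ominus>\<^bsub>Y'\<^esub> a' x) (\<lambda>x. b x \<oplus>\<^bsub>X'\<^esub> \<ominus>\<^bsub>X'\<^esub> b' x)"
proof -
  obtain \<phi> where p: "\<And>i. i \<le> Suc n \<Longrightarrow> lin (E i) (E' i) (\<phi> i)"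
     "\<And>x. x \<in> carrier (E 0) \<Longrightarrow> \<phi> 0 x = a x" "\<And>x. x \<in> carrier (E (Suc n)) \<Longrightarrow> \<phi> (Suc n) x = b x"
     "\<And>i x. i \<le> n \<Longrightarrow> x \<in> carrier (E i) \<Longrightarrow> d' i (\<phi> i x) = \<phi> (Suc i) (d i x)"
    using f unfolding seq_morphism_def by blast
  obtain \<psi> where q: "\<And>i. i \<le> Suc n \<Longrightarrow> lin (E i) (E' i) (\<psi> i)"
     "\<And>x. x \<in> carrier (E 0) \<Longrightarrow> \<psi> 0 x = a' x" "\<And>x. x \<in> carrier (E (Suc n)) \<Longrightarrow> \<psi> (Suc n) x = b' x"
     "\<And>i x. i \<le> n \<Longrightarrow> x \<in> carrier (E i) \<Longrightarrow> d' i (\<psi> i x) = \<psi> (Suc i) (d i x)"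
    using g unfolding seq_morphism_def by blast
  note D = exact_seqD[OF e(1)] and D' = exact_seqD[OF e(2)]
  let ?\<chi> = "\<lambda>i x. \<phi> i x \<oplus>\<^bsub>E' i\<^esub> \<ominus>\<^bsub>E' i\<^esub> \<psi> i x"
  have "lin (E i) (E' i) (?\<chi> i)" if "i \<le> Suc n" for i
    by (rule lin_minus[OF D(8) D'(8) p(1) q(1)]) (use that in simp_all)
  moreover have "d' i (?\<chi> i x) = ?\<chi> (Suc i) (d i x)" if i: "i \<le> n" and x: "x \<in> carrier (E i)" for i x
  proof -
    have i': "i \<le> Suc n" using i by simp
    show ?thesis
      using lin_closed[OF p(1)[OF i'] x] lin_closed[OF q(1)[OF i'] x] i i' x D'(8)
      by (simp add: lin_add[OF D'(4)[OF i]] lin_neg[OF D'(4)[OF i]] p(4)[OF i x] q(4)[OF i x])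
  qed
  ultimately show ?thesis
    unfolding seq_morphism_def using p(2,3) q(2,3) D'(1,2) by (intro exI[of _ ?\<chi>]) simp
qed

section \<open>Pushing an extension forward\<close>

text \<open>
  Only the first two terms change: \<open>E 0\<close> becomes \<open>M\<close> and \<open>E 1\<close> the pushout. By the universal property of the
  pushout, a morphism from \<open>E\<close> whose component at \<open>E 0\<close> factors through \<open>a\<close> factors itself.
\<close>

lemma ex_pushforward:
  assumes e: "exact_seq n X Y E d" and n: "n \<ge> 1" and M: "obj M" and a: "lin Y M a"
  shows "\<exists>E' d'. exact_seq n X M E' d' \<and> seq_morphism n E d E' d' a (\<lambda>x. x) \<and>
    (\<forall>N E2 d2 b. exact_seq n X N E2 d2 \<and> lin M N b \<and>
       seq_morphism n E d E2 d2 (\<lambda>x. b (a x)) (\<lambda>x. x) \<longrightarrow>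
       seq_morphism n E' d' E2 d2 b (\<lambda>x. x))"
proof -
  note D = exact_seqD[OF e]
  have oE: "obj (E 1)" "obj (E 2)" using D(3)[of 1] D(3)[of 2] n by simp_all
  have d0: "lin Y (E 1) (d 0)" using D(4)[of 0] D(1) by simp
  have d1: "lin (E 1) (E 2) (d 1)" using D(4)[of 1] n by (simp add: numeral_2_eq_2)
  have inj0: "y = \<zero>\<^bsub>Y\<^esub>" if "y \<in> carrier Y" "d 0 y = \<zero>\<^bsub>E 1\<^esub>" for y
    using lin_inj_iff[OF d0 D(14)] D(5) D(1) oE that by simp
  obtain W u v where W: "obj W" "lin M W u" "lin (E 1) W v" "\<forall>y \<in> carrier Y. u (a y) = v (d 0 y)"
    "\<forall>w \<in> carrier W. \<exists>m \<in> carrier M. \<exists>x \<in> carrier (E 1). w = u m \<oplus>\<^bsub>W\<^esub> v x"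
    "\<forall>m \<in> carrier M. u m = \<zero>\<^bsub>W\<^esub> \<longrightarrow> (\<exists>y \<in> carrier Y. m = a y \<and> d 0 y = \<zero>\<^bsub>E 1\<^esub>)"
    and univ': "\<forall>N s t. obj N \<and> lin M N s \<and> lin (E 1) N t \<and> (\<forall>y \<in> carrier Y. s (a y) = t (d 0 y)) \<longrightarrow>
      (\<exists>w. lin W N w \<and> (\<forall>m \<in> carrier M. w (u m) = s m) \<and> (\<forall>e \<in> carrier (E 1). w (v e) = t e))"
    using ex_pushout[OF D(12) M oE(1) a d0] by (elim exE conjE) (rule that; assumption)
  have univ: "\<exists>w. lin W N w \<and> (\<forall>m \<in> carrier M. w (u m) = s m) \<and> (\<forall>e \<in> carrier (E 1). w (v e) = t e)"
    if "obj N" "lin M N s" "lin (E 1) N t" "\<forall>y \<in> carrier Y. s (a y) = t (d 0 y)" for N s t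
    by (rule univ'[rule_format]) (use that in simp)
  have lms: "lm M" "lm W" "lm (E 1)" "lm (E 2)" using M W(1) oE by simp_all
  have d10: "d 1 (d 0 y) = \<zero>\<^bsub>E 2\<^esub>" if "y \<in> carrier Y" for y
    using D(10)[of 0 y] that n D(1) by (simp add: numeral_2_eq_2)
  obtain w1 where w1: "lin W (E 2) w1" "\<forall>m \<in> carrier M. w1 (u m) = \<zero>\<^bsub>E 2\<^esub>"
    "\<forall>x \<in> carrier (E 1). w1 (v x) = d 1 x"
    using univ[OF oE(2) lin_zero_map[OF lms(4)] d1] d10 by auto
  note cl = lin_closed[OF W(2)] lin_closed[OF W(3)] lin_closed[OF d1]
  have w1_add: "w1 (u m \<oplus>\<^bsub>W\<^esub> v x) = d 1 x" if "m \<in> carrier M" "x \<in> carrier (E 1)" for m x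
    using that w1 cl lms by (simp add: lin_add[OF w1(1)])
  have w1_im: "w1 ` carrier W = d 1 ` carrier (E 1)"
  proof (intro equalityI subsetI)
    fix z assume "z \<in> w1 ` carrier W"
    then obtain w where "w \<in> carrier W" "z = w1 w" by blast
    then show "z \<in> d 1 ` carrier (E 1)" using W(5) w1_add by force
  next
    fix z assume "z \<in> d 1 ` carrier (E 1)"
    then obtain x where "x \<in> carrier (E 1)" "z = d 1 x" by blast
    then have "z = w1 (v x)" "v x \<in> carrier W" using w1(3) cl(2) by simp_all
    then show "z \<in> w1 ` carrier W" by (rule image_eqI)
  qed
  have inj_u: "inj_on u (carrier M)"
    unfolding lin_inj_iff[OF W(2) lms(1,2)]
  proof (intro ballI impI)
    fix m assume "m \<in> carrier M" "u m = \<zero>\<^bsub>W\<^esub>"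
    then obtain y where "y \<in> carrier Y" "m = a y" "d 0 y = \<zero>\<^bsub>E 1\<^esub>" using W(6) by blast
    then show "m = \<zero>\<^bsub>M\<^esub>" using inj0 lin_zero[OF a D(14) lms(1)] by simp
  qed
  have ker_w1: "u ` carrier M = {w \<in> carrier W. w1 w = \<zero>\<^bsub>E 2\<^esub>}" if n1: "0 < n"
  proof (intro equalityI subsetI)
    fix z assume "z \<in> u ` carrier M"
    then show "z \<in> {w \<in> carrier W. w1 w = \<zero>\<^bsub>E 2\<^esub>}" using w1(2) cl(1) by blast
  next
    fix w assume w: "w \<in> {w \<in> carrier W. w1 w = \<zero>\<^bsub>E 2\<^esub>}"
    then obtain m x where mx: "m \<in> carrier M" "x \<in> carrier (E 1)" "w = u m \<oplus>\<^bsub>W\<^esub> v x"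
      using W(5) by blast
    then have "d 1 x = \<zero>\<^bsub>E 2\<^esub>" using w w1_add by simp
    then have "x \<in> d 0 ` carrier (E 0)"
      using D(6)[OF n1] mx(2) by (simp add: numeral_2_eq_2)
    then obtain y where y: "y \<in> carrier Y" "x = d 0 y" using D(1) by blast
    have "w = u (m \<oplus>\<^bsub>M\<^esub> a y)"
      using mx y W(4) lin_closed[OF a y(1)] by (simp add: lin_add[OF W(2)])
    then show "w \<in> u ` carrier M"
      by (rule image_eqI) (use mx(1) lin_closed[OF a y(1)] lms(1) in simp)
  qed
  define E' where "E' = E(0 := M, 1 := W)"
  define d' where "d' = d(0 := u, 1 := w1)"
  have E': "E' 0 = M" "E' (Suc 0) = W" "\<And>i. E' (Suc (Suc i)) = E (Suc (Suc i))"
    by (simp_all add: E'_def)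
  have d': "d' 0 = u" "d' (Suc 0) = w1" "\<And>i. d' (Suc (Suc i)) = d (Suc (Suc i))"
    by (simp_all add: d'_def)
  have two: "E 2 = E (Suc (Suc 0))" "E 1 = E (Suc 0)" "d 1 = d (Suc 0)" by (simp_all add: numeral_2_eq_2)
  have "exact_seq n X M E' d'"
    unfolding exact_seq_def
  proof (intro conjI allI impI)
    show "E' 0 = M" by (rule E')
    show "E' (Suc n) = X" using n D(2) E'(3)[of "n - 1"] by simp
    show "obj (E' i)" if "i \<le> Suc n" for i
      using that M W(1) D(3)[of i] by (simp add: E'_def)
    show "lin (E' i) (E' (Suc i)) (d' i)" if i: "i \<le> n" for i
    proof (cases i)
      case 0
      then show ?thesis using W(2) by (simp add: E' d')
    next
      case (Suc j)
      then show ?thesis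
      proof (cases j)
        case 0
        then show ?thesis using Suc w1(1) two by (simp add: E' d')
      next
        case (Suc k)
        then show ?thesis using \<open>i = Suc j\<close> i D(4)[of i] by (simp add: E' d')
      qed
    qed
    show "inj_on (d' 0) (carrier (E' 0))" using inj_u by (simp add: E' d')
    show "d' i ` carrier (E' i) = {y \<in> carrier (E' (Suc i)). d' (Suc i) y = \<zero>\<^bsub>E' (Suc (Suc i))\<^esub>}"
      if i: "i < n" for i
    proof (cases i)
      case 0
      then show ?thesis using ker_w1 i two by (simp add: E' d')
    next
      case (Suc j)
      then show ?thesis
      proof (cases j)
        case 0
        then show ?thesis using \<open>i = Suc j\<close> w1_im D(6)[OF i] two by (simp add: E' d')
      next
        case (Suc k)
        then show ?thesis using \<open>i = Suc j\<close> D(6)[OF i] by (simp add: E' d')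
      qed
    qed
    show "d' n ` carrier (E' n) = carrier (E' (Suc n))"
    proof (cases "n = 1")
      case True
      then show ?thesis using w1_im D(7) two by (simp add: E' d')
    next
      case False
      then obtain k where "n = Suc (Suc k)" using n by (cases n; cases "n - 1") auto
      then show ?thesis using D(7) by (simp add: E' d')
    qed
  qed
  moreover have "seq_morphism n E d E' d' a (\<lambda>x. x)"
    unfolding seq_morphism_def
  proof (intro exI[of _ "(\<lambda>i x. x)(0 := a, 1 := v)"] conjI allI impI ballI)
    show "lin (E i) (E' i) (((\<lambda>i x. x)(0 := a, 1 := v)) i)" if "i \<le> Suc n" for i
      using a W(3) D(1) by (simp add: E'_def lin_id)
    show "d' i (((\<lambda>i x. x)(0 := a, 1 := v)) i x) = ((\<lambda>i x. x)(0 := a, 1 := v)) (Suc i) (d i x)"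
      if "i \<le> n" "x \<in> carrier (E i)" for i x
      using that W(4) w1(3) D(1) by (auto simp: d'_def)
  qed (use n in auto)
  moreover have "seq_morphism n E' d' E2 d2 b (\<lambda>x. x)"
    if H: "exact_seq n X N E2 d2" "lin M N b" "seq_morphism n E d E2 d2 (\<lambda>x. b (a x)) (\<lambda>x. x)"
    for N E2 d2 b
  proof -
    note D2 = exact_seqD[OF H(1)]
    obtain \<phi> where p: "\<And>i. i \<le> Suc n \<Longrightarrow> lin (E i) (E2 i) (\<phi> i)"
      "\<And>x. x \<in> carrier (E 0) \<Longrightarrow> \<phi> 0 x = b (a x)" "\<And>x. x \<in> carrier (E (Suc n)) \<Longrightarrow> \<phi> (Suc n) x = x"
      "\<And>i x. i \<le> n \<Longrightarrow> x \<in> carrier (E i) \<Longrightarrow> d2 i (\<phi> i x) = \<phi> (Suc i) (d i x)"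
      using H(3) unfolding seq_morphism_def by blast
    have s: "lin M (E2 1) (\<lambda>m. d2 0 (b m))" using lin_comp[OF H(2)] D2(4)[of 0] D2(1) by simp
    have t: "lin (E 1) (E2 1) (\<phi> 1)" using p(1)[of 1] n by simp
    have o1: "obj (E2 1)" using D2(3)[of 1] n by simp
    have st: "\<forall>y \<in> carrier Y. d2 0 (b (a y)) = \<phi> 1 (d 0 y)"
    proof
      fix y assume "y \<in> carrier Y"
      then show "d2 0 (b (a y)) = \<phi> 1 (d 0 y)" using p(2)[of y] p(4)[of 0 y] D(1) by simp
    qed
    obtain w where w: "lin W (E2 1) w" "\<forall>m \<in> carrier M. w (u m) = d2 0 (b m)"
      "\<forall>x \<in> carrier (E 1). w (v x) = \<phi> 1 x"
      using univ[OF o1 s t st] by blast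
    have sq: "d2 (Suc 0) (w z) = \<phi> (Suc (Suc 0)) (w1 z)" if z: "z \<in> carrier W" for z
    proof -
      obtain m x where mx: "m \<in> carrier M" "x \<in> carrier (E 1)" "z = u m \<oplus>\<^bsub>W\<^esub> v x"
        using W(5) z by blast
      have l21: "lin (E2 (Suc 0)) (E2 (Suc (Suc 0))) (d2 (Suc 0))" using D2(4)[of "Suc 0"] n by simp
      have bm: "b m \<in> carrier N" by (rule lin_closed[OF H(2) mx(1)])
      have "w z = d2 0 (b m) \<oplus>\<^bsub>E2 1\<^esub> \<phi> 1 x"
        using mx w cl by (simp add: lin_add[OF w(1)])
      then have "d2 (Suc 0) (w z) = d2 (Suc 0) (d2 0 (b m)) \<oplus>\<^bsub>E2 (Suc (Suc 0))\<^esub> d2 (Suc 0) (\<phi> 1 x)"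
        using lin_add[OF l21] lin_closed[OF s mx(1)] lin_closed[OF t mx(2)] by simp
      also have "d2 (Suc 0) (d2 0 (b m)) = \<zero>\<^bsub>E2 (Suc (Suc 0))\<^esub>"
        using D2(10)[of 0 "b m"] n bm D2(1) by simp
      also have "d2 (Suc 0) (\<phi> 1 x) = \<phi> (Suc (Suc 0)) (d 1 x)"
        using p(4)[of "Suc 0" x] n mx(2) by simp
      finally have "d2 (Suc 0) (w z) = \<phi> (Suc (Suc 0)) (d 1 x)"
        using lin_closed[OF p(1)[of "Suc (Suc 0)"], of "d 1 x"] n cl(3)[OF mx(2)] two D2(8)[of "Suc (Suc 0)"]
        by simp
      then show ?thesis using w1_add mx by simp
    qed
    show ?thesis
      unfolding seq_morphism_def
    proof (intro exI[of _ "\<phi>(0 := b, 1 := w)"] conjI allI impI ballI)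
      show "lin (E' i) (E2 i) ((\<phi>(0 := b, 1 := w)) i)" if "i \<le> Suc n" for i
        using that H(2) w(1) D2(1) p(1) by (simp add: E'_def)
      show "d2 i ((\<phi>(0 := b, 1 := w)) i x) = (\<phi>(0 := b, 1 := w)) (Suc i) (d' i x)"
        if i: "i \<le> n" "x \<in> carrier (E' i)" for i x
      proof (cases i)
        case 0
        then show ?thesis using i w(2) by (simp add: E' d')
      next
        case (Suc j)
        then show ?thesis
        proof (cases j)
          case 0
          then show ?thesis using \<open>i = Suc j\<close> i sq by (simp add: E' d')
        next
          case (Suc k)
          then show ?thesis using \<open>i = Suc j\<close> i p(4)[of i x] by (simp add: E' d')
        qed
      qed
    qed (use n p(3) in \<open>auto simp: E'_def\<close>)
  qed
  ultimately show ?thesis by blast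
qed

end

section \<open>Projective resolutions and the vanishing of Ext\<close>

context module_universe begin

lemma Idn_extensional: "Idn (RMod R) M \<in> extensional (carrier M)"
  by (simp add: RMod_def)

lemma HZero_extensional: "HZero (RMod R) M N \<in> extensional (carrier M)"
  by (simp add: RMod_def)

definition projective_seq :: "nat \<Rightarrow> (nat \<Rightarrow> ('r, 'u) module) \<Rightarrow> bool" where
  "projective_seq n E \<longleftrightarrow> (\<forall>i. 1 \<le> i \<and> i \<le> n \<longrightarrow> projective (E i))"

text \<open>
  The comparison theorem. The chain map is built downwards from the identity of \<open>X\<close>, using projectivity;
  the last component, at \<open>Y\<close>, exists because the target starts with an injective map.
\<close>

lemma comparison:
  assumes e: "exact_seq n X Y E d" and pr: "projective_seq n E" and e': "exact_seq n X M E' d'"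
  shows "\<exists>a. lin Y M a \<and> seq_morphism n E d E' d' a (\<lambda>x. x)"
proof -
  note D = exact_seqD[OF e] and D' = exact_seqD[OF e']
  \<comment> \<open>\<open>k\<close> counts the components built so far, besides the identity at the right end.\<close>
  have "\<exists>\<phi>. (\<forall>x. \<phi> (Suc n) x = x) \<and> (\<forall>i. Suc n \<le> i + k \<and> i \<le> Suc n \<longrightarrow> lin (E i) (E' i) (\<phi> i)) \<and>
     (\<forall>i. Suc n \<le> i + k \<and> i \<le> n \<longrightarrow> (\<forall>x \<in> carrier (E i). d' i (\<phi> i x) = \<phi> (Suc i) (d i x)))"
    if "k \<le> Suc n" for k
    using that
  proof (induction k)
    case 0
    have "lin (E i) (E' i) (\<lambda>x. x)" if "Suc n \<le> i" "i \<le> Suc n" for i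
    proof -
      have "i = Suc n" using that by simp
      then show ?thesis using D(2) D'(2) by (simp add: lin_id)
    qed
    then show ?case by (intro exI[of _ "\<lambda>i x. x"]) auto
  next
    case (Suc k)
    then obtain \<phi> where p': "\<forall>x. \<phi> (Suc n) x = x"
      "\<forall>i. Suc n \<le> i + k \<and> i \<le> Suc n \<longrightarrow> lin (E i) (E' i) (\<phi> i)"
      "\<forall>i. Suc n \<le> i + k \<and> i \<le> n \<longrightarrow> (\<forall>x \<in> carrier (E i). d' i (\<phi> i x) = \<phi> (Suc i) (d i x))"
      using Suc_leD[OF Suc.prems] by blast
    have p: "\<And>x. \<phi> (Suc n) x = x"
      "\<And>i. Suc n \<le> i + k \<Longrightarrow> i \<le> Suc n \<Longrightarrow> lin (E i) (E' i) (\<phi> i)"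
      "\<And>i x. Suc n \<le> i + k \<Longrightarrow> i \<le> n \<Longrightarrow> x \<in> carrier (E i) \<Longrightarrow> d' i (\<phi> i x) = \<phi> (Suc i) (d i x)"
      using p' by simp_all
    define j where "j = n - k"
    have j: "j \<le> n" "Suc j + k = Suc n" using Suc.prems by (simp_all add: j_def)
    let ?h = "\<lambda>x. \<phi> (Suc j) (d j x)"
    have pSj: "lin (E (Suc j)) (E' (Suc j)) (\<phi> (Suc j))" using p(2) j by simp
    have h: "lin (E j) (E' (Suc j)) ?h" by (rule lin_comp[OF D(4)[OF j(1)] pSj])
    have im: "?h x \<in> d' j ` carrier (E' j)" if x: "x \<in> carrier (E j)" for x
    proof (cases "j = n")
      case True
      then show ?thesis using D'(7) lin_closed[OF h x] by simp
    next
      case False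
      then have jn: "j < n" using j by simp
      have "d' (Suc j) (?h x) = \<phi> (Suc (Suc j)) (d (Suc j) (d j x))"
        using p(3)[of "Suc j"] j jn D(9)[OF j(1) x] by simp
      also have "\<dots> = \<zero>\<^bsub>E' (Suc (Suc j))\<^esub>"
        using D(10)[OF jn x] lin_zero[OF p(2)[of "Suc (Suc j)"] D(8) D'(8)] j jn by simp
      finally show ?thesis using D'(6)[OF jn] lin_closed[OF h x] by simp
    qed
    have d'j: "lin (E' j) (E' (Suc j)) (d' j)" by (rule D'(4)[OF j(1)])
    have "\<exists>l. lin (E j) (E' j) l \<and> (\<forall>x \<in> carrier (E j). d' j (l x) = ?h x)"
    proof (cases "j = 0")
      case True
      then show ?thesis
        using lin_factor_inj[OF d'j _ h _ _ _ im] D'(5) D(8) D'(8) j by simp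
    next
      case False
      then have "projective (E j)" using pr j by (simp add: projective_seq_def)
      then show ?thesis using projectiveD[OF _ D'(3) D'(3) d'j h im] j by simp
    qed
    then obtain l where l: "lin (E j) (E' j) l" "\<forall>x \<in> carrier (E j). d' j (l x) = ?h x" by blast
    let ?\<phi> = "\<phi>(j := l)"
    have eqj: "Suc n \<le> i + Suc k \<Longrightarrow> i \<noteq> j \<Longrightarrow> Suc n \<le> i + k" for i using j by simp
    have "\<forall>x. ?\<phi> (Suc n) x = x" using p(1) j by simp
    moreover have "\<forall>i. Suc n \<le> i + Suc k \<and> i \<le> Suc n \<longrightarrow> lin (E i) (E' i) (?\<phi> i)"
      using p(2) l(1) eqj by simp
    moreover have "\<forall>i. Suc n \<le> i + Suc k \<and> i \<le> n \<longrightarrow>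
        (\<forall>x \<in> carrier (E i). d' i (?\<phi> i x) = ?\<phi> (Suc i) (d i x))"
    proof (intro allI impI ballI)
      fix i x assume i: "Suc n \<le> i + Suc k \<and> i \<le> n" and x: "x \<in> carrier (E i)"
      show "d' i (?\<phi> i x) = ?\<phi> (Suc i) (d i x)"
      proof (cases "i = j")
        case True
        then show ?thesis using l(2) x by simp
      next
        case False
        then have "Suc i \<noteq> j" using i j by simp
        then show ?thesis using False eqj[of i] i x p(3)[of i x] by simp
      qed
    qed
    ultimately show ?case by blast
  qed
  from this[OF order_refl] obtain \<phi> where p': "\<forall>x. \<phi> (Suc n) x = x"
    "\<forall>i. Suc n \<le> i + Suc n \<and> i \<le> Suc n \<longrightarrow> lin (E i) (E' i) (\<phi> i)"
    "\<forall>i. Suc n \<le> i + Suc n \<and> i \<le> n \<longrightarrow> (\<forall>x \<in> carrier (E i). d' i (\<phi> i x) = \<phi> (Suc i) (d i x))"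
    by blast
  have p: "\<forall>x. \<phi> (Suc n) x = x" "\<forall>i \<le> Suc n. lin (E i) (E' i) (\<phi> i)"
    "\<forall>i \<le> n. \<forall>x \<in> carrier (E i). d' i (\<phi> i x) = \<phi> (Suc i) (d i x)"
    using p' by simp_all
  have "lin Y M (\<phi> 0)" using p(2) D(1) D'(1) by force
  moreover have "seq_morphism n E d E' d' (\<phi> 0) (\<lambda>x. x)"
    unfolding seq_morphism_def using p by (intro exI[of _ \<phi>]) simp
  ultimately show ?thesis by blast
qed

text \<open>
  For a projective resolution \<open>E\<close> this is the vanishing of the class of \<open>a\<close> in \<open>Hom (E 0, M) / Hom (E 1, M)\<close>,
  which computes \<open>Ext^n (X, M)\<close> when \<open>E\<close> resolves \<open>X\<close> in \<open>n\<close> steps.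
\<close>

definition extends_to_next ::
  "(nat \<Rightarrow> ('r, 'u) module) \<Rightarrow> (nat \<Rightarrow> 'u \<Rightarrow> 'u) \<Rightarrow> ('r, 'u) module \<Rightarrow> ('u \<Rightarrow> 'u) \<Rightarrow> bool" where
  "extends_to_next E d M a \<longleftrightarrow> (\<exists>h. lin (E 1) M h \<and> (\<forall>x \<in> carrier (E 0). h (d 0 x) = a x))"

text \<open>
  The usual null-homotopy is built downwards, and at its end it is the desired map out of \<open>E 1\<close>. The
  induction remembers only the current component \<open>h\<close>, with the equation \<open>d' h = \<phi>\<close> on the image of \<open>d\<close>.
\<close>

lemma null_homotopy:
  assumes e: "exact_seq n X Y E d" and pr: "projective_seq n E" and e': "exact_seq n X' M E' d'"
    and f: "seq_morphism n E d E' d' a (\<lambda>x. \<zero>\<^bsub>X'\<^esub>)"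
  shows "extends_to_next E d M a"
proof -
  note D = exact_seqD[OF e] and D' = exact_seqD[OF e']
  obtain \<phi> where p: "\<And>i. i \<le> Suc n \<Longrightarrow> lin (E i) (E' i) (\<phi> i)"
     "\<And>x. x \<in> carrier (E 0) \<Longrightarrow> \<phi> 0 x = a x" "\<And>x. x \<in> carrier (E (Suc n)) \<Longrightarrow> \<phi> (Suc n) x = \<zero>\<^bsub>X'\<^esub>"
     "\<And>i x. i \<le> n \<Longrightarrow> x \<in> carrier (E i) \<Longrightarrow> d' i (\<phi> i x) = \<phi> (Suc i) (d i x)"
    using f unfolding seq_morphism_def by blast
  have "\<exists>h. lin (E (Suc j)) (E' j) h \<and>
      (\<forall>x \<in> carrier (E j). d' j (h (d j x)) = \<phi> (Suc j) (d j x))" if "j \<le> n" for j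
    using that
  proof (induction j rule: inc_induct)
    case base
    have "lin (E (Suc n)) (E' n) (\<lambda>x. \<zero>\<^bsub>E' n\<^esub>)" by (rule lin_zero_map) (simp add: D'(8))
    moreover have "d' n \<zero>\<^bsub>E' n\<^esub> = \<phi> (Suc n) (d n x)" if "x \<in> carrier (E n)" for x
      using p(3) D(9)[OF _ that] lin_zero[OF D'(4) D'(8) D'(8)] D'(2) by simp
    ultimately show ?case by blast
  next
    case (step j)
    then obtain h where h: "lin (E (Suc (Suc j))) (E' (Suc j)) h"
      "\<And>x. x \<in> carrier (E (Suc j)) \<Longrightarrow> d' (Suc j) (h (d (Suc j) x)) = \<phi> (Suc (Suc j)) (d (Suc j) x)"
      by blast
    have jn: "j < n" "Suc j \<le> n" "Suc j \<le> Suc n" "j \<le> n" "j \<le> Suc n" "Suc (Suc j) \<le> Suc n"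
      using step by simp_all
    let ?g = "\<lambda>x. \<phi> (Suc j) x \<oplus>\<^bsub>E' (Suc j)\<^esub> \<ominus>\<^bsub>E' (Suc j)\<^esub> h (d (Suc j) x)"
    have hd: "lin (E (Suc j)) (E' (Suc j)) (\<lambda>x. h (d (Suc j) x))"
      by (rule lin_comp[OF D(4)[OF jn(2)] h(1)])
    have g: "lin (E (Suc j)) (E' (Suc j)) ?g"
      by (rule lin_minus[OF D(8)[OF jn(3)] D'(8)[OF jn(3)] p(1)[OF jn(3)] hd])
    have dSj: "lin (E' (Suc j)) (E' (Suc (Suc j))) (d' (Suc j))" by (rule D'(4)[OF jn(2)])
    have im: "?g x \<in> d' j ` carrier (E' j)" if x: "x \<in> carrier (E (Suc j))" for x
    proof -
      have "d' (Suc j) (?g x) = \<zero>\<^bsub>E' (Suc (Suc j))\<^esub>"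
        using h(2)[OF x] p(4)[OF jn(2) x] lin_closed[OF p(1)[OF jn(3)] x] lin_closed[OF hd x]
          D'(8)[OF jn(3)] D'(8)[OF jn(6)] lin_closed[OF p(1)[OF jn(6)] D(9)[OF jn(2) x]]
        by (simp add: lin_add[OF dSj] lin_neg[OF dSj])
      then show ?thesis using D'(6)[OF jn(1)] lin_closed[OF g x] by simp
    qed
    have "projective (E (Suc j))" using pr jn by (simp add: projective_seq_def)
    then obtain l where l: "lin (E (Suc j)) (E' j) l" "\<forall>x \<in> carrier (E (Suc j)). d' j (l x) = ?g x"
      using projectiveD[OF _ D'(3)[OF jn(5)] D'(3)[OF jn(3)] D'(4)[OF jn(4)] g im] by blast
    have "d' j (l (d j x)) = \<phi> (Suc j) (d j x)" if x: "x \<in> carrier (E j)" for x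
    proof -
      have dx: "d j x \<in> carrier (E (Suc j))" by (rule D(9)[OF jn(4) x])
      have "h (d (Suc j) (d j x)) = \<zero>\<^bsub>E' (Suc j)\<^esub>"
        using D(10)[OF jn(1) x] lin_zero[OF h(1) D(8)[OF jn(6)] D'(8)[OF jn(3)]] by simp
      then show ?thesis
        using l(2) dx D'(8)[OF jn(3)] lin_closed[OF p(1)[OF jn(3)] dx] by simp
    qed
    then show ?case using l(1) by blast
  qed
  from this[of 0] obtain h where h: "lin (E (Suc 0)) (E' 0) h"
    "\<And>x. x \<in> carrier (E 0) \<Longrightarrow> d' 0 (h (d 0 x)) = \<phi> (Suc 0) (d 0 x)" by blast
  have "h (d 0 x) = a x" if x: "x \<in> carrier (E 0)" for x
  proof (rule inj_onD[OF D'(5)])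
    show "d' 0 (h (d 0 x)) = d' 0 (a x)" using h(2)[OF x] p(4)[of 0 x] p(2)[OF x] x by simp
    show "h (d 0 x) \<in> carrier (E' 0)" using lin_closed[OF h(1)] D(9)[of 0 x] x by simp
    show "a x \<in> carrier (E' 0)" using lin_closed[OF p(1)[of 0] x] p(2)[OF x] by simp
  qed
  then show ?thesis unfolding extends_to_next_def using h(1) D'(1) by auto
qed

lemma extends_to_next_homotopic:
  assumes e: "exact_seq n X Y E d" and pr: "projective_seq n E" and e': "exact_seq n X M E' d'"
    and n: "n \<ge> 1" and lms: "lin Y M a" "lin Y M a'"
    and f: "seq_morphism n E d E' d' a (\<lambda>x. x)" and g: "seq_morphism n E d E' d' a' (\<lambda>x. x)"
    and ex: "extends_to_next E d M a"
  shows "extends_to_next E d M a'"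
proof -
  note D = exact_seqD[OF e] and D' = exact_seqD[OF e']
  have "seq_morphism n E d E' d' (\<lambda>x. a' x \<oplus>\<^bsub>M\<^esub> \<ominus>\<^bsub>M\<^esub> a x) (\<lambda>x. \<zero>\<^bsub>X\<^esub>)"
    by (rule seq_morphism_cong(2)[OF e e' seq_morphism_minus[OF e e' g f]]) (simp_all add: D(13))
  then have "extends_to_next E d M (\<lambda>x. a' x \<oplus>\<^bsub>M\<^esub> \<ominus>\<^bsub>M\<^esub> a x)"
    by (rule null_homotopy[OF e pr e'])
  then obtain k where k: "lin (E 1) M k" "\<forall>x \<in> carrier (E 0). k (d 0 x) = a' x \<oplus>\<^bsub>M\<^esub> \<ominus>\<^bsub>M\<^esub> a x"
    unfolding extends_to_next_def by blast
  obtain h where h: "lin (E 1) M h" "\<forall>x \<in> carrier (E 0). h (d 0 x) = a x"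
    using ex unfolding extends_to_next_def by blast
  have "lin (E 1) M (\<lambda>x. k x \<oplus>\<^bsub>M\<^esub> h x)"
    by (rule lin_plus[OF D(8) D'(14) k(1) h(1)]) simp
  moreover have "k (d 0 x) \<oplus>\<^bsub>M\<^esub> h (d 0 x) = a' x" if x: "x \<in> carrier (E 0)" for x
  proof -
    have "a x \<in> carrier M" "a' x \<in> carrier M"
      using lin_closed[OF lms(1)] lin_closed[OF lms(2)] x D(1) by simp_all
    then show ?thesis using k(2) h(2) x D'(14) by (simp add: mod_assoc)
  qed
  ultimately show ?thesis unfolding extends_to_next_def by blast
qed

text \<open>
  The push-forward of \<open>E\<close> along the zero map is a representative of zero. If it maps to every
  extension then all extensions are equivalent.
\<close>

lemma Ext_vanishesI:
  assumes e: "exact_seq n X Y E d" and n: "n \<ge> 1" and M: "obj M"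
    and ex: "\<And>E' d'. exact_seq n X M E' d' \<Longrightarrow> seq_morphism n E d E' d' (\<lambda>x. \<zero>\<^bsub>M\<^esub>) (\<lambda>x. x)"
  shows "Ext_vanishes (RMod R) n X M"
proof -
  note D = exact_seqD[OF e]
  have lmM: "lm M" using M by simp
  obtain Z z where Z: "exact_seq n X M Z z" "seq_morphism n E d Z z (\<lambda>x. \<zero>\<^bsub>M\<^esub>) (\<lambda>x. x)"
    and univ: "\<forall>N E2 d2 b. exact_seq n X N E2 d2 \<and> lin M N b \<and>
       seq_morphism n E d E2 d2 (\<lambda>x. b \<zero>\<^bsub>M\<^esub>) (\<lambda>x. x) \<longrightarrow>
       seq_morphism n Z z E2 d2 b (\<lambda>x. x)"
    using ex_pushforward[OF e n M lin_zero_map[OF lmM]] by (elim exE conjE) (rule that; assumption)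
  let ?C = "RMod R"
  let ?\<zeta> = "(Z, restrict_maps Z z)"
  have \<zeta>: "?\<zeta> \<in> extensions ?C n X M" by (rule restrict_extension[OF Z(1) n])
  then have \<zeta>': "exact_seq n X M Z (restrict_maps Z z)" using extensions_iff[OF n] by blast
  note IX = Idn_extensional[of X] and IM = Idn_extensional[of M] and ZM = HZero_extensional[of M M]
  have to_all: "(?\<zeta>, \<xi>) \<in> Yoneda_rel ?C n X M" if \<xi>: "\<xi> \<in> extensions ?C n X M" for \<xi>
  proof (rule Yoneda_relI[OF \<zeta> \<xi>])
    obtain E' d' where E': "\<xi> = (E', d')" by (cases \<xi>)
    then have e': "exact_seq n X M E' d'" and ext: "\<forall>i \<le> n. d' i \<in> extensional (carrier (E' i))"
      using \<xi> extensions_iff[OF n] by auto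
    have "seq_morphism n Z z E' d' (\<lambda>x. x) (\<lambda>x. x)"
      using univ[rule_format, of M E' d' "\<lambda>x. x"] e' ex[OF e'] lin_id[of M] by simp
    then have "seq_morphism n Z (restrict_maps Z z) E' (restrict_maps E' d') (Idn ?C M) (Idn ?C X)"
      by (rule seq_morphism_cong(1)[OF Z(1) e']) (simp_all add: Idn_apply)
    then have "seq_morphism n Z (restrict_maps Z z) E' d' (Idn ?C M) (Idn ?C X)"
    proof -
      assume a: "seq_morphism n Z (restrict_maps Z z) E' (restrict_maps E' d') (Idn ?C M) (Idn ?C X)"
      have "restrict_maps E' d' i = d' i" if "i \<le> n" for i
        using ext that by (simp add: extensional_restrict)
      then show ?thesis using a unfolding seq_morphism_def by simp
    qed
    then show "ext_morphism ?C n ?\<zeta> \<xi> (Idn ?C M) (Idn ?C X)"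
      unfolding E' using ext_morphism_iff[OF \<zeta>' e' IM IX] by simp
  qed
  have zero: "ext_morphism ?C n ?\<zeta> ?\<zeta> (HZero ?C M M) (Idn ?C X)"
  proof -
    have "seq_morphism n Z z Z z (\<lambda>x. \<zero>\<^bsub>M\<^esub>) (\<lambda>x. x)"
      using univ[rule_format, of M Z z "\<lambda>x. \<zero>\<^bsub>M\<^esub>"] Z by (simp add: lin_zero_map[OF lmM])
    then have "seq_morphism n Z (restrict_maps Z z) Z (restrict_maps Z z) (HZero ?C M M) (Idn ?C X)"
      by (rule seq_morphism_cong(1)[OF Z(1) Z(1)]) (simp_all add: Idn_apply HZero_apply)
    then show ?thesis using ext_morphism_iff[OF \<zeta>' \<zeta>' ZM IX] by simp
  qed
  have rel: "(\<xi>, \<eta>) \<in> Yoneda_rel ?C n X M"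
    if "\<xi> \<in> extensions ?C n X M" "\<eta> \<in> extensions ?C n X M" for \<xi> \<eta>
    using Yoneda_rel_trans[OF Yoneda_rel_sym[OF to_all[OF that(1)]] to_all[OF that(2)]] .
  have cls: "Yoneda_rel ?C n X M `` A = extensions ?C n X M"
    if "A \<subseteq> extensions ?C n X M" "A \<noteq> {}" for A
  proof (intro equalityI subsetI)
    fix \<xi> assume "\<xi> \<in> Yoneda_rel ?C n X M `` A"
    then show "\<xi> \<in> extensions ?C n X M" using Yoneda_rel_extensions(2) by (metis ImageE)
  next
    fix \<xi> assume "\<xi> \<in> extensions ?C n X M"
    then show "\<xi> \<in> Yoneda_rel ?C n X M `` A" using that rel by blast
  qed
  have "extensions ?C n X M // Yoneda_rel ?C n X M = {extensions ?C n X M}"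
    unfolding quotient_def using cls[of "{_}"] \<zeta> by auto
  moreover have "Yoneda_rel ?C n X M `` {\<zeta> \<in> extensions ?C n X M.
        \<exists>\<omega> \<in> extensions ?C n X M. ext_morphism ?C n \<omega> \<zeta> (HZero ?C M M) (Idn ?C X)} =
     extensions ?C n X M"
    by (rule cls) (use \<zeta> zero in auto)
  ultimately show ?thesis
    unfolding Ext_vanishes_def Ext_def using n by simp
qed

lemma Yoneda_rel_refl:
  fixes X Y :: "('r, 'u) module"
  assumes \<xi>: "\<xi> \<in> extensions (RMod R) n X Y" and n: "n \<ge> 1"
  shows "(\<xi>, \<xi>) \<in> Yoneda_rel (RMod R) n X Y"
proof (rule Yoneda_relI[OF \<xi> \<xi>])
  obtain E d where E: "\<xi> = (E, d)" by (cases \<xi>)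
  then have e: "exact_seq n X Y E d" using \<xi> extensions_iff[OF n] by blast
  have "seq_morphism n E d E d (\<lambda>x. x) (\<lambda>x. x)"
    unfolding seq_morphism_def by (intro exI[of _ "\<lambda>i x. x"]) (simp add: lin_id)
  then have "seq_morphism n E d E d (Idn (RMod R) Y) (Idn (RMod R) X)"
    by (rule seq_morphism_cong(2)[OF e e]) (simp_all add: Idn_apply)
  then show "ext_morphism (RMod R) n \<xi> \<xi> (Idn (RMod R) Y) (Idn (RMod R) X)"
    unfolding E ext_morphism_iff[OF e e Idn_extensional Idn_extensional] .
qed

text \<open>
  Subtract from the component at \<open>E 1\<close> the composite of the extension of \<open>a\<close> with \<open>d' 0\<close>. The square at
  \<open>E 1\<close> does not notice, because \<open>d' 1\<close> kills the image of \<open>d' 0\<close>.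
\<close>

lemma seq_morphism_absorb:
  assumes e: "exact_seq n X Y E d" and n: "n \<ge> 1" and e': "exact_seq n X' M E' d'"
    and f: "seq_morphism n E d E' d' a b" and ex: "extends_to_next E d M a"
  shows "seq_morphism n E d E' d' (\<lambda>x. \<zero>\<^bsub>M\<^esub>) b"
proof -
  note D = exact_seqD[OF e] and D' = exact_seqD[OF e']
  obtain h where h: "lin (E 1) M h" "\<And>x. x \<in> carrier (E 0) \<Longrightarrow> h (d 0 x) = a x"
    using ex unfolding extends_to_next_def by blast
  obtain \<phi> where p: "\<And>i. i \<le> Suc n \<Longrightarrow> lin (E i) (E' i) (\<phi> i)"
     "\<And>x. x \<in> carrier (E 0) \<Longrightarrow> \<phi> 0 x = a x" "\<And>x. x \<in> carrier (E (Suc n)) \<Longrightarrow> \<phi> (Suc n) x = b x"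
     "\<And>i x. i \<le> n \<Longrightarrow> x \<in> carrier (E i) \<Longrightarrow> d' i (\<phi> i x) = \<phi> (Suc i) (d i x)"
    using f unfolding seq_morphism_def by blast
  have n': "1 \<le> Suc n" "0 \<le> n" "1 \<le> n" using n by simp_all
  let ?g = "\<lambda>x. \<phi> 1 x \<oplus>\<^bsub>E' 1\<^esub> \<ominus>\<^bsub>E' 1\<^esub> d' 0 (h x)"
  have d0: "lin M (E' 1) (d' 0)" using D'(4)[of 0] D'(1) by simp
  have dh: "lin (E 1) (E' 1) (\<lambda>x. d' 0 (h x))" by (rule lin_comp[OF h(1) d0])
  have g: "lin (E 1) (E' 1) ?g"
    by (rule lin_minus[OF D(8)[OF n'(1)] D'(8)[OF n'(1)] p(1)[OF n'(1)] dh])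
  have sq0: "?g (d 0 x) = \<zero>\<^bsub>E' 1\<^esub>" if x: "x \<in> carrier (E 0)" for x
  proof -
    have "\<phi> 1 (d 0 x) = d' 0 (a x)" using p(4)[of 0 x] p(2)[OF x] x by simp
    moreover have "a x \<in> carrier M" using lin_closed[OF p(1)[of 0] x] p(2)[OF x] D'(1) by simp
    ultimately show ?thesis using h(2)[OF x] lin_closed[OF d0] D'(8)[OF n'(1)] by simp
  qed
  have d1: "lin (E' (Suc 0)) (E' (Suc (Suc 0))) (d' (Suc 0))" using D'(4)[OF n'(3)] by simp
  have sq1: "d' 1 (?g x) = \<phi> (Suc 1) (d 1 x)" if x: "x \<in> carrier (E 1)" for x
  proof -
    have hx: "h x \<in> carrier (E' 0)" using lin_closed[OF h(1) x] D'(1) by simp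
    have z: "d' 1 (d' 0 (h x)) = \<zero>\<^bsub>E' (Suc 1)\<^esub>" using D'(10)[of 0 "h x"] hx n by simp
    have S2: "Suc 1 \<le> Suc n" using n by simp
    show ?thesis
      using z p(4)[OF n'(3) x] lin_closed[OF p(1)[OF n'(1)] x] lin_closed[OF dh x]
        D'(8)[OF n'(1)] D'(8)[OF S2] lin_closed[OF p(1)[OF S2] D(9)[OF n'(3) x]]
      by (simp add: lin_add[OF d1] lin_neg[OF d1])
  qed
  show ?thesis
    unfolding seq_morphism_def
  proof (intro exI[of _ "\<phi>(0 := \<lambda>x. \<zero>\<^bsub>M\<^esub>, 1 := ?g)"] conjI allI impI ballI)
    show "lin (E i) (E' i) ((\<phi>(0 := \<lambda>x. \<zero>\<^bsub>M\<^esub>, 1 := ?g)) i)" if "i \<le> Suc n" for i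
      using that p(1)[of i] g D'(1) by (simp add: lin_zero_map[OF D'(14)])
    show "d' i ((\<phi>(0 := \<lambda>x. \<zero>\<^bsub>M\<^esub>, 1 := ?g)) i x) = (\<phi>(0 := \<lambda>x. \<zero>\<^bsub>M\<^esub>, 1 := ?g)) (Suc i) (d i x)"
      if i: "i \<le> n" and x: "x \<in> carrier (E i)" for i x
    proof -
      consider "i = 0" | "i = 1" | "i \<noteq> 0" "i \<noteq> 1" by blast
      then show ?thesis
      proof cases
        case 1
        then show ?thesis using sq0[of x] x lin_zero[OF d0 D'(14) D'(8)[OF n'(1)]] by simp
      next
        case 2
        then show ?thesis using sq1[of x] x by simp
      next
        case 3
        then show ?thesis using p(4)[OF i x] by simp
      qed
    qed
  qed (use n p(3) in auto)
qed

text \<open>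
  Comparison with a resolution yields a morphism to any extension over some \<open>a\<close>; absorbing \<open>a\<close> turns it
  into a morphism over zero.
\<close>

lemma Ext_vanishes_resolution:
  assumes e: "exact_seq n X Y E d" and pr: "projective_seq n E" and n: "n \<ge> 1" and M: "obj M"
    and ex: "\<And>a. lin Y M a \<Longrightarrow> extends_to_next E d M a"
  shows "Ext_vanishes (RMod R) n X M"
proof (rule Ext_vanishesI[OF e n M])
  fix E' d' assume e': "exact_seq n X M E' d'"
  obtain a where a: "lin Y M a" "seq_morphism n E d E' d' a (\<lambda>x. x)"
    using comparison[OF e pr e'] by blast
  show "seq_morphism n E d E' d' (\<lambda>x. \<zero>\<^bsub>M\<^esub>) (\<lambda>x. x)"
    by (rule seq_morphism_absorb[OF e n e' a(2) ex[OF a(1)]])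
qed

text \<open>
  The obstruction to extending \<open>a : Y \<rightarrow> M\<close> to \<open>E 1\<close> is an invariant of the Yoneda class of the
  push-forward of \<open>E\<close> along \<open>a\<close>, and it vanishes for classes with a representative whose last map splits.
\<close>

lemma extends_to_next_if_split:
  assumes e: "exact_seq n X Y E d" and pr: "projective_seq n E" and n: "n \<ge> 1" and M: "obj M"
    and a: "lin Y M a"
    and split: "\<And>\<eta>. \<eta> \<in> extensions (RMod R) n X M \<Longrightarrow>
      \<exists>Z z s. ((Z, z), \<eta>) \<in> Yoneda_rel (RMod R) n X M \<and> lin X (Z n) s \<and>
        (\<forall>x \<in> carrier X. z n (s x) = x)"
  shows "extends_to_next E d M a"
proof -
  let ?C = "RMod R"
  note D = exact_seqD[OF e]
  have lmM: "lm M" using M by simp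
  obtain W w where W: "exact_seq n X M W w" "seq_morphism n E d W w a (\<lambda>x. x)"
    using ex_pushforward[OF e n M a] by blast
  let ?\<eta> = "(W, restrict_maps W w)"
  have \<eta>: "?\<eta> \<in> extensions ?C n X M" by (rule restrict_extension[OF W(1) n])
  obtain Z z s where Z: "((Z, z), ?\<eta>) \<in> Yoneda_rel ?C n X M" and s: "lin X (Z n) s"
    "\<forall>x \<in> carrier X. z n (s x) = x"
    using split[OF \<eta>] by blast
  \<comment> \<open>As any two morphisms from \<open>E\<close> to \<open>\<xi>\<close> over the identity of \<open>X\<close> are homotopic, the choice of \<open>b\<close> does not
    matter. Phrased with some \<open>b\<close>, the property moves forward along morphisms by composition.\<close>
  define unobstructed where "unobstructed \<xi> \<longleftrightarrow>
    (\<exists>b. lin Y M b \<and> seq_morphism n E d (fst \<xi>) (snd \<xi>) b (\<lambda>x. x) \<and> extends_to_next E d M b)" for \<xi>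
  have "unobstructed (Z, z) \<longleftrightarrow> unobstructed ?\<eta>"
  proof (rule Yoneda_rel_invariant[OF Z])
    fix \<xi> \<eta>
    assume x: "\<xi> \<in> extensions ?C n X M" and y: "\<eta> \<in> extensions ?C n X M"
      and m: "ext_morphism ?C n \<xi> \<eta> (Idn ?C M) (Idn ?C X)"
    obtain A \<alpha> B \<beta> where AB: "\<xi> = (A, \<alpha>)" "\<eta> = (B, \<beta>)" by (cases \<xi>, cases \<eta>)
    have eA: "exact_seq n X M A \<alpha>" and eB: "exact_seq n X M B \<beta>"
      using x y AB extensions_iff[OF n] by auto
    have "seq_morphism n A \<alpha> B \<beta> (Idn ?C M) (Idn ?C X)"
      using m ext_morphism_iff[OF eA eB Idn_extensional Idn_extensional] unfolding AB by simp
    then have mor: "seq_morphism n A \<alpha> B \<beta> (\<lambda>x. x) (\<lambda>x. x)"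
      by (rule seq_morphism_cong(2)[OF eA eB]) (simp_all add: Idn_apply)
    show "unobstructed \<xi> \<longleftrightarrow> unobstructed \<eta>"
    proof
      assume "unobstructed \<xi>"
      then obtain b where b: "lin Y M b" "seq_morphism n E d A \<alpha> b (\<lambda>x. x)" "extends_to_next E d M b"
        unfolding unobstructed_def AB by auto
      then show "unobstructed \<eta>"
        unfolding unobstructed_def AB using seq_morphism_comp[OF b(2) mor e] by auto
    next
      assume "unobstructed \<eta>"
      then obtain b where b: "lin Y M b" "seq_morphism n E d B \<beta> b (\<lambda>x. x)" "extends_to_next E d M b"
        unfolding unobstructed_def AB by auto
      obtain c where c: "lin Y M c" "seq_morphism n E d A \<alpha> c (\<lambda>x. x)"
        using comparison[OF e pr eA] by blast
      have "extends_to_next E d M c"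
        by (rule extends_to_next_homotopic[OF e pr eB n b(1) c(1) b(2) seq_morphism_comp[OF c(2) mor e] b(3)])
      then show "unobstructed \<xi>"
        unfolding unobstructed_def AB using c by auto
    qed
  qed
  moreover have "unobstructed (Z, z)"
  proof -
    have eZ: "exact_seq n X M Z z"
      using Yoneda_rel_extensions(1)[OF Z] extensions_iff[OF n] by blast
    note Z' = exact_seqD[OF eZ]
    \<comment> \<open>A morphism over the zero map: it is zero except in the last places, where \<open>s\<close> lifts the identity of \<open>X\<close>.\<close>
    let ?\<phi> = "\<lambda>i. if i = Suc n then (\<lambda>x. x) else if i = n then (\<lambda>x. s (d n x)) else (\<lambda>x. \<zero>\<^bsub>Z i\<^esub>)"
    have "lin (E n) (Z n) (\<lambda>x. s (d n x))" using lin_comp[OF D(4)[of n]] s(1) D(2) by simp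
    then have "lin (E i) (Z i) (?\<phi> i)" if "i \<le> Suc n" for i
      using that D(2) Z'(2) by (simp add: lin_id lin_zero_map[OF Z'(8)[OF that]])
    moreover have "z i (?\<phi> i x) = ?\<phi> (Suc i) (d i x)" if i: "i \<le> n" and x: "x \<in> carrier (E i)" for i x
    proof -
      consider "i = n" | "Suc i = n" | "i < n" "Suc i \<noteq> n" using i by linarith
      then show ?thesis
      proof cases
        case 1
        then show ?thesis using s(2) D(9)[OF i x] D(2) by simp
      next
        case 2
        then have i: "i < n" by simp
        have "z i \<zero>\<^bsub>Z i\<^esub> = \<zero>\<^bsub>Z n\<^esub>"
          using lin_zero[OF Z'(4)[of i] Z'(8) Z'(8)] i 2 by simp
        moreover have "s (d n (d i x)) = \<zero>\<^bsub>Z n\<^esub>"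
          using D(10)[OF i x] 2 D(2) lin_zero[OF s(1) D(13) Z'(8)] by simp
        ultimately show ?thesis using 2 by auto
      next
        case 3
        then show ?thesis using lin_zero[OF Z'(4)[of i] Z'(8) Z'(8)] by simp
      qed
    qed
    ultimately have "seq_morphism n E d Z z (\<lambda>x. \<zero>\<^bsub>M\<^esub>) (\<lambda>x. x)"
      unfolding seq_morphism_def using n Z'(1) by (intro exI[of _ ?\<phi>]) simp
    moreover have "extends_to_next E d M (\<lambda>x. \<zero>\<^bsub>M\<^esub>)"
      unfolding extends_to_next_def by (intro exI[of _ "\<lambda>x. \<zero>\<^bsub>M\<^esub>"]) (simp add: lin_zero_map[OF lmM])
    ultimately show ?thesis
      unfolding unobstructed_def
      by (intro exI[of _ "\<lambda>x. \<zero>\<^bsub>M\<^esub>"]) (simp add: lin_zero_map[OF lmM])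
  qed
  ultimately obtain b where b: "lin Y M b" "seq_morphism n E d W (restrict_maps W w) b (\<lambda>x. x)"
    "extends_to_next E d M b"
    unfolding unobstructed_def by auto
  have eW: "exact_seq n X M W (restrict_maps W w)" using \<eta> extensions_iff[OF n] by blast
  have "seq_morphism n E d W (restrict_maps W w) a (\<lambda>x. x)"
  proof -
    have "seq_morphism n E (restrict_maps E d) W (restrict_maps W w) a (\<lambda>x. x)"
      by (rule seq_morphism_cong(1)[OF e W]) simp_all
    then show ?thesis unfolding seq_morphism_def by (simp cong: ball_cong)
  qed
  then show ?thesis
    by (rule extends_to_next_homotopic[OF e pr eW n b(1) a b(2) _ b(3)])
qed

end

context module_universe begin

lemma ex_projective_resolution:
  assumes X: "obj X" and n: "n \<ge> 1"
  shows "\<exists>E d Y. exact_seq n X Y E d \<and> projective_seq n E"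
  using n
proof (induction n rule: dec_induct)
  case base
  obtain F p where F: "obj F" "projective F" "lin F X p" "p ` carrier F = carrier X"
    using ex_projective_cover[OF X] by blast
  let ?k = "{x \<in> carrier F. p x = \<zero>\<^bsub>X\<^esub>}"
  have k: "submod F ?k" using submod_kernel[OF F(3)] F(1) X by simp
  let ?K = "restr F ?k"
  have K: "obj ?K" by (rule obj_restr[OF F(1) k])
  let ?E = "\<lambda>i :: nat. if i = 0 then ?K else if i = 1 then F else X"
  let ?d = "\<lambda>i :: nat. if i = 0 then (\<lambda>x. x) else p"
  have "exact_seq 1 X ?K ?E ?d"
    unfolding exact_seq_def
  proof (intro conjI allI impI)
    show "lin (?E i) (?E (Suc i)) (?d i)" if "i \<le> 1" for i
      using that F(3) submod_module(2)[OF obj_lm[OF F(1)] k] by (cases i) auto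
    show "?d i ` carrier (?E i) = {y \<in> carrier (?E (Suc i)). ?d (Suc i) y = \<zero>\<^bsub>?E (Suc (Suc i))\<^esub>}"
      if "i < 1" for i using that by auto
  qed (use K F X in auto)
  moreover have "projective_seq 1 ?E" using F(2) by (simp add: projective_seq_def)
  ultimately show ?case by blast
next
  case (step n)
  then obtain E d Y where e: "exact_seq n X Y E d" and pr: "projective_seq n E" by blast
  note D = exact_seqD[OF e]
  obtain F p where F: "obj F" "projective F" "lin F Y p" "p ` carrier F = carrier Y"
    using ex_projective_cover[OF D(12)] by blast
  let ?k = "{x \<in> carrier F. p x = \<zero>\<^bsub>Y\<^esub>}"
  have k: "submod F ?k" using submod_kernel[OF F(3)] F(1) D(14) by simp
  let ?K = "restr F ?k"
  have K: "obj ?K" by (rule obj_restr[OF F(1) k])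
  \<comment> \<open>Splice a projective cover of \<open>Y\<close> into the left end; the old map out of \<open>Y\<close> becomes \<open>d 0 \<circ> p\<close>.\<close>
  define E' where "E' i = (case i of 0 \<Rightarrow> ?K | Suc j \<Rightarrow> (case j of 0 \<Rightarrow> F | Suc l \<Rightarrow> E j))" for i
  define d' where "d' i = (case i of 0 \<Rightarrow> (\<lambda>x. x) | Suc j \<Rightarrow>
    (case j of 0 \<Rightarrow> (\<lambda>x. d 0 (p x)) | Suc l \<Rightarrow> d j))" for i
  have E': "E' 0 = ?K" "E' (Suc 0) = F" "\<And>l. E' (Suc (Suc l)) = E (Suc l)" by (simp_all add: E'_def)
  have d': "d' 0 = (\<lambda>x. x)" "d' (Suc 0) = (\<lambda>x. d 0 (p x))" "\<And>l. d' (Suc (Suc l)) = d (Suc l)"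
    by (simp_all add: d'_def)
  have d0: "lin Y (E (Suc 0)) (d 0)" using D(4)[of 0] D(1) by simp
  have inj0: "d 0 y = \<zero>\<^bsub>E (Suc 0)\<^esub> \<longleftrightarrow> y = \<zero>\<^bsub>Y\<^esub>" if "y \<in> carrier Y" for y
    using lin_inj_iff[OF d0 D(14) D(8)] D(5) D(1) that lin_zero[OF d0 D(14) D(8)] by auto
  have dp_im: "(\<lambda>x. d 0 (p x)) ` carrier F = d 0 ` carrier (E 0)"
    using F(4) D(1) by (simp add: image_image[symmetric])
  have "exact_seq (Suc n) X ?K E' d'"
    unfolding exact_seq_def
  proof (intro conjI allI impI)
    show "E' 0 = ?K" "E' (Suc (Suc n)) = X" using D(2) by (simp_all add: E')
    show "obj (E' i)" if i: "i \<le> Suc (Suc n)" for i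
    proof -
      consider "i = 0" | "i = Suc 0" | l where "i = Suc (Suc l)" by (metis not0_implies_Suc)
      then show ?thesis using i K F(1) D(3) by cases (simp_all add: E')
    qed
    show "lin (E' i) (E' (Suc i)) (d' i)" if i: "i \<le> Suc n" for i
    proof -
      consider "i = 0" | "i = Suc 0" | l where "i = Suc (Suc l)" by (metis not0_implies_Suc)
      then show ?thesis
      proof cases
        case 1
        then show ?thesis using submod_module(2)[OF obj_lm[OF F(1)] k] by (simp add: E' d')
      next
        case 2
        then show ?thesis using lin_comp[OF F(3) d0] by (simp add: E' d')
      next
        case 3
        then show ?thesis using i D(4) by (simp add: E' d')
      qed
    qed
    show "inj_on (d' 0) (carrier (E' 0))" by (simp add: d')
    show "d' i ` carrier (E' i) = {y \<in> carrier (E' (Suc i)). d' (Suc i) y = \<zero>\<^bsub>E' (Suc (Suc i))\<^esub>}"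
      if i: "i < Suc n" for i
    proof -
      consider "i = 0" | "i = Suc 0" | l where "i = Suc (Suc l)" by (metis not0_implies_Suc)
      then show ?thesis
      proof cases
        case 1
        have "d 0 (p y) = \<zero>\<^bsub>E (Suc 0)\<^esub> \<longleftrightarrow> p y = \<zero>\<^bsub>Y\<^esub>" if "y \<in> carrier F" for y
          using inj0 lin_closed[OF F(3) that] by simp
        then show ?thesis using 1 by (auto simp: E' d')
      next
        case 2
        then show ?thesis using dp_im D(6)[of 0] i by (simp add: E' d')
      next
        case 3
        then show ?thesis using i D(6)[of "Suc l"] by (simp add: E' d')
      qed
    qed
    show "d' (Suc n) ` carrier (E' (Suc n)) = carrier (E' (Suc (Suc n)))"
      using D(7) step(1) by (cases n) (simp_all add: E' d')
  qed
  moreover have "projective_seq (Suc n) E'"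
    unfolding projective_seq_def
  proof (intro allI impI)
    fix i assume i: "1 \<le> i \<and> i \<le> Suc n"
    then consider "i = Suc 0" | l where "i = Suc (Suc l)" by (metis not0_implies_Suc not_one_le_zero)
    then show "projective (E' i)"
      using i F(2) pr by cases (simp_all add: E' projective_seq_def)
  qed
  ultimately show ?case by blast
qed

text \<open>
  A resolution of \<open>C\<close> arises from one of \<open>T\<close> by adding \<open>F\<close> in a single place, next to the second projective
  from the right. The left end \<open>E 0 \<rightarrow> E 1\<close> is the same for both, up to a summand \<open>F\<close> of \<open>E 1\<close> when \<open>n = 2\<close>, so
  a map that extends for \<open>T\<close> extends for \<open>C\<close>.
\<close>

lemma resolution_of_cokernel:
  assumes e: "exact_seq n T Y E d" and pr: "projective_seq n E" and n: "n \<ge> 2"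
    and F: "obj F" "projective F" and f: "lin F T f" "inj_on f (carrier F)"
    and C: "obj C" and q: "lin T C q" "q ` carrier T = carrier C"
      "f ` carrier F = {t \<in> carrier T. q t = \<zero>\<^bsub>C\<^esub>}"
  shows "\<exists>E' d'. exact_seq n C Y E' d' \<and> projective_seq n E' \<and>
    (\<forall>M a. obj M \<and> extends_to_next E d M a \<longrightarrow> extends_to_next E' d' M a)"
proof -
  note D = exact_seqD[OF e]
  obtain m where m: "n = Suc (Suc m)" using n by (cases n; cases "n - 1") auto
  let ?P = "E (Suc m)" and ?G = "E n"
  have le: "m \<le> n" "Suc m \<le> n" "m < n" "Suc m < n" "m \<le> Suc n" "Suc m \<le> Suc n" "n \<le> Suc n" using m by simp_all
  have oP: "obj ?P" and lmP: "lm ?P" and oG: "obj ?G" and lmG: "lm ?G" using D(3,8) le by simp_all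
  have lmF: "lm F" using F(1) by simp
  have ESm: "E (Suc (Suc m)) = ?G" using m by simp
  have dn: "lin ?G T (d n)" using D(4)[of n] D(2) by simp
  have dSm: "lin ?P ?G (d (Suc m))" using D(4)[OF le(2)] m by simp
  have dm: "lin (E m) ?P (d m)" by (rule D(4)[OF le(1)])
  \<comment> \<open>Lifting \<open>f\<close> to \<open>l : F \<rightarrow> E n\<close>, the kernel of \<open>E n \<rightarrow> C\<close> is the image of \<open>d (n - 1)\<close> together with that of \<open>l\<close>.\<close>
  obtain l where l: "lin F ?G l" "\<forall>x \<in> carrier F. d n (l x) = f x"
  proof -
    have "f x \<in> d n ` carrier ?G" if "x \<in> carrier F" for x
      using D(7) D(2) lin_closed[OF f(1) that] by simp
    then show ?thesis
      using projectiveD[OF F(2) oG D(11) dn f(1)] that by blast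
  qed
  obtain S i1 i2 p1 p2 where S: "obj S" "lin ?P S i1" "lin F S i2" "lin S ?P p1" "lin S F p2"
    and p: "\<forall>x \<in> carrier ?P. p1 (i1 x) = x \<and> p2 (i1 x) = \<zero>\<^bsub>F\<^esub>"
      "\<forall>y \<in> carrier F. p1 (i2 y) = \<zero>\<^bsub>?P\<^esub> \<and> p2 (i2 y) = y"
      and ps: "\<forall>s \<in> carrier S. i1 (p1 s) \<oplus>\<^bsub>S\<^esub> i2 (p2 s) = s"
    using ex_biproduct[OF oP F(1)] by blast
  have lmS: "lm S" using S(1) by simp
  let ?h = "\<lambda>s. d (Suc m) (p1 s) \<oplus>\<^bsub>?G\<^esub> l (p2 s)"
  have h: "lin S ?G ?h"
    by (rule lin_plus[OF lmS lmG lin_comp[OF S(4) dSm] lin_comp[OF S(5) l(1)]])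
  let ?k = "\<lambda>y. i1 (d m y)"
  have k: "lin (E m) S ?k" by (rule lin_comp[OF dm S(2)])
  have dd: "d n (d (Suc m) x) = \<zero>\<^bsub>T\<^esub>" if "x \<in> carrier ?P" for x
    using D(10)[OF le(4) that] m D(2) by simp
  have dnh: "d n (?h s) = f (p2 s)" if s: "s \<in> carrier S" for s
    using lin_closed[OF S(4) s] lin_closed[OF S(5) s] lin_closed[OF dSm] lin_closed[OF l(1)] dd l(2)
      lin_closed[OF f(1)] D(13) by (simp add: lin_add[OF dn])
  have f0: "x = \<zero>\<^bsub>F\<^esub>" if "x \<in> carrier F" "f x = \<zero>\<^bsub>T\<^esub>" for x
    using lin_inj_iff[OF f(1) lmF D(13)] f(2) that by blast
  have ker_h: "?k ` carrier (E m) = {s \<in> carrier S. ?h s = \<zero>\<^bsub>?G\<^esub>}"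
  proof (intro equalityI subsetI)
    fix s assume "s \<in> ?k ` carrier (E m)"
    then obtain y where y: "y \<in> carrier (E m)" "s = i1 (d m y)" by blast
    have dy: "d m y \<in> carrier ?P" by (rule lin_closed[OF dm y(1)])
    have "d (Suc m) (d m y) = \<zero>\<^bsub>?G\<^esub>" using D(10)[OF le(3) y(1)] m by simp
    then have "?h s = \<zero>\<^bsub>?G\<^esub>" using y(2) p dy lin_zero[OF l(1) lmF lmG] lmG by simp
    then show "s \<in> {s \<in> carrier S. ?h s = \<zero>\<^bsub>?G\<^esub>}" using lin_closed[OF S(2) dy] y(2) by simp
  next
    fix s assume "s \<in> {s \<in> carrier S. ?h s = \<zero>\<^bsub>?G\<^esub>}"
    then have s: "s \<in> carrier S" "?h s = \<zero>\<^bsub>?G\<^esub>" by auto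
    have "f (p2 s) = \<zero>\<^bsub>T\<^esub>" using dnh[OF s(1)] s(2) lin_zero[OF dn lmG D(13)] by simp
    then have p2: "p2 s = \<zero>\<^bsub>F\<^esub>" using f0 lin_closed[OF S(5) s(1)] by simp
    have p1s: "p1 s \<in> carrier ?P" by (rule lin_closed[OF S(4) s(1)])
    have "d (Suc m) (p1 s) = \<zero>\<^bsub>?G\<^esub>"
      using s(2) p2 lin_zero[OF l(1) lmF lmG] lmG lin_closed[OF dSm p1s] by simp
    then obtain y where y: "y \<in> carrier (E m)" "p1 s = d m y"
      using D(6)[OF le(3)] p1s m by auto
    have "s = i1 (d m y)"
      using ps s(1) p2 y(2) lin_zero[OF S(3) lmF lmS] lmS lin_closed[OF S(2) p1s]
      by (metis mod_add_zero)
    then show "s \<in> ?k ` carrier (E m)" using y(1) by blast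
  qed
  have ker_q: "?h ` carrier S = {z \<in> carrier ?G. q (d n z) = \<zero>\<^bsub>C\<^esub>}"
  proof (intro equalityI subsetI)
    fix z assume "z \<in> ?h ` carrier S"
    then obtain s where s: "s \<in> carrier S" "z = ?h s" by blast
    have "f (p2 s) \<in> f ` carrier F" using lin_closed[OF S(5) s(1)] by blast
    then have "q (f (p2 s)) = \<zero>\<^bsub>C\<^esub>" using q(3) by blast
    then show "z \<in> {z \<in> carrier ?G. q (d n z) = \<zero>\<^bsub>C\<^esub>}"
      using dnh[OF s(1)] s(2) lin_closed[OF h s(1)] by simp
  next
    fix z assume "z \<in> {z \<in> carrier ?G. q (d n z) = \<zero>\<^bsub>C\<^esub>}"
    then have z: "z \<in> carrier ?G" "q (d n z) = \<zero>\<^bsub>C\<^esub>" by auto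
    have "d n z \<in> f ` carrier F" using z lin_closed[OF dn z(1)] q(3) by simp
    then obtain x where x: "x \<in> carrier F" "d n z = f x" by blast
    have lx: "l x \<in> carrier ?G" by (rule lin_closed[OF l(1) x(1)])
    have "d n (z \<oplus>\<^bsub>?G\<^esub> \<ominus>\<^bsub>?G\<^esub> l x) = \<zero>\<^bsub>T\<^esub>"
      using lin_eq_diff[OF dn lmG D(13) z(1) lx] l(2) x by simp
    then have "z \<oplus>\<^bsub>?G\<^esub> \<ominus>\<^bsub>?G\<^esub> l x \<in> d (Suc m) ` carrier ?P"
      using D(6)[OF le(4)] m D(2) z(1) lx lmG by simp
    then obtain y where y: "y \<in> carrier ?P" "z \<oplus>\<^bsub>?G\<^esub> \<ominus>\<^bsub>?G\<^esub> l x = d (Suc m) y" by blast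
    let ?s = "i1 y \<oplus>\<^bsub>S\<^esub> i2 x"
    have c: "i1 y \<in> carrier S" "i2 x \<in> carrier S" using lin_closed[OF S(2) y(1)] lin_closed[OF S(3) x(1)] .
    have "?h ?s = d (Suc m) y \<oplus>\<^bsub>?G\<^esub> l x"
      using c p x y lmP lmF by (simp add: lin_add[OF S(4)] lin_add[OF S(5)])
    also have "\<dots> = z" using y(2)[symmetric] z(1) lx lmG by (simp add: mod_assoc)
    finally have "z = ?h ?s" by simp
    moreover have "?s \<in> carrier S" using c lmS by simp
    ultimately show "z \<in> ?h ` carrier S" by (rule image_eqI)
  qed
  have im_q: "(\<lambda>z. q (d n z)) ` carrier ?G = carrier C"
    using D(7) D(2) q(2) by (simp add: image_image[symmetric])
  define E' where "E' = E(Suc m := S, Suc n := C)"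
  define d' where "d' = d(m := ?k, Suc m := ?h, n := (\<lambda>z. q (d n z)))"
  have E'1: "E' (Suc m) = S" "E' (Suc n) = C" "E' n = ?G" "E' m = E m"
    "\<And>i. i < m \<Longrightarrow> E' i = E i \<and> E' (Suc i) = E (Suc i)" using m by (simp_all add: E'_def)
  have d'1: "d' m = ?k" "d' (Suc m) = ?h" "d' n = (\<lambda>z. q (d n z))" "\<And>i. i < m \<Longrightarrow> d' i = d i"
    using m by (simp_all add: d'_def)
  have cs: "i < m \<or> i = m \<or> i = Suc m \<or> i = n" if "i \<le> n" for i using that m by linarith
  have p1_zero: "?k y = \<zero>\<^bsub>S\<^esub> \<longleftrightarrow> d m y = \<zero>\<^bsub>?P\<^esub>" if y: "y \<in> carrier (E m)" for y
    using p(1) lin_closed[OF dm y] lin_zero[OF S(2) lmP lmS] lin_zero[OF S(4) lmS lmP] by metis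
  have "exact_seq n C Y E' d'"
    unfolding exact_seq_def
  proof (intro conjI allI impI)
    show "E' 0 = Y" using D(1) by (simp add: E'_def)
    show "E' (Suc n) = C" by (rule E'1)
    show "obj (E' i)" if "i \<le> Suc n" for i using that D(3)[of i] S(1) C by (simp add: E'_def)
    show "lin (E' i) (E' (Suc i)) (d' i)" if i: "i \<le> n" for i
      using cs[OF i]
    proof (elim disjE)
      assume "i < m" then show ?thesis using D(4)[OF i] E'1(5) d'1(4) by simp
    next
      assume "i = m" then show ?thesis using k E'1 d'1 by simp
    next
      assume "i = Suc m" then show ?thesis using h E'1 d'1 m by simp
    next
      assume "i = n" then show ?thesis using lin_comp[OF dn q(1)] E'1 d'1 by simp
    qed
    show "inj_on (d' 0) (carrier (E' 0))"
    proof (cases m)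
      case 0
      have k0: "lin (E 0) S (\<lambda>y. i1 (d 0 y))" and d0: "lin (E 0) ?P (d 0)" and lm0: "lm (E 0)"
        using k dm D(8)[of 0] 0 by simp_all
      have "inj_on (\<lambda>y. i1 (d 0 y)) (carrier (E 0))"
        using lin_inj_iff[OF k0 lm0 lmS] lin_inj_iff[OF d0 lm0 lmP] p1_zero 0 D(5) by simp
      then show ?thesis using 0 E'1(4) d'1(1) by simp
    next
      case (Suc j)
      then show ?thesis using D(5) E'1(5)[of 0] d'1(4)[of 0] by simp
    qed
    show "d' i ` carrier (E' i) = {y \<in> carrier (E' (Suc i)). d' (Suc i) y = \<zero>\<^bsub>E' (Suc (Suc i))\<^esub>}"
      if i: "i < n" for i
    proof -
      consider "Suc i < m" | "Suc i = m" | "i = m" | "i = Suc m" using i m by linarith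
      then show ?thesis
      proof cases
        case 1
        then show ?thesis using D(6)[OF i] E'1(5)[of i] E'1(5)[of "Suc i"] d'1(4) by simp
      next
        case 2
        then have "d i ` carrier (E i) = {y \<in> carrier (E m). d m y = \<zero>\<^bsub>?P\<^esub>}" using D(6)[OF i] by simp
        also have "\<dots> = {y \<in> carrier (E m). ?k y = \<zero>\<^bsub>S\<^esub>}" using p1_zero by blast
        finally show ?thesis using 2 E'1(5)[of i] E'1(1,4) d'1(4)[of i] d'1(1) by simp
      next
        case 3
        then show ?thesis using ker_h E'1 d'1 m by simp
      next
        case 4
        then show ?thesis using ker_q E'1 d'1 m by simp
      qed
    qed
    show "d' n ` carrier (E' n) = carrier (E' (Suc n))" using im_q E'1 d'1 by simp
  qed
  moreover have "projective_seq n E'"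
    unfolding projective_seq_def
  proof (intro allI impI)
    fix i assume i: "1 \<le> i \<and> i \<le> n"
    have "projective S"
      by (rule projective_biproduct[OF _ F(2) lmS S(2-5) ps])
        (use pr le in \<open>simp add: projective_seq_def\<close>)
    then show "projective (E' i)" using i pr by (simp add: E'_def projective_seq_def)
  qed
  moreover have "extends_to_next E' d' M a" if M: "obj M" "extends_to_next E d M a" for M a
  proof -
    obtain g where g: "lin (E 1) M g" "\<forall>x \<in> carrier (E 0). g (d 0 x) = a x"
      using M(2) unfolding extends_to_next_def by blast
    show ?thesis
    proof (cases m)
      case 0
      have "lin S M (\<lambda>s. g (p1 s))" using lin_comp[OF S(4)] g(1) 0 by simp
      moreover have "g (p1 (i1 (d 0 x))) = a x" if x: "x \<in> carrier (E 0)" for x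
        using g(2) p(1) lin_closed[OF dm] x 0 by simp
      ultimately show ?thesis
        unfolding extends_to_next_def using E'1(1,4) d'1(1) 0 by (intro exI[of _ "\<lambda>s. g (p1 s)"]) simp
    next
      case (Suc j)
      then show ?thesis using M(2) E'1(5)[of 0] d'1(4)[of 0] by (simp add: extends_to_next_def)
    qed
  qed
  ultimately show ?thesis by blast
qed

section \<open>Short exact sequences\<close>

definition short_exact ::
  "('r, 'u) module \<Rightarrow> ('r, 'u) module \<Rightarrow> ('r, 'u) module \<Rightarrow> ('u \<Rightarrow> 'u) \<Rightarrow> ('u \<Rightarrow> 'u) \<Rightarrow> bool" where
  "short_exact Y W X f g \<longleftrightarrow> obj Y \<and> obj W \<and> obj X \<and> lin Y W f \<and> lin W X g \<and> inj_on f (carrier Y) \<and>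
     f ` carrier Y = {w \<in> carrier W. g w = \<zero>\<^bsub>X\<^esub>} \<and> g ` carrier W = carrier X"

lemma exact_seq_1_iff:
  "exact_seq 1 X Y E d \<longleftrightarrow> E 0 = Y \<and> E 2 = X \<and> short_exact Y (E 1) X (d 0) (d 1)"
proof -
  have le: "(\<forall>i \<le> Suc (Suc 0). Q i) \<longleftrightarrow> Q 0 \<and> Q (Suc 0) \<and> Q (Suc (Suc 0))"
    "(\<forall>i \<le> Suc 0. Q i) \<longleftrightarrow> Q 0 \<and> Q (Suc 0)" for Q
    by (auto simp: le_Suc_eq)
  show ?thesis
    unfolding exact_seq_def short_exact_def by (auto simp: le numeral_2_eq_2)
qed

lemma short_exact_seq:
  "short_exact Y W X f g \<Longrightarrow>
    exact_seq 1 X Y (\<lambda>i. if i = 0 then Y else if i = 1 then W else X) (\<lambda>i. if i = 0 then f else g)"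
  unfolding exact_seq_1_iff by simp

definition splits :: "('r, 'u) module \<Rightarrow> ('r, 'u) module \<Rightarrow> ('u \<Rightarrow> 'u) \<Rightarrow> bool" where
  "splits W X g \<longleftrightarrow> (\<exists>s. lin X W s \<and> (\<forall>x \<in> carrier X. g (s x) = x))"

lemma splits_retraction:
  assumes "short_exact Y W X f g" "splits W X g"
  shows "\<exists>r. lin W Y r \<and> (\<forall>y \<in> carrier Y. r (f y) = y)"
proof -
  note s = assms(1)[unfolded short_exact_def]
  obtain s' where s': "lin X W s'" "\<forall>x \<in> carrier X. g (s' x) = x"
    using assms(2) unfolding splits_def by blast
  have lms: "lm Y" "lm W" "lm X" and f: "lin Y W f" and g: "lin W X g" and inj: "inj_on f (carrier Y)"
    and ker: "f ` carrier Y = {w \<in> carrier W. g w = \<zero>\<^bsub>X\<^esub>}" using s by auto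
  let ?h = "\<lambda>w. w \<oplus>\<^bsub>W\<^esub> \<ominus>\<^bsub>W\<^esub> s' (g w)"
  have sg: "lin W W (\<lambda>w. s' (g w))" by (rule lin_comp[OF g s'(1)])
  have h: "lin W W ?h" by (rule lin_minus[OF lms(2,2) lin_id sg])
  have "?h w \<in> f ` carrier Y" if w: "w \<in> carrier W" for w
  proof -
    have "g (s' (g w)) = g w" using s'(2) lin_closed[OF g w] by simp
    then have "g (?h w) = \<zero>\<^bsub>X\<^esub>" using lin_eq_diff[OF g lms(2,3) w lin_closed[OF sg w]] by simp
    then show ?thesis using ker lin_closed[OF h w] by simp
  qed
  then obtain r where r: "lin W Y r" "\<forall>w \<in> carrier W. f (r w) = ?h w"
    using lin_factor_inj[OF f inj h lms(1,2,2)] by blast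
  have "r (f y) = y" if y: "y \<in> carrier Y" for y
  proof (rule inj_onD[OF inj])
    have fy: "f y \<in> carrier W" "g (f y) = \<zero>\<^bsub>X\<^esub>" using ker y by auto
    then show "f (r (f y)) = f y" using r(2) lin_zero[OF s'(1) lms(3,2)] lms(2) by simp
    show "r (f y) \<in> carrier Y" by (rule lin_closed[OF r(1) fy(1)])
  qed (rule y)
  then show ?thesis using r(1) by blast
qed

lemma short_five:
  assumes s: "short_exact Y W X f g" "short_exact Y W' X f' g'" and p: "lin W W' p"
    and sq: "\<And>y. y \<in> carrier Y \<Longrightarrow> p (f y) = f' y" "\<And>w. w \<in> carrier W \<Longrightarrow> g' (p w) = g w"
  shows "inj_on p (carrier W)" "p ` carrier W = carrier W'"
proof -
  note s1 = s(1)[unfolded short_exact_def] and s2 = s(2)[unfolded short_exact_def]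
  have lms: "lm Y" "lm W" "lm X" "lm W'" and f: "lin Y W f" and g: "lin W X g" "lin W' X g'"
    and f': "lin Y W' f'" and inj: "inj_on f' (carrier Y)"
    and ker: "f ` carrier Y = {w \<in> carrier W. g w = \<zero>\<^bsub>X\<^esub>}"
    and ker': "f' ` carrier Y = {w \<in> carrier W'. g' w = \<zero>\<^bsub>X\<^esub>}"
    and sur: "g ` carrier W = carrier X" using s1 s2 by auto
  show "inj_on p (carrier W)"
    unfolding lin_inj_iff[OF p lms(2,4)]
  proof (intro ballI impI)
    fix w assume w: "w \<in> carrier W" "p w = \<zero>\<^bsub>W'\<^esub>"
    then have "g w = \<zero>\<^bsub>X\<^esub>" using sq(2)[OF w(1)] lin_zero[OF g(2) lms(4,3)] by simp
    then obtain y where y: "y \<in> carrier Y" "w = f y" using w ker by blast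
    then have "f' y = \<zero>\<^bsub>W'\<^esub>" using sq(1) w by simp
    then have "y = \<zero>\<^bsub>Y\<^esub>" using inj lin_inj_iff[OF f' lms(1,4)] y by blast
    then show "w = \<zero>\<^bsub>W\<^esub>" using y lin_zero[OF f lms(1,2)] by simp
  qed
  show "p ` carrier W = carrier W'"
  proof (intro equalityI subsetI)
    fix z assume "z \<in> p ` carrier W"
    then show "z \<in> carrier W'" using lin_closed[OF p] by blast
  next
    fix z assume z: "z \<in> carrier W'"
    have "g' z \<in> g ` carrier W" using lin_closed[OF g(2) z] sur by simp
    then obtain w where w: "w \<in> carrier W" "g w = g' z" by (metis imageE)
    have pw: "p w \<in> carrier W'" by (rule lin_closed[OF p w(1)])
    have "g' (z \<oplus>\<^bsub>W'\<^esub> \<ominus>\<^bsub>W'\<^esub> p w) = \<zero>\<^bsub>X\<^esub>"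
      using lin_eq_diff[OF g(2) lms(4,3) z pw] sq(2)[OF w(1)] w(2) by simp
    then have "z \<oplus>\<^bsub>W'\<^esub> \<ominus>\<^bsub>W'\<^esub> p w \<in> f' ` carrier Y" using ker' z pw lms by simp
    then obtain y where y: "y \<in> carrier Y" "z \<oplus>\<^bsub>W'\<^esub> \<ominus>\<^bsub>W'\<^esub> p w = f' y" by blast
    have "p (f y \<oplus>\<^bsub>W\<^esub> w) = f' y \<oplus>\<^bsub>W'\<^esub> p w"
      using lin_add[OF p lin_closed[OF f y(1)] w(1)] sq(1)[OF y(1)] by simp
    also have "\<dots> = z" using y(2)[symmetric] z pw lms by (simp add: mod_assoc)
    finally have "z = p (f y \<oplus>\<^bsub>W\<^esub> w)" by simp
    moreover have "f y \<oplus>\<^bsub>W\<^esub> w \<in> carrier W" using lin_closed[OF f y(1)] w(1) lms by simp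
    ultimately show "z \<in> p ` carrier W" by (rule image_eqI)
  qed
qed

lemma seq_morphism_1_iff:
  "seq_morphism 1 E d E' d' a b \<longleftrightarrow> (\<exists>p. lin (E 1) (E' 1) p \<and>
     lin (E 0) (E' 0) a \<and> lin (E 2) (E' 2) b \<and>
     (\<forall>x \<in> carrier (E 0). d' 0 (a x) = p (d 0 x)) \<and> (\<forall>x \<in> carrier (E 1). d' 1 (p x) = b (d 1 x)))"
  if e: "exact_seq 1 X Y E d"
proof
  note D = exact_seqD[OF e]
  assume "seq_morphism 1 E d E' d' a b"
  then obtain \<phi> where p: "\<And>i. i \<le> Suc 1 \<Longrightarrow> lin (E i) (E' i) (\<phi> i)"
     "\<And>x. x \<in> carrier (E 0) \<Longrightarrow> \<phi> 0 x = a x" "\<And>x. x \<in> carrier (E (Suc 1)) \<Longrightarrow> \<phi> (Suc 1) x = b x"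
     "\<And>i x. i \<le> 1 \<Longrightarrow> x \<in> carrier (E i) \<Longrightarrow> d' i (\<phi> i x) = \<phi> (Suc i) (d i x)"
    unfolding seq_morphism_def by blast
  have two: "(2::nat) = Suc 1" by simp
  have "lin (E 0) (E' 0) a" by (rule lin_cong[OF p(1)[of 0] D(8) p(2)]) simp_all
  moreover have "lin (E 2) (E' 2) b" unfolding two by (rule lin_cong[OF p(1)[of "Suc 1"] D(8) p(3)]) simp_all
  moreover have "\<forall>x \<in> carrier (E 0). d' 0 (a x) = \<phi> 1 (d 0 x)" using p(2) p(4)[of 0] by simp
  moreover have "\<forall>x \<in> carrier (E 1). d' 1 (\<phi> 1 x) = b (d 1 x)"
    using p(3) p(4)[of 1] D(9)[of 1] by simp
  moreover have "lin (E 1) (E' 1) (\<phi> 1)" using p(1) by simp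
  ultimately show "\<exists>p. lin (E 1) (E' 1) p \<and> lin (E 0) (E' 0) a \<and> lin (E 2) (E' 2) b \<and>
     (\<forall>x \<in> carrier (E 0). d' 0 (a x) = p (d 0 x)) \<and> (\<forall>x \<in> carrier (E 1). d' 1 (p x) = b (d 1 x))"
    by blast
next
  assume "\<exists>p. lin (E 1) (E' 1) p \<and> lin (E 0) (E' 0) a \<and> lin (E 2) (E' 2) b \<and>
     (\<forall>x \<in> carrier (E 0). d' 0 (a x) = p (d 0 x)) \<and> (\<forall>x \<in> carrier (E 1). d' 1 (p x) = b (d 1 x))"
  then obtain p where p: "lin (E 1) (E' 1) p" "lin (E 0) (E' 0) a" "lin (E 2) (E' 2) b"
     "\<forall>x \<in> carrier (E 0). d' 0 (a x) = p (d 0 x)" "\<forall>x \<in> carrier (E 1). d' 1 (p x) = b (d 1 x)" by blast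
  have "i = 0 \<or> i = 1 \<or> i = 2" if "i \<le> Suc 1" for i :: nat using that by linarith
  moreover have "i = 0 \<or> i = 1" if "i \<le> 1" for i :: nat using that by linarith
  ultimately show "seq_morphism 1 E d E' d' a b"
    unfolding seq_morphism_def using p
    by (intro exI[of _ "\<lambda>i. if i = 0 then a else if i = 1 then p else b"])
      (auto simp: numeral_2_eq_2)
qed

text \<open>
  In degree one morphisms over identities are isomorphisms, by the five lemma. So the middle term and the
  existence of a section are invariants of the Yoneda class.
\<close>

lemma Yoneda_rel_1_step:
  fixes X Y :: "('r, 'u) module"
  assumes \<xi>: "(A, \<alpha>) \<in> extensions (RMod R) 1 X Y" and \<eta>: "(B, \<beta>) \<in> extensions (RMod R) 1 X Y"
    and m: "ext_morphism (RMod R) 1 (A, \<alpha>) (B, \<beta>) (Idn (RMod R) Y) (Idn (RMod R) X)"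
  shows "\<exists>p. lin (A 1) (B 1) p \<and> inj_on p (carrier (A 1)) \<and> p ` carrier (A 1) = carrier (B 1) \<and>
    (\<forall>x \<in> carrier (A 1). \<beta> 1 (p x) = \<alpha> 1 x)"
proof -
  have eA: "exact_seq 1 X Y A \<alpha>" and eB: "exact_seq 1 X Y B \<beta>"
    using \<xi> \<eta> extensions_iff[of 1] by auto
  note A = eA[unfolded exact_seq_1_iff] and B = eB[unfolded exact_seq_1_iff]
  have "seq_morphism 1 A \<alpha> B \<beta> (Idn (RMod R) Y) (Idn (RMod R) X)"
    using m ext_morphism_iff[OF eA eB Idn_extensional Idn_extensional] by simp
  then have "seq_morphism 1 A \<alpha> B \<beta> (\<lambda>x. x) (\<lambda>x. x)"
    by (rule seq_morphism_cong(2)[OF eA eB]) (simp_all add: Idn_apply)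
  then obtain p where p: "lin (A 1) (B 1) p" "\<forall>x \<in> carrier (A 0). \<beta> 0 x = p (\<alpha> 0 x)"
    "\<forall>x \<in> carrier (A 1). \<beta> 1 (p x) = \<alpha> 1 x"
    unfolding seq_morphism_1_iff[OF eA] by blast
  have "inj_on p (carrier (A 1))" "p ` carrier (A 1) = carrier (B 1)"
    using short_five[of Y "A 1" X "\<alpha> 0" "\<alpha> 1" "B 1" "\<beta> 0" "\<beta> 1" p] A B p by simp_all
  then show ?thesis using p by blast
qed

lemma Yoneda_rel_1_middle:
  fixes X Y :: "('r, 'u) module"
  assumes "(\<xi>, \<eta>) \<in> Yoneda_rel (RMod R) 1 X Y"
  shows "iso_modules (fst \<xi> 1) (fst \<eta> 1)"
proof -
  have "iso_modules (fst \<xi> 1) (fst \<xi> 1) \<longleftrightarrow> iso_modules (fst \<xi> 1) (fst \<eta> 1)"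
  proof (rule Yoneda_rel_invariant[OF assms])
    fix \<alpha> \<beta>
    assume x: "\<alpha> \<in> extensions (RMod R) 1 X Y" and y: "\<beta> \<in> extensions (RMod R) 1 X Y"
      and m: "ext_morphism (RMod R) 1 \<alpha> \<beta> (Idn (RMod R) Y) (Idn (RMod R) X)"
    obtain A a B b where AB: "\<alpha> = (A, a)" "\<beta> = (B, b)" by (cases \<alpha>, cases \<beta>)
    obtain p where p: "lin (A 1) (B 1) p" "inj_on p (carrier (A 1))" "p ` carrier (A 1) = carrier (B 1)"
      using Yoneda_rel_1_step[OF x[unfolded AB] y[unfolded AB] m[unfolded AB]] by blast
    have "lm (A 1)" "lm (B 1)"
      using x y AB extensions_iff[of 1] by (auto simp: exact_seq_1_iff[unfolded One_nat_def] short_exact_def)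
    then have "iso_modules (A 1) (B 1)" by (rule iso_modulesI[OF p])
    then show "iso_modules (fst \<xi> 1) (fst \<alpha> 1) \<longleftrightarrow> iso_modules (fst \<xi> 1) (fst \<beta> 1)"
      using AB iso_modules_trans iso_modules_sym by (metis fst_conv)
  qed
  then show ?thesis using iso_modules_refl by blast
qed

lemma Yoneda_rel_1_splits:
  fixes X Y :: "('r, 'u) module"
  assumes "(\<xi>, \<eta>) \<in> Yoneda_rel (RMod R) 1 X Y"
  shows "splits (fst \<xi> 1) X (snd \<xi> 1) \<longleftrightarrow> splits (fst \<eta> 1) X (snd \<eta> 1)"
proof (rule Yoneda_rel_invariant[OF assms])
  fix \<alpha> \<beta>
  assume x: "\<alpha> \<in> extensions (RMod R) 1 X Y" and y: "\<beta> \<in> extensions (RMod R) 1 X Y"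
    and m: "ext_morphism (RMod R) 1 \<alpha> \<beta> (Idn (RMod R) Y) (Idn (RMod R) X)"
  obtain A a B b where AB: "\<alpha> = (A, a)" "\<beta> = (B, b)" by (cases \<alpha>, cases \<beta>)
  obtain p where p: "lin (A 1) (B 1) p" "inj_on p (carrier (A 1))" "p ` carrier (A 1) = carrier (B 1)"
    "\<forall>x \<in> carrier (A 1). b 1 (p x) = a 1 x"
    using Yoneda_rel_1_step[OF x[unfolded AB] y[unfolded AB] m[unfolded AB]] by blast
  have lms: "lm (A 1)" "lm (B 1)" "lm X"
    using x y AB extensions_iff[of 1] by (auto simp: exact_seq_1_iff[unfolded One_nat_def] short_exact_def)
  have "splits (A 1) X (a 1) \<longleftrightarrow> splits (B 1) X (b 1)"
  proof
    assume "splits (A 1) X (a 1)"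
    then obtain s where s: "lin X (A 1) s" "\<forall>x \<in> carrier X. a 1 (s x) = x" unfolding splits_def by blast
    then show "splits (B 1) X (b 1)"
      unfolding splits_def using lin_comp[OF s(1) p(1)] p(4) lin_closed[OF s(1)]
      by (intro exI[of _ "\<lambda>x. p (s x)"]) simp
  next
    assume "splits (B 1) X (b 1)"
    then obtain s where s: "lin X (B 1) s" "\<forall>x \<in> carrier X. b 1 (s x) = x" unfolding splits_def by blast
    have "s x \<in> p ` carrier (A 1)" if "x \<in> carrier X" for x using p(3) lin_closed[OF s(1) that] by simp
    then obtain t where t: "lin X (A 1) t" "\<forall>x \<in> carrier X. p (t x) = s x"
      using lin_factor_inj[OF p(1,2) s(1) lms(1,3,2)] by blast
    have "a 1 (t x) = x" if "x \<in> carrier X" for x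
      using p(4) t(2) s(2) lin_closed[OF t(1) that] that by metis
    then show "splits (A 1) X (a 1)" unfolding splits_def using t(1) by blast
  qed
  then show "splits (fst \<alpha> 1) X (snd \<alpha> 1) \<longleftrightarrow> splits (fst \<beta> 1) X (snd \<beta> 1)" using AB by simp
qed

text \<open>
  The class of an extension being that of zero, it contains some \<open>\<zeta>\<close> that receives a morphism over the zero
  map of \<open>M\<close>. The middle component kills \<open>M\<close>, so it descends to a section of \<open>\<zeta>\<close>.
\<close>

lemma Ext_vanishes_1D:
  fixes X M :: "('r, 'u) module"
  assumes v: "Ext_vanishes (RMod R) 1 X M"
  shows "\<exists>W f g. short_exact M W X f g" "\<And>W f g. short_exact M W X f g \<Longrightarrow> splits W X g"
proof -
  let ?C = "RMod R"
  let ?Z = "{\<zeta> \<in> extensions ?C 1 X M.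
        \<exists>\<omega> \<in> extensions ?C 1 X M. ext_morphism ?C 1 \<omega> \<zeta> (HZero ?C M M) (Idn ?C X)}"
  have q: "extensions ?C 1 X M // Yoneda_rel ?C 1 X M = {Yoneda_rel ?C 1 X M `` ?Z}"
    using v by (simp add: Ext_vanishes_def Ext_def)
  have "extensions ?C 1 X M \<noteq> {}" using q by (auto simp: quotient_def)
  then obtain A a where Aa: "(A, a) \<in> extensions ?C 1 X M" by fastforce
  then have "exact_seq 1 X M A a" using extensions_iff[of 1] by blast
  then show "\<exists>W f g. short_exact M W X f g" unfolding exact_seq_1_iff by blast
  fix W f g assume se: "short_exact M W X f g"
  let ?E = "\<lambda>i :: nat. if i = 0 then M else if i = 1 then W else X"
  let ?d = "\<lambda>i :: nat. if i = 0 then f else g"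
  have e: "exact_seq 1 X M ?E ?d" by (rule short_exact_seq[OF se])
  let ?\<xi> = "(?E, restrict_maps ?E ?d)"
  have \<xi>: "?\<xi> \<in> extensions ?C 1 X M" by (rule restrict_extension[OF e order_refl])
  have lms: "lm X" "lm M" "lm W" using se by (auto simp: short_exact_def)
  have "(?\<xi>, ?\<xi>) \<in> Yoneda_rel ?C 1 X M" by (rule Yoneda_rel_refl[OF \<xi> order_refl])
  moreover have "Yoneda_rel ?C 1 X M `` {?\<xi>} \<in> extensions ?C 1 X M // Yoneda_rel ?C 1 X M"
    by (rule quotientI[OF \<xi>])
  then have "Yoneda_rel ?C 1 X M `` {?\<xi>} = Yoneda_rel ?C 1 X M `` ?Z" unfolding q by simp
  ultimately obtain \<zeta> where \<zeta>: "\<zeta> \<in> ?Z" "(\<zeta>, ?\<xi>) \<in> Yoneda_rel ?C 1 X M" by blast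
  then obtain \<omega> where \<omega>: "\<omega> \<in> extensions ?C 1 X M" "\<zeta> \<in> extensions ?C 1 X M"
    "ext_morphism ?C 1 \<omega> \<zeta> (HZero ?C M M) (Idn ?C X)" by blast
  obtain A a B b where AB: "\<omega> = (A, a)" "\<zeta> = (B, b)" by (cases \<omega>, cases \<zeta>)
  have eA: "exact_seq 1 X M A a" and eB: "exact_seq 1 X M B b"
    using \<omega> AB extensions_iff[of 1] by auto
  obtain p where p: "lin (A 1) (B 1) p" "\<forall>x \<in> carrier (A 0). b 0 (HZero ?C M M x) = p (a 0 x)"
    "\<forall>x \<in> carrier (A 1). b 1 (p x) = Idn ?C X (a 1 x)"
    using \<omega>(3) unfolding AB ext_morphism_iff[OF eA eB HZero_extensional Idn_extensional]
      seq_morphism_1_iff[OF eA] by blast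
  have A: "A 0 = M" "short_exact M (A 1) X (a 0) (a 1)" and B: "short_exact M (B 1) X (b 0) (b 1)"
    using eA eB unfolding exact_seq_1_iff by auto
  have lmAB: "lm (A 1)" "lm (B 1)" "lin (A 1) X (a 1)" "lin M (B 1) (b 0)"
    "a 1 ` carrier (A 1) = carrier X"
    "a 0 ` carrier M = {w \<in> carrier (A 1). a 1 w = \<zero>\<^bsub>X\<^esub>}"
    using A(2) B by (auto simp: short_exact_def)
  have "p w = \<zero>\<^bsub>B 1\<^esub>" if w: "w \<in> carrier (A 1)" "a 1 w = \<zero>\<^bsub>X\<^esub>" for w
  proof -
    have "w \<in> a 0 ` carrier M" using w lmAB(6) by simp
    then obtain y where "y \<in> carrier M" "w = a 0 y" by blast
    then show ?thesis
      using p(2) A(1) lin_zero[OF lmAB(4) lms(2) lmAB(2)] by (simp add: HZero_apply)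
  qed
  then obtain s where s: "lin X (B 1) s" "\<forall>w \<in> carrier (A 1). s (a 1 w) = p w"
    using lin_factor_surj[OF lmAB(3,5) p(1) lmAB(1) lms(1) lmAB(2)] by blast
  have "b 1 (s x) = x" if x: "x \<in> carrier X" for x
  proof -
    have "x \<in> a 1 ` carrier (A 1)" using x lmAB(5) by simp
    then obtain w where "w \<in> carrier (A 1)" "x = a 1 w" by blast
    then show ?thesis using s(2) p(3) x by (simp add: Idn_apply)
  qed
  then have "splits (fst \<zeta> 1) X (snd \<zeta> 1)" unfolding splits_def AB using s(1) by auto
  then have "splits (fst ?\<xi> 1) X (snd ?\<xi> 1)" using Yoneda_rel_1_splits[OF \<zeta>(2)] by blast
  then obtain s' where s': "lin X W s'" "\<forall>x \<in> carrier X. restrict g (carrier W) (s' x) = x"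
    unfolding splits_def by auto
  then have "g (s' x) = x" if "x \<in> carrier X" for x
    using that lin_closed[OF s'(1) that] by (metis restrict_apply')
  then show "splits W X g" unfolding splits_def using s'(1) by blast
qed

end

section \<open>Perpendicular subcategories of modules\<close>

context module_universe begin

lemma Ext_vanishes_0_iff:
  assumes E: "obj E" and M: "obj M"
  shows "Ext_vanishes (RMod R) 0 E M \<longleftrightarrow> (\<forall>h. lin E M h \<longrightarrow> (\<forall>x \<in> carrier E. h x = \<zero>\<^bsub>M\<^esub>))"
proof
  assume v: "Ext_vanishes (RMod R) 0 E M"
  show "\<forall>h. lin E M h \<longrightarrow> (\<forall>x \<in> carrier E. h x = \<zero>\<^bsub>M\<^esub>)"
  proof (intro allI impI ballI)
    fix h x assume h: "lin E M h" and x: "x \<in> carrier E"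
    have "restrict h (carrier E) \<in> Hom (RMod R) E M" by (rule restrict_Hom[OF h obj_lm[OF E]])
    then have "restrict h (carrier E) = HZero (RMod R) E M" using v by (simp add: Ext_vanishes_def)
    from fun_cong[OF this, of x] show "h x = \<zero>\<^bsub>M\<^esub>" using x by (simp add: HZero_apply)
  qed
next
  assume z: "\<forall>h. lin E M h \<longrightarrow> (\<forall>x \<in> carrier E. h x = \<zero>\<^bsub>M\<^esub>)"
  have "Hom (RMod R) E M = {HZero (RMod R) E M}"
  proof (intro equalityI subsetI)
    fix f assume f: "f \<in> Hom (RMod R) E M"
    then have "f = HZero (RMod R) E M" using z HZero_eq_iff[of f E M] by (simp add: Hom_iff)
    then show "f \<in> {HZero (RMod R) E M}" by simp
  next
    fix f assume "f \<in> {HZero (RMod R) E M}"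
    then show "f \<in> Hom (RMod R) E M" using HZero_Hom[OF obj_lm[OF E] obj_lm[OF M]] by simp
  qed
  then show "Ext_vanishes (RMod R) 0 E M" by (simp add: Ext_vanishes_def)
qed

lemma closed_under_extensions_iff:
  assumes S: "S \<subseteq> Ob (RMod R)"
  shows "closed_under_extensions (RMod R) S \<longleftrightarrow>
    (\<forall>X \<in> S. \<forall>Z \<in> S. \<forall>W f g. short_exact X W Z f g \<longrightarrow> W \<in> S)"
proof
  assume c: "closed_under_extensions (RMod R) S"
  show "\<forall>X \<in> S. \<forall>Z \<in> S. \<forall>W f g. short_exact X W Z f g \<longrightarrow> W \<in> S"
  proof (intro ballI allI impI)
    fix X Z W f g assume X: "X \<in> S" "Z \<in> S" and s: "short_exact X W Z f g"
    note s' = s[unfolded short_exact_def]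
    have o: "obj X" "obj W" "obj Z" using s' by auto
    let ?f = "restrict f (carrier X)" and ?g = "restrict g (carrier W)"
    have f: "?f \<in> Hom (RMod R) X W" and g: "?g \<in> Hom (RMod R) W Z"
      using s' by (auto intro: restrict_Hom)
    have "inj_on ?f (carrier X)" using s' by (simp add: inj_on_def)
    then have "is_mono (RMod R) X W ?f" using is_mono_iff[OF o(1,2)] f by blast
    moreover have "is_epi (RMod R) W Z ?g" using is_epi_iff[OF o(2,3)] g s' by simp
    moreover have "?f ` carrier X = {w \<in> carrier W. ?g w = \<zero>\<^bsub>Z\<^esub>}" using s' by auto
    then have "exact_at (RMod R) X W Z ?f ?g" using exact_at_iff[OF o] f g by blast
    ultimately show "W \<in> S" using c X o(2) unfolding closed_under_extensions_def by blast
  qed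
next
  assume c: "\<forall>X \<in> S. \<forall>Z \<in> S. \<forall>W f g. short_exact X W Z f g \<longrightarrow> W \<in> S"
  show "closed_under_extensions (RMod R) S"
    unfolding closed_under_extensions_def
  proof (intro ballI allI impI)
    fix X Z W f g assume X: "X \<in> S" "Z \<in> S" and W: "obj W"
      and s: "is_mono (RMod R) X W f \<and> exact_at (RMod R) X W Z f g \<and> is_epi (RMod R) W Z g"
    have o: "obj X" "obj Z" using X S by blast+
    have "short_exact X W Z f g"
      unfolding short_exact_def
      using s o W is_mono_iff[OF o(1) W, of f] exact_at_iff[OF o(1) W o(2), of f g]
        is_epi_iff[OF W o(2), of g] by (simp add: Hom_lin)
    then show "W \<in> S" using c X by blast
  qed
qed

text \<open>The middle component is the section composed with the projection of \<open>E\<close>; it kills \<open>Y\<close>.\<close>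

lemma splits_seq_morphism:
  assumes e: "exact_seq 1 X Y E d" and e': "exact_seq 1 X M E' d'" and s: "splits (E' 1) X (d' 1)"
  shows "seq_morphism 1 E d E' d' (\<lambda>x. \<zero>\<^bsub>M\<^esub>) (\<lambda>x. x)"
proof -
  note e1 = e[unfolded exact_seq_1_iff short_exact_def] and e1' = e'[unfolded exact_seq_1_iff short_exact_def]
  have E: "E 0 = Y" "E 2 = X" "lin (E 1) X (d 1)" "lm X" "lm M"
    "d 0 ` carrier Y = {w \<in> carrier (E 1). d 1 w = \<zero>\<^bsub>X\<^esub>}" using e1 e1' by auto
  have E': "E' 0 = M" "E' 2 = X" "lin M (E' 1) (d' 0)" "lm (E' 1)" using e1' by auto
  obtain t where t: "lin X (E' 1) t" "\<forall>x \<in> carrier X. d' 1 (t x) = x"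
    using s unfolding splits_def by blast
  show ?thesis
    unfolding seq_morphism_1_iff[OF e]
  proof (intro exI[of _ "\<lambda>x. t (d 1 x)"] conjI ballI)
    show "lin (E 1) (E' 1) (\<lambda>x. t (d 1 x))" by (rule lin_comp[OF E(3) t(1)])
    show "lin (E 0) (E' 0) (\<lambda>x. \<zero>\<^bsub>M\<^esub>)" unfolding E'(1) by (rule lin_zero_map[OF E(5)])
    show "lin (E 2) (E' 2) (\<lambda>x. x)" unfolding E(2) E'(2) by (rule lin_id)
    show "d' 1 (t (d 1 x)) = d 1 x" if "x \<in> carrier (E 1)" for x
      using t(2) lin_closed[OF E(3) that] by blast
    show "d' 0 \<zero>\<^bsub>M\<^esub> = t (d 1 (d 0 x))" if "x \<in> carrier (E 0)" for x
    proof -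
      have "d 1 (d 0 x) = \<zero>\<^bsub>X\<^esub>" using E(1,6) that by blast
      then show ?thesis using lin_zero[OF t(1) E(4) E'(4)] lin_zero[OF E'(3) E(5) E'(4)] by simp
    qed
  qed
qed

lemma Ext_vanishes_1I:
  assumes ex: "short_exact Y W X f g" and M: "obj M"
    and sp: "\<And>W f g. short_exact M W X f g \<Longrightarrow> splits W X g"
  shows "Ext_vanishes (RMod R) 1 X M"
proof (rule Ext_vanishesI[OF short_exact_seq[OF ex] order_refl M])
  fix E' d' assume e': "exact_seq 1 X M E' d'"
  then have "splits (E' 1) X (d' 1)" unfolding exact_seq_1_iff using sp by blast
  then show "seq_morphism 1 (\<lambda>i. if i = 0 then Y else if i = 1 then W else X)
      (\<lambda>i. if i = 0 then f else g) E' d' (\<lambda>x. \<zero>\<^bsub>M\<^esub>) (\<lambda>x. x)"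
    by (rule splits_seq_morphism[OF short_exact_seq[OF ex] e'])
qed

text \<open>Push an extension forward along \<open>a\<close> and use a retraction onto \<open>M\<close>.\<close>

lemma extend_if_splits:
  assumes ex: "short_exact Y W X f g" and M: "obj M" and a: "lin Y M a"
    and sp: "\<And>W f g. short_exact M W X f g \<Longrightarrow> splits W X g"
  shows "\<exists>h. lin W M h \<and> (\<forall>y \<in> carrier Y. h (f y) = a y)"
proof -
  let ?E = "\<lambda>i :: nat. if i = 0 then Y else if i = 1 then W else X"
  let ?d = "\<lambda>i :: nat. if i = 0 then f else g"
  have e: "exact_seq 1 X Y ?E ?d" by (rule short_exact_seq[OF ex])
  obtain E' d' where E': "exact_seq 1 X M E' d'" "seq_morphism 1 ?E ?d E' d' a (\<lambda>x. x)"
    using ex_pushforward[OF e order_refl M a] by blast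
  have s: "short_exact M (E' 1) X (d' 0) (d' 1)" using E'(1) unfolding exact_seq_1_iff by blast
  obtain r where r: "lin (E' 1) M r" "\<forall>y \<in> carrier M. r (d' 0 y) = y"
    using splits_retraction[OF s sp[OF s]] by blast
  obtain p where p: "lin W (E' 1) p" "\<forall>x \<in> carrier Y. d' 0 (a x) = p (f x)"
    using E'(2) unfolding seq_morphism_1_iff[OF e] by auto
  have "r (p (f y)) = a y" if y: "y \<in> carrier Y" for y
  proof -
    have "r (p (f y)) = r (d' 0 (a y))" using p(2) y by simp
    then show ?thesis using r(2) lin_closed[OF a y] by simp
  qed
  then show ?thesis using lin_comp[OF p(1) r(1)] by blast
qed

text \<open>
  This is the exactness of \<open>Ext^1 (E, X) \<rightarrow> Ext^1 (E, W) \<rightarrow> Ext^1 (E, Z)\<close>. For an extension \<open>N\<close> of \<open>E\<close> by \<open>W\<close>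
  the map \<open>g\<close> extends to \<open>\<rho> : N \<rightarrow> Z\<close>; the kernel of \<open>\<rho>\<close> is an extension of \<open>E\<close> by \<open>X\<close>, and its section is one of \<open>N\<close>.
\<close>

lemma right_perp1_closed_under_extensions:
  fixes S \<E> :: "('r, 'u) module set"
  assumes perp: "right_perp1 (RMod R) S \<E>"
  shows "closed_under_extensions (RMod R) S"
proof -
  have oE: "\<And>E. E \<in> \<E> \<Longrightarrow> obj E"
    and SE: "S = {B. obj B \<and> (\<forall>E \<in> \<E>. Ext_vanishes (RMod R) 0 E B \<and> Ext_vanishes (RMod R) 1 E B)}"
    using perp by (auto simp: right_perp1_def)
  have S: "S \<subseteq> Ob (RMod R)" using SE by blast
  show ?thesis
    unfolding closed_under_extensions_iff[OF S]
  proof (intro ballI allI impI)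
    fix X Z W f g
    assume X: "X \<in> S" and Z: "Z \<in> S" and s: "short_exact X W Z f g"
    have o: "obj X" "obj W" "obj Z" and f: "lin X W f" and g: "lin W Z g" and inj: "inj_on f (carrier X)"
      and ker: "f ` carrier X = {w \<in> carrier W. g w = \<zero>\<^bsub>Z\<^esub>}" and sur: "g ` carrier W = carrier Z"
      using s by (auto simp: short_exact_def)
    have lms: "lm X" "lm W" "lm Z" using o by simp_all
    have "Ext_vanishes (RMod R) 0 E W \<and> Ext_vanishes (RMod R) 1 E W" if E: "E \<in> \<E>" for E
    proof
      have oE': "obj E" and lmE: "lm E" using oE[OF E] by simp_all
      have v: "Ext_vanishes (RMod R) 0 E X" "Ext_vanishes (RMod R) 1 E X"
        "Ext_vanishes (RMod R) 0 E Z" "Ext_vanishes (RMod R) 1 E Z" using X Z E SE by blast+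
      show "Ext_vanishes (RMod R) 0 E W"
        unfolding Ext_vanishes_0_iff[OF oE' o(2)]
      proof (intro allI impI ballI)
        fix h x assume h: "lin E W h" and x: "x \<in> carrier E"
        have gh: "g (h y) = \<zero>\<^bsub>Z\<^esub>" if "y \<in> carrier E" for y
          using v(3) lin_comp[OF h g] that unfolding Ext_vanishes_0_iff[OF oE' o(3)] by blast
        have "h y \<in> f ` carrier X" if y: "y \<in> carrier E" for y
          using gh[OF y] lin_closed[OF h y] ker by simp
        then obtain k where k: "lin E X k" "\<forall>y \<in> carrier E. f (k y) = h y"
          using lin_factor_inj[OF f inj h lms(1) lmE lms(2)] by blast
        have "k x = \<zero>\<^bsub>X\<^esub>" using v(1) k(1) x unfolding Ext_vanishes_0_iff[OF oE' o(1)] by blast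
        then show "h x = \<zero>\<^bsub>W\<^esub>" using k(2) x lin_zero[OF f lms(1,2)] by (metis)
      qed
      obtain V f0 g0 where V: "short_exact X V E f0 g0" using Ext_vanishes_1D(1)[OF v(2)] by blast
      show "Ext_vanishes (RMod R) 1 E W"
      proof (rule Ext_vanishes_1I[OF V o(2)])
        fix N u w assume N: "short_exact W N E u w"
        have oN: "obj N" and u: "lin W N u" and w: "lin N E w" and uinj: "inj_on u (carrier W)"
          and uker: "u ` carrier W = {n \<in> carrier N. w n = \<zero>\<^bsub>E\<^esub>}" and wsur: "w ` carrier N = carrier E"
          using N by (auto simp: short_exact_def)
        have lmN: "lm N" using oN by simp
        obtain \<rho> where \<rho>: "lin N Z \<rho>" "\<forall>y \<in> carrier W. \<rho> (u y) = g y"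
          using extend_if_splits[OF N o(3) g] Ext_vanishes_1D(2)[OF v(4)] by blast
        let ?k = "{n \<in> carrier N. \<rho> n = \<zero>\<^bsub>Z\<^esub>}"
        have k: "submod N ?k" by (rule submod_kernel[OF \<rho>(1) lmN lms(3)])
        let ?K = "restr N ?k"
        have oK: "obj ?K" by (rule obj_restr[OF oN k])
        have iK: "lin ?K N (\<lambda>x. x)" by (rule submod_module(2)[OF lmN k])
        have uf: "lin X N (\<lambda>x. u (f x))" by (rule lin_comp[OF f u])
        have ufk: "u (f x) \<in> ?k" if x: "x \<in> carrier X" for x
        proof -
          have "f x \<in> carrier W" "g (f x) = \<zero>\<^bsub>Z\<^esub>" using ker x by auto
          then show ?thesis using \<rho>(2) lin_closed[OF u] by simp
        qed
        have "short_exact X ?K E (\<lambda>x. u (f x)) w"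
          unfolding short_exact_def
        proof (intro conjI o(1) oK oE')
          show "lin X ?K (\<lambda>x. u (f x))" using uf ufk lin_into_submod[of ?k N X] by simp
          show "lin ?K E w" by (rule lin_comp[OF iK w])
          show "inj_on (\<lambda>x. u (f x)) (carrier X)"
          proof (rule inj_onI)
            fix x y assume xy: "x \<in> carrier X" "y \<in> carrier X" "u (f x) = u (f y)"
            have "f x = f y" by (rule inj_onD[OF uinj xy(3) lin_closed[OF f xy(1)] lin_closed[OF f xy(2)]])
            then show "x = y" by (rule inj_onD[OF inj]) (use xy in simp_all)
          qed
          show "(\<lambda>x. u (f x)) ` carrier X = {n \<in> carrier ?K. w n = \<zero>\<^bsub>E\<^esub>}"
          proof (intro equalityI subsetI)
            fix n assume "n \<in> (\<lambda>x. u (f x)) ` carrier X"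
            then obtain x where x: "x \<in> carrier X" "n = u (f x)" by blast
            have "u (f x) \<in> u ` carrier W" using lin_closed[OF f x(1)] by blast
            then have "w (u (f x)) = \<zero>\<^bsub>E\<^esub>" using uker by simp
            then show "n \<in> {n \<in> carrier ?K. w n = \<zero>\<^bsub>E\<^esub>}" using x ufk by simp
          next
            fix n assume "n \<in> {n \<in> carrier ?K. w n = \<zero>\<^bsub>E\<^esub>}"
            then have n: "n \<in> carrier N" "\<rho> n = \<zero>\<^bsub>Z\<^esub>" "w n = \<zero>\<^bsub>E\<^esub>" by auto
            then have "n \<in> u ` carrier W" using uker by simp
            then obtain y where y: "y \<in> carrier W" "n = u y" by blast
            then have "g y = \<zero>\<^bsub>Z\<^esub>" using \<rho>(2) n(2) by simp
            then have "y \<in> f ` carrier X" using ker y(1) by simp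
            then show "n \<in> (\<lambda>x. u (f x)) ` carrier X" using y(2) by blast
          qed
          show "w ` carrier ?K = carrier E"
          proof (intro equalityI subsetI)
            fix e assume "e \<in> w ` carrier ?K"
            then show "e \<in> carrier E" using lin_closed[OF w] by auto
          next
            fix e assume "e \<in> carrier E"
            then have "e \<in> w ` carrier N" using wsur by simp
            then obtain n where n: "n \<in> carrier N" "e = w n" by blast
            have "\<rho> n \<in> g ` carrier W" using sur lin_closed[OF \<rho>(1) n(1)] by simp
            then obtain y where y: "y \<in> carrier W" "\<rho> n = g y" by blast
            have uy: "u y \<in> carrier N" by (rule lin_closed[OF u y(1)])
            \<comment> \<open>A preimage of \<open>e\<close> is corrected by an element of \<open>W\<close> to lie in the kernel of \<open>\<rho>\<close>.\<close>
            let ?n = "n \<oplus>\<^bsub>N\<^esub> \<ominus>\<^bsub>N\<^esub> u y"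
            have "\<rho> ?n = \<zero>\<^bsub>Z\<^esub>" using lin_eq_diff[OF \<rho>(1) lmN lms(3) n(1) uy] \<rho>(2) y by simp
            moreover have "w (u y) = \<zero>\<^bsub>E\<^esub>" using uker y(1) by blast
            then have "w ?n = e" using n uy lmN lmE lin_closed[OF w n(1)] by (simp add: lin_add[OF w] lin_neg[OF w])
            ultimately show "e \<in> w ` carrier ?K" using n(1) uy lmN by (intro image_eqI[of _ _ ?n]) simp_all
          qed
        qed
        then have "splits ?K E w" by (rule Ext_vanishes_1D(2)[OF v(2)])
        then obtain t where t: "lin E ?K t" "\<forall>x \<in> carrier E. w (t x) = x" unfolding splits_def by blast
        show "splits N E w" unfolding splits_def using lin_comp[OF t(1) iK] t(2) by blast
      qed
    qed
    then show "W \<in> S" using SE o(2) by blast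
  qed
qed

section \<open>The cokernel of the comparison map from a free module\<close>

text \<open>
  Being free towards \<open>M\<close> on \<open>c\<close> means for \<open>T\<close> that \<open>f\<close> induces a bijection \<open>Hom (T, M) \<rightarrow> Hom (F, M)\<close>. The exact
  sequence \<open>0 \<rightarrow> Hom (C, M) \<rightarrow> Hom (T, M) \<rightarrow> Hom (F, M) \<rightarrow> Ext^1 (C, M)\<close> relates this to \<open>C\<close>.
\<close>

context
  fixes F T C :: "('r, 'u) module" and e c :: "'i \<Rightarrow> 'u" and X :: "'i set" and f q :: "'u \<Rightarrow> 'u"
  assumes free: "\<And>M :: ('r, 'u) module. lm M \<Longrightarrow> free_towards R F e X M"
    and e_in: "\<forall>x \<in> X. e x \<in> carrier F" and c_def: "\<forall>x \<in> X. f (e x) = c x"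
    and seq: "short_exact F T C f q"
begin

lemma cokernel_facts:
  "obj F" "obj T" "obj C" "lm F" "lm T" "lm C" "lin F T f" "lin T C q" "inj_on f (carrier F)"
  "f ` carrier F = {t \<in> carrier T. q t = \<zero>\<^bsub>C\<^esub>}" "q ` carrier T = carrier C"
  "\<And>x. x \<in> carrier F \<Longrightarrow> q (f x) = \<zero>\<^bsub>C\<^esub>" "\<And>x. x \<in> X \<Longrightarrow> c x \<in> carrier T"
proof -
  note s = seq[unfolded short_exact_def]
  show "obj F" "obj T" "obj C" "lm F" "lm T" "lm C" "lin F T f" "lin T C q" "inj_on f (carrier F)"
    "f ` carrier F = {t \<in> carrier T. q t = \<zero>\<^bsub>C\<^esub>}" "q ` carrier T = carrier C" using s by auto
  then show "\<And>x. x \<in> carrier F \<Longrightarrow> q (f x) = \<zero>\<^bsub>C\<^esub>" by blast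
  show "c x \<in> carrier T" if "x \<in> X" for x
    using lin_closed[of F T f "e x"] s e_in c_def that by metis
qed

lemma free_towards_if_perp:
  assumes M: "obj M" and v0: "Ext_vanishes (RMod R) 0 C M" and v1: "Ext_vanishes (RMod R) 1 C M"
  shows "free_towards R T c X M"
  unfolding free_towards_def
proof (intro conjI allI impI)
  note cf = cokernel_facts
  have lmM: "lm M" using M by simp
  fix m assume "\<forall>x \<in> X. m x \<in> carrier M"
  then obtain a where a: "lin F M a" "\<forall>x \<in> X. a (e x) = m x"
    using free_towards_ex[OF free[OF lmM], of m] by blast
  obtain h where h: "lin T M h" "\<forall>y \<in> carrier F. h (f y) = a y"
    using extend_if_splits[OF seq M a(1)] Ext_vanishes_1D(2)[OF v1] by blast
  have "\<forall>x\<in>X. h (c x) = m x"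
  proof
    fix x assume x: "x \<in> X"
    then have "h (f (e x)) = m x" using h(2) a(2) e_in by simp
    then show "h (c x) = m x" using c_def x by simp
  qed
  then show "\<exists>g. lin T M g \<and> (\<forall>x \<in> X. g (c x) = m x)" using h(1) by blast
next
  note cf = cokernel_facts
  have lmM: "lm M" using M by simp
  fix g h assume gh: "lin T M g \<and> lin T M h \<and> (\<forall>x \<in> X. g (c x) = h (c x))"
  have gl: "lin T M g" and hl: "lin T M h" using gh by auto
  have eq: "g (f y) = h (f y)" if y: "y \<in> carrier F" for y
    by (rule free_towards_unique[OF free[OF lmM] lin_comp[OF cf(7) gl] lin_comp[OF cf(7) hl] _ y])
      (use gh c_def in simp)
  let ?k = "\<lambda>t. g t \<oplus>\<^bsub>M\<^esub> \<ominus>\<^bsub>M\<^esub> h t"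
  have k: "lin T M ?k" by (rule lin_minus[OF cf(5) lmM gl hl])
  have "?k t = \<zero>\<^bsub>M\<^esub>" if t: "t \<in> carrier T" "q t = \<zero>\<^bsub>C\<^esub>" for t
  proof -
    have "t \<in> f ` carrier F" using t cf(10) by simp
    then obtain y where "y \<in> carrier F" "t = f y" by blast
    then show ?thesis using eq lin_closed[OF hl t(1)] lmM by simp
  qed
  then obtain l where l: "lin C M l" "\<forall>t \<in> carrier T. l (q t) = ?k t"
    using lin_factor_surj[OF cf(8,11) k cf(5,6) lmM] by blast
  show "\<forall>t \<in> carrier T. g t = h t"
  proof
    fix t assume t: "t \<in> carrier T"
    have "l (q t) = \<zero>\<^bsub>M\<^esub>"
      using v0 l(1) lin_closed[OF cf(8) t] unfolding Ext_vanishes_0_iff[OF cf(3) M] by blast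
    then have "?k t = \<zero>\<^bsub>M\<^esub>" using l(2) t by simp
    then show "g t = h t" using mod_eq_iff_diff[OF lmM lin_closed[OF gl t] lin_closed[OF hl t]] by simp
  qed
qed

lemma Ext_vanishes_0_if_free_towards:
  assumes M: "obj M" and ft: "free_towards R T c X M"
  shows "Ext_vanishes (RMod R) 0 C M"
  unfolding Ext_vanishes_0_iff[OF cokernel_facts(3) M]
proof (intro allI impI ballI)
  note cf = cokernel_facts
  have lmM: "lm M" using M by simp
  fix h z assume h: "lin C M h" and z: "z \<in> carrier C"
  have "z \<in> q ` carrier T" using z cf(11) by simp
  then obtain t where t: "t \<in> carrier T" "z = q t" by blast
  have "h (q t) = \<zero>\<^bsub>M\<^esub>"
  proof (rule free_towards_unique[OF ft lin_comp[OF cf(8) h] lin_zero_map[OF lmM] _ t(1)])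
    fix x assume x: "x \<in> X"
    have "q (c x) = \<zero>\<^bsub>C\<^esub>" using cf(12)[of "e x"] e_in c_def x by simp
    then show "h (q (c x)) = \<zero>\<^bsub>M\<^esub>" using lin_zero[OF h cf(6) lmM] by simp
  qed
  then show "h z = \<zero>\<^bsub>M\<^esub>" using t(2) by simp
qed

text \<open>
  Pull an extension of \<open>C\<close> by \<open>M\<close> back to one of \<open>T\<close> by \<open>M\<close>. Its middle term \<open>V\<close> lies in \<open>S\<close>, so the
  obvious lift of the family \<open>c\<close> to \<open>V\<close> extends to a section over \<open>T\<close> that kills \<open>F\<close>, hence descends to \<open>C\<close>.
\<close>

lemma Ext_vanishes_1_if_closed:
  assumes S: "S \<subseteq> Ob (RMod R)" and cl: "closed_under_extensions (RMod R) S"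
    and ft: "\<And>N. N \<in> S \<Longrightarrow> free_towards R T c X N" and TS: "T \<in> S" and M: "M \<in> S"
  shows "Ext_vanishes (RMod R) 1 C M"
proof (rule Ext_vanishes_1I[OF seq])
  note cf = cokernel_facts
  show oM: "obj M" using S M by blast
  have lmM: "lm M" using oM by simp
  fix W u w assume s: "short_exact M W C u w"
  have oW: "obj W" and u: "lin M W u" and w: "lin W C w" and uinj: "inj_on u (carrier M)"
    and uker: "u ` carrier M = {x \<in> carrier W. w x = \<zero>\<^bsub>C\<^esub>}" and wsur: "w ` carrier W = carrier C"
    using s by (auto simp: short_exact_def)
  have lmW: "lm W" using oW by simp
  obtain P i1 i2 p1 p2 where P: "obj P" "lin W P i1" "lin T P i2" "lin P W p1" "lin P T p2"
    and p: "\<forall>x \<in> carrier W. p1 (i1 x) = x \<and> p2 (i1 x) = \<zero>\<^bsub>T\<^esub>"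
      "\<forall>y \<in> carrier T. p1 (i2 y) = \<zero>\<^bsub>W\<^esub> \<and> p2 (i2 y) = y"
      and ps: "\<forall>s \<in> carrier P. i1 (p1 s) \<oplus>\<^bsub>P\<^esub> i2 (p2 s) = s"
    using ex_biproduct[OF oW cf(2)] by blast
  have lmP: "lm P" using P(1) by simp
  let ?k = "\<lambda>s. w (p1 s) \<oplus>\<^bsub>C\<^esub> \<ominus>\<^bsub>C\<^esub> q (p2 s)"
  have k: "lin P C ?k" by (rule lin_minus[OF lmP cf(6) lin_comp[OF P(4) w] lin_comp[OF P(5) cf(8)]])
  \<comment> \<open>The pullback of \<open>w\<close> and \<open>q\<close>, as a submodule of \<open>W \<oplus> T\<close>.\<close>
  define V where "V = {s \<in> carrier P. ?k s = \<zero>\<^bsub>C\<^esub>}"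
  have V_iff: "s \<in> V \<longleftrightarrow> s \<in> carrier P \<and> w (p1 s) = q (p2 s)" for s
  proof -
    have "w (p1 s) \<in> carrier C" "q (p2 s) \<in> carrier C" if "s \<in> carrier P"
      using lin_closed[OF w lin_closed[OF P(4) that]] lin_closed[OF cf(8) lin_closed[OF P(5) that]] by simp_all
    then show ?thesis unfolding V_def using mod_eq_iff_diff[OF cf(6)] by auto
  qed
  have Vsub: "submod P V" unfolding V_def by (rule submod_kernel[OF k lmP cf(6)])
  let ?VM = "restr P V"
  have oV: "obj ?VM" by (rule obj_restr[OF P(1) Vsub])
  have iV: "lin ?VM P (\<lambda>x. x)" by (rule submod_module(2)[OF lmP Vsub])
  have i1V: "i1 (u m) \<in> V" if m: "m \<in> carrier M" for m
  proof -
    have um: "u m \<in> carrier W" "w (u m) = \<zero>\<^bsub>C\<^esub>" using uker m by auto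
    then show ?thesis unfolding V_iff using p(1) lin_closed[OF P(2) um(1)] lin_zero[OF cf(8,5,6)] by simp
  qed
  have sV: "short_exact M ?VM T (\<lambda>m. i1 (u m)) p2"
    unfolding short_exact_def
  proof (intro conjI oM oV cf(2))
    show "lin M ?VM (\<lambda>m. i1 (u m))"
      using lin_comp[OF u P(2)] i1V lin_into_submod[of V P M] Vsub by (simp add: submod_def)
    show "lin ?VM T p2" by (rule lin_comp[OF iV P(5)])
    show "inj_on (\<lambda>m. i1 (u m)) (carrier M)"
    proof (rule inj_onI)
      fix x y assume xy: "x \<in> carrier M" "y \<in> carrier M" "i1 (u x) = i1 (u y)"
      have "p1 (i1 (u x)) = u x" "p1 (i1 (u y)) = u y"
        using p(1) lin_closed[OF u xy(1)] lin_closed[OF u xy(2)] by blast+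
      then have "u x = u y" using xy(3) by metis
      then show "x = y" by (rule inj_onD[OF uinj]) (use xy in simp_all)
    qed
    show "(\<lambda>m. i1 (u m)) ` carrier M = {s \<in> carrier ?VM. p2 s = \<zero>\<^bsub>T\<^esub>}"
    proof (intro equalityI subsetI)
      fix s assume "s \<in> (\<lambda>m. i1 (u m)) ` carrier M"
      then obtain m where m: "m \<in> carrier M" "s = i1 (u m)" by blast
      have "p2 s = \<zero>\<^bsub>T\<^esub>" using p(1) lin_closed[OF u m(1)] m(2) by simp
      moreover have "s \<in> V" using i1V[OF m(1)] unfolding m(2) .
      ultimately show "s \<in> {s \<in> carrier ?VM. p2 s = \<zero>\<^bsub>T\<^esub>}" by simp
    next
      fix s assume "s \<in> {s \<in> carrier ?VM. p2 s = \<zero>\<^bsub>T\<^esub>}"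
      then have s: "s \<in> V" "p2 s = \<zero>\<^bsub>T\<^esub>" by simp_all
      then have sP: "s \<in> carrier P" and "w (p1 s) = \<zero>\<^bsub>C\<^esub>" using V_iff lin_zero[OF cf(8,5,6)] by auto
      then have "p1 s \<in> u ` carrier M" using uker lin_closed[OF P(4) sP] by simp
      then obtain m where m: "m \<in> carrier M" "p1 s = u m" by blast
      have "i1 (p1 s) \<in> carrier P" by (rule lin_closed[OF P(2) lin_closed[OF P(4) sP]])
      then have "s = i1 (u m)"
        using ps sP s(2) m(2) lin_zero[OF P(3) cf(5) lmP] lmP by (metis mod_add_zero)
      then show "s \<in> (\<lambda>m. i1 (u m)) ` carrier M" using m(1) by blast
    qed
    show "p2 ` carrier ?VM = carrier T"
    proof (intro equalityI subsetI)
      fix t assume "t \<in> p2 ` carrier ?VM"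
      then show "t \<in> carrier T" using lin_closed[OF P(5)] by (auto simp: V_iff)
    next
      fix t assume t: "t \<in> carrier T"
      have "q t \<in> w ` carrier W" using wsur lin_closed[OF cf(8) t] by simp
      then obtain x where x: "x \<in> carrier W" "q t = w x" by blast
      let ?s = "i1 x \<oplus>\<^bsub>P\<^esub> i2 t"
      have c: "i1 x \<in> carrier P" "i2 t \<in> carrier P" using lin_closed[OF P(2) x(1)] lin_closed[OF P(3) t] .
      have "p1 ?s = x" "p2 ?s = t"
        using c p x t lmW cf(5) by (simp_all add: lin_add[OF P(4)] lin_add[OF P(5)])
      then show "t \<in> p2 ` carrier ?VM"
        using c x(2) lmP V_iff[of ?s] by (intro image_eqI[of _ _ ?s]) simp_all
    qed
  qed
  have VS: "?VM \<in> S" using cl sV M TS unfolding closed_under_extensions_iff[OF S] by blast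
  have "i2 (c x) \<in> carrier ?VM" if x: "x \<in> X" for x
  proof -
    have "q (c x) = \<zero>\<^bsub>C\<^esub>" using cf(12)[of "e x"] e_in c_def x by simp
    then show ?thesis
      using p(2) cf(13)[OF x] lin_closed[OF P(3) cf(13)[OF x]] lin_zero[OF w lmW cf(6)] V_iff[of "i2 (c x)"]
      by simp
  qed
  then obtain g where g: "lin T ?VM g" "\<forall>x \<in> X. g (c x) = i2 (c x)"
    using free_towards_ex[OF ft[OF VS], of "\<lambda>x. i2 (c x)"] by blast
  have gP: "lin T P g" by (rule lin_comp[OF g(1) iV])
  have p2g: "p2 (g t) = t" if t: "t \<in> carrier T" for t
    by (rule free_towards_unique[OF ft[OF TS] lin_comp[OF gP P(5)] lin_id _ t]) (use g(2) p(2) cf(13) in simp)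
  let ?h = "\<lambda>t. p1 (g t)"
  have h: "lin T W ?h" by (rule lin_comp[OF gP P(4)])
  have wh: "w (?h t) = q t" if t: "t \<in> carrier T" for t
  proof -
    have "g t \<in> V" using lin_closed[OF g(1) t] by simp
    then show ?thesis using V_iff p2g[OF t] by simp
  qed
  have hf: "?h (f y) = \<zero>\<^bsub>W\<^esub>" if y: "y \<in> carrier F" for y
    by (rule free_towards_unique[OF free[OF lmW] lin_comp[OF cf(7) h] lin_zero_map[OF lmW] _ y])
      (use g(2) p(2) cf(13) c_def in simp)
  have "?h t = \<zero>\<^bsub>W\<^esub>" if t: "t \<in> carrier T" "q t = \<zero>\<^bsub>C\<^esub>" for t
  proof -
    have "t \<in> f ` carrier F" using t cf(10) by simp
    then show ?thesis using hf by blast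
  qed
  then obtain v where v: "lin C W v" "\<forall>t \<in> carrier T. v (q t) = ?h t"
    using lin_factor_surj[OF cf(8,11) h cf(5,6) lmW] by blast
  have "w (v z) = z" if z: "z \<in> carrier C" for z
  proof -
    have "z \<in> q ` carrier T" using z cf(11) by simp
    then obtain t where "t \<in> carrier T" "z = q t" by blast
    then show ?thesis using v(2) wh by simp
  qed
  then show "splits W C w" unfolding splits_def using v(1) by blast
qed

end

end

section \<open>Recognising the image by a single orthogonality condition\<close>

text \<open>
  The properties of \<open>Theta\<close> that matter for modules: \<open>T X\<close> stands for \<open>Theta\<close> of the coproduct of
  \<open>X\<close> copies of \<open>P\<close>, and \<open>S\<close> for the essential image. The last assumption says that every element
  of \<open>T X\<close> involves at most \<open>K\<close> of the summands; it is stated through the idempotent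
  endomorphism of \<open>T X\<close> that retains the summands in \<open>X'\<close>.
\<close>

locale free_family = module_universe U R for U :: "'u itself" and R :: "'r ring" +
  fixes T :: "'u set \<Rightarrow> ('r, 'u) module" and c :: "'u set \<Rightarrow> 'u \<Rightarrow> 'u"
    and S :: "('r, 'u) module set" and K :: "'u set"
  assumes S_obj: "S \<subseteq> Ob (RMod R)"
    and S_iso: "\<lbrakk>M \<in> S; N \<in> Ob (RMod R); iso_modules M N\<rbrakk> \<Longrightarrow> N \<in> S"
    and T_S: "small TYPE('u) X \<Longrightarrow> T X \<in> S"
    and c_in: "\<lbrakk>small TYPE('u) X; x \<in> X\<rbrakk> \<Longrightarrow> c X x \<in> carrier (T X)"
    and T_free: "\<lbrakk>small TYPE('u) X; M \<in> S\<rbrakk> \<Longrightarrow> free_towards R (T X) (c X) X M"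
    and T_cokernel: "\<lbrakk>small TYPE('u) X; small TYPE('u) Y; linear_map R (T Y) (T X) \<delta>\<rbrakk> \<Longrightarrow>
      \<exists>C \<in> S. \<exists>q. linear_map R (T X) C q \<and> q ` carrier (T X) = carrier C \<and>
        (\<forall>t \<in> carrier (T X). q t = \<zero>\<^bsub>C\<^esub> \<longleftrightarrow> t \<in> \<delta> ` carrier (T Y))"
    and small_K: "small TYPE('u) K"
    and infinite_K: "infinite K"
    and support: "\<lbrakk>small TYPE('u) X; t \<in> carrier (T X)\<rbrakk> \<Longrightarrow>
      \<exists>X' \<subseteq> X. |X'| \<le>o |K| \<and> (\<forall>e. linear_map R (T X) (T X) e \<and>
        (\<forall>x \<in> X. e (c X x) = (if x \<in> X' then c X x else \<zero>\<^bsub>T X\<^esub>)) \<longrightarrow> e t = t)"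
begin

lemma S_lm: "M \<in> S \<Longrightarrow> lm M"
  using S_obj by auto

lemma T_lm: "small TYPE('u) X \<Longrightarrow> lm (T X)"
  using T_S S_lm by blast

definition supported :: "'u set \<Rightarrow> 'u set \<Rightarrow> 'u \<Rightarrow> bool" where
  "supported X X' t \<longleftrightarrow> (\<forall>e. lin (T X) (T X) e \<and>
        (\<forall>x \<in> X. e (c X x) = (if x \<in> X' then c X x else \<zero>\<^bsub>T X\<^esub>)) \<longrightarrow> e t = t)"

context
  fixes M assumes M: "lm M" and orth: "free_towards R (T K) (c K) K M"
begin

text \<open>
  For \<open>X'\<close> no larger than \<open>K\<close>, the part of \<open>T X\<close> supported in \<open>X'\<close> is a retract of \<open>T K\<close> and inherits the
  unique extension property.
\<close>

lemma orth_small_part: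
  assumes X: "small TYPE('u) X" and X': "X' \<subseteq> X" "|X'| \<le>o |K|"
  shows "\<lbrakk>lin (T X) M g; lin (T X) M h; \<And>x. x \<in> X' \<Longrightarrow> g (c X x) = h (c X x);
      supported X X' t; t \<in> carrier (T X)\<rbrakk> \<Longrightarrow> g t = h t"
    and "(\<And>x. x \<in> X' \<Longrightarrow> m x \<in> carrier M) \<Longrightarrow>
      \<exists>g. lin (T X) M g \<and> (\<forall>x \<in> X'. g (c X x) = m x)"
proof -
  note lX = T_lm[OF X] and lK = T_lm[OF small_K]
  obtain j where j: "inj_on j X'" "j ` X' \<subseteq> K"
    using X'(2) unfolding card_of_ordLeq[symmetric] by blast
  define j' where "j' = inv_into X' j"
  have j'j: "j' (j x) = x" if "x \<in> X'" for x using that j(1) by (simp add: j'_def)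
  have "\<exists>\<alpha>. lin (T X) (T K) \<alpha> \<and> (\<forall>x\<in>X. \<alpha> (c X x) = (if x \<in> X' then c K (j x) else \<zero>\<^bsub>T K\<^esub>))"
    by (rule free_towards_ex[OF T_free[OF X T_S[OF small_K]]])
      (use c_in[OF small_K] j(2) lK in auto)
  then obtain \<alpha> where \<alpha>: "lin (T X) (T K) \<alpha>"
    "\<forall>x\<in>X. \<alpha> (c X x) = (if x \<in> X' then c K (j x) else \<zero>\<^bsub>T K\<^esub>)" by blast
  have "\<exists>\<beta>. lin (T K) (T X) \<beta> \<and> (\<forall>k\<in>K. \<beta> (c K k) = (if k \<in> j ` X' then c X (j' k) else \<zero>\<^bsub>T X\<^esub>))"
    by (rule free_towards_ex[OF T_free[OF small_K T_S[OF X]]])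
      (use c_in[OF X] j'j X'(1) lX in auto)
  then obtain \<beta> where \<beta>: "lin (T K) (T X) \<beta>"
    "\<forall>k\<in>K. \<beta> (c K k) = (if k \<in> j ` X' then c X (j' k) else \<zero>\<^bsub>T X\<^esub>)" by blast
  have jK: "j x \<in> K" if "x \<in> X'" for x using j(2) that by blast
  have \<beta>j: "\<beta> (c K (j x)) = c X x" if "x \<in> X'" for x
    using \<beta>(2) jK[OF that] that j'j by simp
  have "\<beta> (\<alpha> (c X x)) = (if x \<in> X' then c X x else \<zero>\<^bsub>T X\<^esub>)" if "x \<in> X" for x
    using \<alpha>(2) that \<beta>j lin_zero[OF \<beta>(1) lK lX] by simp
  then have \<beta>\<alpha>: "\<beta> (\<alpha> t) = t" if "supported X X' t" for t
    using that[unfolded supported_def, rule_format, of "\<lambda>x. \<beta> (\<alpha> x)"] lin_comp[OF \<alpha>(1) \<beta>(1)] by simp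
  show "g t = h t" if g: "lin (T X) M g" and h: "lin (T X) M h"
    and eq: "\<And>x. x \<in> X' \<Longrightarrow> g (c X x) = h (c X x)"
    and t: "supported X X' t" "t \<in> carrier (T X)" for g h t
  proof -
    have "g (\<beta> (c K k)) = h (\<beta> (c K k))" if k: "k \<in> K" for k
    proof (cases "k \<in> j ` X'")
      case True
      then obtain x where "x \<in> X'" "k = j x" by blast
      then show ?thesis using \<beta>j eq by simp
    next
      case False
      then show ?thesis using \<beta>(2) k lin_zero[OF g lX M] lin_zero[OF h lX M] by simp
    qed
    then have "g (\<beta> (\<alpha> t)) = h (\<beta> (\<alpha> t))"
      by (rule free_towards_unique[OF orth lin_comp[OF \<beta>(1) g] lin_comp[OF \<beta>(1) h] _
            lin_closed[OF \<alpha>(1) t(2)]])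
    then show ?thesis using \<beta>\<alpha>[OF t(1)] by simp
  qed
  show "\<exists>g. lin (T X) M g \<and> (\<forall>x \<in> X'. g (c X x) = m x)"
    if m: "\<And>x. x \<in> X' \<Longrightarrow> m x \<in> carrier M" for m
  proof -
    have "\<exists>g. lin (T K) M g \<and> (\<forall>k\<in>K. g (c K k) = (if k \<in> j ` X' then m (j' k) else \<zero>\<^bsub>M\<^esub>))"
      by (rule free_towards_ex[OF orth]) (use m j'j M in auto)
    then obtain g where g: "lin (T K) M g"
      "\<forall>k\<in>K. g (c K k) = (if k \<in> j ` X' then m (j' k) else \<zero>\<^bsub>M\<^esub>)" by blast
    have "g (\<alpha> (c X x)) = m x" if x: "x \<in> X'" for x
    proof -
      have "x \<in> X" using x X'(1) by blast
      then show ?thesis using \<alpha>(2) g(2) jK[OF x] x j'j[OF x] by simp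
    qed
    then show ?thesis using lin_comp[OF \<alpha>(1) g(1)] by blast
  qed
qed

text \<open>
  Each element of \<open>T X\<close> lies in a part supported in at most \<open>K\<close> summands, and any two such parts lie in a
  third, as \<open>K\<close> is infinite. By uniqueness the extensions to the parts agree where they meet, so they glue.
\<close>

lemma orth_all:
  assumes X: "small TYPE('u) X"
  shows "free_towards R (T X) (c X) X M"
proof -
  note lX = T_lm[OF X]
  have "\<exists>X'. X' \<subseteq> X \<and> |X'| \<le>o |K| \<and> supported X X' t" if "t \<in> carrier (T X)" for t
    using support[OF X that] unfolding supported_def by blast
  then obtain s where s: "\<And>t. t \<in> carrier (T X) \<Longrightarrow> s t \<subseteq> X"
    "\<And>t. t \<in> carrier (T X) \<Longrightarrow> |s t| \<le>o |K|" "\<And>t. t \<in> carrier (T X) \<Longrightarrow> supported X (s t) t"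
    by metis
  have Un: "|A \<union> B| \<le>o |K|" if "|A| \<le>o |K|" "|B| \<le>o |K|" for A B :: "'u set"
    using card_of_Un_ordLeq_infinite_Field[OF _ that card_of_Card_order] infinite_K
    by (simp add: Field_card_of)
  show ?thesis
    unfolding free_towards_def
  proof (intro conjI allI impI ballI)
    fix m assume m: "\<forall>x \<in> X. m x \<in> carrier M"
    have ex: "\<exists>g. lin (T X) M g \<and> (\<forall>x \<in> A. g (c X x) = m x)" if "A \<subseteq> X" "|A| \<le>o |K|" for A
      by (rule orth_small_part(2)[OF X that]) (use m that in blast)
    define G where "G A = (SOME g. lin (T X) M g \<and> (\<forall>x \<in> A. g (c X x) = m x))" for A
    have G: "lin (T X) M (G A)" "\<And>x. x \<in> A \<Longrightarrow> G A (c X x) = m x" if "A \<subseteq> X" "|A| \<le>o |K|" for A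
      using someI_ex[OF ex[OF that]] unfolding G_def by blast+
    define g where "g t = G (s t) t" for t
    have g: "g t = G A t" if t: "t \<in> carrier (T X)" and A: "s t \<subseteq> A" "A \<subseteq> X" "|A| \<le>o |K|" for t A
      unfolding g_def
    proof (rule orth_small_part(1)[OF X s(1,2)[OF t] G(1) G(1)[OF A(2,3)] _ s(3)[OF t] t])
      show "s t \<subseteq> X" "|s t| \<le>o |K|" by (rule s(1,2)[OF t])+
      show "G (s t) (c X x) = G A (c X x)" if "x \<in> s t" for x
        using G(2)[OF s(1,2)[OF t] that] G(2)[OF A(2,3), of x] A(1) that by auto
    qed
    have "lin (T X) M g"
    proof (rule linI)
      fix t assume t: "t \<in> carrier (T X)"
      show "g t \<in> carrier M" unfolding g_def by (rule lin_closed[OF G(1)[OF s(1,2)[OF t]] t])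
    next
      fix t u assume t: "t \<in> carrier (T X)" and u: "u \<in> carrier (T X)"
      have tu: "t \<oplus>\<^bsub>T X\<^esub> u \<in> carrier (T X)" using t u lX by simp
      let ?A = "s t \<union> s u \<union> s (t \<oplus>\<^bsub>T X\<^esub> u)"
      have A: "?A \<subseteq> X" "|?A| \<le>o |K|" using s(1,2)[OF t] s(1,2)[OF u] s(1,2)[OF tu] by (auto intro!: Un)
      have "g t = G ?A t" "g u = G ?A u" "g (t \<oplus>\<^bsub>T X\<^esub> u) = G ?A (t \<oplus>\<^bsub>T X\<^esub> u)"
        by (rule g[OF _ _ A]; use t u tu in auto)+
      then show "g (t \<oplus>\<^bsub>T X\<^esub> u) = g t \<oplus>\<^bsub>M\<^esub> g u" using lin_add[OF G(1)[OF A] t u] by simp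
    next
      fix a t assume a: "a \<in> carrier R" and t: "t \<in> carrier (T X)"
      have at: "a \<odot>\<^bsub>T X\<^esub> t \<in> carrier (T X)" using a t lX by simp
      let ?A = "s t \<union> s (a \<odot>\<^bsub>T X\<^esub> t)"
      have A: "?A \<subseteq> X" "|?A| \<le>o |K|" using s(1,2)[OF t] s(1,2)[OF at] by (auto intro!: Un)
      have "g t = G ?A t" "g (a \<odot>\<^bsub>T X\<^esub> t) = G ?A (a \<odot>\<^bsub>T X\<^esub> t)"
        by (rule g[OF _ _ A]; use t at in auto)+
      then show "g (a \<odot>\<^bsub>T X\<^esub> t) = a \<odot>\<^bsub>M\<^esub> g t" using lin_smult[OF G(1)[OF A] a t] by simp
    qed
    moreover have "g (c X x) = m x" if x: "x \<in> X" for x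
    proof -
      note cx = c_in[OF X x]
      have "|{x}| \<le>o |K|" using infinite_K by (intro card_of_singl_ordLeq) auto
      then have A: "s (c X x) \<union> {x} \<subseteq> X" "|s (c X x) \<union> {x}| \<le>o |K|"
        using s(1,2)[OF cx] x by (auto intro!: Un simp del: Un_insert_right)
      then show ?thesis using g[OF cx Un_upper1 A] G(2)[OF A, of x] by simp
    qed
    ultimately show "\<exists>g. lin (T X) M g \<and> (\<forall>x \<in> X. g (c X x) = m x)" by blast
  next
    fix g h t
    assume gh: "lin (T X) M g \<and> lin (T X) M h \<and> (\<forall>x \<in> X. g (c X x) = h (c X x))"
      and t: "t \<in> carrier (T X)"
    show "g t = h t"
      by (rule orth_small_part(1)[OF X s(1,2)[OF t] _ _ _ s(3)[OF t] t]) (use gh s(1)[OF t] in auto)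
  qed
qed

end

text \<open>
  A presentation of \<open>M\<close> by the \<open>T X\<close>, with \<open>X\<close> all elements and \<open>Y\<close> all relations, is a cokernel taken in \<open>S\<close>.
\<close>

lemma mem_S_iff: "M \<in> S \<longleftrightarrow> obj M \<and> free_towards R (T K) (c K) K M"
proof
  assume "M \<in> S"
  then show "obj M \<and> free_towards R (T K) (c K) K M" using S_obj T_free[OF small_K] by blast
next
  assume M: "obj M \<and> free_towards R (T K) (c K) K M"
  then have oM: "obj M" and lM: "lm M" by simp_all
  note ft = orth_all[OF lM conjunct2[OF M]]
  define X where "X = carrier M"
  have X: "small TYPE('u) X" using oM by (simp add: obj_iff X_def)
  note lX = T_lm[OF X]
  have "\<exists>g. lin (T X) M g \<and> (\<forall>x\<in>X. g (c X x) = x)"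
    by (rule free_towards_ex[OF ft[OF X]]) (simp add: X_def)
  then obtain g where g: "lin (T X) M g" "\<forall>x\<in>X. g (c X x) = x" by blast
  define Y where "Y = {t \<in> carrier (T X). g t = \<zero>\<^bsub>M\<^esub>}"
  have "small TYPE('u) (carrier (T X))" using T_S[OF X] S_obj obj_iff by blast
  then have Y: "small TYPE('u) Y" by (rule small_subset) (auto simp: Y_def)
  note lY = T_lm[OF Y]
  have "\<exists>\<delta>. lin (T Y) (T X) \<delta> \<and> (\<forall>y\<in>Y. \<delta> (c Y y) = y)"
    by (rule free_towards_ex[OF T_free[OF Y T_S[OF X]]]) (simp add: Y_def)
  then obtain \<delta> where \<delta>: "lin (T Y) (T X) \<delta>" "\<forall>y\<in>Y. \<delta> (c Y y) = y" by blast
  \<comment> \<open>Here orthogonality is used for \<open>Y\<close>: the composite and zero agree on the family \<open>c Y\<close>, hence everywhere.\<close>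
  have g\<delta>: "g (\<delta> t) = \<zero>\<^bsub>M\<^esub>" if t: "t \<in> carrier (T Y)" for t
    by (rule free_towards_unique[OF ft[OF Y] lin_comp[OF \<delta>(1) g(1)] lin_zero_map[OF lM] _ t])
      (use \<delta>(2) in \<open>simp add: Y_def\<close>)
  obtain C q where C: "C \<in> S" "lin (T X) C q" "q ` carrier (T X) = carrier C"
    "\<forall>t \<in> carrier (T X). q t = \<zero>\<^bsub>C\<^esub> \<longleftrightarrow> t \<in> \<delta> ` carrier (T Y)"
    using T_cokernel[OF X Y \<delta>(1)] by blast
  note lC = S_lm[OF C(1)]
  have ker: "q t = \<zero>\<^bsub>C\<^esub> \<longleftrightarrow> g t = \<zero>\<^bsub>M\<^esub>" if t: "t \<in> carrier (T X)" for t
  proof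
    assume "q t = \<zero>\<^bsub>C\<^esub>"
    then obtain z where "z \<in> carrier (T Y)" "t = \<delta> z" using C(4) t by blast
    then show "g t = \<zero>\<^bsub>M\<^esub>" using g\<delta> by simp
  next
    assume "g t = \<zero>\<^bsub>M\<^esub>"
    then have tY: "t \<in> Y" using t by (simp add: Y_def)
    then have "t = \<delta> (c Y t)" using \<delta>(2) by simp
    then have "t \<in> \<delta> ` carrier (T Y)" using c_in[OF Y tY] by (rule image_eqI)
    then show "q t = \<zero>\<^bsub>C\<^esub>" using C(4) t by blast
  qed
  obtain k where k: "lin C M k" "\<forall>t \<in> carrier (T X). k (q t) = g t"
    using lin_factor_surj[OF C(2,3) g(1) lX lC lM] ker by blast
  have qt: "\<exists>t \<in> carrier (T X). z = q t" if "z \<in> carrier C" for z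
    using C(3) that by (metis imageE)
  have "inj_on k (carrier C)"
    unfolding lin_inj_iff[OF k(1) lC lM]
  proof (intro ballI impI)
    fix z assume z: "z \<in> carrier C" "k z = \<zero>\<^bsub>M\<^esub>"
    obtain t where t: "t \<in> carrier (T X)" "z = q t" using qt[OF z(1)] by blast
    then show "z = \<zero>\<^bsub>C\<^esub>" using k(2) z(2) ker by simp
  qed
  moreover have "k ` carrier C = carrier M"
  proof (intro equalityI subsetI)
    fix x assume "x \<in> k ` carrier C"
    then show "x \<in> carrier M" using lin_closed[OF k(1)] by blast
  next
    fix x assume "x \<in> carrier M"
    then have x: "x \<in> X" by (simp add: X_def)
    have "k (q (c X x)) = x" using k(2) c_in[OF X x] g(2) x by simp
    moreover have "q (c X x) \<in> carrier C" by (rule lin_closed[OF C(2) c_in[OF X x]])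
    ultimately show "x \<in> k ` carrier C" by (metis image_eqI)
  qed
  ultimately have "iso_modules C M" by (intro iso_modulesI[OF k(1)]) (use lC lM in simp_all)
  then show "M \<in> S" by (rule S_iso[OF C(1) oM])
qed

end

section \<open>Categories with a projective generator\<close>

text \<open>
  A point outside all images would give two maps to a two-element set, one constant and one
  exceptional at that point, that complete the same cocone.
\<close>

lemma colimit_Set_cat_surj:
  fixes D :: "('i, 'j, 'u set, 'u \<Rightarrow> 'u) func" and Y :: "'u set"
  assumes inacc: "inaccessible_universe TYPE('u)"
    and col: "is_colimit J Set_cat D Y c"
    and maps: "\<And>i j f z. \<lbrakk>i \<in> Ob J; j \<in> Ob J; f \<in> Hom J i j; z \<in> Fob D i\<rbrakk> \<Longrightarrow> Fmap D i j f z \<in> Fob D j"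
    and y: "y \<in> Y"
  shows "\<exists>i \<in> Ob J. \<exists>z \<in> Fob D i. c i z = y"
proof (rule ccontr)
  assume none: "\<not> (\<exists>i \<in> Ob J. \<exists>z \<in> Fob D i. c i z = y)"
  interpret universe "TYPE('u)" by unfold_locales (rule inacc)
  obtain u0 u1 :: 'u where u: "u0 \<noteq> u1"
    using infinite_universe by (metis (full_types) UNIV_I finite.emptyI finite.insertI finite_subset insertI1 subsetI)
  let ?W = "{u0, u1}"
  let ?d = "\<lambda>i. \<lambda>z \<in> Fob D i. u0"
  have c: "c i \<in> Fob D i \<rightarrow>\<^sub>E Y" if "i \<in> Ob J" for i
    using col that unfolding is_colimit_def is_cocone_def by (auto simp: Set_cat_def)
  have "is_cocone J Set_cat D ?W ?d"
    unfolding is_cocone_def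
  proof (intro conjI ballI)
    show "?W \<in> Ob Set_cat" by (simp add: Set_cat_def small_finite)
    show "?d i \<in> Hom Set_cat (Fob D i) ?W" for i by (simp add: Set_cat_def)
    show "Comp Set_cat (Fob D i) (Fob D j) ?W (?d j) (Fmap D i j f) = ?d i"
      if "i \<in> Ob J" "j \<in> Ob J" "f \<in> Hom J i j" for i j f
      using maps[OF that] by (auto simp: Set_cat_def compose_def intro!: restrict_ext)
  qed
  then have uniq: "\<exists>!h. h \<in> Hom Set_cat Y ?W \<and>
      (\<forall>i \<in> Ob J. Comp Set_cat (Fob D i) Y ?W h (c i) = ?d i)"
    using col unfolding is_colimit_def by blast
  let ?h1 = "\<lambda>z \<in> Y. u0" and ?h2 = "\<lambda>z \<in> Y. if z = y then u1 else u0"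
  have h1: "?h1 \<in> Hom Set_cat Y ?W \<and> (\<forall>i \<in> Ob J. Comp Set_cat (Fob D i) Y ?W ?h1 (c i) = ?d i)"
    using c by (fastforce simp: Set_cat_def compose_def intro!: restrict_ext)
  have h2: "?h2 \<in> Hom Set_cat Y ?W \<and> (\<forall>i \<in> Ob J. Comp Set_cat (Fob D i) Y ?W ?h2 (c i) = ?d i)"
    using c none by (fastforce simp: Set_cat_def compose_def intro!: restrict_ext)
  have "?h1 = ?h2" using uniq h1 h2 by blast
  then have "?h1 y = ?h2 y" by simp
  then show False using y u by simp
qed

definition is_copower ::
  "('o, 'm, 'x) cat_scheme \<Rightarrow> 'o \<Rightarrow> 'i set \<Rightarrow> 'o \<Rightarrow> ('i \<Rightarrow> 'm) \<Rightarrow> bool" where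
  "is_copower C P X Q c \<longleftrightarrow> Q \<in> Ob C \<and> (\<forall>x \<in> X. c x \<in> Hom C P Q) \<and>
     (\<forall>Y \<in> Ob C. \<forall>d. (\<forall>x \<in> X. d x \<in> Hom C P Y) \<longrightarrow>
        (\<exists>!h. h \<in> Hom C Q Y \<and> (\<forall>x \<in> X. Comp C P Q Y h (c x) = d x)))"

context category begin

lemma colimit_jointly_epi:
  assumes col: "is_colimit J C D Y c" and D: "\<And>i. i \<in> Ob J \<Longrightarrow> Fob D i \<in> Ob C"
    and maps: "\<And>i j f. \<lbrakk>i \<in> Ob J; j \<in> Ob J; f \<in> Hom J i j\<rbrakk> \<Longrightarrow> Fmap D i j f \<in> Hom C (Fob D i) (Fob D j)"
    and Z: "Z \<in> Ob C" and g: "g \<in> Hom C Y Z" "h \<in> Hom C Y Z"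
    and eq: "\<And>i. i \<in> Ob J \<Longrightarrow> Comp C (Fob D i) Y Z g (c i) = Comp C (Fob D i) Y Z h (c i)"
  shows "g = h"
proof -
  have co: "Y \<in> Ob C" "\<And>i. i \<in> Ob J \<Longrightarrow> c i \<in> Hom C (Fob D i) Y"
    "\<And>i j f. \<lbrakk>i \<in> Ob J; j \<in> Ob J; f \<in> Hom J i j\<rbrakk> \<Longrightarrow>
      Comp C (Fob D i) (Fob D j) Y (c j) (Fmap D i j f) = c i"
    using col unfolding is_colimit_def is_cocone_def by blast+
  let ?d = "\<lambda>i. Comp C (Fob D i) Y Z g (c i)"
  have "is_cocone J C D Z ?d"
    unfolding is_cocone_def
  proof (intro conjI ballI Z)
    show "?d i \<in> Hom C (Fob D i) Z" if "i \<in> Ob J" for i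
      by (rule Comp_in_Hom[OF D[OF that] co(1) Z co(2)[OF that] g(1)])
    show "Comp C (Fob D i) (Fob D j) Z (?d j) (Fmap D i j f) = ?d i"
      if i: "i \<in> Ob J" "j \<in> Ob J" "f \<in> Hom J i j" for i j f
      using Comp_assoc[OF D[OF i(1)] D[OF i(2)] co(1) Z maps[OF i] co(2)[OF i(2)] g(1)] co(3)[OF i]
      by simp
  qed
  then have "\<exists>!k. k \<in> Hom C Y Z \<and> (\<forall>i \<in> Ob J. Comp C (Fob D i) Y Z k (c i) = ?d i)"
    using col unfolding is_colimit_def by blast
  then show ?thesis using g eq by (metis (no_types, lifting))
qed

lemma copower_ex:
  assumes "is_copower C P X Q c" "Y \<in> Ob C" "\<And>x. x \<in> X \<Longrightarrow> d x \<in> Hom C P Y"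
  shows "\<exists>h. h \<in> Hom C Q Y \<and> (\<forall>x \<in> X. Comp C P Q Y h (c x) = d x)"
proof -
  have "\<exists>!h. h \<in> Hom C Q Y \<and> (\<forall>x \<in> X. Comp C P Q Y h (c x) = d x)"
    using assms unfolding is_copower_def by simp
  then show ?thesis by (rule ex1_implies_ex)
qed

lemma copower_unique:
  assumes "is_copower C P X Q c" "Y \<in> Ob C" "P \<in> Ob C" "g \<in> Hom C Q Y" "h \<in> Hom C Q Y"
    and eq: "\<And>x. x \<in> X \<Longrightarrow> Comp C P Q Y g (c x) = Comp C P Q Y h (c x)"
  shows "g = h"
proof -
  have Q: "Q \<in> Ob C" "\<And>x. x \<in> X \<Longrightarrow> c x \<in> Hom C P Q" using assms(1) by (auto simp: is_copower_def)
  have "\<forall>x \<in> X. Comp C P Q Y g (c x) \<in> Hom C P Y"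
    using Comp_in_Hom[OF assms(3) Q(1) assms(2) Q(2) assms(4)] by blast
  then have "\<exists>!k. k \<in> Hom C Q Y \<and> (\<forall>x \<in> X. Comp C P Q Y k (c x) = Comp C P Q Y g (c x))"
    using assms(1,2) unfolding is_copower_def by simp
  then show ?thesis using assms(4,5) eq by (metis (no_types, lifting))
qed

end

text \<open>
  A copower is a colimit over a discrete category.
\<close>

lemma ex_copower:
  fixes C :: "('o, 'u, 'x) cat_scheme" and X :: "'u set"
  assumes inacc: "inaccessible_universe TYPE('u)" and cat: "category C" and cc: "cocomplete C"
    and P: "P \<in> Ob C" and X: "small TYPE('u) X"
  shows "\<exists>Q c. is_copower C P X Q c"
proof -
  interpret universe "TYPE('u)" by unfold_locales (rule inacc)
  interpret category C by (rule cat)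
  let ?J = "\<lparr>Ob = X, Hom = \<lambda>i j. if i = j then {i} else {}, Comp = \<lambda>_ _ _ g f. f, Idn = \<lambda>i. i\<rparr> :: ('u, 'u) cat"
  let ?D = "\<lparr>Fob = \<lambda>_. P, Fmap = \<lambda>_ _ _. Idn C P\<rparr> :: ('u, 'u, 'o, 'u) func"
  have "category ?J" by unfold_locales (auto split: if_splits)
  moreover have "locally_small ?J" by (auto simp: locally_small_def small_finite)
  moreover have "is_functor ?J C ?D"
    using P Idn_in_Hom[OF P] Comp_Idn_left[OF P P Idn_in_Hom[OF P]] by (auto simp: is_functor_def)
  moreover have "small TYPE('u) (Ob ?J)" using X by simp
  ultimately obtain Q c where Qc: "is_colimit ?J C ?D Q c"
    using cc unfolding cocomplete_def by blast
  have cone: "is_cocone ?J C ?D Y d \<longleftrightarrow> Y \<in> Ob C \<and> (\<forall>x \<in> X. d x \<in> Hom C P Y)" for Y d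
    unfolding is_cocone_def using Comp_Idn_right[OF P] by auto
  have "is_copower C P X Q c"
    using Qc unfolding is_colimit_def cone is_copower_def by simp
  then show ?thesis by blast
qed

section \<open>Elements of copowers have small support\<close>

context preadditive_category begin

lemma HZero_in_Hom: "X \<in> Ob C \<Longrightarrow> Y \<in> Ob C \<Longrightarrow> HZero C X Y \<in> Hom C X Y"
  using hom_comm_group[THEN comm_group.axioms(1), THEN comm_monoid.axioms(1), THEN monoid.one_closed]
  by (simp add: hom_group_def)

lemma HAdd_idem:
  assumes "X \<in> Ob C" "Y \<in> Ob C" "f \<in> Hom C X Y" "HAdd C X Y f f = f"
  shows "f = HZero C X Y"
proof -
  interpret G: comm_group "hom_group C X Y" by (rule hom_comm_group[OF assms(1,2)])
  have "f \<otimes>\<^bsub>hom_group C X Y\<^esub> f = f" "f \<in> carrier (hom_group C X Y)"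
    using assms by (simp_all add: hom_group_def)
  then have "f = \<one>\<^bsub>hom_group C X Y\<^esub>" using G.l_cancel_one by blast
  then show ?thesis by (simp add: hom_group_def)
qed

lemma Comp_HZero_right:
  assumes X: "X \<in> Ob C" "Y \<in> Ob C" "Z \<in> Ob C" and g: "g \<in> Hom C Y Z"
  shows "Comp C X Y Z g (HZero C X Y) = HZero C X Z"
proof (rule HAdd_idem[OF X(1,3)])
  note z = HZero_in_Hom[OF X(1,2)]
  show "Comp C X Y Z g (HZero C X Y) \<in> Hom C X Z" by (rule Comp_in_Hom[OF X z g])
  interpret G: comm_group "hom_group C X Y" by (rule hom_comm_group[OF X(1,2)])
  have "HAdd C X Y (HZero C X Y) (HZero C X Y) = HZero C X Y"
    using G.r_one[OF G.one_closed] by (simp add: hom_group_def)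
  then show "HAdd C X Z (Comp C X Y Z g (HZero C X Y)) (Comp C X Y Z g (HZero C X Y)) =
      Comp C X Y Z g (HZero C X Y)"
    using Comp_HAdd_right[OF X z z g] by simp
qed

lemma Comp_HZero_left:
  assumes X: "X \<in> Ob C" "Y \<in> Ob C" "Z \<in> Ob C" and f: "f \<in> Hom C X Y"
  shows "Comp C X Y Z (HZero C Y Z) f = HZero C X Z"
proof (rule HAdd_idem[OF X(1,3)])
  note z = HZero_in_Hom[OF X(2,3)]
  show "Comp C X Y Z (HZero C Y Z) f \<in> Hom C X Z" by (rule Comp_in_Hom[OF X f z])
  interpret G: comm_group "hom_group C Y Z" by (rule hom_comm_group[OF X(2,3)])
  have "HAdd C Y Z (HZero C Y Z) (HZero C Y Z) = HZero C Y Z"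
    using G.r_one[OF G.one_closed] by (simp add: hom_group_def)
  then show "HAdd C X Z (Comp C X Y Z (HZero C Y Z) f) (Comp C X Y Z (HZero C Y Z) f) =
      Comp C X Y Z (HZero C Y Z) f"
    using Comp_HAdd_left[OF X f z z] by simp
qed

end

text \<open>
  The copower of \<open>P\<close> over \<open>X\<close> is the colimit of the copowers over subsets of size at most \<open>K\<close>, which
  is \<open>\<kappa>\<close>-directed since \<open>\<kappa>\<close> does not exceed \<open>K\<close>. Maps out of a \<open>\<kappa>\<close>-presentable object hence factor.
\<close>

lemma presentable_factors_through_part:
  fixes C :: "('o, 'u, 'x) cat_scheme" and K :: "'u set" and Q :: "'u set \<Rightarrow> 'o"
  assumes inacc: "inaccessible_universe TYPE('u)" and cat: "category C"
    and Z: "presentable C \<kappa> Z" and \<kappa>: "Card_order \<kappa>" "Field \<kappa> \<subseteq> K"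
    and K: "infinite K" and P: "P \<in> Ob C"
    and Q: "\<And>A. small TYPE('u) A \<Longrightarrow> is_copower C P A (Q A) (c A)"
    and X: "small TYPE('u) X" and h: "h \<in> Hom C Z (Q X)"
  shows "\<exists>A \<subseteq> X. |A| \<le>o |K| \<and> (\<exists>i \<in> Hom C (Q A) (Q X). \<exists>h' \<in> Hom C Z (Q A).
    (\<forall>x \<in> A. Comp C P (Q A) (Q X) i (c A x) = c X x) \<and> h = Comp C Z (Q A) (Q X) i h')"
proof -
  interpret universe "TYPE('u)" by unfold_locales (rule inacc)
  interpret category C by (rule cat)
  have ZO: "Z \<in> Ob C" using Z by (simp add: presentable_def)
  define Ps where "Ps = {A. A \<subseteq> X \<and> |A| \<le>o |K|}"
  have sm: "small TYPE('u) A" if "A \<subseteq> X" for A using small_subset[OF X that] .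
  have QO: "Q A \<in> Ob C" and cA: "\<And>x. x \<in> A \<Longrightarrow> c A x \<in> Hom C P (Q A)" if "A \<subseteq> X" for A
    using Q[OF sm[OF that]] by (auto simp: is_copower_def)
  have smPs: "small TYPE('u) Ps" by (rule small_subset[OF small_Pow[OF X]]) (auto simp: Ps_def)
  \<comment> \<open>The indices of a colimit are elements of \<open>'u\<close>, so \<open>en\<close> and \<open>de\<close> translate between subsets and their codes.\<close>
  obtain en :: "'u set \<Rightarrow> 'u" where en: "inj_on en Ps" using small_embedding[OF smPs] by blast
  define de where "de = inv_into Ps en"
  have de: "de (en A) = A" if "A \<in> Ps" for A using that en by (simp add: de_def)
  define r where "r = {(en A, en B) | A B. A \<in> Ps \<and> B \<in> Ps \<and> A \<subseteq> B}"
  have rI: "(en A, en B) \<in> r" if "A \<in> Ps" "B \<in> Ps" "A \<subseteq> B" for A B using that by (auto simp: r_def)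
  have rD: "de i \<in> Ps" "de j \<in> Ps" "de i \<subseteq> de j" "i = en (de i)" "j = en (de j)" if "(i, j) \<in> r" for i j
    using that de by (auto simp: r_def)
  have Field_r: "Field r = en ` Ps" by (auto simp: r_def Field_def)
  have deF: "de i \<in> Ps" "en (de i) = i" if "i \<in> Field r" for i using that de by (auto simp: Field_r)
  have PsX: "A \<subseteq> X" if "A \<in> Ps" for A using that by (simp add: Ps_def)
  have sub: "(i, j) \<in> r \<longleftrightarrow> i \<in> Field r \<and> j \<in> Field r \<and> de i \<subseteq> de j" for i j
    using rD[of i j] rI[of "de i" "de j"] deF[of i] deF[of j] by (auto simp: Field_r)
  have dir: "directed_poset \<kappa> r"
    unfolding directed_poset_def partial_order_on_def preorder_on_def
  proof (intro conjI allI impI)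
    show "r \<subseteq> Field r \<times> Field r" using sub by auto
    show "refl_on (Field r) r" unfolding refl_on_def using sub by auto
    show "trans r" unfolding trans_def using sub by auto
    show "antisym r"
      unfolding antisym_def
    proof (intro allI impI)
      fix i j assume "(i, j) \<in> r" "(j, i) \<in> r"
      then show "i = j" using sub deF by (metis subset_antisym)
    qed
    show "small TYPE('u) (Field r)" unfolding Field_r by (rule small_image[OF smPs])
    fix W assume W: "W \<subseteq> Field r \<and> |W| <o \<kappa>"
    have "|W| \<le>o |Field \<kappa>|"
      using W ordLess_imp_ordLeq card_of_Field_ordIso[OF \<kappa>(1)] ordLeq_ordIso_trans ordIso_symmetric by blast
    then have WK: "|W| \<le>o |K|" using card_of_mono1[OF \<kappa>(2)] ordLeq_transitive by blast
    let ?b = "\<Union>i \<in> W. de i"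
    have "\<forall>i \<in> W. |de i| \<le>o |K|" using W deF(1) unfolding Ps_def by blast
    then have "|?b| \<le>o |K|" by (rule card_of_UNION_ordLeq_infinite[OF K WK])
    moreover have "?b \<subseteq> X" using W deF(1) PsX by blast
    ultimately have b: "?b \<in> Ps" by (simp add: Ps_def)
    show "\<exists>b \<in> Field r. \<forall>a \<in> W. (a, b) \<in> r"
    proof (intro bexI ballI)
      show "en ?b \<in> Field r" using b by (simp add: Field_r)
      fix a assume a: "a \<in> W"
      then have aF: "a \<in> Field r" using W by blast
      have "de a \<subseteq> ?b" using a by blast
      then show "(a, en ?b) \<in> r" using rI[OF deF(1)[OF aF] b] unfolding deF(2)[OF aF] by blast
    qed
  qed
  define inc where "inc A B = (SOME i. i \<in> Hom C (Q A) (Q B) \<and> (\<forall>x \<in> A. Comp C P (Q A) (Q B) i (c A x) = c B x))"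
    for A B
  have inc: "inc A B \<in> Hom C (Q A) (Q B)" "\<And>x. x \<in> A \<Longrightarrow> Comp C P (Q A) (Q B) (inc A B) (c A x) = c B x"
    if "A \<subseteq> B" "B \<subseteq> X" for A B
  proof -
    have AX: "A \<subseteq> X" using that by blast
    have "\<exists>i. i \<in> Hom C (Q A) (Q B) \<and> (\<forall>x \<in> A. Comp C P (Q A) (Q B) i (c A x) = c B x)"
      by (rule copower_ex[OF Q[OF sm[OF AX]] QO[OF that(2)]]) (use cA[OF that(2)] that(1) in blast)
    from someI_ex[OF this] show "inc A B \<in> Hom C (Q A) (Q B)"
      "\<And>x. x \<in> A \<Longrightarrow> Comp C P (Q A) (Q B) (inc A B) (c A x) = c B x"
      unfolding inc_def by blast+
  qed
  have uniq: "g = k" if "A \<subseteq> X" "Y \<in> Ob C" "g \<in> Hom C (Q A) Y" "k \<in> Hom C (Q A) Y"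
    "\<And>x. x \<in> A \<Longrightarrow> Comp C P (Q A) Y g (c A x) = Comp C P (Q A) Y k (c A x)" for A Y g k
    by (rule copower_unique[OF Q[OF sm[OF that(1)]] that(2) P that(3,4,5)])
  have inc_id: "inc A A = Idn C (Q A)" if A: "A \<subseteq> X" for A
    by (rule uniq[OF A QO[OF A] inc(1)[OF order_refl A] Idn_in_Hom[OF QO[OF A]]])
      (simp add: inc(2)[OF order_refl A] Comp_Idn_left[OF P QO[OF A] cA[OF A]])
  have inc_comp: "Comp C (Q A) (Q B) Y g (inc A B) = k"
    if A: "A \<subseteq> B" "B \<subseteq> X" and Y: "Y \<in> Ob C" and g: "g \<in> Hom C (Q B) Y" "k \<in> Hom C (Q A) Y"
      and eq: "\<And>x. x \<in> A \<Longrightarrow> Comp C P (Q B) Y g (c B x) = Comp C P (Q A) Y k (c A x)" for A B Y g k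
  proof -
    have AX: "A \<subseteq> X" using A by blast
    show ?thesis
    proof (rule uniq[OF AX Y Comp_in_Hom[OF QO[OF AX] QO[OF A(2)] Y inc(1)[OF A] g(1)] g(2)])
      fix x assume x: "x \<in> A"
      have "Comp C P (Q A) Y (Comp C (Q A) (Q B) Y g (inc A B)) (c A x)
        = Comp C P (Q B) Y g (Comp C P (Q A) (Q B) (inc A B) (c A x))"
        by (rule Comp_assoc[OF P QO[OF AX] QO[OF A(2)] Y cA[OF AX x] inc(1)[OF A] g(1)])
      then show "Comp C P (Q A) Y (Comp C (Q A) (Q B) Y g (inc A B)) (c A x) = Comp C P (Q A) Y k (c A x)"
        using inc(2)[OF A x] eq[OF x] by simp
    qed
  qed
  have inc_inc: "Comp C (Q A) (Q B) (Q B') (inc B B') (inc A B) = inc A B'"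
    if A: "A \<subseteq> B" "B \<subseteq> B'" "B' \<subseteq> X" for A B B'
  proof -
    have BX: "B \<subseteq> X" "A \<subseteq> B'" using A by auto
    show ?thesis
      by (rule inc_comp[OF A(1) BX(1) QO[OF A(3)] inc(1)[OF A(2,3)] inc(1)[OF BX(2) A(3)]])
        (use inc(2)[OF A(2,3)] inc(2)[OF BX(2) A(3)] A(1) in auto)
  qed
  let ?J = "poset_cat r"
  define D where "D = (\<lparr>Fob = \<lambda>i. Q (de i), Fmap = \<lambda>i j _. inc (de i) (de j)\<rparr> :: ('u, unit, 'o, 'u) func)"
  have J: "Ob ?J = Field r" "f \<in> Hom ?J i j \<longleftrightarrow> (i, j) \<in> r" for i j f by (auto simp: poset_cat_def)
  have fD: "Fob D i = Q (de i)" "Fmap D i j f = inc (de i) (de j)" for i j f by (auto simp: D_def)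
  have func: "is_functor ?J C D"
    unfolding is_functor_def J fD
  proof (intro conjI ballI)
    fix i assume i: "i \<in> Field r"
    show "Q (de i) \<in> Ob C" using QO PsX deF(1)[OF i] by blast
    show "inc (de i) (de i) = Idn C (Q (de i))" using inc_id PsX deF(1)[OF i] by blast
    fix j f assume "j \<in> Field r" "f \<in> Hom ?J i j"
    then have j: "j \<in> Field r" "(i, j) \<in> r" by (simp_all add: J)
    show "inc (de i) (de j) \<in> Hom C (Q (de i)) (Q (de j))"
      by (rule inc(1)[OF rD(3)[OF j(2)] PsX[OF rD(2)[OF j(2)]]])
    fix l g assume "l \<in> Field r" "g \<in> Hom ?J j l"
    then have l: "l \<in> Field r" "(j, l) \<in> r" by (simp_all add: J)
    show "inc (de i) (de l) = Comp C (Q (de i)) (Q (de j)) (Q (de l)) (inc (de j) (de l)) (inc (de i) (de j))"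
      by (rule inc_inc[OF rD(3)[OF j(2)] rD(3)[OF l(2)] PsX[OF rD(2)[OF l(2)]], symmetric])
  qed
  let ?c = "\<lambda>i. inc (de i) X"
  have deX: "de i \<subseteq> X" if "i \<in> Field r" for i using PsX deF(1)[OF that] .
  have singl: "{x} \<in> Ps" if "x \<in> X" for x
    using that card_of_singl_ordLeq[of K x] K by (auto simp: Ps_def)
  have col: "is_colimit ?J C D (Q X) ?c"
    unfolding is_colimit_def
  proof (intro conjI allI impI)
    show "is_cocone ?J C D (Q X) ?c"
      unfolding is_cocone_def J fD
    proof (intro conjI ballI)
      show "Q X \<in> Ob C" by (rule QO[OF order_refl])
      show "inc (de i) X \<in> Hom C (Q (de i)) (Q X)" if "i \<in> Field r" for i
        by (rule inc(1)[OF deX[OF that] order_refl])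
      show "Comp C (Q (de i)) (Q (de j)) (Q X) (inc (de j) X) (inc (de i) (de j)) = inc (de i) X"
        if ij: "i \<in> Field r" "j \<in> Field r" "f \<in> Hom ?J i j" for i j f
      proof -
        have "(i, j) \<in> r" using ij(3) by (simp add: J)
        then show ?thesis by (rule inc_inc[OF rD(3) deX[OF ij(2)] order_refl])
      qed
    qed
    fix Y d assume co: "is_cocone ?J C D Y d"
    have Y: "Y \<in> Ob C" and d: "\<And>i. i \<in> Field r \<Longrightarrow> d i \<in> Hom C (Q (de i)) Y"
      using co unfolding is_cocone_def J fD by blast+
    have dd: "Comp C (Q (de i)) (Q (de j)) Y (d j) (inc (de i) (de j)) = d i" if ij: "(i, j) \<in> r" for i j
    proof -
      have "i \<in> Field r" "j \<in> Field r" using ij sub by blast+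
      moreover have "() \<in> Hom ?J i j" using ij by (simp add: J)
      ultimately show ?thesis using co unfolding is_cocone_def J(1) fD by blast
    qed
    \<comment> \<open>A cocone on the parts is determined by its values on the parts with one element.\<close>
    define m where "m x = Comp C P (Q {x}) Y (d (en {x})) (c {x} x)" for x
    have sF: "en {x} \<in> Field r" if "x \<in> X" for x using singl[OF that] by (simp add: Field_r)
    have ds: "d (en {x}) \<in> Hom C (Q {x}) Y" if "x \<in> X" for x using d[OF sF[OF that]] de[OF singl[OF that]] by simp
    have mH: "m x \<in> Hom C P Y" if x: "x \<in> X" for x
      unfolding m_def using Comp_in_Hom[OF P QO Y cA ds[OF x]] x by simp
    obtain k where k: "k \<in> Hom C (Q X) Y" "\<forall>x \<in> X. Comp C P (Q X) Y k (c X x) = m x"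
      using copower_ex[OF Q[OF X] Y, of m] mH by blast
    have dm: "Comp C P (Q (de i)) Y (d i) (c (de i) x) = m x" if i: "i \<in> Field r" and x: "x \<in> de i" for i x
    proof -
      have xX: "x \<in> X" using x deX[OF i] by blast
      have s: "{x} \<subseteq> de i" "{x} \<subseteq> X" using x xX by auto
      have "(en {x}, i) \<in> r" using sub sF[OF xX] i de[OF singl[OF xX]] s by simp
      then have "d (en {x}) = Comp C (Q {x}) (Q (de i)) Y (d i) (inc {x} (de i))"
        using dd[of "en {x}" i] de[OF singl[OF xX]] by simp
      then have "m x = Comp C P (Q (de i)) Y (d i) (Comp C P (Q {x}) (Q (de i)) (inc {x} (de i)) (c {x} x))"
        unfolding m_def
        using Comp_assoc[OF P QO[OF s(2)] QO[OF deX[OF i]] Y cA[OF s(2)] inc(1)[OF s(1) deX[OF i]] d[OF i]] by simp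
      then show ?thesis using inc(2)[OF s(1) deX[OF i]] by simp
    qed
    show "\<exists>!h. h \<in> Hom C (Q X) Y \<and> (\<forall>i \<in> Ob ?J. Comp C (Fob D i) (Q X) Y h (?c i) = d i)"
      unfolding J fD
    proof (intro ex1I[of _ k] conjI ballI k(1))
      fix i assume i: "i \<in> Field r"
      show "Comp C (Q (de i)) (Q X) Y k (inc (de i) X) = d i"
        by (rule inc_comp[OF deX[OF i] order_refl Y k(1) d[OF i]])
          (use k(2) dm[OF i] deX[OF i] in auto)
    next
      fix k' assume k': "k' \<in> Hom C (Q X) Y \<and> (\<forall>i \<in> Field r. Comp C (Q (de i)) (Q X) Y k' (inc (de i) X) = d i)"
      show "k' = k"
      proof (rule uniq[OF order_refl Y _ k(1)])
        show "k' \<in> Hom C (Q X) Y" using k' by blast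
        fix x assume x: "x \<in> X"
        have s: "{x} \<subseteq> X" using x by simp
        have "Comp C (Q {x}) (Q X) Y k' (inc {x} X) = d (en {x})"
          using k' sF[OF x] de[OF singl[OF x]] by metis
        then have "m x = Comp C P (Q X) Y k' (Comp C P (Q {x}) (Q X) (inc {x} X) (c {x} x))"
          unfolding m_def
          using Comp_assoc[OF P QO[OF s] QO[OF order_refl] Y cA[OF s] inc(1)[OF s order_refl], of x k'] k' by simp
        then show "Comp C P (Q X) Y k' (c X x) = Comp C P (Q X) Y k (c X x)"
          using inc(2)[OF s order_refl, of x] k(2) x by simp
      qed
    qed
  qed
  have setcol: "is_colimit ?J Set_cat (func_comp (hom_functor C Z) D) (Hom C Z (Q X))
      (\<lambda>i. Fmap (hom_functor C Z) (Fob D i) (Q X) (?c i))"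
    using Z dir func col unfolding presentable_def by (simp add: hom_functor_def)
  have "\<exists>i \<in> Ob ?J. \<exists>z \<in> Fob (func_comp (hom_functor C Z) D) i.
      Fmap (hom_functor C Z) (Fob D i) (Q X) (?c i) z = h"
  proof (rule colimit_Set_cat_surj[OF inacc setcol _ h])
    fix i j f z
    assume i: "i \<in> Ob ?J" "j \<in> Ob ?J" "f \<in> Hom ?J i j" and z: "z \<in> Fob (func_comp (hom_functor C Z) D) i"
    then have ij: "(i, j) \<in> r" "i \<in> Field r" "j \<in> Field r" by (simp_all add: J)
    have zH: "z \<in> Hom C Z (Q (de i))" using z by (simp add: func_comp_def hom_functor_def fD)
    have "Comp C Z (Q (de i)) (Q (de j)) (inc (de i) (de j)) z \<in> Hom C Z (Q (de j))"
      using Comp_in_Hom[OF ZO QO QO zH inc(1)] deX ij rD(3)[OF ij(1)] by simp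
    then show "Fmap (func_comp (hom_functor C Z) D) i j f z \<in> Fob (func_comp (hom_functor C Z) D) j"
      using zH by (simp add: func_comp_def hom_functor_def fD)
  qed
  then obtain i z where i: "i \<in> Field r" and z: "z \<in> Hom C Z (Q (de i))"
    "Comp C Z (Q (de i)) (Q X) (inc (de i) X) z = h"
    by (auto simp: func_comp_def hom_functor_def fD J)
  have "|de i| \<le>o |K|" using deF(1)[OF i] by (simp add: Ps_def)
  moreover have "\<forall>x \<in> de i. Comp C P (Q (de i)) (Q X) (inc (de i) X) (c (de i) x) = c X x"
    using inc(2)[OF deX[OF i] order_refl] by blast
  ultimately show ?thesis
    using deX[OF i] inc(1)[OF deX[OF i] order_refl] z by (intro exI[of _ "de i"]) blast
qed

text \<open>
  \<open>P\<close> is a colimit of presentable objects over a small poset \<open>r\<close>. The restriction of \<open>t\<close> to each of these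
  objects has its values in a part of size at most \<open>K\<close>, and \<open>K\<close> is chosen so large that the union over \<open>r\<close>
  of these parts is no larger. Membership in a part is expressed by the idempotents \<open>e\<close>, which
  compose well.
\<close>

lemma copower_support:
  fixes C :: "('o, 'u, 'x) addcat_scheme" and Q :: "'u set \<Rightarrow> 'o"
  assumes inacc: "inaccessible_universe TYPE('u)" and cat: "preadditive_category C"
    and lp: "locally_presentable C" and P: "P \<in> Ob C"
    and Q: "\<And>A. small TYPE('u) A \<Longrightarrow> is_copower C P A (Q A) (c A)"
  shows "\<exists>K :: 'u set. small TYPE('u) K \<and> infinite K \<and>
    (\<forall>X. small TYPE('u) X \<longrightarrow> (\<forall>t \<in> Hom C P (Q X). \<exists>A \<subseteq> X. |A| \<le>o |K| \<and>
      (\<forall>e \<in> Hom C (Q X) (Q X). (\<forall>x \<in> X. Comp C P (Q X) (Q X) e (c X x) =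
          (if x \<in> A then c X x else HZero C P (Q X))) \<longrightarrow> Comp C P (Q X) (Q X) e t = t)))"
proof -
  interpret universe "TYPE('u)" by unfold_locales (rule inacc)
  interpret preadditive_category C by (rule cat)
  obtain \<kappa> :: "'u rel" and S0 where \<kappa>: "small_regular_cardinal \<kappa>" and S0: "S0 \<subseteq> Ob C" "\<forall>Z \<in> S0. presentable C \<kappa> Z"
    and gen: "\<forall>Y \<in> Ob C. \<exists>(r :: 'u rel) D b. directed_poset \<kappa> r \<and> is_functor (poset_cat r) C D \<and>
              (\<forall>i \<in> Field r. Fob D i \<in> S0) \<and> is_colimit (poset_cat r) C D Y b"
    using lp unfolding locally_presentable_def by blast
  obtain r :: "'u rel" and D b where r: "directed_poset \<kappa> r" "is_functor (poset_cat r) C D"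
    "\<forall>i \<in> Field r. Fob D i \<in> S0" "is_colimit (poset_cat r) C D P b"
    using gen P by blast
  \<comment> \<open>\<open>Field r\<close> bounds the number of parts to be united and \<open>Field \<kappa>\<close> the directedness required of the diagram of
    parts. Neither depends on \<open>X\<close>.\<close>
  define K where "K = Field r \<union> Field \<kappa>"
  have co: "Card_order \<kappa>" and infF: "infinite (Field \<kappa>)"
    using \<kappa> by (auto simp: small_regular_cardinal_def cinfinite_def)
  have "small TYPE('u) (Field \<kappa>)"
    using \<kappa> card_of_Field_ordIso[OF co] ordIso_ordLess_trans
    unfolding small_regular_cardinal_def small_def by blast
  then have smK: "small TYPE('u) K"
    using r(1) unfolding K_def directed_poset_def by (blast intro: small_Un)
  have infK: "infinite K" using infF by (simp add: K_def)
  have J: "Ob (poset_cat r) = Field r" "f \<in> Hom (poset_cat r) i j \<longleftrightarrow> (i, j) \<in> r" for i j f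
    by (auto simp: poset_cat_def)
  have main: "\<exists>A \<subseteq> X. |A| \<le>o |K| \<and> (\<forall>e \<in> Hom C (Q X) (Q X). (\<forall>x \<in> X. Comp C P (Q X) (Q X) e (c X x) =
          (if x \<in> A then c X x else HZero C P (Q X))) \<longrightarrow> Comp C P (Q X) (Q X) e t = t)"
    if X: "small TYPE('u) X" and t: "t \<in> Hom C P (Q X)" for X t
  proof -
    have QX: "Q X \<in> Ob C" "\<And>x. x \<in> X \<Longrightarrow> c X x \<in> Hom C P (Q X)"
      using Q[OF X] by (auto simp: is_copower_def)
    note z0 = HZero_in_Hom[OF P QX(1)]
    have DO: "Fob D i \<in> Ob C" and b: "b i \<in> Hom C (Fob D i) P" if "i \<in> Field r" for i
      using r(2,4) that unfolding is_functor_def is_colimit_def is_cocone_def J by blast+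
    let ?h = "\<lambda>i. Comp C (Fob D i) P (Q X) t (b i)"
    have h: "?h i \<in> Hom C (Fob D i) (Q X)" if "i \<in> Field r" for i
      by (rule Comp_in_Hom[OF DO[OF that] P QX(1) b[OF that] t])
    have fac: "\<exists>A \<subseteq> X. |A| \<le>o |K| \<and> (\<exists>k \<in> Hom C (Q A) (Q X). \<exists>h' \<in> Hom C (Fob D i) (Q A).
      (\<forall>x \<in> A. Comp C P (Q A) (Q X) k (c A x) = c X x) \<and> ?h i = Comp C (Fob D i) (Q A) (Q X) k h')"
      if i: "i \<in> Field r" for i
      by (rule presentable_factors_through_part[OF inacc category_axioms _ co _ infK P Q X h[OF i]])
        (use S0(2) r(3) i in \<open>auto simp: K_def\<close>)
    define part where "part e A \<longleftrightarrow> e \<in> Hom C (Q X) (Q X) \<and> (\<forall>x \<in> X. Comp C P (Q X) (Q X) e (c X x) =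
          (if x \<in> A then c X x else HZero C P (Q X)))" for e A
    have part_ex: "\<exists>e. part e A" for A
      using copower_ex[OF Q[OF X] QX(1), of "\<lambda>x. if x \<in> A then c X x else HZero C P (Q X)"] QX(2) z0
      unfolding part_def by auto
    have fixed: "\<exists>A \<subseteq> X. |A| \<le>o |K| \<and> (\<forall>e. part e A \<longrightarrow> Comp C (Fob D i) (Q X) (Q X) e (?h i) = ?h i)"
      if i: "i \<in> Field r" for i
    proof -
      obtain A k h' where A: "A \<subseteq> X" "|A| \<le>o |K|" and k: "k \<in> Hom C (Q A) (Q X)"
        and h': "h' \<in> Hom C (Fob D i) (Q A)" "?h i = Comp C (Fob D i) (Q A) (Q X) k h'"
        and kc: "\<forall>x \<in> A. Comp C P (Q A) (Q X) k (c A x) = c X x"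
        using fac[OF i] by blast
      note sA = small_subset[OF X A(1)]
      have QA: "Q A \<in> Ob C" "\<And>x. x \<in> A \<Longrightarrow> c A x \<in> Hom C P (Q A)"
        using Q[OF sA] by (auto simp: is_copower_def)
      have "Comp C (Fob D i) (Q X) (Q X) e (?h i) = ?h i" if e: "part e A" for e
      proof -
        have eH: "e \<in> Hom C (Q X) (Q X)" using e by (simp add: part_def)
        have "Comp C (Q A) (Q X) (Q X) e k = k"
        proof (rule copower_unique[OF Q[OF sA] QX(1) P Comp_in_Hom[OF QA(1) QX(1) QX(1) k eH] k])
          fix x assume x: "x \<in> A"
          have "Comp C P (Q A) (Q X) (Comp C (Q A) (Q X) (Q X) e k) (c A x) =
              Comp C P (Q X) (Q X) e (Comp C P (Q A) (Q X) k (c A x))"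
            by (rule Comp_assoc[OF P QA(1) QX(1) QX(1) QA(2)[OF x] k eH])
          then show "Comp C P (Q A) (Q X) (Comp C (Q A) (Q X) (Q X) e k) (c A x) = Comp C P (Q A) (Q X) k (c A x)"
            using kc x e A(1) by (auto simp: part_def)
        qed
        then show ?thesis
          unfolding h'(2) using Comp_assoc[OF DO[OF i] QA(1) QX(1) QX(1) h'(1) k eH] by simp
      qed
      then show ?thesis using A by blast
    qed
    then obtain As where As: "\<And>i. i \<in> Field r \<Longrightarrow> As i \<subseteq> X" "\<And>i. i \<in> Field r \<Longrightarrow> |As i| \<le>o |K|"
      "\<And>i e. i \<in> Field r \<Longrightarrow> part e (As i) \<Longrightarrow> Comp C (Fob D i) (Q X) (Q X) e (?h i) = ?h i"
      by metis
    define A where "A = (\<Union>i \<in> Field r. As i)"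
    have "|Field r| \<le>o |K|" by (rule card_of_mono1) (simp add: K_def)
    then have AK: "|A| \<le>o |K|"
      unfolding A_def using As(2) by (intro card_of_UNION_ordLeq_infinite[OF infK]) auto
    have AX: "A \<subseteq> X" using As(1) by (auto simp: A_def)
    have "Comp C P (Q X) (Q X) e t = t" if e: "part e A" for e
    proof (rule colimit_jointly_epi[OF r(4) _ _ QX(1) _ t])
      have eH: "e \<in> Hom C (Q X) (Q X)" using e by (simp add: part_def)
      show "Comp C P (Q X) (Q X) e t \<in> Hom C P (Q X)" by (rule Comp_in_Hom[OF P QX(1) QX(1) t eH])
      show "Fob D i \<in> Ob C" if "i \<in> Ob (poset_cat r)" for i using DO that by (simp add: J)
      show "Fmap D i j f \<in> Hom C (Fob D i) (Fob D j)"
        if "i \<in> Ob (poset_cat r)" "j \<in> Ob (poset_cat r)" "f \<in> Hom (poset_cat r) i j" for i j f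
        using r(2) that unfolding is_functor_def by blast
      fix i assume "i \<in> Ob (poset_cat r)"
      then have i: "i \<in> Field r" by (simp add: J)
      obtain e' where e': "part e' (As i)" using part_ex by blast
      have e'H: "e' \<in> Hom C (Q X) (Q X)" using e' by (simp add: part_def)
      \<comment> \<open>Retaining the summands in \<open>As i\<close>, and then those in the larger \<open>A\<close>, is the same as retaining \<open>As i\<close> only.\<close>
      have "Comp C (Q X) (Q X) (Q X) e e' = e'"
      proof (rule copower_unique[OF Q[OF X] QX(1) P Comp_in_Hom[OF QX(1) QX(1) QX(1) e'H eH] e'H])
        fix x assume x: "x \<in> X"
        have 1: "Comp C P (Q X) (Q X) (Comp C (Q X) (Q X) (Q X) e e') (c X x) =
            Comp C P (Q X) (Q X) e (Comp C P (Q X) (Q X) e' (c X x))"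
          by (rule Comp_assoc[OF P QX(1) QX(1) QX(1) QX(2)[OF x] e'H eH])
        show "Comp C P (Q X) (Q X) (Comp C (Q X) (Q X) (Q X) e e') (c X x) = Comp C P (Q X) (Q X) e' (c X x)"
        proof (cases "x \<in> As i")
          case True
          then have "x \<in> A" using i by (auto simp: A_def)
          then show ?thesis using 1 True x e e' by (simp add: part_def)
        next
          case False
          then show ?thesis using 1 x e' Comp_HZero_right[OF P QX(1) QX(1) eH] by (simp add: part_def)
        qed
      qed
      then have "Comp C (Fob D i) (Q X) (Q X) e (Comp C (Fob D i) (Q X) (Q X) e' (?h i)) =
          Comp C (Fob D i) (Q X) (Q X) e' (?h i)"
        using Comp_assoc[OF DO[OF i] QX(1) QX(1) QX(1) h[OF i] e'H eH] by simp
      then have "Comp C (Fob D i) (Q X) (Q X) e (?h i) = ?h i" using As(3)[OF i e'] by simp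
      then show "Comp C (Fob D i) P (Q X) (Comp C P (Q X) (Q X) e t) (b i) = Comp C (Fob D i) P (Q X) t (b i)"
        using Comp_assoc[OF DO[OF i] P QX(1) QX(1) b[OF i] t eH] by simp
    qed
    then show ?thesis using AX AK unfolding part_def by blast
  qed
  show ?thesis
    using smK infK main by (intro exI[of _ K]) simp
qed

section \<open>The functor Theta\<close>

locale theta_embedding = module_universe U R + B: abelian_category B
  for U :: "'u itself" and R :: "'r ring" and B :: "('o, 'u) addcat" +
  fixes P :: 'o and \<theta> :: "'r \<Rightarrow> 'u"
  assumes lp: "locally_presentable B"
    and pg: "projective_generator B P"
    and \<theta>_hom: "\<theta> \<in> ring_hom R (End_op B P)"
    and ff: "fully_faithful B (RMod R) (Theta B P \<theta>)"
begin

abbreviation Th :: "'o \<Rightarrow> ('r, 'u) module" where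
  "Th X \<equiv> Fob (Theta B P \<theta>) X"

lemma Th_simps [simp]:
  "carrier (Th X) = Hom B P X" "\<zero>\<^bsub>Th X\<^esub> = HZero B P X" "x \<oplus>\<^bsub>Th X\<^esub> y = HAdd B P X x y"
  "a \<odot>\<^bsub>Th X\<^esub> x = Comp B P P X x (\<theta> a)"
  by (simp_all add: Theta_def)

lemma P_Ob: "P \<in> Ob B"
  using pg by (simp add: projective_generator_def)

lemma \<theta>_simps:
  "a \<in> carrier R \<Longrightarrow> \<theta> a \<in> Hom B P P"
  "a \<in> carrier R \<Longrightarrow> b \<in> carrier R \<Longrightarrow> \<theta> (a \<oplus>\<^bsub>R\<^esub> b) = HAdd B P P (\<theta> a) (\<theta> b)"
  "a \<in> carrier R \<Longrightarrow> b \<in> carrier R \<Longrightarrow> \<theta> (a \<otimes>\<^bsub>R\<^esub> b) = Comp B P P P (\<theta> b) (\<theta> a)"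
  "\<theta> \<one>\<^bsub>R\<^esub> = Idn B P"
  using \<theta>_hom by (auto simp: ring_hom_def End_op_def)

lemma Th_obj:
  assumes X: "X \<in> Ob B"
  shows "obj (Th X)"
proof -
  interpret R: ring R by (rule ring_R)
  interpret G: comm_group "hom_group B P X" by (rule B.hom_comm_group[OF P_Ob X])
  have g: "carrier (hom_group B P X) = Hom B P X" "mult (hom_group B P X) = HAdd B P X"
    "one (hom_group B P X) = HZero B P X" by (simp_all add: hom_group_def)
  note G = G.m_closed[unfolded g] G.one_closed[unfolded g] G.m_assoc[unfolded g] G.m_comm[unfolded g]
    G.l_one[unfolded g] G.l_inv[unfolded g] G.inv_closed[unfolded g]
  have "lm (Th X)"
  proof (rule left_moduleI)
    show "\<exists>y \<in> carrier (Th X). y \<oplus>\<^bsub>Th X\<^esub> x = \<zero>\<^bsub>Th X\<^esub>" if "x \<in> carrier (Th X)" for x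
      using that G(6,7)[of x] by auto
    show "x \<oplus>\<^bsub>Th X\<^esub> y = y \<oplus>\<^bsub>Th X\<^esub> x" if "x \<in> carrier (Th X)" "y \<in> carrier (Th X)" for x y
      using that G(4)[of x y] by simp
    show "(a \<oplus>\<^bsub>R\<^esub> b) \<odot>\<^bsub>Th X\<^esub> x = a \<odot>\<^bsub>Th X\<^esub> x \<oplus>\<^bsub>Th X\<^esub> b \<odot>\<^bsub>Th X\<^esub> x"
      if "a \<in> carrier R" "b \<in> carrier R" "x \<in> carrier (Th X)" for a b x
      using that B.Comp_HAdd_right[OF P_Ob P_Ob X, of "\<theta> a" "\<theta> b" x] by (simp add: \<theta>_simps)
    show "(a \<otimes>\<^bsub>R\<^esub> b) \<odot>\<^bsub>Th X\<^esub> x = a \<odot>\<^bsub>Th X\<^esub> (b \<odot>\<^bsub>Th X\<^esub> x)"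
      if "a \<in> carrier R" "b \<in> carrier R" "x \<in> carrier (Th X)" for a b x
      using that B.Comp_assoc[OF P_Ob P_Ob P_Ob X, of "\<theta> a" "\<theta> b" x] by (simp add: \<theta>_simps)
  qed (use G \<theta>_simps B.Comp_in_Hom[OF P_Ob P_Ob X] B.Comp_HAdd_left[OF P_Ob P_Ob X]
      B.Comp_Idn_right[OF P_Ob X] in simp_all)
  then show ?thesis
    using lp X P_Ob by (simp add: obj_iff locally_presentable_def locally_small_def)
qed

lemma Th_lm [simp]: "X \<in> Ob B \<Longrightarrow> lm (Th X)"
  using Th_obj by simp

lemma Th_map:
  assumes "X \<in> Ob B" "Y \<in> Ob B" "g \<in> Hom B X Y"
  shows "lin (Th X) (Th Y) (\<lambda>f. Comp B P X Y g f)"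
  using assms P_Ob
  by (intro linI) (simp_all add: B.Comp_in_Hom B.Comp_HAdd_right B.Comp_assoc \<theta>_simps)

lemma Th_full:
  assumes X: "X \<in> Ob B" "Y \<in> Ob B" and G: "lin (Th X) (Th Y) G"
  shows "\<exists>g \<in> Hom B X Y. \<forall>f \<in> Hom B P X. G f = Comp B P X Y g f"
proof -
  let ?G = "restrict G (carrier (Th X))"
  have "?G \<in> Hom (RMod R) (Th X) (Th Y)" by (rule restrict_Hom[OF G]) (simp add: X)
  then have "?G \<in> Fmap (Theta B P \<theta>) X Y ` Hom B X Y"
    using ff X unfolding fully_faithful_def bij_betw_def by blast
  then obtain g where g: "g \<in> Hom B X Y" "?G = Fmap (Theta B P \<theta>) X Y g" by blast
  have "G f = Comp B P X Y g f" if "f \<in> Hom B P X" for f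
    using fun_cong[OF g(2), of f] that by (simp add: Theta_def)
  then show ?thesis using g(1) by blast
qed

lemma generator:
  assumes "X \<in> Ob B" "Y \<in> Ob B" "g \<in> Hom B X Y" "h \<in> Hom B X Y"
    "\<And>f. f \<in> Hom B P X \<Longrightarrow> Comp B P X Y g f = Comp B P X Y h f"
  shows "g = h"
  using pg assms unfolding projective_generator_def by blast

definition copower_choice :: "'u set \<Rightarrow> 'o \<times> ('u \<Rightarrow> 'u)" where
  "copower_choice X = (SOME p. is_copower B P X (fst p) (snd p))"

abbreviation Q :: "'u set \<Rightarrow> 'o" where "Q X \<equiv> fst (copower_choice X)"

abbreviation c :: "'u set \<Rightarrow> 'u \<Rightarrow> 'u" where "c X \<equiv> snd (copower_choice X)"

abbreviation S :: "('r, 'u) module set" where "S \<equiv> Theta_image B P R \<theta>"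

lemma copower:
  assumes X: "small TYPE('u) X"
  shows "is_copower B P X (Q X) (c X)" "Q X \<in> Ob B" "\<And>x. x \<in> X \<Longrightarrow> c X x \<in> Hom B P (Q X)"
proof -
  have "\<exists>A b. is_copower B P X A b"
    using ex_copower[OF inaccessible B.category_axioms _ P_Ob X] lp
    by (simp add: locally_presentable_def)
  then have "\<exists>p. is_copower B P X (fst p) (snd p)" by simp
  then show "is_copower B P X (Q X) (c X)" unfolding copower_choice_def by (rule someI_ex)
  then show "Q X \<in> Ob B" "\<And>x. x \<in> X \<Longrightarrow> c X x \<in> Hom B P (Q X)" by (auto simp: is_copower_def)
qed

lemma S_iff: "M \<in> S \<longleftrightarrow> obj M \<and> (\<exists>X \<in> Ob B. iso_modules (Th X) M)"
  unfolding Theta_image_def essential_image_def using isomorphic_iff Th_obj by blast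

text \<open>
  Full faithfulness identifies linear maps from \<open>Th (Q X)\<close> with morphisms from \<open>Q X\<close>, and the unit \<open>c X\<close> with
  the coprojections, so this is the universal property of the copower.
\<close>

lemma Th_free:
  assumes X: "small TYPE('u) X" and Y: "Y \<in> Ob B"
  shows "free_towards R (Th (Q X)) (c X) X (Th Y)"
  unfolding free_towards_def
proof (intro conjI allI impI ballI)
  note cp = copower[OF X]
  fix m assume "\<forall>x \<in> X. m x \<in> carrier (Th Y)"
  then obtain h where h: "h \<in> Hom B (Q X) Y" "\<forall>x \<in> X. Comp B P (Q X) Y h (c X x) = m x"
    using B.copower_ex[OF cp(1) Y, of m] by auto
  then show "\<exists>g. lin (Th (Q X)) (Th Y) g \<and> (\<forall>x \<in> X. g (c X x) = m x)"
    using Th_map[OF cp(2) Y h(1)] by blast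
next
  note cp = copower[OF X]
  fix g h t
  assume gh: "lin (Th (Q X)) (Th Y) g \<and> lin (Th (Q X)) (Th Y) h \<and> (\<forall>x \<in> X. g (c X x) = h (c X x))"
    and t: "t \<in> carrier (Th (Q X))"
  obtain g' where g': "g' \<in> Hom B (Q X) Y" "\<forall>f \<in> Hom B P (Q X). g f = Comp B P (Q X) Y g' f"
    using Th_full[OF cp(2) Y] gh by blast
  obtain h' where h': "h' \<in> Hom B (Q X) Y" "\<forall>f \<in> Hom B P (Q X). h f = Comp B P (Q X) Y h' f"
    using Th_full[OF cp(2) Y] gh by blast
  have "g' = h'"
  proof (rule B.copower_unique[OF cp(1) Y P_Ob g'(1) h'(1)])
    fix x assume x: "x \<in> X"
    show "Comp B P (Q X) Y g' (c X x) = Comp B P (Q X) Y h' (c X x)"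
      using gh g'(2) h'(2) cp(3)[OF x] x by metis
  qed
  then show "g t = h t" using g'(2) h'(2) t by simp
qed

lemma epi_surj:
  assumes X: "X \<in> Ob B" "Y \<in> Ob B" and g: "is_epi B X Y g"
  shows "(\<lambda>f. Comp B P X Y g f) ` Hom B P X = Hom B P Y"
proof (intro equalityI subsetI)
  have gH: "g \<in> Hom B X Y" using g by (simp add: is_epi_def)
  fix f assume "f \<in> (\<lambda>f. Comp B P X Y g f) ` Hom B P X"
  then show "f \<in> Hom B P Y" using B.Comp_in_Hom[OF P_Ob X _ gH] by blast
next
  fix f assume f: "f \<in> Hom B P Y"
  then obtain h where "h \<in> Hom B P X" "Comp B P X Y g h = f"
    using pg X g unfolding projective_generator_def by blast
  then show "f \<in> (\<lambda>f. Comp B P X Y g f) ` Hom B P X" by blast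
qed

text \<open>
  Exactness of \<open>Theta\<close>, for cokernels. In the factorisation of \<open>\<delta>\<close> through the kernel of its cokernel, the
  first map is epi: a map \<open>v\<close> killing it has as kernel a subobject of \<open>A\<close> that is again a kernel,
  of some map vanishing on \<open>\<delta>\<close>, so this subobject is everything.
\<close>

lemma Th_cokernel:
  assumes A: "A \<in> Ob B" "Y \<in> Ob B" and \<delta>: "linear_map R (Th Y) (Th A) \<delta>"
  shows "\<exists>C \<in> Ob B. \<exists>q. lin (Th A) (Th C) q \<and> q ` carrier (Th A) = carrier (Th C) \<and>
    (\<forall>t \<in> carrier (Th A). q t = \<zero>\<^bsub>Th C\<^esub> \<longleftrightarrow> t \<in> \<delta> ` carrier (Th Y))"
proof -
  obtain d where d: "d \<in> Hom B Y A" "\<forall>f \<in> Hom B P Y. \<delta> f = Comp B P Y A d f"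
    using Th_full[OF A(2,1) \<delta>] by blast
  obtain C q where "is_cokernel B Y A C d q" using B.ex_cokernel[OF A(2,1) d(1)] by blast
  then have C: "C \<in> Ob B" and q: "q \<in> Hom B A C" and qd: "Comp B Y A C q d = HZero B Y C"
    and qu: "\<And>T t. \<lbrakk>T \<in> Ob B; t \<in> Hom B A T; Comp B Y A T t d = HZero B Y T\<rbrakk> \<Longrightarrow>
      \<exists>!u. u \<in> Hom B C T \<and> Comp B A C T u q = t"
    by (auto simp: is_cokernel_def)
  have q_epi: "is_epi B A C q"
    unfolding is_epi_def
  proof (intro conjI q ballI impI)
    fix T g h assume T: "T \<in> Ob B" and g: "g \<in> Hom B C T" "h \<in> Hom B C T"
      and eq: "Comp B A C T g q = Comp B A C T h q"
    have "Comp B Y A T (Comp B A C T g q) d = HZero B Y T"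
      using B.Comp_assoc[OF A(2,1) C T d(1) q g(1)] qd B.Comp_HZero_right[OF A(2) C T g(1)] by simp
    from qu[OF T B.Comp_in_Hom[OF A(1) C T q g(1)] this] show "g = h" using g eq by metis
  qed
  obtain I k where "is_kernel B I A C k q" using B.ex_kernel[OF A(1) C q] by blast
  then have I: "I \<in> Ob B" and k: "k \<in> Hom B I A" and qk: "Comp B I A C q k = HZero B I C"
    and ku: "\<And>T t. \<lbrakk>T \<in> Ob B; t \<in> Hom B T A; Comp B T A C q t = HZero B T C\<rbrakk> \<Longrightarrow>
      \<exists>!u. u \<in> Hom B T I \<and> Comp B T I A k u = t"
    by (auto simp: is_kernel_def)
  have k_mono: "u = u'" if "T \<in> Ob B" "u \<in> Hom B T I" "u' \<in> Hom B T I" "Comp B T I A k u = Comp B T I A k u'"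
    for T u u'
  proof -
    have "Comp B T A C q (Comp B T I A k u) = HZero B T C"
      using B.Comp_assoc[OF that(1) I A(1) C that(2) k q] qk B.Comp_HZero_left[OF that(1) I C that(2)] by simp
    from ku[OF that(1) B.Comp_in_Hom[OF that(1) I A(1) that(2) k] this] show ?thesis using that by metis
  qed
  obtain e where e: "e \<in> Hom B Y I" "Comp B Y I A k e = d" using ku[OF A(2) d(1) qd] by blast
  \<comment> \<open>A map that kills \<open>e\<close> is zero. In the notation below, \<open>L\<close> is the kernel of \<open>v\<close> and also the kernel of some
    \<open>w\<close> out of \<open>A\<close>; \<open>d\<close> factors through \<open>L\<close>, so \<open>w\<close> factors through \<open>q\<close> and kills \<open>I\<close>. Hence \<open>I\<close> lies in \<open>L\<close>.\<close>
  have e_epi0: "v = HZero B I T" if T: "T \<in> Ob B" and v: "v \<in> Hom B I T" and ve: "Comp B Y I T v e = HZero B Y T"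
    for T v
  proof -
    obtain L l where "is_kernel B L I T l v" using B.ex_kernel[OF I T v] by blast
    then have L: "L \<in> Ob B" and l: "l \<in> Hom B L I" and vl: "Comp B L I T v l = HZero B L T"
      and lu: "\<And>W t. \<lbrakk>W \<in> Ob B; t \<in> Hom B W I; Comp B W I T v t = HZero B W T\<rbrakk> \<Longrightarrow>
        \<exists>!u. u \<in> Hom B W L \<and> Comp B W L I l u = t"
      by (auto simp: is_kernel_def)
    have l_mono: "u = u'" if "W \<in> Ob B" "u \<in> Hom B W L" "u' \<in> Hom B W L" "Comp B W L I l u = Comp B W L I l u'"
      for W u u'
    proof -
      have "Comp B W I T v (Comp B W L I l u) = HZero B W T"
        using B.Comp_assoc[OF that(1) L I T that(2) l v] vl B.Comp_HZero_left[OF that(1) L T that(2)] by simp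
      from lu[OF that(1) B.Comp_in_Hom[OF that(1) L I that(2) l] this] show ?thesis using that by metis
    qed
    let ?kl = "Comp B L I A k l"
    have kl: "?kl \<in> Hom B L A" by (rule B.Comp_in_Hom[OF L I A(1) l k])
    have "is_mono B L A ?kl"
      unfolding is_mono_def
    proof (intro conjI kl ballI impI)
      fix W u u' assume W: "W \<in> Ob B" and u: "u \<in> Hom B W L" "u' \<in> Hom B W L"
        and eq: "Comp B W L A ?kl u = Comp B W L A ?kl u'"
      have "Comp B W I A k (Comp B W L I l u) = Comp B W I A k (Comp B W L I l u')"
        using eq B.Comp_assoc[OF W L I A(1) u(1) l k] B.Comp_assoc[OF W L I A(1) u(2) l k] by simp
      then have "Comp B W L I l u = Comp B W L I l u'"
        by (rule k_mono[OF W B.Comp_in_Hom[OF W L I u(1) l] B.Comp_in_Hom[OF W L I u(2) l]])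
      then show "u = u'" by (rule l_mono[OF W u])
    qed
    then obtain Z w where Z: "Z \<in> Ob B" and "is_kernel B L A Z ?kl w"
      using B.mono_is_kernel[OF L A(1)] by blast
    then have w: "w \<in> Hom B A Z" and wkl: "Comp B L A Z w ?kl = HZero B L Z"
      and wu: "\<And>W t. \<lbrakk>W \<in> Ob B; t \<in> Hom B W A; Comp B W A Z w t = HZero B W Z\<rbrakk> \<Longrightarrow>
        \<exists>!u. u \<in> Hom B W L \<and> Comp B W L A ?kl u = t"
      by (auto simp: is_kernel_def)
    obtain e' where e': "e' \<in> Hom B Y L" "Comp B Y L I l e' = e" using lu[OF A(2) e(1) ve] by blast
    have "Comp B Y L A ?kl e' = d" using B.Comp_assoc[OF A(2) L I A(1) e'(1) l k] e' e by simp
    then have "Comp B Y A Z w d = HZero B Y Z"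
      using B.Comp_assoc[OF A(2) L A(1) Z e'(1) kl w] wkl B.Comp_HZero_left[OF A(2) L Z e'(1)] by simp
    then obtain w' where w': "w' \<in> Hom B C Z" "Comp B A C Z w' q = w" using qu[OF Z w] by blast
    have "Comp B I A Z w k = HZero B I Z"
      using B.Comp_assoc[OF I A(1) C Z k q w'(1)] w'(2) qk B.Comp_HZero_right[OF I C Z w'(1)] by simp
    then obtain s where s: "s \<in> Hom B I L" "Comp B I L A ?kl s = k" using wu[OF I k] by blast
    have "Comp B I I A k (Comp B I L I l s) = Comp B I I A k (Idn B I)"
      using B.Comp_assoc[OF I L I A(1) s(1) l k] s(2) B.Comp_Idn_right[OF I A(1) k] by simp
    then have ls: "Comp B I L I l s = Idn B I"
      by (rule k_mono[OF I B.Comp_in_Hom[OF I L I s(1) l] B.Idn_in_Hom[OF I]])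
    have "v = Comp B I I T v (Comp B I L I l s)" using ls B.Comp_Idn_right[OF I T v] by simp
    also have "\<dots> = HZero B I T"
      using B.Comp_assoc[OF I L I T s(1) l v] vl B.Comp_HZero_left[OF I L T s(1)] by simp
    finally show ?thesis .
  qed
  have e_epi: "is_epi B Y I e"
    unfolding is_epi_def
  proof (intro conjI e(1) ballI impI)
    fix T g h assume T: "T \<in> Ob B" and g: "g \<in> Hom B I T" and h: "h \<in> Hom B I T"
      and eq: "Comp B Y I T g e = Comp B Y I T h e"
    interpret G: comm_group "hom_group B I T" by (rule B.hom_comm_group[OF I T])
    have gs: "carrier (hom_group B I T) = Hom B I T" "mult (hom_group B I T) = HAdd B I T"
      "one (hom_group B I T) = HZero B I T" by (simp_all add: hom_group_def)
    define n where "n = inv\<^bsub>hom_group B I T\<^esub> h"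
    have n: "n \<in> Hom B I T" "HAdd B I T h n = HZero B I T"
      using G.inv_closed[unfolded gs, of h] G.r_inv[unfolded gs, of h] h by (simp_all add: n_def)
    let ?v = "HAdd B I T g n"
    have v: "?v \<in> Hom B I T" using G.m_closed[unfolded gs, of g n] g n by simp
    have "Comp B Y I T ?v e = HAdd B Y T (Comp B Y I T g e) (Comp B Y I T n e)"
      by (rule B.Comp_HAdd_left[OF A(2) I T e(1) g n(1)])
    also have "\<dots> = Comp B Y I T (HAdd B I T h n) e"
      unfolding eq by (rule B.Comp_HAdd_left[OF A(2) I T e(1) h n(1), symmetric])
    also have "\<dots> = HZero B Y T" using n(2) B.Comp_HZero_left[OF A(2) I T e(1)] by simp
    finally have "?v = HZero B I T" by (rule e_epi0[OF T v])
    then have "?v = HAdd B I T h n" using n(2) by simp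
    then show "g = h" using G.right_cancel[unfolded gs, of n g h] g h n(1) by simp
  qed
  \<comment> \<open>Here projectivity of \<open>P\<close> enters: maps from \<open>P\<close> lift along the epimorphisms \<open>e\<close> and \<open>q\<close>.\<close>
  let ?q = "\<lambda>f. Comp B P A C q f"
  have "?q t = HZero B P C \<longleftrightarrow> t \<in> \<delta> ` Hom B P Y" if t: "t \<in> Hom B P A" for t
  proof
    assume "?q t = HZero B P C"
    then obtain u where u: "u \<in> Hom B P I" "Comp B P I A k u = t" using ku[OF P_Ob t] by blast
    then obtain z where z: "z \<in> Hom B P Y" "u = Comp B P Y I e z"
      using epi_surj[OF A(2) I e_epi] by blast
    have "t = \<delta> z"
      using u(2) z d(2) B.Comp_assoc[OF P_Ob A(2) I A(1) z(1) e(1) k] e(2) by simp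
    then show "t \<in> \<delta> ` Hom B P Y" using z(1) by blast
  next
    assume "t \<in> \<delta> ` Hom B P Y"
    then obtain z where z: "z \<in> Hom B P Y" "t = Comp B P Y A d z" using d(2) by auto
    then show "?q t = HZero B P C"
      using B.Comp_assoc[OF P_Ob A(2,1) C z(1) d(1) q] qd B.Comp_HZero_left[OF P_Ob A(2) C z(1)] by simp
  qed
  then show ?thesis
    using C Th_map[OF A(1) C q] epi_surj[OF A(1) C q_epi] by (intro bexI[of _ C] exI[of _ ?q]) simp_all
qed

lemma S_iso: "M \<in> S \<Longrightarrow> obj N \<Longrightarrow> iso_modules M N \<Longrightarrow> N \<in> S"
  unfolding S_iff using iso_modules_trans by blast

lemma Th_S: "X \<in> Ob B \<Longrightarrow> Th X \<in> S"
  unfolding S_iff using Th_obj iso_modules_refl by blast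

lemma S_free:
  assumes X: "small TYPE('u) X" and M: "M \<in> S"
  shows "free_towards R (Th (Q X)) (c X) X M"
proof -
  obtain Y where Y: "Y \<in> Ob B" "iso_modules (Th Y) M" using M unfolding S_iff by blast
  then obtain f g where "lin (Th Y) M f" "lin M (Th Y) g" "\<forall>y \<in> carrier M. f (g y) = y"
    unfolding iso_modules_def by blast
  then show ?thesis using free_towards_iso[OF Th_free[OF X Y(1)]] by blast
qed

lemma ex_free_family: "\<exists>K. free_family R (\<lambda>X. Th (Q X)) c S (K :: 'u set)"
proof -
  obtain K :: "'u set" where K: "small TYPE('u) K" "infinite K"
    and sup: "\<forall>X. small TYPE('u) X \<longrightarrow> (\<forall>t \<in> Hom B P (Q X). \<exists>A \<subseteq> X. |A| \<le>o |K| \<and>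
      (\<forall>e \<in> Hom B (Q X) (Q X). (\<forall>x \<in> X. Comp B P (Q X) (Q X) e (c X x) =
          (if x \<in> A then c X x else HZero B P (Q X))) \<longrightarrow> Comp B P (Q X) (Q X) e t = t))"
    using copower_support[OF inaccessible B.preadditive_category_axioms lp P_Ob, of Q c] copower(1) by blast
  have "free_family R (\<lambda>X. Th (Q X)) c S K"
  proof unfold_locales
    show "S \<subseteq> Ob (RMod R)" using S_iff by blast
    show "N \<in> S" if "M \<in> S" "obj N" "iso_modules M N" for M N using S_iso that .
    show "Th (Q X) \<in> S" if "small TYPE('u) X" for X by (rule Th_S[OF copower(2)[OF that]])
    show "c X x \<in> carrier (Th (Q X))" if "small TYPE('u) X" "x \<in> X" for X x using copower(3) that by simp
    show "free_towards R (Th (Q X)) (c X) X M" if "small TYPE('u) X" "M \<in> S" for X M by (rule S_free[OF that])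
    show "\<exists>C \<in> S. \<exists>q. lin (Th (Q X)) C q \<and> q ` carrier (Th (Q X)) = carrier C \<and>
        (\<forall>t \<in> carrier (Th (Q X)). q t = \<zero>\<^bsub>C\<^esub> \<longleftrightarrow> t \<in> \<delta> ` carrier (Th (Q Y)))"
      if "small TYPE('u) X" "small TYPE('u) Y" "lin (Th (Q Y)) (Th (Q X)) \<delta>" for X Y \<delta>
      using Th_cokernel[OF copower(2)[OF that(1)] copower(2)[OF that(2)] that(3)] Th_S by blast
    show "small TYPE('u) K" "infinite K" by (rule K)+
    show "\<exists>X' \<subseteq> X. |X'| \<le>o |K| \<and> (\<forall>e. lin (Th (Q X)) (Th (Q X)) e \<and>
        (\<forall>x \<in> X. e (c X x) = (if x \<in> X' then c X x else \<zero>\<^bsub>Th (Q X)\<^esub>)) \<longrightarrow> e t = t)"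
      if X: "small TYPE('u) X" and t: "t \<in> carrier (Th (Q X))" for X t
    proof -
      have tH: "t \<in> Hom B P (Q X)" using t by simp
      obtain A where A: "A \<subseteq> X" "|A| \<le>o |K|"
        "\<forall>e \<in> Hom B (Q X) (Q X). (\<forall>x \<in> X. Comp B P (Q X) (Q X) e (c X x) =
          (if x \<in> A then c X x else HZero B P (Q X))) \<longrightarrow> Comp B P (Q X) (Q X) e t = t"
        using sup X tH by blast
      have "e t = t" if e: "lin (Th (Q X)) (Th (Q X)) e"
        "\<forall>x \<in> X. e (c X x) = (if x \<in> A then c X x else \<zero>\<^bsub>Th (Q X)\<^esub>)" for e
      proof -
        obtain e' where e': "e' \<in> Hom B (Q X) (Q X)" "\<forall>f \<in> Hom B P (Q X). e f = Comp B P (Q X) (Q X) e' f"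
          using Th_full[OF copower(2)[OF X] copower(2)[OF X] e(1)] by blast
        have "\<forall>x \<in> X. Comp B P (Q X) (Q X) e' (c X x) = (if x \<in> A then c X x else HZero B P (Q X))"
        proof
          fix x assume x: "x \<in> X"
          show "Comp B P (Q X) (Q X) e' (c X x) = (if x \<in> A then c X x else HZero B P (Q X))"
            using bspec[OF e'(2) copower(3)[OF X x]] bspec[OF e(2) x] by (cases "x \<in> A") simp_all
        qed
        then have "Comp B P (Q X) (Q X) e' t = t" using A(3) e'(1) by blast
        then show ?thesis using e'(2) tH by simp
      qed
      then show ?thesis using A(1,2) by blast
    qed
  qed
  then show ?thesis by blast
qed

end

section \<open>The essential image of Theta as a perpendicular subcategory\<close>

context module_universe begin

lemma HAdd_extensional: "HAdd (RMod R) M N f g \<in> extensional (carrier M)"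
  by (simp add: RMod_def)

lemma HAdd_apply: "x \<in> carrier M \<Longrightarrow> HAdd (RMod R) M N f g x = f x \<oplus>\<^bsub>N\<^esub> g x"
  by (simp add: RMod_def)

lemma precomposition_iso_iff:
  assumes F: "obj F" and T: "obj T" and M: "obj M" and e: "\<forall>x \<in> X. e x \<in> carrier F"
    and free: "free_towards R F e X M" and f: "lin F T f" and fc: "\<forall>x \<in> X. f (e x) = c x"
  shows "(\<lambda>g. Comp (RMod R) F T M g (restrict f (carrier F))) \<in> iso (hom_group (RMod R) T M) (hom_group (RMod R) F M)
    \<longleftrightarrow> free_towards R T c X M"
proof -
  let ?f = "restrict f (carrier F)"
  let ?\<Phi> = "\<lambda>g. Comp (RMod R) F T M g ?f"
  have lms: "lm F" "lm T" "lm M" using F T M by simp_all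
  have fH: "?f \<in> Hom (RMod R) F T" by (rule restrict_Hom[OF f lms(1)])
  have \<Phi>H: "?\<Phi> g \<in> Hom (RMod R) F M" if "g \<in> Hom (RMod R) T M" for g by (rule Comp_Hom[OF fH that F])
  have \<Phi>x: "?\<Phi> g x = g (f x)" if "x \<in> carrier F" for g x using that by (simp add: Comp_apply)
  have add: "?\<Phi> (HAdd (RMod R) T M g h) = HAdd (RMod R) F M (?\<Phi> g) (?\<Phi> h)" for g h
  proof (rule extensionalityI[OF Comp_extensional HAdd_extensional])
    fix x assume x: "x \<in> carrier F"
    show "?\<Phi> (HAdd (RMod R) T M g h) x = HAdd (RMod R) F M (?\<Phi> g) (?\<Phi> h) x"
      unfolding HAdd_apply[OF x] \<Phi>x[OF x] HAdd_apply[OF lin_closed[OF f x]] by (rule refl)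
  qed
  have "?\<Phi> \<in> iso (hom_group (RMod R) T M) (hom_group (RMod R) F M) \<longleftrightarrow>
      bij_betw ?\<Phi> (Hom (RMod R) T M) (Hom (RMod R) F M)"
    using \<Phi>H add by (auto simp: iso_def hom_def hom_group_def)
  also have "\<dots> \<longleftrightarrow> free_towards R T c X M"
  proof
    assume bij: "bij_betw ?\<Phi> (Hom (RMod R) T M) (Hom (RMod R) F M)"
    show "free_towards R T c X M"
      unfolding free_towards_def
    proof (intro conjI allI impI ballI)
      fix m assume "\<forall>x \<in> X. m x \<in> carrier M"
      then obtain a where a: "lin F M a" "\<forall>x \<in> X. a (e x) = m x"
        using free_towards_ex[OF free, of m] by blast
      have "restrict a (carrier F) \<in> ?\<Phi> ` Hom (RMod R) T M"
        using bij restrict_Hom[OF a(1) lms(1)] unfolding bij_betw_def by blast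
      then obtain g where g: "g \<in> Hom (RMod R) T M" "restrict a (carrier F) = ?\<Phi> g" by blast
      have "g (c x) = m x" if x: "x \<in> X" for x
      proof -
        have ex: "e x \<in> carrier F" using e x by blast
        then have "a (e x) = g (f (e x))" using fun_cong[OF g(2), of "e x"] \<Phi>x[OF ex] by simp
        then show ?thesis using a(2) fc x by simp
      qed
      then show "\<exists>g. lin T M g \<and> (\<forall>x \<in> X. g (c x) = m x)" using Hom_lin[OF g(1)] by blast
    next
      fix g h t assume gh: "lin T M g \<and> lin T M h \<and> (\<forall>x \<in> X. g (c x) = h (c x))" and t: "t \<in> carrier T"
      let ?g = "restrict g (carrier T)" and ?h = "restrict h (carrier T)"
      have H: "?g \<in> Hom (RMod R) T M" "?h \<in> Hom (RMod R) T M" using gh restrict_Hom lms(2) by blast+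
      have gl: "lin T M g" and hl: "lin T M h" using gh by auto
      have "?\<Phi> ?g = ?\<Phi> ?h"
      proof (rule Hom_eqI[OF \<Phi>H[OF H(1)] \<Phi>H[OF H(2)]])
        fix x assume x: "x \<in> carrier F"
        have "g (f x) = h (f x)"
          by (rule free_towards_unique[OF free lin_comp[OF f gl] lin_comp[OF f hl] _ x]) (use gh fc in simp)
        then show "?\<Phi> ?g x = ?\<Phi> ?h x" using x lin_closed[OF f x] by (simp add: \<Phi>x)
      qed
      then have eq: "?g = ?h" using bij H unfolding bij_betw_def by (blast dest: inj_onD)
      show "g t = h t" using fun_cong[OF eq, of t] t by simp
    qed
  next
    assume ft: "free_towards R T c X M"
    have cT: "c x \<in> carrier T" if "x \<in> X" for x using lin_closed[OF f] e fc that by metis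
    show "bij_betw ?\<Phi> (Hom (RMod R) T M) (Hom (RMod R) F M)"
      unfolding bij_betw_def
    proof
      show "inj_on ?\<Phi> (Hom (RMod R) T M)"
      proof (rule inj_onI)
        fix g h assume g: "g \<in> Hom (RMod R) T M" and h: "h \<in> Hom (RMod R) T M" and eq: "?\<Phi> g = ?\<Phi> h"
        show "g = h"
        proof (rule Hom_eqI[OF g h])
          fix t assume t: "t \<in> carrier T"
          show "g t = h t"
          proof (rule free_towards_unique[OF ft Hom_lin[OF g] Hom_lin[OF h] _ t])
            fix x assume x: "x \<in> X"
            have ex: "e x \<in> carrier F" using e x by blast
            show "g (c x) = h (c x)" using fun_cong[OF eq, of "e x"] \<Phi>x[OF ex] fc x by simp
          qed
        qed
      qed
      show "?\<Phi> ` Hom (RMod R) T M = Hom (RMod R) F M"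
      proof (intro equalityI subsetI)
        fix a assume "a \<in> ?\<Phi> ` Hom (RMod R) T M"
        then show "a \<in> Hom (RMod R) F M" using \<Phi>H by blast
      next
        fix a assume a: "a \<in> Hom (RMod R) F M"
        have "\<And>x. x \<in> X \<Longrightarrow> a (e x) \<in> carrier M" using lin_closed[OF Hom_lin[OF a]] e by blast
        then obtain g where g: "lin T M g" "\<forall>x \<in> X. g (c x) = a (e x)"
          using free_towards_ex[OF ft, of "\<lambda>x. a (e x)"] by blast
        have gH: "restrict g (carrier T) \<in> Hom (RMod R) T M" by (rule restrict_Hom[OF g(1) lms(2)])
        have "a = ?\<Phi> (restrict g (carrier T))"
        proof (rule Hom_eqI[OF a \<Phi>H[OF gH]])
          fix x assume x: "x \<in> carrier F"
          have "a x = g (f x)"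
            by (rule free_towards_unique[OF free Hom_lin[OF a] lin_comp[OF f g(1)] _ x]) (use g(2) fc in simp)
          then show "a x = ?\<Phi> (restrict g (carrier T)) x" using x lin_closed[OF f x] by (simp add: \<Phi>x)
        qed
        then show "a \<in> ?\<Phi> ` Hom (RMod R) T M" using gH by blast
      qed
    qed
  qed
  finally show ?thesis .
qed

end

context theta_embedding begin

text \<open>
  If \<open>\<theta>\<close> is injective then so is the comparison map: the coordinates of an element of the free
  module are recovered, up to \<open>\<theta>\<close>, by the projections of the copower to its summands.
\<close>

lemma ex_comparison_map:
  assumes K: "small TYPE('u) K"
  shows "\<exists>F e f. obj F \<and> (\<forall>x \<in> K. e x \<in> carrier F) \<and>
    (\<forall>M :: ('r, 'u) module. lm M \<longrightarrow> free_towards R F e K M) \<and>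
    lin F (Th (Q K)) f \<and> (\<forall>x \<in> K. f (e x) = c K x) \<and> (inj_on \<theta> (carrier R) \<longrightarrow> inj_on f (carrier F))"
proof -
  note cp = copower[OF K]
  interpret R: ring R by (rule ring_R)
  let ?D = "finite_support_module K"
  obtain F e j where F: "obj F" "\<forall>x \<in> K. e x \<in> carrier F"
    "\<forall>M :: ('r, 'u) module. lm M \<longrightarrow> free_towards R F e K M"
    and j: "lin F ?D j" "inj_on j (carrier F)" "\<forall>x \<in> K. j (e x) = unit_vector x"
    using ex_free[OF K] by blast
  have lT: "lm (Th (Q K))" using cp(2) by simp
  have lP: "lm (Th P)" using P_Ob by simp
  have lF: "lm F" using F(1) by simp
  have free: "free_towards R F e K M" if "lm M" for M :: "('r, 'u) module" using F(3) that by blast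
  obtain f where f: "lin F (Th (Q K)) f" "\<forall>x \<in> K. f (e x) = c K x"
    using free_towards_ex[OF free[OF lT], of "c K"] cp(3) by auto
  have "inj_on f (carrier F)" if inj: "inj_on \<theta> (carrier R)"
    unfolding lin_inj_iff[OF f(1) lF lT]
  proof (intro ballI impI)
    fix z assume z: "z \<in> carrier F" "f z = \<zero>\<^bsub>Th (Q K)\<^esub>"
    have "HAdd B P P (\<theta> \<zero>\<^bsub>R\<^esub>) (\<theta> \<zero>\<^bsub>R\<^esub>) = \<theta> \<zero>\<^bsub>R\<^esub>"
      using \<theta>_simps(2)[of "\<zero>\<^bsub>R\<^esub>" "\<zero>\<^bsub>R\<^esub>"] by simp
    then have \<theta>0: "\<theta> \<zero>\<^bsub>R\<^esub> = HZero B P P"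
      by (intro B.HAdd_idem[OF P_Ob P_Ob \<theta>_simps(1)]) simp_all
    have jR: "j y x \<in> carrier R" if "y \<in> carrier F" for x y
      by (rule fs_carrier_R[OF lin_closed[OF j(1) that]])
    have "j z x = \<zero>\<^bsub>R\<^esub>" if x: "x \<in> K" for x
    proof -
      have "\<exists>\<pi>. lin (Th (Q K)) (Th P) \<pi> \<and>
          (\<forall>y \<in> K. \<pi> (c K y) = (if y = x then Idn B P else HZero B P P))"
        by (rule free_towards_ex[OF Th_free[OF K P_Ob]])
          (simp add: B.Idn_in_Hom[OF P_Ob] B.HZero_in_Hom[OF P_Ob P_Ob])
      then obtain \<pi> where \<pi>: "lin (Th (Q K)) (Th P) \<pi>"
        "\<forall>y \<in> K. \<pi> (c K y) = (if y = x then Idn B P else HZero B P P)" by blast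
      have coord: "lin F (Th P) (\<lambda>y. \<theta> (j y x))"
      proof (rule linI)
        fix y assume "y \<in> carrier F"
        then show "\<theta> (j y x) \<in> carrier (Th P)" using \<theta>_simps(1)[OF jR] by simp
      next
        fix y y' assume y: "y \<in> carrier F" "y' \<in> carrier F"
        then show "\<theta> (j (y \<oplus>\<^bsub>F\<^esub> y') x) = \<theta> (j y x) \<oplus>\<^bsub>Th P\<^esub> \<theta> (j y' x)"
          using \<theta>_simps(2)[OF jR jR] by (simp add: lin_add[OF j(1)] fs_simps)
      next
        fix a y assume y: "a \<in> carrier R" "y \<in> carrier F"
        then show "\<theta> (j (a \<odot>\<^bsub>F\<^esub> y) x) = a \<odot>\<^bsub>Th P\<^esub> \<theta> (j y x)"
          using \<theta>_simps(3)[OF y(1) jR] by (simp add: lin_smult[OF j(1)] fs_simps)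
      qed
      have "\<pi> (f z) = \<theta> (j z x)"
      proof (rule free_towards_unique[OF free[OF lP] lin_comp[OF f(1) \<pi>(1)] coord _ z(1)])
        fix y assume y: "y \<in> K"
        then show "\<pi> (f (e y)) = \<theta> (j (e y) x)"
          using f(2) \<pi>(2) j(3) \<theta>0 \<theta>_simps(4) by (simp add: unit_vector_def)
      qed
      then have "\<theta> (j z x) = \<theta> \<zero>\<^bsub>R\<^esub>" using z(2) lin_zero[OF \<pi>(1) lT lP] \<theta>0 by simp
      then show ?thesis by (rule inj_onD[OF inj]) (use jR[OF z(1)] in simp_all)
    qed
    moreover have "j z x = \<zero>\<^bsub>R\<^esub>" if "x \<notin> K" for x
      using lin_closed[OF j(1) z(1)] that by (simp add: finite_support_module_def)
    ultimately have "j z = \<zero>\<^bsub>?D\<^esub>" by (auto simp: fs_simps)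
    then show "z = \<zero>\<^bsub>F\<^esub>"
      using j(2) z(1) unfolding lin_inj_iff[OF j(1) lF finite_support_module] by blast
  qed
  then show ?thesis using F f by blast
qed

text \<open>
  The form in which the hypothesis on \<open>Ext\<close> enters: surjectivity on Yoneda classes, read for
  representatives.
\<close>

lemma Ext_map_surj:
  assumes iso: "Ext_map_iso B (RMod R) (Theta B P \<theta>) n X Y" and n: "n \<ge> 1"
    and \<eta>: "\<eta> \<in> extensions (RMod R) n (Th X) (Th Y)"
  shows "\<exists>E d. (E, d) \<in> extensions B n X Y \<and>
    (ext_apply (Theta B P \<theta>) (E, d), \<eta>) \<in> Yoneda_rel (RMod R) n (Th X) (Th Y)"
proof -
  let ?rel = "Yoneda_rel (RMod R) n (Th X) (Th Y)"
  have "?rel `` {\<eta>} \<in> carrier (Ext (RMod R) n (Th X) (Th Y))"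
    unfolding Ext_def by (simp add: quotientI[OF \<eta>])
  moreover have "Ext_map (RMod R) (Theta B P \<theta>) n X Y ` carrier (Ext B n X Y) =
      carrier (Ext (RMod R) n (Th X) (Th Y))"
    using iso n by (simp add: Ext_map_iso_def iso_def bij_betw_def)
  ultimately have "?rel `` {\<eta>} \<in> Ext_map (RMod R) (Theta B P \<theta>) n X Y ` carrier (Ext B n X Y)" by simp
  then obtain a where a: "a \<in> extensions B n X Y // Yoneda_rel B n X Y"
    "?rel `` {\<eta>} = ?rel `` (ext_apply (Theta B P \<theta>) ` a)"
    by (auto simp: Ext_def Ext_map_def)
  have "\<eta> \<in> ?rel `` {\<eta>}" using Yoneda_rel_refl[OF \<eta> n] by blast
  then obtain \<xi> where \<xi>: "\<xi> \<in> a" "(ext_apply (Theta B P \<theta>) \<xi>, \<eta>) \<in> ?rel" using a(2) by blast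
  obtain E d where Ed: "\<xi> = (E, d)" by (cases \<xi>)
  have "\<xi> \<in> extensions B n X Y"
    using a(1) \<xi>(1) Yoneda_rel_extensions(2) unfolding quotient_def by fastforce
  then show ?thesis using \<xi>(2) Ed by blast
qed

text \<open>
  Up to isomorphism the middle term of an extension depends only on its Yoneda class, and every class
  between objects of the image has a representative that comes from \<open>B\<close>.
\<close>

lemma closed_under_extensions_if_Ext_iso:
  assumes iso: "\<And>X Y. X \<in> Ob B \<Longrightarrow> Y \<in> Ob B \<Longrightarrow> Ext_map_iso B (RMod R) (Theta B P \<theta>) 1 X Y"
  shows "closed_under_extensions (RMod R) S"
proof -
  have SO: "S \<subseteq> Ob (RMod R)" using S_iff by blast
  show ?thesis
    unfolding closed_under_extensions_iff[OF SO]
  proof (intro ballI allI impI)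
    fix X Z W f g assume X: "X \<in> S" and Z: "Z \<in> S" and s: "short_exact X W Z f g"
    have o: "obj X" "obj W" "obj Z" and f: "lin X W f" and g: "lin W Z g" and inj: "inj_on f (carrier X)"
      and ker: "f ` carrier X = {w \<in> carrier W. g w = \<zero>\<^bsub>Z\<^esub>}" and sur: "g ` carrier W = carrier Z"
      using s by (auto simp: short_exact_def)
    have lms: "lm X" "lm W" "lm Z" using o by simp_all
    obtain X' where X': "X' \<in> Ob B" "iso_modules (Th X') X" using X unfolding S_iff by blast
    obtain Z' where Z': "Z' \<in> Ob B" "iso_modules (Th Z') Z" using Z unfolding S_iff by blast
    obtain u u' where u: "lin (Th X') X u" "lin X (Th X') u'" "\<forall>x \<in> carrier (Th X'). u' (u x) = x"
      "\<forall>y \<in> carrier X. u (u' y) = y" using X'(2) unfolding iso_modules_def by blast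
    obtain v v' where v: "lin (Th Z') Z v'" "lin Z (Th Z') v" "\<forall>x \<in> carrier (Th Z'). v (v' x) = x"
      "\<forall>y \<in> carrier Z. v' (v y) = y" using Z'(2) unfolding iso_modules_def by blast
    have lTh: "lm (Th X')" "lm (Th Z')" using X' Z' by simp_all
    have v0: "v z = \<zero>\<^bsub>Th Z'\<^esub> \<longleftrightarrow> z = \<zero>\<^bsub>Z\<^esub>" if "z \<in> carrier Z" for z
      using v(4) that lin_zero[OF v(2) lms(3) lTh(2)] lin_zero[OF v(1) lTh(2) lms(3)] by metis
    have uim: "u ` carrier (Th X') = carrier X"
    proof (intro equalityI subsetI)
      fix x assume "x \<in> u ` carrier (Th X')"
      then show "x \<in> carrier X" using lin_closed[OF u(1)] by blast
    next
      fix x assume x: "x \<in> carrier X"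
      then have "x = u (u' x)" using u(4) by simp
      then show "x \<in> u ` carrier (Th X')" using lin_closed[OF u(2) x] by (rule image_eqI)
    qed
    have vim: "v ` carrier Z = carrier (Th Z')"
    proof (intro equalityI subsetI)
      fix x assume "x \<in> v ` carrier Z"
      then show "x \<in> carrier (Th Z')" using lin_closed[OF v(2)] by blast
    next
      fix x assume x: "x \<in> carrier (Th Z')"
      then have "x = v (v' x)" using v(3) by simp
      then show "x \<in> v ` carrier Z" using lin_closed[OF v(1) x] by (rule image_eqI)
    qed
    have uinj: "inj_on u (carrier (Th X'))" by (rule inj_on_inverseI[of _ u']) (use u(3) in blast)
    have s': "short_exact (Th X') W (Th Z') (\<lambda>x. f (u x)) (\<lambda>w. v (g w))"
      unfolding short_exact_def
    proof (intro conjI Th_obj X'(1) Z'(1) o(2))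
      show "lin (Th X') W (\<lambda>x. f (u x))" by (rule lin_comp[OF u(1) f])
      show "lin W (Th Z') (\<lambda>w. v (g w))" by (rule lin_comp[OF g v(2)])
      show "inj_on (\<lambda>x. f (u x)) (carrier (Th X'))"
        using comp_inj_on[OF uinj] inj unfolding uim comp_def by blast
      have "(\<lambda>x. f (u x)) ` carrier (Th X') = f ` (u ` carrier (Th X'))" by (simp only: image_image)
      also have "\<dots> = {w \<in> carrier W. g w = \<zero>\<^bsub>Z\<^esub>}" unfolding uim by (rule ker)
      also have "\<dots> = {w \<in> carrier W. v (g w) = \<zero>\<^bsub>Th Z'\<^esub>}"
        using v0 lin_closed[OF g] by blast
      finally show "(\<lambda>x. f (u x)) ` carrier (Th X') = {w \<in> carrier W. v (g w) = \<zero>\<^bsub>Th Z'\<^esub>}" .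
      have "(\<lambda>w. v (g w)) ` carrier W = v ` (g ` carrier W)" by (simp only: image_image)
      then show "(\<lambda>w. v (g w)) ` carrier W = carrier (Th Z')" unfolding sur vim .
    qed
    let ?E = "\<lambda>i :: nat. if i = 0 then Th X' else if i = 1 then W else Th Z'"
    let ?d = "\<lambda>i :: nat. if i = 0 then (\<lambda>x. f (u x)) else (\<lambda>w. v (g w))"
    let ?\<eta> = "(?E, restrict_maps ?E ?d)"
    have \<eta>: "?\<eta> \<in> extensions (RMod R) 1 (Th Z') (Th X')"
      by (rule restrict_extension[OF short_exact_seq[OF s'] order_refl])
    obtain E d where E: "(E, d) \<in> extensions B 1 Z' X'"
      "(ext_apply (Theta B P \<theta>) (E, d), ?\<eta>) \<in> Yoneda_rel (RMod R) 1 (Th Z') (Th X')"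
      using Ext_map_surj[OF iso[OF Z'(1) X'(1)] order_refl \<eta>] by blast
    have E1: "E 1 \<in> Ob B" using E(1) by (auto simp: extensions_def)
    have "iso_modules (Th (E 1)) W"
      using Yoneda_rel_1_middle[OF E(2)] by (simp add: ext_apply_def)
    then show "W \<in> S" unfolding S_iff using E1 o(2) by blast
  qed
qed

text \<open>Lift the coprojections along \<open>g\<close>, by projectivity of \<open>P\<close>.\<close>

lemma copower_projective:
  assumes K: "small TYPE('u) K" and X: "X \<in> Ob B" and g: "is_epi B X (Q K) g"
  shows "\<exists>s \<in> Hom B (Q K) X. Comp B (Q K) X (Q K) g s = Idn B (Q K)"
proof -
  note cp = copower[OF K]
  have gH: "g \<in> Hom B X (Q K)" using g by (simp add: is_epi_def)
  have "\<exists>h \<in> Hom B P X. Comp B P X (Q K) g h = c K x" if x: "x \<in> K" for x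
    using epi_surj[OF X cp(2) g] cp(3)[OF x] by (metis imageE)
  then obtain h where h: "\<And>x. x \<in> K \<Longrightarrow> h x \<in> Hom B P X" "\<And>x. x \<in> K \<Longrightarrow> Comp B P X (Q K) g (h x) = c K x"
    by metis
  obtain s where s: "s \<in> Hom B (Q K) X" "\<forall>x \<in> K. Comp B P (Q K) X s (c K x) = h x"
    using B.copower_ex[OF cp(1) X, of h] h(1) by blast
  have "Comp B (Q K) X (Q K) g s = Idn B (Q K)"
  proof (rule B.copower_unique[OF cp(1,2) P_Ob B.Comp_in_Hom[OF cp(2) X cp(2) s(1) gH] B.Idn_in_Hom[OF cp(2)]])
    fix x assume x: "x \<in> K"
    have "Comp B P (Q K) (Q K) (Comp B (Q K) X (Q K) g s) (c K x) = Comp B P X (Q K) g (Comp B P (Q K) X s (c K x))"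
      by (rule B.Comp_assoc[OF P_Ob cp(2) X cp(2) cp(3)[OF x] s(1) gH])
    then show "Comp B P (Q K) (Q K) (Comp B (Q K) X (Q K) g s) (c K x) = Comp B P (Q K) (Q K) (Idn B (Q K)) (c K x)"
      using s(2) h(2) x B.Comp_Idn_left[OF P_Ob cp(2) cp(3)[OF x]] by simp
  qed
  then show ?thesis using s(1) by blast
qed

text \<open>
  In degrees at least two, \<open>Ext (C, M)\<close> is governed by \<open>Ext (T, M)\<close>, which comes from \<open>B\<close>, where
  all extensions of a projective object split on the right.
\<close>

lemma Ext_vanishes_cokernel:
  assumes K: "small TYPE('u) K" and M: "M \<in> S" and n: "n \<ge> 2"
    and iso: "\<And>Y. Y \<in> Ob B \<Longrightarrow> Ext_map_iso B (RMod R) (Theta B P \<theta>) n (Q K) Y"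
    and pr: "projective F" and seq: "short_exact F (Th (Q K)) C f q"
  shows "Ext_vanishes (RMod R) n C M"
proof -
  have n1: "n \<ge> 1" using n by simp
  note cp = copower[OF K]
  have oM: "obj M" using M S_iff by blast
  obtain Y where Y: "Y \<in> Ob B" "iso_modules (Th Y) M" using M unfolding S_iff by blast
  obtain u v where u: "lin (Th Y) M u" and v: "lin M (Th Y) v" and uv: "\<forall>y \<in> carrier M. u (v y) = y"
    using Y(2) unfolding iso_modules_def by blast
  have oT: "obj (Th (Q K))" by (rule Th_obj[OF cp(2)])
  obtain E d Z where e: "exact_seq n (Th (Q K)) Z E d" and pE: "projective_seq n E"
    using ex_projective_resolution[OF oT n1] by blast
  have s: "obj F" "lin F (Th (Q K)) f" "inj_on f (carrier F)" "obj C" "lin (Th (Q K)) C q"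
    "f ` carrier F = {t \<in> carrier (Th (Q K)). q t = \<zero>\<^bsub>C\<^esub>}" "q ` carrier (Th (Q K)) = carrier C"
    using seq unfolding short_exact_def by blast+
  obtain E' d' where e': "exact_seq n C Z E' d'" and pE': "projective_seq n E'"
    and tr: "\<forall>M a. obj M \<and> extends_to_next E d M a \<longrightarrow> extends_to_next E' d' M a"
    using resolution_of_cokernel[OF e pE n s(1) pr s(2,3,4,5,7,6)] by blast
  show ?thesis
  proof (rule Ext_vanishes_resolution[OF e' pE' n1 oM])
    fix a assume a: "lin Z M a"
    have va: "lin Z (Th Y) (\<lambda>x. v (a x))" by (rule lin_comp[OF a v])
    have "extends_to_next E d (Th Y) (\<lambda>x. v (a x))"
    proof (rule extends_to_next_if_split[OF e pE n1 Th_obj[OF Y(1)] va])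
      fix \<eta> assume \<eta>: "\<eta> \<in> extensions (RMod R) n (Th (Q K)) (Th Y)"
      obtain A \<alpha> where A: "(A, \<alpha>) \<in> extensions B n (Q K) Y"
        "(ext_apply (Theta B P \<theta>) (A, \<alpha>), \<eta>) \<in> Yoneda_rel (RMod R) n (Th (Q K)) (Th Y)"
        using Ext_map_surj[OF iso[OF Y(1)] n1 \<eta>] by blast
      have An: "A n \<in> Ob B" "A (Suc n) = Q K" "is_epi B (A n) (Q K) (\<alpha> n)"
        using A(1) by (auto simp: extensions_def)
      have \<alpha>n: "\<alpha> n \<in> Hom B (A n) (Q K)" using An(3) by (simp add: is_epi_def)
      obtain s where s: "s \<in> Hom B (Q K) (A n)" "Comp B (Q K) (A n) (Q K) (\<alpha> n) s = Idn B (Q K)"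
        using copower_projective[OF K An(1,3)] by blast
      let ?s = "\<lambda>x. Comp B P (Q K) (A n) s x"
      have sl: "lin (Th (Q K)) (Th (A n)) ?s" by (rule Th_map[OF cp(2) An(1) s(1)])
      have sec: "Fmap (Theta B P \<theta>) (A n) (A (Suc n)) (\<alpha> n) (?s x) = x" if x: "x \<in> carrier (Th (Q K))" for x
      proof -
        have xH: "x \<in> Hom B P (Q K)" using x by simp
        have "Comp B P (A n) (Q K) (\<alpha> n) (?s x) = x"
          using B.Comp_assoc[OF P_Ob cp(2) An(1) cp(2) xH s(1) \<alpha>n] s(2) B.Comp_Idn_left[OF P_Ob cp(2) xH] by simp
        then show ?thesis using B.Comp_in_Hom[OF P_Ob cp(2) An(1) xH s(1)] An(2) by (simp add: Theta_def)
      qed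
      show "\<exists>Z z s. ((Z, z), \<eta>) \<in> Yoneda_rel (RMod R) n (Th (Q K)) (Th Y) \<and> lin (Th (Q K)) (Z n) s \<and>
        (\<forall>x \<in> carrier (Th (Q K)). z n (s x) = x)"
        using A(2) sl sec unfolding ext_apply_def by (auto intro!: exI)
    qed
    then obtain h where h: "lin (E 1) (Th Y) h" "\<forall>x \<in> carrier (E 0). h (d 0 x) = v (a x)"
      unfolding extends_to_next_def by blast
    have "u (h (d 0 x)) = a x" if x: "x \<in> carrier (E 0)" for x
    proof -
      have "a x \<in> carrier M" using lin_closed[OF a] x exact_seqD(1)[OF e] by simp
      then show ?thesis using h(2) x uv by simp
    qed
    then have "extends_to_next E d M a"
      unfolding extends_to_next_def using lin_comp[OF h(1) u] by blast
    then show "extends_to_next E' d' M a" using tr oM by blast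
  qed
qed

text \<open>
  Both perpendicular descriptions use the one comparison map for the set \<open>K\<close>: the first is orthogonality
  to the map itself, the second is perpendicularity to its cokernel \<open>C\<close>.
\<close>

lemma image_perpendicular:
  "\<exists>\<F>. small TYPE('u) \<F> \<and> right_perp0 (RMod R) S \<F>" (is ?a)
  "inj_on \<theta> (carrier R) \<Longrightarrow> closed_under_extensions (RMod R) S \<Longrightarrow>
    \<exists>C. right_perp1 (RMod R) S {C} \<and> (\<forall>n \<ge> 2. \<forall>M \<in> S.
      (\<forall>X \<in> Ob B. \<forall>Y \<in> Ob B. Ext_map_iso B (RMod R) (Theta B P \<theta>) n X Y) \<longrightarrow> Ext_vanishes (RMod R) n C M)"
    (is "_ \<Longrightarrow> _ \<Longrightarrow> ?b")
proof -
  obtain K where "free_family R (\<lambda>X. Th (Q X)) c S (K :: 'u set)" using ex_free_family by blast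
  then interpret K: free_family U R "\<lambda>X. Th (Q X)" c S K .
  note smK = K.small_K
  let ?T = "Th (Q K)"
  have oT: "obj ?T" by (rule Th_obj[OF copower(2)[OF smK]])
  have TS: "?T \<in> S" by (rule K.T_S[OF smK])
  obtain F e f where F: "obj F" "\<forall>x \<in> K. e x \<in> carrier F"
    "\<forall>M :: ('r, 'u) module. lm M \<longrightarrow> free_towards R F e K M"
    and f: "lin F ?T f" "\<forall>x \<in> K. f (e x) = c K x" "inj_on \<theta> (carrier R) \<longrightarrow> inj_on f (carrier F)"
    using ex_comparison_map[OF smK] by blast
  have free: "free_towards R F e K M" if "lm M" for M :: "('r, 'u) module" using F(3) that by blast
  let ?f = "restrict f (carrier F)"
  have S_eq: "S = {M. obj M \<and> free_towards R ?T (c K) K M}" using K.mem_S_iff by blast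
  have fH: "?f \<in> Hom (RMod R) F ?T" by (rule restrict_Hom[OF f(1) obj_lm[OF F(1)]])
  have "right_perp0 (RMod R) S {(F, ?T, ?f)}"
    unfolding right_perp0_def
  proof
    show "\<forall>(U, V, f) \<in> {(F, ?T, ?f)}. U \<in> Ob (RMod R) \<and> V \<in> Ob (RMod R) \<and> f \<in> Hom (RMod R) U V"
      using F(1) oT fH by simp
    show "S = {M \<in> Ob (RMod R). \<forall>(U, V, f) \<in> {(F, ?T, ?f)}.
        (\<lambda>g. Comp (RMod R) U V M g f) \<in> iso (hom_group (RMod R) V M) (hom_group (RMod R) U M)}"
      unfolding S_eq
      using precomposition_iso_iff[OF F(1) oT _ F(2) free f(1,2)] by auto
  qed
  then show ?a using small_finite[of "{(F, ?T, ?f)}"] by blast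
  assume inj: "inj_on \<theta> (carrier R)" and cl: "closed_under_extensions (RMod R) S"
  have finj: "inj_on f (carrier F)" using f(3) inj by blast
  obtain C q where C: "obj C" "lin ?T C q" "q ` carrier ?T = carrier C"
    "\<forall>x \<in> carrier ?T. q x = \<zero>\<^bsub>C\<^esub> \<longleftrightarrow> x \<in> f ` carrier F"
    using ex_quotient[OF oT submod_image[OF f(1) obj_lm[OF F(1)] obj_lm[OF oT]]] by blast
  have seq: "short_exact F ?T C f q"
    unfolding short_exact_def using F(1) oT C f(1) finj lin_closed[OF f(1)] by blast
  note ctx = free F(2) f(2) seq
  have "S = {M \<in> Ob (RMod R). Ext_vanishes (RMod R) 0 C M \<and> Ext_vanishes (RMod R) 1 C M}"
  proof (intro equalityI subsetI)
    fix M assume M: "M \<in> S"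
    then have oM: "obj M" and ft: "free_towards R ?T (c K) K M" using S_eq by auto
    have "Ext_vanishes (RMod R) 0 C M"
      by (rule Ext_vanishes_0_if_free_towards[OF ctx oM ft])
    moreover have "Ext_vanishes (RMod R) 1 C M"
      by (rule Ext_vanishes_1_if_closed[OF ctx K.S_obj cl K.T_free[OF smK] TS M])
    ultimately show "M \<in> {M \<in> Ob (RMod R). Ext_vanishes (RMod R) 0 C M \<and> Ext_vanishes (RMod R) 1 C M}"
      using oM by blast
  next
    fix M assume "M \<in> {M \<in> Ob (RMod R). Ext_vanishes (RMod R) 0 C M \<and> Ext_vanishes (RMod R) 1 C M}"
    then have M: "obj M" "Ext_vanishes (RMod R) 0 C M" "Ext_vanishes (RMod R) 1 C M" by auto
    have "free_towards R ?T (c K) K M" by (rule free_towards_if_perp[OF ctx M])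
    then show "M \<in> S" using S_eq M(1) by blast
  qed
  then have "right_perp1 (RMod R) S {C}" unfolding right_perp1_def using C(1) by simp
  moreover have "Ext_vanishes (RMod R) n C M"
    if "n \<ge> 2" "M \<in> S" "\<forall>X \<in> Ob B. \<forall>Y \<in> Ob B. Ext_map_iso B (RMod R) (Theta B P \<theta>) n X Y" for n M
    using Ext_vanishes_cokernel[OF smK that(2,1) _ free_projective[OF F(2) free] seq]
      that(3) copower(2)[OF smK] by blast
  ultimately show ?b by blast
qed

lemma image_perpendicular_upto:
  assumes inj: "inj_on \<theta> (carrier R)" and k: "1 \<le> k"
    and iso: "\<And>X Y i. X \<in> Ob B \<Longrightarrow> Y \<in> Ob B \<Longrightarrow> enat i \<le> k \<Longrightarrow> Ext_map_iso B (RMod R) (Theta B P \<theta>) i X Y"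
  shows "\<exists>\<E>. small TYPE('u) \<E> \<and> right_perp (RMod R) k S \<E>"
proof -
  have "closed_under_extensions (RMod R) S"
    by (rule closed_under_extensions_if_Ext_iso[OF iso]) (use k in \<open>simp_all add: one_enat_def\<close>)
  then obtain C where C: "right_perp1 (RMod R) S {C}"
    "\<forall>n \<ge> 2. \<forall>M \<in> S. (\<forall>X \<in> Ob B. \<forall>Y \<in> Ob B. Ext_map_iso B (RMod R) (Theta B P \<theta>) n X Y) \<longrightarrow>
      Ext_vanishes (RMod R) n C M"
    using image_perpendicular(2)[OF inj] by blast
  have low: "Ext_vanishes (RMod R) 0 C M" "Ext_vanishes (RMod R) 1 C M" if "M \<in> S" for M
    using C(1) that unfolding right_perp1_def by blast+
  have "Ext_vanishes (RMod R) i C M" if M: "M \<in> S" and i: "enat i \<le> k" for M i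
  proof -
    consider "i = 0" | "i = 1" | "i \<ge> 2" by linarith
    then show ?thesis
    proof cases
      case 3
      then show ?thesis using C(2) M iso[OF _ _ i] by blast
    qed (use low M in simp_all)
  qed
  then have "right_perp (RMod R) k S {C}" unfolding right_perp_def using C(1) by simp
  then show ?thesis using small_finite[of "{C}"] by blast
qed

end

theorem theorem4p6:
  fixes B :: "('o, 'u) addcat"
    and P :: 'o
    and R :: "'r ring"
    and \<theta> :: "'r \<Rightarrow> 'u"
  assumes "inaccessible_universe TYPE('u)"
    and "abelian_category B"
    and "locally_presentable B"
    and "projective_generator B P"
    and "ring R"
    and "small TYPE('u) (carrier R)"
    and "\<theta> \<in> ring_hom R (End_op B P)"
    and "fully_faithful B (RMod R) (Theta B P \<theta>)"
  shows
    "(\<exists>\<F>. small TYPE('u) \<F> \<and> right_perp0 (RMod R) (Theta_image B P R \<theta>) \<F>) \<and>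
     (inj_on \<theta> (carrier R) \<longrightarrow>
        ((\<exists>\<E>. right_perp1 (RMod R) (Theta_image B P R \<theta>) \<E>) \<longleftrightarrow>
           closed_under_extensions (RMod R) (Theta_image B P R \<theta>)) \<and>
        (closed_under_extensions (RMod R) (Theta_image B P R \<theta>) \<longrightarrow>
           (\<exists>\<E>. small TYPE('u) \<E> \<and> right_perp1 (RMod R) (Theta_image B P R \<theta>) \<E>))) \<and>
     (\<forall>n :: nat. inj_on \<theta> (carrier R) \<and> n \<ge> 1 \<and>
        (\<forall>X \<in> Ob B. \<forall>Y \<in> Ob B. \<forall>i \<le> n. Ext_map_iso B (RMod R) (Theta B P \<theta>) i X Y) \<longrightarrow>
        (\<exists>\<E>. small TYPE('u) \<E> \<and> right_perp (RMod R) (enat n) (Theta_image B P R \<theta>) \<E>)) \<and>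
     (inj_on \<theta> (carrier R) \<and>
        (\<forall>X \<in> Ob B. \<forall>Y \<in> Ob B. \<forall>i. Ext_map_iso B (RMod R) (Theta B P \<theta>) i X Y) \<longrightarrow>
        (\<exists>\<E>. small TYPE('u) \<E> \<and> right_perp (RMod R) \<infinity> (Theta_image B P R \<theta>) \<E>))"
proof -
  interpret theta_embedding "TYPE('u)" R B P \<theta>
    by (intro theta_embedding.intro module_universe.intro universe.intro base_ring.intro
        module_universe_axioms.intro theta_embedding_axioms.intro assms)
  have b: "\<exists>\<E>. small TYPE('u) \<E> \<and> right_perp1 (RMod R) S \<E>"
    if "inj_on \<theta> (carrier R)" "closed_under_extensions (RMod R) S"
    using image_perpendicular(2)[OF that] small_finite by (metis finite.emptyI finite.insertI)
  show ?thesis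
  proof (intro conjI impI allI iffI)
    show "\<exists>\<F>. small TYPE('u) \<F> \<and> right_perp0 (RMod R) S \<F>" by (rule image_perpendicular(1))
  next
    assume "\<exists>\<E>. right_perp1 (RMod R) S \<E>"
    then show "closed_under_extensions (RMod R) S" using right_perp1_closed_under_extensions by blast
  next
    assume "inj_on \<theta> (carrier R)" "closed_under_extensions (RMod R) S"
    then show "\<exists>\<E>. right_perp1 (RMod R) S \<E>" using b by blast
  next
    assume "inj_on \<theta> (carrier R)" "closed_under_extensions (RMod R) S"
    then show "\<exists>\<E>. small TYPE('u) \<E> \<and> right_perp1 (RMod R) S \<E>" by (rule b)
  next
    fix n :: nat
    assume "inj_on \<theta> (carrier R) \<and> n \<ge> 1 \<and>
      (\<forall>X \<in> Ob B. \<forall>Y \<in> Ob B. \<forall>i \<le> n. Ext_map_iso B (RMod R) (Theta B P \<theta>) i X Y)"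
    then show "\<exists>\<E>. small TYPE('u) \<E> \<and> right_perp (RMod R) (enat n) S \<E>"
      by (intro image_perpendicular_upto) (auto simp: one_enat_def)
  next
    assume "inj_on \<theta> (carrier R) \<and>
      (\<forall>X \<in> Ob B. \<forall>Y \<in> Ob B. \<forall>i. Ext_map_iso B (RMod R) (Theta B P \<theta>) i X Y)"
    then show "\<exists>\<E>. small TYPE('u) \<E> \<and> right_perp (RMod R) \<infinity> S \<E>"
      by (intro image_perpendicular_upto) auto
  qed
qed

end
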